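(* Let $0<p<\infty$, $n$ a positive integer, and $A\in W^{n-1,q}(D,\mathbb{B})$ with $q>2$. Let $f=\sum_{k=0}^{n-1}\widehat{z^*}^{\,k}\varphi_k\in V^{n,p}_{A,0}(D,\mathbb{B})$ with $\varphi_k\in H_{A,0}(D,\mathbb{B})$, and suppose that for every $k$, $\varphi_k^+\in H^p_{w_k}(D)$ for some $w_k\in L^{q_k}(D)$, where either $q_k>2$, or $1<q_k\le2$ and $p<\frac{q_k}{2-q_k}$ (with $\frac{q_k}{2-q_k}=\infty$ if $q_k=2$). Then $f$ has a nontangential limit $f_{nt}\in L^p(\partial D,\mathbb{B})$, and $$\lim_{r\nearrow1}\int_0^{2\pi}\|f_{nt}(e^{i\theta})-f(re^{i\theta})\|_{\mathbb{B}}^p\,d\theta=0.$$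
   Context: $D$ is the open unit disk in $\mathbb{C}$, $\partial D$ the unit circle. For $u=x+iy\in\mathbb{C}$, $u^*=x-iy$; $\frac{\partial}{\partial z^*}=\frac12(\partial_x+i\partial_y)$. $\mathbb{B}$ denotes the bicomplex numbers: the commutative $\mathbb{C}$-algebra of elements $z_1+jz_2$ with $z_1,z_2\in\mathbb{C}$, $j^2=-1$, $ij=ji$. Put $p^\pm=\frac12(1\pm ij)$. Each $w=z_1+jz_2\in\mathbb{B}$ is uniquely $w=p^+w^++p^-w^-$ with $w^\pm=z_1\mp iz_2\in\mathbb{C}$ (for functions, pointwise), and $\|w\|_{\mathbb{B}}=\sqrt{(|w^+|^2+|w^-|^2)/2}$. $L^p(\partial D,\mathbb{B})$ is the set of $\mathbb{B}$-valued functions on $\partial D$ with $\|\cdot\|_{\mathbb{B}}^p$ integrable; $L^{q_k}(D)$ is the usual complex-valued Lebesgue space. The bicomplexification of $u=x+iy$ is $\widehat u=x+jy\in\mathbb{B}$; thus $\widehat{z^*}=x-jy$. $W^{n-1,q}(D,\mathbb{B})$ is the Sobolev space of $\mathbb{B}$-valued functions on $D$ whose components are in the usual Sobolev space $W^{n-1,q}(D)$ (with $W^{0,q}=L^q$). $\bar\partial=\frac12(\partial_x+j\partial_y)$. For $0<p<\infty$, $\|f\|_{H^p_{\mathbb{B}}}=\sup_{0<r<1}\left(\int_0^{2\pi}\|f(re^{i\theta})\|_{\mathbb{B}}^p\,d\theta\right)^{1/p}$. $H_{A,0}(D,\mathbb{B})$ is the set of $f:D\to\mathbb{B}$ with $\bar\partial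 f=Af$. $V^{n,p}_{A,0}(D,\mathbb{B})$ is the set of $f:D\to\mathbb{B}$ with $(\bar\partial-A)^nf=0$ and $\sum_{k=0}^{n-1}\|(\bar\partial-A)^kf\|_{H^p_{\mathbb{B}}}<\infty$, where $A$ acts by multiplication. For $w:D\to\mathbb{C}$, $H^p_w(D)$ is the set of $u:D\to\mathbb{C}$ with $\frac{\partial u}{\partial z^*}=w$ and $\sup_{0<r<1}\int_0^{2\pi}|u(re^{i\theta})|^p\,d\theta<\infty$. Derivatives are understood in the weak sense, the iterates $(\bar\partial-A)^kf$ being locally integrable functions obtained successively, and solutions are taken with their continuous representatives. A function $f$ on $D$ has nontangential limit $f_{nt}$ if for almost every $\theta$, $f(z)\to f_{nt}(e^{i\theta})$ as $z\to e^{i\theta}$ within every nontangential approach region (Stolz angle) at $e^{i\theta}$. *)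

theory Defs
  imports "HOL-Analysis.Analysis"
begin

section \<open>Bicomplex numbers\<close>

text \<open>\<open>Bicomplex z1 z2\<close> is the number \<open>z1 + j z2\<close>, where \<open>j\<^sup>2 = -1\<close> and \<open>i j = j i\<close>.\<close>

datatype bicomplex = Bicomplex (bc_fst: complex) (bc_snd: complex)

definition bc_plus :: "bicomplex \<Rightarrow> complex"
  where "bc_plus w = bc_fst w - \<i> * bc_snd w"

definition bc_minus :: "bicomplex \<Rightarrow> complex"
  where "bc_minus w = bc_fst w + \<i> * bc_snd w"

instantiation bicomplex :: comm_ring_1
begin

definition zero_bicomplex_def: "0 = Bicomplex 0 0"
definition one_bicomplex_def: "1 = Bicomplex 1 0"
definition plus_bicomplex_def: "v + w = Bicomplex (bc_fst v + bc_fst w) (bc_snd v + bc_snd w)"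
definition minus_bicomplex_def: "v - w = Bicomplex (bc_fst v - bc_fst w) (bc_snd v - bc_snd w)"
definition uminus_bicomplex_def: "- w = Bicomplex (- bc_fst w) (- bc_snd w)"
definition times_bicomplex_def:
  "v * w = Bicomplex (bc_fst v * bc_fst w - bc_snd v * bc_snd w)
                     (bc_fst v * bc_snd w + bc_snd v * bc_fst w)"

instance
  by standard
    (simp_all add: zero_bicomplex_def one_bicomplex_def plus_bicomplex_def minus_bicomplex_def
      uminus_bicomplex_def times_bicomplex_def algebra_simps)

end

lemma bc_sel_simps [simp]:
  "bc_fst 0 = 0" "bc_snd 0 = 0" "bc_fst 1 = 1" "bc_snd 1 = 0"
  "bc_fst (v + w) = bc_fst v + bc_fst w" "bc_snd (v + w) = bc_snd v + bc_snd w"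
  "bc_fst (v - w) = bc_fst v - bc_fst w" "bc_snd (v - w) = bc_snd v - bc_snd w"
  "bc_fst (- w) = - bc_fst w" "bc_snd (- w) = - bc_snd w"
  "bc_fst (v * w) = bc_fst v * bc_fst w - bc_snd v * bc_snd w"
  "bc_snd (v * w) = bc_fst v * bc_snd w + bc_snd v * bc_fst w"
  by (simp_all add: zero_bicomplex_def one_bicomplex_def plus_bicomplex_def minus_bicomplex_def
      uminus_bicomplex_def times_bicomplex_def)

instantiation bicomplex :: real_algebra_1
begin

definition scaleR_bicomplex_def: "r *\<^sub>R w = Bicomplex (r *\<^sub>R bc_fst w) (r *\<^sub>R bc_snd w)"

instance
  by standard (rule bicomplex.expand; simp add: scaleR_bicomplex_def algebra_simps)+

end

lemma bc_sel_scaleR [simp]: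
  "bc_fst (r *\<^sub>R w) = r *\<^sub>R bc_fst w" "bc_snd (r *\<^sub>R w) = r *\<^sub>R bc_snd w"
  by (simp_all add: scaleR_bicomplex_def)

lemma bc_norm_square:
  "((cmod (bc_plus w))\<^sup>2 + (cmod (bc_minus w))\<^sup>2) / 2
     = bc_fst w \<bullet> bc_fst w + bc_snd w \<bullet> bc_snd w"
  unfolding cmod_power2 by (simp add: bc_plus_def bc_minus_def inner_complex_def power2_eq_square)
    (simp add: algebra_simps)

text \<open>This norm is the Euclidean norm of the pair \<open>(z1, z2)\<close>. It is not submultiplicative,
  so \<open>bicomplex\<close> is not an instance of \<open>real_normed_algebra\<close>.\<close>

instantiation bicomplex :: real_inner
begin

definition inner_bicomplex_def: "v \<bullet> w = bc_fst v \<bullet> bc_fst w + bc_snd v \<bullet> bc_snd w"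
definition norm_bicomplex_def:
  "norm w = sqrt (((cmod (bc_plus w))\<^sup>2 + (cmod (bc_minus w))\<^sup>2) / 2)"
definition sgn_bicomplex_def: "sgn (w::bicomplex) = w /\<^sub>R norm w"
definition dist_bicomplex_def: "dist (v::bicomplex) w = norm (v - w)"
definition uniformity_bicomplex_def:
  "(uniformity :: (bicomplex \<times> bicomplex) filter)
     = (INF e\<in>{0<..}. principal {(v, w). dist v w < e})"
definition open_bicomplex_def:
  "open (U :: bicomplex set) \<longleftrightarrow>
     (\<forall>w\<in>U. eventually (\<lambda>(w', v). w' = w \<longrightarrow> v \<in> U) uniformity)"

instance
proof
  fix v w u :: bicomplex and r :: real
  show "dist v w = norm (v - w)" by (rule dist_bicomplex_def)
  show "sgn w = w /\<^sub>R norm w" by (rule sgn_bicomplex_def)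
  show "(uniformity :: (bicomplex \<times> bicomplex) filter)
      = (INF e\<in>{0<..}. principal {(v, w). dist v w < e})"
    by (rule uniformity_bicomplex_def)
  show "open U \<longleftrightarrow> (\<forall>w\<in>U. eventually (\<lambda>(w', v). w' = w \<longrightarrow> v \<in> U) uniformity)"
    for U :: "bicomplex set"
    by (rule open_bicomplex_def)
  show "v \<bullet> w = w \<bullet> v" by (simp add: inner_bicomplex_def inner_commute)
  show "(v + w) \<bullet> u = v \<bullet> u + w \<bullet> u" by (simp add: inner_bicomplex_def inner_left_distrib)
  show "(r *\<^sub>R v) \<bullet> w = r * (v \<bullet> w)" by (simp add: inner_bicomplex_def distrib_left)
  show "0 \<le> v \<bullet> v" by (simp add: inner_bicomplex_def)
  show "v \<bullet> v = 0 \<longleftrightarrow> v = 0"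
    by (cases v) (simp add: inner_bicomplex_def add_nonneg_eq_0_iff zero_bicomplex_def)
  show "norm v = sqrt (v \<bullet> v)"
    by (simp add: norm_bicomplex_def bc_norm_square inner_bicomplex_def)
qed

end

instantiation bicomplex :: euclidean_space
begin

definition Basis_bicomplex_def:
  "Basis = {Bicomplex 1 0, Bicomplex \<i> 0, Bicomplex 0 1, Bicomplex 0 \<i>}"

instance
proof
  show "(Basis :: bicomplex set) \<noteq> {}" "finite (Basis :: bicomplex set)"
    by (simp_all add: Basis_bicomplex_def)
  fix u v :: bicomplex
  show "u \<bullet> v = (if u = v then 1 else 0)" if "u \<in> Basis" "v \<in> Basis"
    using that unfolding Basis_bicomplex_def inner_bicomplex_def inner_complex_def
    by (elim insertE; simp add: complex_eq_iff)
  show "(\<forall>b\<in>Basis. u \<bullet> b = 0) \<longleftrightarrow> u = 0"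
    by (cases u) (simp add: Basis_bicomplex_def inner_bicomplex_def inner_complex_def
        complex_eq_iff zero_bicomplex_def conj_ac)
qed

end

definition bc_j :: bicomplex
  where "bc_j = Bicomplex 0 1"

definition bc_of_complex :: "complex \<Rightarrow> bicomplex"
  where "bc_of_complex z = Bicomplex z 0"

text \<open>The bicomplexification \<open>x + iy \<mapsto> x + jy\<close>.\<close>

definition bc_hat :: "complex \<Rightarrow> bicomplex"
  where "bc_hat u = of_real (Re u) + bc_j * of_real (Im u)"

lemma bc_j_square: "bc_j * bc_j = -1"
  by (rule bicomplex.expand) (simp add: bc_j_def)

lemma bicomplex_eq: "w = bc_of_complex (bc_fst w) + bc_j * bc_of_complex (bc_snd w)"
  by (rule bicomplex.expand) (simp add: bc_j_def bc_of_complex_def)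

lemma bc_idempotent_decomposition:
  defines "p \<equiv> (1/2) *\<^sub>R (1 + bc_of_complex \<i> * bc_j)"
    and "m \<equiv> (1/2) *\<^sub>R (1 - bc_of_complex \<i> * bc_j)"
  shows "w = p * bc_of_complex (bc_plus w) + m * bc_of_complex (bc_minus w)"
  by (rule bicomplex.expand)
    (simp add: p_def m_def bc_j_def bc_of_complex_def bc_plus_def bc_minus_def
      complex_eq_iff algebra_simps)


section \<open>Weak derivatives and function spaces on the unit disc\<close>

abbreviation unit_disc :: "complex set"
  where "unit_disc \<equiv> ball 0 1"

primrec C_k :: "nat \<Rightarrow> ('a::real_normed_vector \<Rightarrow> 'b::real_normed_vector) \<Rightarrow> bool" where
  "C_k 0 f \<longleftrightarrow> continuous_on UNIV f"
| "C_k (Suc k) f \<longleftrightarrow>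
     (\<forall>z. f differentiable at z) \<and> (\<forall>v. C_k k (\<lambda>z. frechet_derivative f (at z) v))"

text \<open>Real-valued test functions suffice for vector-valued weak derivatives, by linearity.\<close>

definition test_function :: "(complex \<Rightarrow> real) \<Rightarrow> bool" where
  "test_function \<phi> \<longleftrightarrow> (\<forall>k. C_k k \<phi>) \<and>
     (\<exists>K. compact K \<and> K \<subseteq> unit_disc \<and> (\<forall>z. z \<notin> K \<longrightarrow> \<phi> z = 0))"

definition partial_x :: "(complex \<Rightarrow> real) \<Rightarrow> complex \<Rightarrow> real"
  where "partial_x \<phi> z = frechet_derivative \<phi> (at z) 1"

definition partial_y :: "(complex \<Rightarrow> real) \<Rightarrow> complex \<Rightarrow> real"
  where "partial_y \<phi> z = frechet_derivative \<phi> (at z) \<i>"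

definition locally_integrable :: "(complex \<Rightarrow> 'a::euclidean_space) \<Rightarrow> bool" where
  "locally_integrable f \<longleftrightarrow>
     (\<forall>K. compact K \<and> K \<subseteq> unit_disc \<longrightarrow> integrable (lebesgue_on K) f)"

definition Lq_disc :: "real \<Rightarrow> (complex \<Rightarrow> complex) set" where
  "Lq_disc q = {f \<in> borel_measurable (lebesgue_on unit_disc).
     integrable (lebesgue_on unit_disc) (\<lambda>z. cmod (f z) powr q)}"

text \<open>\<open>v\<close> is the weak derivative \<open>\<partial>\<^sub>x\<^sup>a \<partial>\<^sub>y\<^sup>b u\<close> on the disc.\<close>

definition weak_partial ::
  "nat \<Rightarrow> nat \<Rightarrow> (complex \<Rightarrow> complex) \<Rightarrow> (complex \<Rightarrow> complex) \<Rightarrow> bool" where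
  "weak_partial a b u v \<longleftrightarrow> locally_integrable u \<and> locally_integrable v \<and>
     (\<forall>\<phi>. test_function \<phi> \<longrightarrow>
        (LINT z|lebesgue_on unit_disc. (partial_x ^^ a) ((partial_y ^^ b) \<phi>) z *\<^sub>R u z)
        = (-1) ^ (a + b) * (LINT z|lebesgue_on unit_disc. \<phi> z *\<^sub>R v z))"

definition sobolev_disc :: "nat \<Rightarrow> real \<Rightarrow> (complex \<Rightarrow> complex) set" where
  "sobolev_disc m q = {u \<in> Lq_disc q.
     \<forall>a b. a + b \<le> m \<longrightarrow> (\<exists>v \<in> Lq_disc q. weak_partial a b u v)}"

definition sobolev_disc_bc :: "nat \<Rightarrow> real \<Rightarrow> (complex \<Rightarrow> bicomplex) set" where
  "sobolev_disc_bc m q = {A. (\<lambda>z. bc_fst (A z)) \<in> sobolev_disc m q \<and>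
                            (\<lambda>z. bc_snd (A z)) \<in> sobolev_disc m q}"

text \<open>\<open>w = \<partial>u/\<partial>z\<^sup>*\<close> weakly on the disc, with \<open>\<partial>/\<partial>z\<^sup>* = (\<partial>\<^sub>x + i \<partial>\<^sub>y)/2\<close>.\<close>

definition weak_dzstar :: "(complex \<Rightarrow> complex) \<Rightarrow> (complex \<Rightarrow> complex) \<Rightarrow> bool" where
  "weak_dzstar u w \<longleftrightarrow> locally_integrable u \<and> locally_integrable w \<and>
     (\<forall>\<phi>. test_function \<phi> \<longrightarrow>
        (LINT z|lebesgue_on unit_disc.
           ((of_real (partial_x \<phi> z) + \<i> * of_real (partial_y \<phi> z)) / 2) * u z)
        = - (LINT z|lebesgue_on unit_disc. \<phi> z *\<^sub>R w z))"

text \<open>\<open>g\<close> is the weak bicomplex derivative \<open>(\<partial>\<^sub>x + j \<partial>\<^sub>y)f/2\<close> on the disc.\<close>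

definition weak_dbar :: "(complex \<Rightarrow> bicomplex) \<Rightarrow> (complex \<Rightarrow> bicomplex) \<Rightarrow> bool" where
  "weak_dbar f g \<longleftrightarrow> locally_integrable f \<and> locally_integrable g \<and>
     (\<forall>\<phi>. test_function \<phi> \<longrightarrow>
        (LINT z|lebesgue_on unit_disc.
           ((1/2) *\<^sub>R (of_real (partial_x \<phi> z) + bc_j * of_real (partial_y \<phi> z))) * f z)
        = - (LINT z|lebesgue_on unit_disc. \<phi> z *\<^sub>R g z))"


section \<open>Hardy classes\<close>

text \<open>\<open>\<integral>\<^sub>0\<^sup>2\<^sup>\<pi> \<parallel>g(\<theta>)\<parallel>\<^sup>p d\<theta>\<close>, as an extended nonnegative real, and its \<open>p\<close>-th root.\<close>

definition circle_int :: "real \<Rightarrow> (real \<Rightarrow> 'a::real_normed_vector) \<Rightarrow> ennreal" where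
  "circle_int p g = (\<integral>\<^sup>+\<theta>. ennreal (norm (g \<theta>) powr p) \<partial>lebesgue_on {0..2*pi})"

definition ennreal_root :: "real \<Rightarrow> ennreal \<Rightarrow> ennreal" where
  "ennreal_root p x = (if x = \<infinity> then \<infinity> else ennreal (enn2real x powr (1 / p)))"

definition hardy_norm :: "real \<Rightarrow> (complex \<Rightarrow> bicomplex) \<Rightarrow> ennreal" where
  "hardy_norm p f = (SUP r\<in>{0<..<1}. ennreal_root p (circle_int p (\<lambda>\<theta>. f (rcis r \<theta>))))"

definition H_w :: "real \<Rightarrow> (complex \<Rightarrow> complex) \<Rightarrow> (complex \<Rightarrow> complex) set" where
  "H_w p w = {u. weak_dzstar u w \<and>
     (SUP r\<in>{0<..<1}. circle_int p (\<lambda>\<theta>. u (rcis r \<theta>))) < \<infinity>}"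

text \<open>Solutions are represented by functions on the whole plane of which only the values on the
  disc matter, and which are continuous there.\<close>

definition H_A0 :: "(complex \<Rightarrow> bicomplex) \<Rightarrow> (complex \<Rightarrow> bicomplex) set" where
  "H_A0 A = {f. continuous_on unit_disc f \<and> weak_dbar f (\<lambda>z. A z * f z)}"

text \<open>\<open>g k\<close> is the continuous representative of the \<open>k\<close>-th iterate of \<open>f\<close> under the weak
  operator \<open>(\<partial>\<^sub>x + j \<partial>\<^sub>y)/2 - A\<close>: the equation \<open>g (k+1) = ((\<partial>\<^sub>x + j \<partial>\<^sub>y)/2 - A) (g k)\<close> is
  written as a condition on the weak derivative of \<open>g k\<close>.\<close>

definition V_A0 :: "nat \<Rightarrow> real \<Rightarrow> (complex \<Rightarrow> bicomplex) \<Rightarrow> (complex \<Rightarrow> bicomplex) set" where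
  "V_A0 n p A = {f. \<exists>g :: nat \<Rightarrow> complex \<Rightarrow> bicomplex.
     g 0 = f \<and>
     (\<forall>k<n. continuous_on unit_disc (g k) \<and>
            weak_dbar (g k) (\<lambda>z. A z * g k z + g (Suc k) z)) \<and>
     (\<forall>z\<in>unit_disc. g n z = 0) \<and>
     (\<Sum>k<n. hardy_norm p (g k)) < \<infinity>}"


section \<open>Boundary values\<close>

definition stolz :: "real \<Rightarrow> complex \<Rightarrow> complex set" where
  "stolz \<alpha> \<zeta> = {z \<in> unit_disc. cmod (z - \<zeta>) < \<alpha> * (1 - cmod z)}"

definition has_nt_limit :: "(complex \<Rightarrow> bicomplex) \<Rightarrow> (complex \<Rightarrow> bicomplex) \<Rightarrow> bool" where
  "has_nt_limit f fnt \<longleftrightarrow>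
     (AE \<theta> in lebesgue_on {0..2*pi}. \<forall>\<alpha>>1.
        (f \<longlongrightarrow> fnt (cis \<theta>)) (at (cis \<theta>) within stolz \<alpha> (cis \<theta>)))"

definition Lp_circle :: "real \<Rightarrow> (complex \<Rightarrow> bicomplex) set" where
  "Lp_circle p = {h. (\<lambda>\<theta>. h (cis \<theta>)) \<in> borel_measurable (lebesgue_on {0..2*pi}) \<and>
     integrable (lebesgue_on {0..2*pi}) (\<lambda>\<theta>. norm (h (cis \<theta>)) powr p)}"

end

theory Submission
  imports Defs "HOL-Complex_Analysis.Complex_Analysis"
begin

text \<open>In the idempotent components the bicomplex unit \<open>j\<close> acts as \<open>i\<close> or as \<open>-i\<close>, so \<open>f\<^sup>-\<close> and the
  conjugate of \<open>f\<^sup>+\<close> are sums \<open>\<Sum> (z\<^sup>*)\<^sup>k u\<^sub>k\<close> with \<open>\<partial>u\<^sub>k/\<partial>z\<^sup>* = a u\<^sub>k\<close> and \<open>a \<in> L\<^sup>q\<close>, \<open>q > 2\<close>. The operator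
  \<open>\<partial>/\<partial>z\<^sup>* - a\<close> shifts the coefficients, hence the Hardy bounds on the iterates pass to every \<open>u\<^sub>k\<close>.
  The Cauchy transform \<open>S\<close> of \<open>a\<close> is continuous on the plane and \<open>h\<^sub>k = e\<^sup>-\<^sup>S u\<^sub>k\<close> is holomorphic of class
  \<open>H\<^sup>p\<close> (similarity principle). For \<open>H\<^sup>2\<close> the boundary behaviour follows from a maximal inequality; dividing
  out the zeros reduces \<open>H\<^sup>p\<close> to powers of \<open>H\<^sup>2\<close> functions and gives \<open>\<bar>h\<^sub>k\<bar>\<^sup>p \<le> \<bar>D\<^sub>k\<bar>\<^sup>2\<close> with
  \<open>D\<^sub>k \<in> H\<^sup>2\<close>. Since \<open>\<bar>D\<^sub>k\<bar>\<^sup>2\<close> converges in \<open>L\<^sup>1\<close> on circles, dominated convergence applies to \<open>f\<close>.\<close>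


section \<open>Boundary values in \<open>H\<^sup>2\<close>\<close>

text \<open>For p < 1 the space \<open>L^p\<close> has no norm and a boundary function need not
  reproduce its interior values by a Poisson integral. The quantitative work is therefore done with
  squares. In \<open>H^2\<close> the circle means are power series with nonnegative coefficients,
  which makes the circle functions Cauchy in \<open>L^2\<close> as the radius tends to 1, and
  Cauchy's formula yields Poisson-type bounds without any boundary function. In place of an
  integrable maximal function, the final majorant is a family |D(r e^{it})|^2 that varies with r but
  converges in \<open>L^1\<close>. The condition q > 2 enters through the conjugate exponent q' < 2:
  |z|^(-q') is then locally integrable in the plane, so the Cauchy transform S is continuous beyond
  the circle. Hence e^S and e^(-S) are bounded on the closed disc and have limits at every boundary
  point, and passing between u_k and h_k loses neither Hardy bounds nor limits. Since S and u need
  not be differentiable, the product rule for e^(-S) u has to be recovered by mollification.\<close>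

text \<open>Cauchy's formula for derivatives, written in the angle: the factor
  \<open>r ^ n / \<i>\<close> cancels the contour factors and leaves F against the character
  e^(-int).\<close>

lemma has_integral_circle_coeff:
  fixes F :: "complex \<Rightarrow> complex"
  assumes hol: "F holomorphic_on ball 0 R" and r: "0 < r" "r < R"
  shows "((\<lambda>t. F (rcis r t) * cis (- (real n * t))) has_integral
           2 * pi * ((deriv ^^ n) F 0 / fact n) * r ^ n) {0..2*pi}"
proof -
  have sub: "cball 0 r \<subseteq> ball (0::complex) R" "ball 0 r \<subseteq> ball (0::complex) R"
    using r by auto
  have "((\<lambda>u. F u / (u - 0) ^ Suc n) has_contour_integral
          ((2 * pi * \<i>) / fact n * (deriv ^^ n) F 0)) (circlepath 0 r)"
    by (rule Cauchy_has_contour_integral_higher_derivative_circlepath)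
       (use hol sub r in \<open>auto intro: holomorphic_on_imp_continuous_on holomorphic_on_subset\<close>)
  then have "((\<lambda>t. F (0 + r * cis t) / (0 + r * cis t - 0) ^ Suc n * r * \<i> * cis t) has_integral
          ((2 * pi * \<i>) / fact n * (deriv ^^ n) F 0)) {0..2*pi}"
    unfolding circlepath_def
    by (subst (asm) has_contour_integral_part_circlepath_iff) auto
  then have "((\<lambda>t. (r ^ n / \<i>) * (F (0 + r * cis t) / (0 + r * cis t - 0) ^ Suc n * r * \<i> * cis t))
      has_integral (r ^ n / \<i>) * ((2 * pi * \<i>) / fact n * (deriv ^^ n) F 0)) {0..2*pi}"
    by (rule has_integral_mult_right)
  moreover have "(r ^ n / \<i>) * (F (0 + r * cis t) / (0 + r * cis t - 0) ^ Suc n * r * \<i> * cis t)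
      = F (rcis r t) * cis (- (real n * t))" for t
  proof -
    have "cis (- (real n * t)) = inverse (cis t ^ n)"
      by (simp add: Complex.DeMoivre flip: cis_inverse)
    then show ?thesis
      using r by (simp add: rcis_def field_simps power_mult_distrib)
  qed
  moreover have "(r ^ n / \<i>) * ((2 * pi * \<i>) / fact n * (deriv ^^ n) F 0)
      = 2 * pi * ((deriv ^^ n) F 0 / fact n) * r ^ n"
    by (simp add: field_simps)
  ultimately show ?thesis by simp
qed

text \<open>Parseval, polarized over two radii: J(x) is 2 pi times the sum of |a_n|^2 x^n. It sees
  only the product of the radii and has nonnegative coefficients. Equal radii give circle means,
  different radii give distances between circles.\<close>

lemma circle_correlation:
  fixes F :: "complex \<Rightarrow> complex"
  assumes hol: "F holomorphic_on ball 0 R" and R: "0 < R"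
  obtains J :: "real \<Rightarrow> real"
  where "\<And>r s. 0 < r \<Longrightarrow> r < R \<Longrightarrow> 0 < s \<Longrightarrow> s < R \<Longrightarrow>
      ((\<lambda>t. F (rcis r t) * cnj (F (rcis s t))) has_integral of_real (J (r * s))) {0..2*pi}"
    and "\<And>x y. 0 < x \<Longrightarrow> x \<le> y \<Longrightarrow> y < R\<^sup>2 \<Longrightarrow> J x \<le> J y"
proof -
  define a where "a n = (deriv ^^ n) F 0 / fact n" for n
  have ps: "(\<lambda>n. a n * w ^ n) sums F w" if "norm w < R" for w
    using holomorphic_power_series[OF hol, of w] that by (simp add: a_def)
  have abs: "summable (\<lambda>n. norm (a n) * s ^ n)" if sR: "0 < s" "s < R" for s
  proof -
    obtain s' where s': "s < s'" "s' < R" using dense[OF sR(2)] by blast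
    have "summable (\<lambda>n. a n * of_real s' ^ n)"
      using ps[of "of_real s'"] s' sR by (auto simp: sums_iff)
    from powser_insidea[OF this, of "of_real s"] s' sR
    show ?thesis by (simp add: norm_mult norm_power)
  qed
  define J where "J x = (\<Sum>n. 2 * pi * (norm (a n))\<^sup>2 * x ^ n)" for x
  have bsum: "summable (\<lambda>n. 2 * pi * (norm (a n))\<^sup>2 * (r * s) ^ n)"
    if "0 < r" "r < R" "0 < s" "s < R" for r s
  proof -
    \<comment> \<open>The factor at radius r tends to 0, hence is eventually below 1, and the factor
      at radius s is summable on its own.\<close>
    have "summable (\<lambda>n. (norm (a n) * r ^ n) * (norm (a n) * s ^ n))"
    proof (rule summable_comparison_test_ev)
      have "(\<lambda>n. norm (a n) * r ^ n) \<longlonglongrightarrow> 0" using abs[of r] that summable_LIMSEQ_zero by blast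
      then have "eventually (\<lambda>n. norm (a n) * r ^ n < 1) sequentially"
        by (rule order_tendstoD) auto
      then show "eventually (\<lambda>n. norm ((norm (a n) * r ^ n) * (norm (a n) * s ^ n))
          \<le> norm (a n) * s ^ n) sequentially"
        by eventually_elim (use that in \<open>auto simp: abs_mult intro!: mult_left_le_one_le\<close>)
      show "summable (\<lambda>n. norm (a n) * s ^ n)" using abs that by auto
    qed
    from summable_mult[OF this, of "2 * pi"] show ?thesis
      by (simp add: power2_eq_square power_mult_distrib mult_ac)
  qed
  show ?thesis
  proof
    fix r s assume rs: "0 < r" "r < R" "0 < s" "s < R"
    \<comment> \<open>Only the conjugated factor is expanded: one uniformly convergent series is
      enough, and its terms integrate to Fourier coefficients of F on the other circle.\<close>
    define f where "f n t = F (rcis r t) * (cnj (a n) * s ^ n * cis (- (real n * t)))" for n t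
    have sub: "rcis r t \<in> ball 0 R" for t using rs by simp
    have cont: "continuous_on {0..2*pi} (\<lambda>t. F (rcis r t))"
      by (rule continuous_on_compose2[OF holomorphic_on_imp_continuous_on[OF hol]])
         (use sub in \<open>auto simp: rcis_def intro!: continuous_intros\<close>)
    have contf: "continuous_on {0..2*pi} (f n)" for n
      unfolding f_def by (intro continuous_intros cont) 
    obtain B where B: "\<And>t. t \<in> {0..2*pi} \<Longrightarrow> norm (F (rcis r t)) \<le> B"
      using compact_imp_bounded[OF compact_continuous_image[OF cont]]
      by (auto simp: bounded_iff simp del: atLeastAtMost_iff)
    have "uniform_limit {0..2*pi} (\<lambda>N t. \<Sum>n<N. f n t) (\<lambda>t. \<Sum>n. f n t) sequentially"
    proof (rule Weierstrass_m_test)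
      show "norm (f n t) \<le> B * (norm (a n) * s ^ n)" if "t \<in> {0..2*pi}" for n t
        using B[OF that] rs by (simp add: f_def norm_mult norm_power mult_right_mono)
      show "summable (\<lambda>n. B * (norm (a n) * s ^ n))"
        by (intro summable_mult abs rs)
    qed
    moreover have "(\<Sum>n. f n t) = F (rcis r t) * cnj (F (rcis s t))" for t
    proof -
      have "(\<lambda>n. a n * (rcis s t) ^ n) sums F (rcis s t)"
        using rs by (intro ps) auto
      then have "(\<lambda>n. cnj (a n * (rcis s t) ^ n)) sums cnj (F (rcis s t))"
        by (simp only: sums_cnj)
      then have "(\<lambda>n. F (rcis r t) * cnj (a n * (rcis s t) ^ n)) sums (F (rcis r t) * cnj (F (rcis s t)))"
        by (rule sums_mult)
      moreover have "cnj (a n * (rcis s t) ^ n) = cnj (a n) * s ^ n * cis (- (real n * t))" for n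
        by (simp add: rcis_def power_mult_distrib Complex.DeMoivre cis_cnj)
      ultimately have "(\<lambda>n. f n t) sums (F (rcis r t) * cnj (F (rcis s t)))"
        by (simp only: f_def)
      then show ?thesis by (rule sums_unique[symmetric])
    qed
    ultimately have ul: "uniform_limit {0..2*pi} (\<lambda>N t. \<Sum>n<N. f n t)
        (\<lambda>t. F (rcis r t) * cnj (F (rcis s t))) sequentially" by simp
    obtain I K where IK: "\<And>N. ((\<lambda>t. \<Sum>n<N. f n t) has_integral I N) {0..2*pi}"
      "((\<lambda>t. F (rcis r t) * cnj (F (rcis s t))) has_integral K) {0..2*pi}" "I \<longlonglongrightarrow> K"
      by (rule uniform_limit_integral[OF ul]) (auto intro!: continuous_intros contf)
    have fint: "(f n has_integral of_real (2 * pi * (norm (a n))\<^sup>2 * (r * s) ^ n)) {0..2*pi}" for n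
    proof -
      have "((\<lambda>t. (cnj (a n) * s ^ n) * (F (rcis r t) * cis (- (real n * t)))) has_integral
          (cnj (a n) * s ^ n) * (2 * pi * a n * r ^ n)) {0..2*pi}"
        unfolding a_def
        using has_integral_circle_coeff[OF hol, of r n] rs by (intro has_integral_mult_right) auto
      moreover have "(cnj (a n) * s ^ n) * (2 * pi * a n * r ^ n)
          = of_real (2 * pi * (norm (a n))\<^sup>2 * (r * s) ^ n)"
        by (simp add: complex_norm_square power_mult_distrib mult_ac flip: of_real_power)
      moreover have "(cnj (a n) * s ^ n) * (F (rcis r t) * cis (- (real n * t))) = f n t" for t
        by (simp add: f_def)
      ultimately show ?thesis by (simp only:)
    qed
    have "I N = of_real (\<Sum>n<N. 2 * pi * (norm (a n))\<^sup>2 * (r * s) ^ n)" for N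
      using has_integral_unique[OF IK(1)[of N] has_integral_sum[OF _ fint]] by simp
    then have "I = (\<lambda>N. of_real (\<Sum>n<N. 2 * pi * (norm (a n))\<^sup>2 * (r * s) ^ n))" by (rule ext)
    moreover have "(\<lambda>N. of_real (\<Sum>n<N. 2 * pi * (norm (a n))\<^sup>2 * (r * s) ^ n)) \<longlonglongrightarrow> (of_real (J (r * s)) :: complex)"
      unfolding J_def by (intro tendsto_of_real summable_LIMSEQ bsum rs)
    ultimately have "I \<longlonglongrightarrow> of_real (J (r * s))" by (simp only:)
    with IK(3) have "K = of_real (J (r * s))" by (rule LIMSEQ_unique)
    with IK(2) show "((\<lambda>t. F (rcis r t) * cnj (F (rcis s t))) has_integral of_real (J (r * s))) {0..2*pi}"
      by simp
  next
    fix x y :: real assume xy: "0 < x" "x \<le> y" "y < R\<^sup>2"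
    \<comment> \<open>\<open>bsum\<close> speaks of products of two radii; x is the product of
      \<open>sqrt x\<close> with itself.\<close>
    have sq: "sqrt z < R" if "z < R\<^sup>2" for z
      using that R real_less_lsqrt real_sqrt_less_mono by fastforce
    show "J x \<le> J y" unfolding J_def
    proof (rule suminf_le)
      show "2 * pi * (norm (a n))\<^sup>2 * x ^ n \<le> 2 * pi * (norm (a n))\<^sup>2 * y ^ n" for n
        using xy by (intro mult_left_mono power_mono) auto
      show "summable (\<lambda>n. 2 * pi * (norm (a n))\<^sup>2 * x ^ n)"
        using bsum[of "sqrt x" "sqrt x"] sq xy by simp
      show "summable (\<lambda>n. 2 * pi * (norm (a n))\<^sup>2 * y ^ n)"
        using bsum[of "sqrt y" "sqrt y"] sq xy by simp
    qed
  qed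
qed

section \<open>Poisson kernel bounds and the nontangential maximal inequality\<close>

text \<open>The chord is 2 |sin (x/2)|. Since |x/2| \<le> 2 (from pi < 4), the cubic Taylor
  remainder of the sine is at most (4/6) |x/2|, which leaves |sin (x/2)| \<ge> |x/2| / 3.\<close>

lemma chord_lower_bound:
  assumes "\<bar>x\<bar> \<le> pi" shows "\<bar>x\<bar> / 3 \<le> cmod (cis x - 1)"
proof -
  have "(cmod (cis x - 1))\<^sup>2 = (2 * sin (x/2))\<^sup>2"
  proof -
    have "cos x = 1 - 2 * (sin (x/2))\<^sup>2" using cos_double_sin[of "x/2"] by simp
    moreover have "(cmod (cis x - 1))\<^sup>2 = 2 - 2 * cos x"
      using sin_cos_squared_add[of x] unfolding cmod_power2 by (simp add: power2_diff)
    ultimately show ?thesis by (simp add: power2_eq_square)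
  qed
  then have eq: "cmod (cis x - 1) = \<bar>2 * sin (x/2)\<bar>"
    by (metis norm_ge_zero power2_abs power2_eq_iff_nonneg abs_ge_zero)
  have "\<bar>sin (x/2) - (\<Sum>m<3. sin_coeff m * (x/2) ^ m)\<bar> \<le> inverse (fact 3) * \<bar>x/2\<bar> ^ 3"
    by (rule Maclaurin_sin_bound)
  then have "\<bar>sin (x/2) - x/2\<bar> \<le> \<bar>x/2\<bar> ^ 3 / 6"
    by (simp add: sin_coeff_def numeral_3_eq_3 fact_numeral field_simps)
  moreover have "\<bar>x/2\<bar> ^ 3 \<le> \<bar>x/2\<bar> * 4"
  proof -
    have "\<bar>x/2\<bar> ^ 2 \<le> 2 ^ 2"
      using assms pi_less_4 by (intro power_mono) auto
    then have "\<bar>x/2\<bar> * \<bar>x/2\<bar> ^ 2 \<le> \<bar>x/2\<bar> * 2 ^ 2" by (intro mult_left_mono) auto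
    then show ?thesis by (simp add: power3_eq_cube power2_eq_square)
  qed
  ultimately show ?thesis unfolding eq by (simp add: abs_if split: if_splits)
qed

lemma continuous_antiderivative:
  fixes g :: "real \<Rightarrow> real"
  assumes "continuous_on UNIV g"
  obtains G where "\<And>x. x \<in> {a<..<b} \<Longrightarrow> (G has_real_derivative g x) (at x)"
    "\<And>x y. a \<le> x \<Longrightarrow> x \<le> y \<Longrightarrow> y \<le> b \<Longrightarrow> (g has_integral (G y - G x)) {x..y}"
proof -
  have c: "continuous_on S g" for S using assms continuous_on_subset by blast
  define G where "G x = integral {a..x} g" for x
  have D: "(G has_real_derivative g x) (at x within {a..b})" if "x \<in> {a..b}" for x
    unfolding G_def by (rule integral_has_real_derivative[OF c that])
  show ?thesis
  proof
    show "(G has_real_derivative g x) (at x)" if "x \<in> {a<..<b}" for x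
      using D[of x] that at_within_Icc_at[of a x b] by auto
    show "(g has_integral (G y - G x)) {x..y}" if "a \<le> x" "x \<le> y" "y \<le> b" for x y
      using that by (intro fundamental_theorem_of_calculus)
        (auto simp flip: has_real_derivative_iff_has_vector_derivative intro!: DERIV_subset[OF D])
  qed
qed

text \<open>Replaces averages over symmetric intervals by averages against the Poisson-type kernel
  \<open>s \<mapsto> \<delta> / (\<delta>\<^sup>2 + s\<^sup>2)\<close>; the auxiliary function comes from integrating by parts twice.\<close>

lemma poisson_kernel_average:
  fixes g :: "real \<Rightarrow> real"
  assumes cont: "continuous_on UNIV g" and \<delta>: "0 < \<delta>"
    and avg: "\<And>r. 0 < r \<Longrightarrow> r \<le> R \<Longrightarrow> integral {c - r..c + r} g \<le> 2 * r * l" and R: "0 < R" and l: "0 \<le> l"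
  shows "integral {c - R..c + R} (\<lambda>t. g t * (\<delta> / (\<delta>\<^sup>2 + (t - c)\<^sup>2))) \<le> pi * l"
proof -
  define k where "k s = \<delta> / (\<delta>\<^sup>2 + s\<^sup>2)" for s
  define k' where "k' s = - 2 * s * \<delta> / (\<delta>\<^sup>2 + s\<^sup>2)\<^sup>2" for s
  have nz: "\<delta>\<^sup>2 + s\<^sup>2 > 0" for s using \<delta> by (simp add: add_pos_nonneg)
  have nz': "\<delta>\<^sup>2 + s\<^sup>2 \<noteq> 0" for s using nz[of s] by linarith
  have k: "(k has_real_derivative k' s) (at s)" for s
    unfolding k_def k'_def
    by (rule derivative_eq_intros refl nz' | use nz' in \<open>simp add: power2_eq_square\<close>)+
  have contk: "continuous_on UNIV k" 
    using k by (intro continuous_at_imp_continuous_on) (auto intro: DERIV_isCont)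
  have contgk: "continuous_on UNIV (\<lambda>t. g t * k (t - c))"
    by (intro continuous_intros cont continuous_on_compose2[OF contk]) auto
  \<comment> \<open>The interval is enlarged by 1 at both ends so that c - R and c + R are interior
    points, where a two-sided derivative is available.\<close>
  obtain G where G: "\<And>x. x \<in> {c-R-1<..<c+R+1} \<Longrightarrow> (G has_real_derivative g x) (at x)"
    "\<And>x y. c-R-1 \<le> x \<Longrightarrow> x \<le> y \<Longrightarrow> y \<le> c+R+1 \<Longrightarrow> (g has_integral (G y - G x)) {x..y}"
    using continuous_antiderivative[OF cont, of "c-R-1" "c+R+1"] by blast
  obtain E where E: "\<And>x. x \<in> {c-R-1<..<c+R+1} \<Longrightarrow> (E has_real_derivative g x * k (x - c)) (at x)"
    "\<And>x y. c-R-1 \<le> x \<Longrightarrow> x \<le> y \<Longrightarrow> y \<le> c+R+1 \<Longrightarrow>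
       ((\<lambda>t. g t * k (t - c)) has_integral (E y - E x)) {x..y}"
    using continuous_antiderivative[OF contgk, of "c-R-1" "c+R+1"] by blast
  \<comment> \<open>The terms are the integral of g against the kernel over [c - r, c + r], l times
    the integral of the kernel over [-r, r], and the boundary term of an integration by parts. In
    the derivative all cancels except -k'(r) times the excess of the integral of g over 2 l r. Both
    k' and the excess are nonpositive, so D decreases from D 0 = 0.\<close>
  define D where "D r = (E (c + r) - E (c - r)) - 2 * l * arctan (r / \<delta>)
      - ((G (c + r) - G (c - r)) - 2 * l * r) * k r" for r
  have U: "G (c + r) - G (c - r) \<le> 2 * l * r" if "0 \<le> r" "r \<le> R" for r
  proof (cases "r = 0")
    case False
    then show ?thesis using avg[of r] that integral_unique[OF G(2)[of "c - r" "c + r"]]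
      by (simp add: mult_ac)
  qed simp
  have k0: "k r > 0" for r using nz \<delta> by (simp add: k_def)
  have "D R \<le> D 0"
  proof (rule DERIV_nonpos_imp_nonincreasing[of 0 R D])
    fix r assume r: "0 \<le> r" "r \<le> R"
    have at: "((\<lambda>r. arctan (r / \<delta>)) has_real_derivative k r) (at r)"
    proof -
      have "inverse (1 + (r / \<delta>)\<^sup>2) * (1 / \<delta>) = k r"
        using \<delta> nz'[of r] by (simp add: k_def field_simps power2_eq_square)
      then show ?thesis
        by (auto intro!: derivative_eq_intros simp: \<delta> less_imp_neq[OF \<delta>, symmetric])
    qed
    have p: "((\<lambda>r. f (c + r)) has_real_derivative f') (at r)"
      if "(f has_real_derivative f') (at (c + r))" for f f'
    proof -
      have "((\<lambda>r. c + r) has_real_derivative 1) (at r)" by (auto intro!: derivative_eq_intros)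
      from DERIV_chain2[where f = f, OF that this] show ?thesis by simp
    qed
    have m: "((\<lambda>r. f (c - r)) has_real_derivative - f') (at r)"
      if "(f has_real_derivative f') (at (c - r))" for f f'
    proof -
      have "((\<lambda>r. c - r) has_real_derivative -1) (at r)" by (auto intro!: derivative_eq_intros)
      from DERIV_chain2[where f = f, OF that this] show ?thesis by simp
    qed
    have "(D has_real_derivative
        (g (c + r) * k r - - (g (c - r) * k (-r))) - 2 * l * k r
        - (((g (c + r) - - g (c - r)) - 2 * l) * k r + k' r * ((G (c + r) - G (c - r)) - 2 * l * r))) (at r)"
      unfolding D_def using r
      by (intro DERIV_diff DERIV_mult DERIV_cmult p m at k G(1))
         (use E(1)[of "c + r"] E(1)[of "c - r"] in
           \<open>auto intro!: p m G(1) derivative_eq_intros\<close>)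
    moreover have "k (-r) = k r" by (simp add: k_def)
    ultimately have "(D has_real_derivative - (k' r * ((G (c + r) - G (c - r)) - 2 * l * r))) (at r)"
      by (simp add: algebra_simps)
    moreover have "k' r * ((G (c + r) - G (c - r)) - 2 * l * r) \<ge> 0"
      using U[OF r] r \<delta> nz[of r]
      by (intro mult_nonpos_nonpos) (auto simp: k'_def divide_nonpos_pos mult_nonneg_nonneg)
    ultimately show "\<exists>y. (D has_real_derivative y) (at r) \<and> y \<le> 0" by force
  qed (use R in auto)
  also have "D 0 = 0" by (simp add: D_def)
  finally have "E (c + R) - E (c - R) \<le> 2 * l * arctan (R / \<delta>) + ((G (c + R) - G (c - R)) - 2 * l * R) * k R"
    by (simp add: D_def)
  \<comment> \<open>The arctangent stays below pi / 2, and the boundary term is nonpositive by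
    \<open>U\<close>.\<close>
  also have "\<dots> \<le> 2 * l * (pi / 2) + 0"
    using U[of R] R k0[of R] l arctan_ubound[of "R / \<delta>"]
    by (intro add_mono mult_left_mono mult_nonpos_nonneg) auto
  also have "\<dots> = pi * l" by simp
  finally show ?thesis
    using integral_unique[OF E(2)[of "c - R" "c + R"]] R by (simp add: k_def)
qed

text \<open>Cauchy's formula at z for F(u)^2 / (1 - cnj z u). The auxiliary denominator is 1 - |z|^2
  at u = z and has modulus |u - z| on the unit circle, so taking absolute values produces the
  Poisson kernel.\<close>

lemma holomorphic_square_poisson_bound:
  fixes F :: "complex \<Rightarrow> complex"
  assumes hol: "F holomorphic_on ball 0 R" and R: "1 < R" and z: "cmod z < 1"
  shows "(cmod (F z))\<^sup>2 \<le> (1 - (cmod z)\<^sup>2) / (2*pi) *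
     integral {0..2*pi} (\<lambda>t. (cmod (F (cis t)))\<^sup>2 / (cmod (cis t - z))\<^sup>2)"
proof -
  have nz: "1 - cnj z * u \<noteq> 0" if "cmod u \<le> 1" for u
  proof -
    have "cmod (cnj z * u) < 1" using z that
      by (simp add: norm_mult) (metis mult_less_cancel_right2 mult_right_le_one_le norm_ge_zero not_less order_le_less_trans)
    then show ?thesis by auto
  qed
  have nz2: "cis t - z \<noteq> 0" for t using z by auto
  define f where "f u = (F u)\<^sup>2 / (1 - cnj z * u)" for u
  have "cball 0 1 \<subseteq> ball (0::complex) R" using R by auto
  then have hc: "F holomorphic_on cball 0 1" using hol holomorphic_on_subset by blast
  have "f holomorphic_on cball 0 1"
    unfolding f_def by (intro holomorphic_intros hc) (use nz in auto)
  then have "((\<lambda>u. f u / (u - z)) has_contour_integral (2 * of_real pi * \<i> * f z)) (circlepath 0 1)"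
    by (rule Cauchy_integral_circlepath_simple) (use z in auto)
  then have I: "((\<lambda>t. f (0 + of_real 1 * cis t) / (0 + of_real 1 * cis t - z) * of_real 1 * \<i> * cis t)
      has_integral (2 * of_real pi * \<i> * f z)) {0..2*pi}"
    unfolding circlepath_def
    by (subst (asm) has_contour_integral_part_circlepath_iff) auto
  have contF: "continuous_on {0..2*pi} (\<lambda>t. F (cis t))"
    by (rule continuous_on_compose2[OF holomorphic_on_imp_continuous_on[OF hc]])
       (auto intro!: continuous_intros)
  have nrm: "norm (f (0 + of_real 1 * cis t) / (0 + of_real 1 * cis t - z) * of_real 1 * \<i> * cis t)
      = (cmod (F (cis t)))\<^sup>2 / (cmod (cis t - z))\<^sup>2" for t
  proof -
    have "1 - cnj z * cis t = cis t * cnj (cis t - z)"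
      by (simp add: algebra_simps cis_cnj cis_mult)
    then have "cmod (1 - cnj z * cis t) = cmod (cis t - z)"
      by (simp add: norm_mult flip: complex_cnj_diff)
    then show ?thesis
      by (simp add: f_def norm_mult norm_divide norm_power power2_eq_square)
  qed
  have int: "(\<lambda>t. (cmod (F (cis t)))\<^sup>2 / (cmod (cis t - z))\<^sup>2) integrable_on {0..2*pi}"
    by (intro integrable_continuous_interval continuous_intros contF) (use nz2 in auto)
  have le: "norm (2 * of_real pi * \<i> * f z) \<le>
     integral {0..2*pi} (\<lambda>t. (cmod (F (cis t)))\<^sup>2 / (cmod (cis t - z))\<^sup>2)"
    unfolding integral_unique[OF I, symmetric]
    by (rule integral_norm_bound_integral) (use I int nrm in auto)
  have eq: "norm (2 * of_real pi * \<i> * f z) = 2 * pi * (cmod (F z))\<^sup>2 / (1 - (cmod z)\<^sup>2)"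
  proof -
    have "1 - cnj z * z = of_real (1 - (cmod z)\<^sup>2)" by (simp add: complex_norm_square mult.commute flip: of_real_power)
    moreover have "1 - (cmod z)\<^sup>2 > 0" using z by (simp add: power_less_one_iff abs_square_less_1)
    ultimately show ?thesis by (simp add: f_def norm_mult norm_divide norm_power del: of_real_diff)
  qed
  have pos: "1 - (cmod z)\<^sup>2 > 0" using z by (simp add: abs_square_less_1)
  have arith: "a \<le> d / (2 * pi) * X" if "2 * pi * a / d \<le> X" "0 < d" for a d X :: real
    using that by (simp add: field_simps)
  show ?thesis by (rule arith[OF le[unfolded eq] pos])
qed

text \<open>The base point -1 has angle pi, the midpoint of [0, 2 pi], so the symmetric intervals in
  \<open>avg\<close> stay inside the interval of integration. In the Stolz region the Poisson kernel
  is at most 4 / \<kappa>^2 times the kernel of \<open>poisson_kernel_average\<close>, and the final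
  constant is 2 / \<kappa>^2.\<close>

lemma nontangential_square_bound_at_minus_one:
  fixes F :: "complex \<Rightarrow> complex"
  assumes hol: "F holomorphic_on ball 0 R" and R: "1 < R" and z: "cmod z < 1"
    and \<alpha>: "0 < \<alpha>" and nt: "cmod (z + 1) < \<alpha> * (1 - cmod z)" and l: "0 \<le> l"
    and avg: "\<And>r. 0 < r \<Longrightarrow> r \<le> pi \<Longrightarrow> integral {pi - r..pi + r} (\<lambda>t. (cmod (F (cis t)))\<^sup>2) \<le> 2 * r * l"
  shows "(cmod (F z))\<^sup>2 \<le> 18 * (1 + \<alpha>)\<^sup>2 * l"
proof -
  define \<delta> where "\<delta> = 1 - cmod z"
  have \<delta>: "0 < \<delta>" using z by (simp add: \<delta>_def)
  \<comment> \<open>The 3 is from \<open>chord_lower_bound\<close>. The factor 1 + \<alpha> pays for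
    moving the base point to z: |z + 1| < \<alpha> \<delta>, and \<delta> is at most the distance
    from e^(it) to z.\<close>
  define \<kappa> where "\<kappa> = 1 / (3 * (1 + \<alpha>))"
  have \<kappa>: "0 < \<kappa>" "\<kappa> \<le> 1" using \<alpha> by (auto simp: \<kappa>_def field_simps)
  define g where "g t = (cmod (F (cis t)))\<^sup>2" for t
  have "cball 0 1 \<subseteq> ball (0::complex) R" using R by auto
  then have hc: "F holomorphic_on cball 0 1" using hol holomorphic_on_subset by blast
  have contF: "continuous_on UNIV (\<lambda>t. F (cis t))"
    by (rule continuous_on_compose2[OF holomorphic_on_imp_continuous_on[OF hc]])
       (auto intro!: continuous_intros)
  have contg: "continuous_on UNIV g" unfolding g_def by (intro continuous_intros contF)
  have contg': "continuous_on S g" for S using contg continuous_on_subset by blast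
  have nz: "\<delta>\<^sup>2 + s\<^sup>2 > 0" for s using \<delta> by (simp add: add_pos_nonneg)
  have kb: "(1 - (cmod z)\<^sup>2) / (cmod (cis t - z))\<^sup>2 \<le> 4 / \<kappa>\<^sup>2 * (\<delta> / (\<delta>\<^sup>2 + (t - pi)\<^sup>2))"
    if t: "t \<in> {0..2*pi}" for t
  proof -
    define d where "d = cmod (cis t - z)"
    have d1: "\<delta> \<le> d" using norm_triangle_ineq2[of "cis t" z] by (simp add: d_def \<delta>_def)
    have "\<bar>t - pi\<bar> / 3 \<le> cmod (cis (t - pi) - 1)"
      using t by (intro chord_lower_bound) (auto simp: abs_if)
    also have "cis (t - pi) - 1 = - (cis t + 1)" by (simp add: complex_eq_iff)
    also have "cmod (- (cis t + 1)) = cmod ((cis t - z) + (z + 1))" by (simp only: norm_minus_cancel) simp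
    also have "\<dots> \<le> d + cmod (z + 1)" unfolding d_def by (rule norm_triangle_ineq)
    also have "\<dots> \<le> d + \<alpha> * d"
    proof -
      have "\<alpha> * \<delta> \<le> \<alpha> * d" using d1 \<alpha> by simp
      then show ?thesis using nt by (simp add: \<delta>_def)
    qed
    finally have d2: "\<kappa> * \<bar>t - pi\<bar> \<le> d" using \<alpha> by (simp add: \<kappa>_def field_simps)
    have "\<kappa>\<^sup>2 * (\<delta>\<^sup>2 + (t - pi)\<^sup>2) = (\<kappa> * \<delta>)\<^sup>2 + (\<kappa> * \<bar>t - pi\<bar>)\<^sup>2"
      by (simp add: power_mult_distrib algebra_simps)
    also have "\<dots> \<le> d\<^sup>2 + d\<^sup>2"
    proof (intro add_mono power_mono d2)
      have "\<kappa> * \<delta> \<le> 1 * \<delta>" using \<kappa> \<delta> by (intro mult_right_mono) auto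
      then show "\<kappa> * \<delta> \<le> d" using d1 by simp
    qed (use \<kappa> \<delta> in auto)
    finally have q: "\<kappa>\<^sup>2 * (\<delta>\<^sup>2 + (t - pi)\<^sup>2) \<le> 2 * d\<^sup>2" by simp
    have "1 - (cmod z)\<^sup>2 = (1 + cmod z) * \<delta>" by (simp add: \<delta>_def power2_eq_square algebra_simps)
    also have "\<dots> \<le> 2 * \<delta>" using z \<delta> by (intro mult_right_mono) auto
    finally have "(1 - (cmod z)\<^sup>2) / d\<^sup>2 \<le> 2 * \<delta> / d\<^sup>2" by (simp add: divide_right_mono)
    also have "\<dots> \<le> 2 * \<delta> / (\<kappa>\<^sup>2 * (\<delta>\<^sup>2 + (t - pi)\<^sup>2) / 2)"
      using q \<delta> \<kappa> nz[of "t - pi"] d1 by (intro divide_left_mono mult_pos_pos) auto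
    also have "\<dots> = 4 / \<kappa>\<^sup>2 * (\<delta> / (\<delta>\<^sup>2 + (t - pi)\<^sup>2))" by simp
    finally show ?thesis by (simp add: d_def)
  qed
  have nz2: "cis t - z \<noteq> 0" for t using z by auto
  have nz3: "\<delta>\<^sup>2 + (t - pi)\<^sup>2 \<noteq> 0" for t using nz[of "t - pi"] by linarith
  have "(cmod (F z))\<^sup>2 \<le> (1 - (cmod z)\<^sup>2) / (2*pi) *
     integral {0..2*pi} (\<lambda>t. g t / (cmod (cis t - z))\<^sup>2)"
    unfolding g_def by (rule holomorphic_square_poisson_bound[OF hol R z])
  also have "\<dots> = 1 / (2 * pi) * integral {0..2*pi} (\<lambda>t. (1 - (cmod z)\<^sup>2) * (g t / (cmod (cis t - z))\<^sup>2))"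
    by (simp only: integral_mult_right) simp
  also have "\<dots> \<le> 1 / (2 * pi) * integral {0..2*pi} (\<lambda>t. 4 / \<kappa>\<^sup>2 * (g t * (\<delta> / (\<delta>\<^sup>2 + (t - pi)\<^sup>2))))"
  proof (intro mult_left_mono integral_le)
    fix t assume "t \<in> {0..2*pi}"
    from mult_left_mono[OF kb[OF this], of "g t"]
    show "(1 - (cmod z)\<^sup>2) * (g t / (cmod (cis t - z))\<^sup>2) \<le> 4 / \<kappa>\<^sup>2 * (g t * (\<delta> / (\<delta>\<^sup>2 + (t - pi)\<^sup>2)))"
      by (simp add: g_def mult_ac)
  next
    show "(\<lambda>t. (1 - (cmod z)\<^sup>2) * (g t / (cmod (cis t - z))\<^sup>2)) integrable_on {0..2*pi}"
      by (intro integrable_continuous_interval continuous_intros contg') (use nz2 in auto)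
    show "(\<lambda>t. 4 / \<kappa>\<^sup>2 * (g t * (\<delta> / (\<delta>\<^sup>2 + (t - pi)\<^sup>2)))) integrable_on {0..2*pi}"
      by (intro integrable_continuous_interval continuous_intros contg') (use nz3 in auto)
  qed auto
  also have "\<dots> = 1 / (2 * pi) * (4 / \<kappa>\<^sup>2 * integral {0..2*pi} (\<lambda>t. g t * (\<delta> / (\<delta>\<^sup>2 + (t - pi)\<^sup>2))))"
    by (simp only: integral_mult_right)
  also have "\<dots> \<le> 1 / (2 * pi) * (4 / \<kappa>\<^sup>2 * (pi * l))"
  proof (intro mult_left_mono)
    have "integral {pi - pi..pi + pi} (\<lambda>t. g t * (\<delta> / (\<delta>\<^sup>2 + (t - pi)\<^sup>2))) \<le> pi * l"
      by (rule poisson_kernel_average[OF contg \<delta> _ _ l]) (use avg in \<open>auto simp: g_def[abs_def]\<close>)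
    then show "integral {0..2*pi} (\<lambda>t. g t * (\<delta> / (\<delta>\<^sup>2 + (t - pi)\<^sup>2))) \<le> pi * l" by simp
  qed (use \<kappa> in auto)
  also have "\<dots> = 18 * (1 + \<alpha>)\<^sup>2 * l"
    using \<alpha> by (simp add: \<kappa>_def power2_eq_square algebra_simps)
  finally show ?thesis .
qed

text \<open>Rotation by pi - \<theta> carries the boundary point e^(i\<theta>) to -1 and shifts the
  averaging intervals accordingly.\<close>

lemma nontangential_square_bound:
  fixes F :: "complex \<Rightarrow> complex"
  assumes hol: "F holomorphic_on ball 0 R" and R: "1 < R" and z: "cmod z < 1"
    and \<alpha>: "0 < \<alpha>" and nt: "cmod (z - cis \<theta>) < \<alpha> * (1 - cmod z)" and l: "0 \<le> l"
    and avg: "\<And>r. 0 < r \<Longrightarrow> r \<le> pi \<Longrightarrow> integral {\<theta> - r..\<theta> + r} (\<lambda>t. (cmod (F (cis t)))\<^sup>2) \<le> 2 * r * l"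
  shows "(cmod (F z))\<^sup>2 \<le> 18 * (1 + \<alpha>)\<^sup>2 * l"
proof -
  define G where "G u = F (u * cis (\<theta> - pi))" for u
  have "cmod (G (z * cis (pi - \<theta>)))^2 \<le> 18 * (1 + \<alpha>)\<^sup>2 * l"
  proof (rule nontangential_square_bound_at_minus_one[where F = G and z = "z * cis (pi - \<theta>)" and R = R])
    show "G holomorphic_on ball 0 R" unfolding G_def
      by (rule holomorphic_on_compose_gen[OF _ hol, unfolded o_def])
         (auto intro!: holomorphic_intros simp: norm_mult)
    have "z * cis (pi - \<theta>) + 1 = (z - cis \<theta>) * cis (pi - \<theta>)"
      by (simp add: algebra_simps cis_mult)
    then show "cmod (z * cis (pi - \<theta>) + 1) < \<alpha> * (1 - cmod (z * cis (pi - \<theta>)))"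
      using nt by (simp add: norm_mult)
    show "cmod (z * cis (pi - \<theta>)) < 1" using z by (simp add: norm_mult)
    show "1 < R" "0 < \<alpha>" "0 \<le> l" by fact+
  next
    fix r assume r: "0 < r" "r \<le> pi"
    define g where "g t = (cmod (F (cis t)))\<^sup>2" for t
    have "cball 0 1 \<subseteq> ball (0::complex) R" using R by auto
    then have hc: "F holomorphic_on cball 0 1" using hol holomorphic_on_subset by blast
    have "continuous_on S (\<lambda>t. F (cis t))" for S
      by (rule continuous_on_compose2[OF holomorphic_on_imp_continuous_on[OF hc]])
         (auto intro!: continuous_intros)
    then have "(g has_integral integral {\<theta> - r..\<theta> + r} g) {\<theta> - r..\<theta> + r}"
      unfolding g_def by (intro integrable_integral integrable_continuous_interval continuous_intros)
    from has_integral_shift_real_ivl[OF this, of "\<theta> - pi"]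
    have "integral {pi - r..pi + r} (\<lambda>t. g (t + (\<theta> - pi))) = integral {\<theta> - r..\<theta> + r} g"
      by (intro integral_unique) (simp add: algebra_simps)
    moreover have "(cmod (G (cis t)))\<^sup>2 = g (t + (\<theta> - pi))" for t
      by (simp add: G_def g_def cis_mult)
    ultimately show "integral {pi - r..pi + r} (\<lambda>t. (cmod (G (cis t)))\<^sup>2) \<le> 2 * r * l"
      using avg[OF r] by (simp add: g_def[abs_def])
  qed
  moreover have "G (z * cis (pi - \<theta>)) = F z" by (simp add: G_def mult.assoc cis_mult)
  ultimately show ?thesis by simp
qed

text \<open>By the contrapositive of \<open>nontangential_square_bound\<close>, each exceptional
  angle is the centre of an interval on which |F|^2 has mean above l / (18 (1 + \<alpha>)^2);
  Vitali's covering lemma selects disjoint ones. The constant is 270 = 5 * 3 * 18: Vitali dilation,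
  three periods, pointwise bound. Enclosing the exceptional set in E avoids the question of its
  measurability.\<close>

lemma weak_type_maximal_square:
  fixes F :: "complex \<Rightarrow> complex"
  assumes hol: "F holomorphic_on ball 0 R" and R: "1 < R"
    and \<alpha>: "0 < \<alpha>" and l: "0 < l"
    and K: "integral {0..2*pi} (\<lambda>t. (cmod (F (cis t)))\<^sup>2) \<le> K"
  shows "\<exists>E. E \<in> lmeasurable \<and> measure lebesgue E \<le> 270 * (1 + \<alpha>)\<^sup>2 * K / l \<and>
    {\<theta> \<in> {0..2*pi}. \<exists>z. cmod z < 1 \<and> cmod (z - cis \<theta>) < \<alpha> * (1 - cmod z) \<and> l < (cmod (F z))\<^sup>2} \<subseteq> E"
proof -
  define g where "g t = (cmod (F (cis t)))\<^sup>2" for t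
  have "cball 0 1 \<subseteq> ball (0::complex) R" using R by auto
  then have hc: "F holomorphic_on cball 0 1" using hol holomorphic_on_subset by blast
  have contF: "continuous_on S (\<lambda>t. F (cis t))" for S
    by (rule continuous_on_compose2[OF holomorphic_on_imp_continuous_on[OF hc]])
       (auto intro!: continuous_intros)
  have gint: "g integrable_on {a..b}" for a b unfolding g_def
    by (intro integrable_continuous_interval continuous_intros contF)
  have g0: "0 \<le> g t" for t by (simp add: g_def)
  define m where "m = l / (18 * (1 + \<alpha>)\<^sup>2)"
  have m: "0 < m" using l \<alpha> by (simp add: m_def)
  define B where "B = {\<theta> \<in> {0..2*pi}. \<exists>z. cmod z < 1 \<and> cmod (z - cis \<theta>) < \<alpha> * (1 - cmod z) \<and> l < (cmod (F z))\<^sup>2}"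
  have "\<exists>r. 0 < r \<and> r \<le> pi \<and> 2 * r * m < integral {\<theta> - r..\<theta> + r} g" if th: "\<theta> \<in> B" for \<theta>
  proof (rule ccontr)
    assume "\<not> ?thesis"
    then have avg: "integral {\<theta> - r..\<theta> + r} g \<le> 2 * r * m" if "0 < r" "r \<le> pi" for r
      using that by (meson not_less)
    obtain z where z: "cmod z < 1" "cmod (z - cis \<theta>) < \<alpha> * (1 - cmod z)" "l < (cmod (F z))\<^sup>2"
      using th by (auto simp: B_def)
    have "(cmod (F z))\<^sup>2 \<le> 18 * (1 + \<alpha>)\<^sup>2 * m"
      by (rule nontangential_square_bound[OF hol R z(1) \<alpha> z(2) less_imp_le[OF m] avg[unfolded g_def]])
    also have "\<dots> = l" using \<alpha> by (simp add: m_def)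
    finally show False using z by simp
  qed
  then obtain r where r: "\<And>\<theta>. \<theta> \<in> B \<Longrightarrow> 0 < r \<theta>" "\<And>\<theta>. \<theta> \<in> B \<Longrightarrow> r \<theta> \<le> pi"
    "\<And>\<theta>. \<theta> \<in> B \<Longrightarrow> 2 * r \<theta> * m < integral {\<theta> - r \<theta>..\<theta> + r \<theta>} g" by metis
  have "B \<subseteq> (\<Union>i\<in>B. ball i (r i))" using r by auto
  then obtain C where C: "countable C" "C \<subseteq> B"
      "pairwise (\<lambda>i j. disjnt (ball i (r i)) (ball j (r j))) C"
      "B \<subseteq> (\<Union>i\<in>C. ball i (5 * r i))"
    using Vitali_covering_lemma_balls[where S = B and K = B and a = "\<lambda>i. i" and r = r and B = pi] r by auto
  \<comment> \<open>The selected intervals have radius at most pi and centres in [0, 2 pi], so three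
    periods of g contain them all.\<close>
  have tot: "integral {-2*pi..4*pi} g \<le> 3 * K"
  proof -
    have sh: "integral {a..a+2*pi} g = integral {a+2*pi..a+4*pi} g" for a
    proof -
      have "(g has_integral integral {a+2*pi..a+4*pi} g) {a+2*pi..a+4*pi}"
        by (intro integrable_integral gint)
      from has_integral_shift_real_ivl[OF this, of "2*pi"]
      have "((\<lambda>t. g (t + 2*pi)) has_integral integral {a+2*pi..a+4*pi} g) {a..a+2*pi}"
        by (simp add: algebra_simps)
      moreover have "g (t + 2*pi) = g t" for t by (simp add: g_def flip: cis_mult)
      ultimately show ?thesis by (simp add: integral_unique)
    qed
    have "integral {-2*pi..4*pi} g = integral {-2*pi..0} g + integral {0..2*pi} g + integral {2*pi..4*pi} g"
      using Henstock_Kurzweil_Integration.integral_combine[OF _ _ gint, of "-2*pi" 0 "4*pi"]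
        Henstock_Kurzweil_Integration.integral_combine[OF _ _ gint, of 0 "2*pi" "4*pi"] by simp
    then show ?thesis using sh[of "-2*pi"] sh[of 0] K by (simp add: g_def[abs_def])
  qed
  have K0: "0 \<le> K" using K integral_nonneg[OF gint, of 0 "2*pi"] g0 by (simp add: g_def[abs_def])
  have bound: "measure lebesgue (\<Union>i\<in>I. ball i (5 * r i)) \<le> 270 * (1 + \<alpha>)\<^sup>2 * K / l"
    if I: "I \<subseteq> C" "finite I" for I
  proof -
    have IB: "i \<in> B" if "i \<in> I" for i using that I C by auto
    have "measure lebesgue (\<Union>i\<in>I. ball i (5 * r i)) \<le> (\<Sum>i\<in>I. measure lebesgue (ball i (5 * r i)))"
      by (rule measure_UNION_le) (use I in auto)
    also have "\<dots> = (\<Sum>i\<in>I. 10 * r i)"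
      using r(1)[OF IB] by (intro sum.cong) (auto simp: ball_eq_greaterThanLessThan less_imp_le)
    also have "\<dots> \<le> (\<Sum>i\<in>I. 5 / m * integral {i - r i..i + r i} g)"
      using r(3)[OF IB] m by (intro sum_mono) (simp add: field_simps less_imp_le)
    also have "\<dots> = 5 / m * (\<Sum>i\<in>I. integral {i - r i..i + r i} g)"
      by (simp add: sum_distrib_left)
    also have "(\<Sum>i\<in>I. integral {i - r i..i + r i} g) \<le> integral {-2*pi..4*pi} g"
    proof -
      have hi: "(g has_integral (\<Sum>i\<in>I. integral {i - r i..i + r i} g)) (\<Union>i\<in>I. {i - r i..i + r i})"
      proof (rule has_integral_UN)
        show "pairwise (\<lambda>i i'. negligible ({i - r i..i + r i} \<inter> {i' - r i'..i' + r i'})) I"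
        proof (rule pairwiseI)
          fix i j assume ij: "i \<in> I" "j \<in> I" "i \<noteq> j"
          then have "disjnt (ball i (r i)) (ball j (r j))"
            using C(3) I by (meson pairwiseD subsetD)
          then have nb: "x \<notin> ball i (r i) \<or> x \<notin> ball j (r j)" for x by (auto simp: disjnt_iff)
          \<comment> \<open>The open intervals are disjoint, so the closed ones share at most
            endpoints, a null set.\<close>
          have "{i - r i..i + r i} \<inter> {j - r j..j + r j} \<subseteq> {i - r i, i + r i, j - r j, j + r j}"
          proof
            fix x assume x: "x \<in> {i - r i..i + r i} \<inter> {j - r j..j + r j}"
            have "\<not> (i - r i < x \<and> x < i + r i) \<or> \<not> (j - r j < x \<and> x < j + r j)"
              using nb[of x] by (simp add: ball_eq_greaterThanLessThan)
            then show "x \<in> {i - r i, i + r i, j - r j, j + r j}"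
              using x by (simp add: not_less) linarith
          qed
          then show "negligible ({i - r i..i + r i} \<inter> {j - r j..j + r j})"
            by (rule negligible_subset[rotated]) (auto intro: negligible_finite)
        qed
      qed (use I gint in \<open>auto intro!: integrable_integral\<close>)
      have sub: "(\<Union>i\<in>I. {i - r i..i + r i}) \<subseteq> {-2*pi..4*pi}"
      proof safe
        fix i x assume i: "i \<in> I" "x \<in> {i - r i..i + r i}"
        then have "0 \<le> i" "i \<le> 2 * pi" using IB by (auto simp: B_def)
        then show "x \<in> {-2*pi..4*pi}" using i r(2)[OF IB[OF i(1)]] pi_gt_zero by auto
      qed
      show ?thesis
        using integral_subset_le[OF sub has_integral_integrable[OF hi] gint] g0 integral_unique[OF hi]
        by simp
    qed
    also have "5 / m * integral {-2*pi..4*pi} g \<le> 5 / m * (3 * K)"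
      using tot m by (intro mult_left_mono) auto
    also have "\<dots> = 270 * (1 + \<alpha>)\<^sup>2 * K / l" by (simp add: m_def)
    finally show ?thesis using m by (simp add: divide_right_mono)
  qed
  show ?thesis
  proof (intro exI conjI)
    show "(\<Union>i\<in>C. ball i (5 * r i)) \<in> lmeasurable"
      by (rule fmeasurable_UN_bound[OF C(1) _ bound]) auto
    show "measure lebesgue (\<Union>i\<in>C. ball i (5 * r i)) \<le> 270 * (1 + \<alpha>)\<^sup>2 * K / l"
      by (rule measure_UN_bound[OF C(1) _ bound]) auto
  qed (use C(4) in \<open>auto simp: B_def\<close>)
qed

lemma nn_integral_lebesgue_on_interval:
  fixes f :: "real \<Rightarrow> real"
  assumes "continuous_on {a..b} f" "\<And>x. x \<in> {a..b} \<Longrightarrow> 0 \<le> f x"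
  shows "(\<integral>\<^sup>+x. ennreal (f x) \<partial>lebesgue_on {a..b}) = ennreal (integral {a..b} f)"
proof -
  have "(f has_integral integral {a..b} f) {a..b}"
    by (intro integrable_integral integrable_continuous_interval assms)
  from nn_integral_has_integral_lebesgue'[OF assms(2) this]
  show ?thesis by (simp add: nn_integral_restrict_space nn_integral_completion)
qed

lemma continuous_on_circle:
  assumes "continuous_on (ball 0 1) F" "0 \<le> r" "r < 1"
  shows "continuous_on S (\<lambda>t. F (rcis r t))"
  by (rule continuous_on_compose2[OF assms(1)])
     (use assms in \<open>auto simp: rcis_def norm_mult intro!: continuous_intros\<close>)

text \<open>The preceding bound wants F beyond the unit circle, so it is applied to the dilations
  F(\<rho>_n z). The resulting sets need not be nested, but their lower limit keeps the measure
  bound, and it catches every bad angle because |F(\<rho>_n z)|^2 > l for all large n by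
  continuity.\<close>

lemma nontangential_maximal_weak_type:
  fixes F :: "complex \<Rightarrow> complex"
  assumes hol: "F holomorphic_on ball 0 1" and \<alpha>: "0 < \<alpha>" and l: "0 < l"
    and K: "\<And>r. 0 < r \<Longrightarrow> r < 1 \<Longrightarrow> integral {0..2*pi} (\<lambda>t. (cmod (F (rcis r t)))\<^sup>2) \<le> K"
  shows "\<exists>E. E \<in> lmeasurable \<and> measure lebesgue E \<le> 270 * (1 + \<alpha>)\<^sup>2 * K / l \<and>
    {\<theta> \<in> {0..2*pi}. \<exists>z \<in> stolz \<alpha> (cis \<theta>). l < (cmod (F z))\<^sup>2} \<subseteq> E"
proof -
  define \<rho> where "\<rho> n = 1 - 1 / (real n + 2)" for n
  have \<rho>: "0 < \<rho> n" "\<rho> n < 1" for n by (auto simp: \<rho>_def field_simps)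
  have "\<exists>E. E \<in> lmeasurable \<and> measure lebesgue E \<le> 270 * (1 + \<alpha>)\<^sup>2 * K / l \<and>
    {\<theta> \<in> {0..2*pi}. \<exists>z. cmod z < 1 \<and> cmod (z - cis \<theta>) < \<alpha> * (1 - cmod z) \<and> l < (cmod (F (of_real (\<rho> n) * z)))\<^sup>2} \<subseteq> E" for n
  proof (rule weak_type_maximal_square[OF _ _ \<alpha> l, where R = "1 / \<rho> n"])
    show "(\<lambda>z. F (of_real (\<rho> n) * z)) holomorphic_on ball 0 (1 / \<rho> n)"
      by (rule holomorphic_on_compose_gen[OF _ hol, unfolded o_def])
         (use \<rho>[of n] in \<open>auto intro!: holomorphic_intros simp: norm_mult field_simps\<close>)
    show "1 < 1 / \<rho> n" using \<rho>[of n] by simp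
    show "integral {0..2*pi} (\<lambda>t. (cmod (F (\<rho> n * cis t)))\<^sup>2) \<le> K"
      using K[OF \<rho>] by (simp add: rcis_def)
  qed
  then have "\<forall>n. \<exists>E. E \<in> lmeasurable \<and> measure lebesgue E \<le> 270 * (1 + \<alpha>)\<^sup>2 * K / l \<and>
    {\<theta> \<in> {0..2*pi}. \<exists>z. cmod z < 1 \<and> cmod (z - cis \<theta>) < \<alpha> * (1 - cmod z) \<and> l < (cmod (F (of_real (\<rho> n) * z)))\<^sup>2} \<subseteq> E"
    by (rule allI)
  from choice[OF this] obtain E where E: "\<And>n. E n \<in> lmeasurable" "\<And>n. measure lebesgue (E n) \<le> 270 * (1 + \<alpha>)\<^sup>2 * K / l"
    "\<And>n. {\<theta> \<in> {0..2*pi}. \<exists>z. cmod z < 1 \<and> cmod (z - cis \<theta>) < \<alpha> * (1 - cmod z) \<and> l < (cmod (F (of_real (\<rho> n) * z)))\<^sup>2} \<subseteq> E n"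
    by blast
  \<comment> \<open>The sets \<open>A m\<close> increase with m and satisfy
    \<open>A m \<subseteq> E m\<close>, so all finite unions obey the same bound.\<close>
  define A where "A m = (\<Inter>n\<in>{m..}. E n)" for m
  have A2: "A m \<subseteq> E m" for m unfolding A_def by auto
  have A1: "A m \<in> lmeasurable" for m
  proof (rule fmeasurableI2[OF E(1) A2])
    show "A m \<in> sets lebesgue"
      unfolding A_def by (rule sets.countable_INT'') (use E(1) in \<open>auto intro: fmeasurableD\<close>)
  qed
  have bd: "measure lebesgue (\<Union>i\<le>m. A i) \<le> 270 * (1 + \<alpha>)\<^sup>2 * K / l" for m
  proof -
    have "(\<Union>i\<le>m. A i) = A m" by (auto simp: A_def)
    then show ?thesis
      using measure_mono_fmeasurable[OF A2[of m] fmeasurableD[OF A1[of m]] E(1)] E(2)[of m] by simp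
  qed
  have "{\<theta> \<in> {0..2*pi}. \<exists>z \<in> stolz \<alpha> (cis \<theta>). l < (cmod (F z))\<^sup>2} \<subseteq> (\<Union>m. A m)"
  proof safe
    fix \<theta> z assume th: "\<theta> \<in> {0..2*pi}" "z \<in> stolz \<alpha> (cis \<theta>)" "l < (cmod (F z))\<^sup>2"
    have z: "cmod z < 1" "cmod (z - cis \<theta>) < \<alpha> * (1 - cmod z)" using th by (auto simp: stolz_def)
    have "isCont F z"
      using holomorphic_on_imp_continuous_on[OF hol] z by (simp add: continuous_on_eq_continuous_at)
    moreover have "(\<lambda>n. \<rho> n * z) \<longlonglongrightarrow> z"
    proof -
      have "(\<lambda>n. 1 / (real n + 2)) \<longlonglongrightarrow> 0" by real_asymp
      then have "\<rho> \<longlonglongrightarrow> 1" unfolding \<rho>_def using tendsto_diff[OF tendsto_const[of 1]] by fastforce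
      then have "(\<lambda>n. of_real (\<rho> n) * z) \<longlonglongrightarrow> of_real 1 * z" by (intro tendsto_intros)
      then show ?thesis by simp
    qed
    ultimately have "(\<lambda>n. F (\<rho> n * z)) \<longlonglongrightarrow> F z" by (rule isCont_tendsto_compose)
    then have "(\<lambda>n. (cmod (F (\<rho> n * z)))\<^sup>2) \<longlonglongrightarrow> (cmod (F z))\<^sup>2" by (intro tendsto_intros)
    then have "eventually (\<lambda>n. l < (cmod (F (of_real (\<rho> n) * z)))\<^sup>2) sequentially"
      using th(3) by (rule order_tendstoD)
    then obtain m where "\<And>n. m \<le> n \<Longrightarrow> l < (cmod (F (of_real (\<rho> n) * z)))\<^sup>2"
      by (auto simp: eventually_sequentially)
    then have "\<theta> \<in> A m" using E(3) th(1) z unfolding A_def by blast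
    then show "\<theta> \<in> (\<Union>m. A m)" by blast
  qed
  then show ?thesis
    using fmeasurable_countable_Union[OF A1 bd] measure_countable_Union_le[OF A1 bd] by blast
qed

text \<open>The circle means of \<open>\<bar>F(z) - F(\<rho> z)\<bar>\<^sup>2\<close> are increments of the bounded increasing
  correlation function \<open>J\<close>.\<close>

lemma H2_dilation_error:
  fixes F :: "complex \<Rightarrow> complex"
  assumes hol: "F holomorphic_on ball 0 1" and \<epsilon>: "0 < \<epsilon>"
    and K: "\<And>r. 0 < r \<Longrightarrow> r < 1 \<Longrightarrow> integral {0..2*pi} (\<lambda>t. (cmod (F (rcis r t)))\<^sup>2) \<le> K"
  obtains \<rho>0 where "0 < \<rho>0" "\<rho>0 < 1"
    "\<And>r s. \<rho>0 \<le> r \<Longrightarrow> r < 1 \<Longrightarrow> \<rho>0 \<le> s \<Longrightarrow> s < 1 \<Longrightarrow>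
       integral {0..2*pi} (\<lambda>t. (cmod (F (rcis r t) - F (rcis s t)))\<^sup>2) \<le> \<epsilon>"
proof -
  obtain J where J: "\<And>r s. 0 < r \<Longrightarrow> r < 1 \<Longrightarrow> 0 < s \<Longrightarrow> s < 1 \<Longrightarrow>
      ((\<lambda>t. F (rcis r t) * cnj (F (rcis s t))) has_integral of_real (J (r * s))) {0..2*pi}"
    and mono: "\<And>x y. 0 < x \<Longrightarrow> x \<le> y \<Longrightarrow> y < 1 \<Longrightarrow> J x \<le> J y"
    using circle_correlation[OF hol] by auto
  have ReJ: "((\<lambda>t. Re (F (rcis r t) * cnj (F (rcis s t)))) has_integral J (r * s)) {0..2*pi}"
    if "0 < r" "r < 1" "0 < s" "s < 1" for r s
    using has_integral_Re[OF J[OF that]] by simp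
  have sq: "((\<lambda>t. (cmod (F (rcis r t)))\<^sup>2) has_integral J (r * r)) {0..2*pi}" if "0 < r" "r < 1" for r
    using ReJ[OF that that] by (simp add: complex_mult_cnj cmod_power2)
  have JK: "J x \<le> K" if "0 < x" "x < 1" for x
    using K[of "sqrt x"] integral_unique[OF sq[of "sqrt x"]] that by (simp add: real_sqrt_lt_1_iff)
  define S where "S = Sup (J ` {0<..<1})"
  have bdd: "bdd_above (J ` {0<..<1})" using JK by (auto intro!: bdd_aboveI[where M = K])
  have JS: "J x \<le> S" if "0 < x" "x < 1" for x
    unfolding S_def using that bdd by (intro cSup_upper) auto
  \<comment> \<open>J is increasing and bounded by K, so from some x0 on it stays within \<epsilon>
    of its supremum. The radius \<open>\<rho>0\<close> is a square root because J is evaluated at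
    products of radii.\<close>
  have "\<exists>x\<in>J ` {0<..<1}. S - \<epsilon> < x"
    unfolding S_def by (rule less_cSupD) (use \<epsilon> in \<open>auto intro!: exI[of _ "1/2"]\<close>)
  then obtain x0 where x0: "0 < x0" "x0 < 1" "S - \<epsilon> < J x0" by auto
  define \<rho>0 where "\<rho>0 = sqrt x0"
  have \<rho>0: "0 < \<rho>0" "\<rho>0 < 1" "\<rho>0 * \<rho>0 = x0" using x0 by (auto simp: \<rho>0_def real_sqrt_lt_1_iff)
  have le: "integral {0..2*pi} (\<lambda>t. (cmod (F (rcis r t) - F (rcis s t)))\<^sup>2) \<le> \<epsilon>"
    if rs: "\<rho>0 \<le> r" "r < 1" "\<rho>0 \<le> s" "s < 1" "r \<le> s" for r s
  proof -
    have r: "0 < r" "0 < s" using rs \<rho>0 by auto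
    have "((\<lambda>t. (cmod (F (rcis r t)))\<^sup>2 - 2 * Re (F (rcis r t) * cnj (F (rcis s t))) + (cmod (F (rcis s t)))\<^sup>2)
        has_integral (J (r * r) - 2 * J (r * s) + J (s * s))) {0..2*pi}"
      by (intro has_integral_add has_integral_diff has_integral_mult_right sq ReJ) (use r rs in auto)
    moreover have "(cmod (F (rcis r t)))\<^sup>2 - 2 * Re (F (rcis r t) * cnj (F (rcis s t))) + (cmod (F (rcis s t)))\<^sup>2
       = (cmod (F (rcis r t) - F (rcis s t)))\<^sup>2" for t
      unfolding cmod_power2 by (simp add: power2_eq_square algebra_simps)
    ultimately have "integral {0..2*pi} (\<lambda>t. (cmod (F (rcis r t) - F (rcis s t)))\<^sup>2)
        = J (r * r) - 2 * J (r * s) + J (s * s)" by (simp add: integral_unique)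
    \<comment> \<open>Replacing J (r s) by the smaller J (r r) turns the quadratic expression into a
      single increment of J.\<close>
    also have "\<dots> \<le> J (s * s) - J (r * r)"
      using mono[of "r * r" "r * s"] r rs mult_strict_mono[of r 1 s 1] by (simp add: mult_left_mono)
    also have "\<dots> \<le> S - J x0"
    proof (rule diff_mono)
     show "J x0 \<le> J (r * r)"
      using \<rho>0 x0 rs r mult_strict_mono[of r 1 r 1] mult_mono[of \<rho>0 r \<rho>0 r] by (intro mono) auto
     show "J (s * s) \<le> S" using r rs mult_strict_mono[of s 1 s 1] by (intro JS) auto
    qed
    finally show ?thesis using x0 by simp
  qed
  show ?thesis
  proof
    show "integral {0..2*pi} (\<lambda>t. (cmod (F (rcis r t) - F (rcis s t)))\<^sup>2) \<le> \<epsilon>"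
      if "\<rho>0 \<le> r" "r < 1" "\<rho>0 \<le> s" "s < 1" for r s
      using le[of r s] le[of s r] that by (cases "r \<le> s") (auto simp: norm_minus_commute)
  qed fact+
qed

text \<open>The mean at radius r is the diagonal value J (r r) of the increasing correlation
  function.\<close>

lemma circle_mean_mono:
  fixes F :: "complex \<Rightarrow> complex"
  assumes hol: "F holomorphic_on ball 0 R" and r: "0 < r" "r \<le> s" "s < R"
  shows "integral {0..2*pi} (\<lambda>t. (cmod (F (rcis r t)))\<^sup>2) \<le> integral {0..2*pi} (\<lambda>t. (cmod (F (rcis s t)))\<^sup>2)"
proof -
  have R: "0 < R" using r by simp
  obtain J where J: "\<And>r s. 0 < r \<Longrightarrow> r < R \<Longrightarrow> 0 < s \<Longrightarrow> s < R \<Longrightarrow>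
      ((\<lambda>t. F (rcis r t) * cnj (F (rcis s t))) has_integral of_real (J (r * s))) {0..2*pi}"
    and mono: "\<And>x y. 0 < x \<Longrightarrow> x \<le> y \<Longrightarrow> y < R\<^sup>2 \<Longrightarrow> J x \<le> J y"
    using circle_correlation[OF hol R] by blast
  have sq: "((\<lambda>t. (cmod (F (rcis r t)))\<^sup>2) has_integral J (r * r)) {0..2*pi}" if "0 < r" "r < R" for r
    using has_integral_Re[OF J[OF that that]] by (simp add: complex_mult_cnj cmod_power2)
  have "J (r * r) \<le> J (s * s)"
    using r mult_strict_mono[of s R s R] by (intro mono) (auto simp: mult_mono power2_eq_square)
  then show ?thesis using integral_unique[OF sq] r by simp
qed

section \<open>Nontangential and radial limits\<close>

text \<open>A limit along one fixed sequence of radii, so that measurability follows from countable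
  operations. The shift by 2 makes the radii start at 1/2.\<close>

definition radial_limit :: "(complex \<Rightarrow> 'a::t2_space) \<Rightarrow> complex \<Rightarrow> 'a" where
  "radial_limit F \<zeta> = lim (\<lambda>n. F (of_real (1 - 1 / (real n + 2)) * \<zeta>))"

text \<open>A single value L serves all apertures. Since |z - \<zeta>| \<ge> 1 - |z| for |\<zeta>| =
  1, regions with \<alpha> \<le> 1 would be empty.\<close>

definition nt_converges :: "(complex \<Rightarrow> 'a::t2_space) \<Rightarrow> complex \<Rightarrow> bool" where
  "nt_converges F \<zeta> \<longleftrightarrow> (\<exists>L. \<forall>\<alpha>>1. (F \<longlongrightarrow> L) (at \<zeta> within stolz \<alpha> \<zeta>))"

lemma stolz_radial:
  assumes "cmod \<zeta> = 1" "0 < r" "r < 1" "1 < \<alpha>"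
  shows "of_real r * \<zeta> \<in> stolz \<alpha> \<zeta>"
proof -
  have "of_real r * \<zeta> - \<zeta> = of_real (r - 1) * \<zeta>" by (simp add: algebra_simps)
  then have "cmod (of_real r * \<zeta> - \<zeta>) = 1 - r" using assms by (simp only: norm_mult norm_of_real) simp
  then show ?thesis using assms by (simp add: stolz_def norm_mult)
qed

lemma stolz_filter_radial:
  assumes "cmod \<zeta> = 1" "1 < \<alpha>"
  shows "filterlim (\<lambda>r. of_real r * \<zeta>) (at \<zeta> within stolz \<alpha> \<zeta>) (at_left 1)"
  unfolding filterlim_at
proof
  have "((\<lambda>r. of_real r * \<zeta>) \<longlongrightarrow> of_real 1 * \<zeta>) (at_left 1)" by (intro tendsto_intros)
  then show "((\<lambda>r. of_real r * \<zeta>) \<longlongrightarrow> \<zeta>) (at_left 1)" by simp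
  have "eventually (\<lambda>r. r \<in> {0<..<1::real}) (at_left 1)" by (rule eventually_at_leftI[of 0]) auto
  then show "eventually (\<lambda>r. of_real r * \<zeta> \<in> stolz \<alpha> \<zeta> \<and> of_real r * \<zeta> \<noteq> \<zeta>) (at_left 1)"
  proof eventually_elim
    case (elim r)
    then have "cmod (of_real r * \<zeta>) \<noteq> cmod \<zeta>" using assms by (simp add: norm_mult)
    then show ?case using stolz_radial[OF assms(1) _ _ assms(2), of r] elim by auto
  qed
qed

lemma radial_sequence: "filterlim (\<lambda>n. 1 - 1 / (real n + 2)) (at_left 1) sequentially"
  unfolding filterlim_at by (auto simp: field_simps) real_asymp

text \<open>The radius lies in every Stolz region, so a nontangential limit must be the value that
  \<open>radial_limit\<close> picks.\<close>

lemma nt_converges_at_left: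
  fixes F :: "complex \<Rightarrow> 'a::t2_space"
  assumes nt: "nt_converges F \<zeta>" and \<zeta>: "cmod \<zeta> = 1"
  shows "\<And>\<alpha>. 1 < \<alpha> \<Longrightarrow> (F \<longlongrightarrow> radial_limit F \<zeta>) (at \<zeta> within stolz \<alpha> \<zeta>)"
    and "((\<lambda>r. F (of_real r * \<zeta>)) \<longlongrightarrow> radial_limit F \<zeta>) (at_left 1)"
proof -
  obtain L where L: "\<And>\<alpha>. 1 < \<alpha> \<Longrightarrow> (F \<longlongrightarrow> L) (at \<zeta> within stolz \<alpha> \<zeta>)"
    using nt by (auto simp: nt_converges_def)
  have r: "((\<lambda>r. F (of_real r * \<zeta>)) \<longlongrightarrow> L) (at_left 1)"
    by (rule filterlim_compose[OF L[of 2] stolz_filter_radial[OF \<zeta>]]) auto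
  have "radial_limit F \<zeta> = L"
    unfolding radial_limit_def by (rule limI) (rule filterlim_compose[OF r radial_sequence])
  then show "\<And>\<alpha>. 1 < \<alpha> \<Longrightarrow> (F \<longlongrightarrow> radial_limit F \<zeta>) (at \<zeta> within stolz \<alpha> \<zeta>)"
    "((\<lambda>r. F (of_real r * \<zeta>)) \<longlongrightarrow> radial_limit F \<zeta>) (at_left 1)" using L r by auto
qed

lemma negligible_imp_AE_interval:
  fixes a b :: real
  assumes "negligible N" "\<And>\<theta>. \<theta> \<in> {a..b} \<Longrightarrow> \<theta> \<notin> N \<Longrightarrow> P \<theta>"
  shows "AE \<theta> in lebesgue_on {a..b}. P \<theta>"
proof -
  have "AE \<theta> in lebesgue. \<theta> \<notin> N"
    using assms(1) by (intro AE_not_in) (simp add: negligible_iff_null_sets)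
  then have "AE \<theta> in lebesgue. \<theta> \<in> {a..b} \<longrightarrow> P \<theta>"
    by eventually_elim (use assms(2) in blast)
  then show ?thesis
    by (subst AE_restrict_space_iff) auto
qed

text \<open>A Cauchy criterion indexed by integer apertures and tolerances 1 / (m + 1), so that the
  exceptional angles will form a countable union. The radial sequence enters every aperture, which
  forces a common limit.\<close>

lemma nt_cauchy_imp_nt_converges:
  fixes F :: "complex \<Rightarrow> complex"
  assumes \<zeta>: "cmod \<zeta> = 1"
    and osc: "\<And>N m::nat. \<exists>d>0. \<forall>z\<in>stolz (real N + 2) \<zeta> \<inter> ball \<zeta> d. \<forall>z'\<in>stolz (real N + 2) \<zeta> \<inter> ball \<zeta> d.
      cmod (F z - F z') \<le> 1 / (real m + 1)"
  shows "nt_converges F \<zeta>"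
proof -
  define x where "x n = of_real (1 - 1 / (real n + 2)) * \<zeta>" for n :: nat
  have xlim: "filterlim x (at \<zeta> within stolz (real N + 2) \<zeta>) sequentially" for N :: nat
    unfolding x_def by (rule filterlim_compose[OF stolz_filter_radial[OF \<zeta>] radial_sequence]) simp
  have xev: "eventually (\<lambda>n. x n \<in> stolz (real N + 2) \<zeta> \<inter> ball \<zeta> d) sequentially" if "0 < d" for N d
  proof -
    have "x \<longlonglongrightarrow> \<zeta>" "eventually (\<lambda>n. x n \<in> stolz (real N + 2) \<zeta>) sequentially"
      using xlim[of N] by (auto simp: filterlim_at eventually_conj_iff)
    moreover from this(1) have "eventually (\<lambda>n. dist (x n) \<zeta> < d) sequentially" using that by (rule tendstoD)
    ultimately show ?thesis by (auto elim: eventually_elim2 simp: dist_commute)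
  qed
  have "Cauchy (\<lambda>n. F (x n))"
  proof (rule CauchyI)
    fix e :: real assume e: "0 < e"
    then obtain m :: nat where m: "inverse (real (Suc m)) < e" using reals_Archimedean by blast
    obtain d where d: "d > 0" "\<And>z z'. z \<in> stolz (real 0 + 2) \<zeta> \<inter> ball \<zeta> d \<Longrightarrow>
      z' \<in> stolz (real 0 + 2) \<zeta> \<inter> ball \<zeta> d \<Longrightarrow> cmod (F z - F z') \<le> 1 / (real m + 1)" using osc[of 0 m] by blast
    obtain M where "\<And>n. M \<le> n \<Longrightarrow> x n \<in> stolz (real 0 + 2) \<zeta> \<inter> ball \<zeta> d"
      using xev[OF d(1), of 0] unfolding eventually_sequentially by blast
    then have "norm (F (x k) - F (x n)) \<le> 1 / (real m + 1)" if "M \<le> k" "M \<le> n" for k n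
      using d(2) that by blast
    moreover have "1 / (real m + 1) < e" using m by (simp add: inverse_eq_divide add.commute)
    ultimately show "\<exists>M. \<forall>m\<ge>M. \<forall>n\<ge>M. norm (F (x m) - F (x n)) < e" by (meson le_less_trans)
  qed
  then obtain L where L: "(\<lambda>n. F (x n)) \<longlonglongrightarrow> L" using Cauchy_convergent convergent_def by blast
  have "(F \<longlongrightarrow> L) (at \<zeta> within stolz \<alpha> \<zeta>)" if \<alpha>: "1 < \<alpha>" for \<alpha>
  proof -
    obtain N where N: "\<alpha> \<le> real N" using real_arch_simple by blast
    have sub: "stolz \<alpha> \<zeta> \<subseteq> stolz (real N + 2) \<zeta>"
    proof
      fix z assume "z \<in> stolz \<alpha> \<zeta>"
      then have z: "cmod z < 1" "cmod (z - \<zeta>) < \<alpha> * (1 - cmod z)" by (auto simp: stolz_def)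
      have "\<alpha> * (1 - cmod z) \<le> (real N + 2) * (1 - cmod z)" using N z by (intro mult_right_mono) auto
      with z(2) have "cmod (z - \<zeta>) < (real N + 2) * (1 - cmod z)" by (rule order_less_le_trans)
      then show "z \<in> stolz (real N + 2) \<zeta>" using z by (simp add: stolz_def)
    qed
    show ?thesis
    proof (rule tendstoI)
      fix e :: real assume e: "0 < e"
      then obtain m :: nat where m: "inverse (real (Suc m)) < e" using reals_Archimedean by blast
      obtain d where d: "d > 0" "\<And>z z'. z \<in> stolz (real N + 2) \<zeta> \<inter> ball \<zeta> d \<Longrightarrow>
        z' \<in> stolz (real N + 2) \<zeta> \<inter> ball \<zeta> d \<Longrightarrow> cmod (F z - F z') \<le> 1 / (real m + 1)" using osc[of N m] by blast
      have "dist (F z) L < e" if z: "z \<in> stolz (real N + 2) \<zeta> \<inter> ball \<zeta> d" for z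
      proof -
        have "(\<lambda>n. cmod (F z - F (x n))) \<longlonglongrightarrow> cmod (F z - L)" by (intro tendsto_intros L)
        moreover have "eventually (\<lambda>n. cmod (F z - F (x n)) \<le> 1 / (real m + 1)) sequentially"
          using xev[OF d(1), of N] by eventually_elim (use d(2) z in blast)
        ultimately have "cmod (F z - L) \<le> 1 / (real m + 1)"
          using tendsto_upperbound trivial_limit_sequentially by blast
        also have "\<dots> < e" using m by (simp add: inverse_eq_divide add.commute)
        finally show ?thesis by (simp add: dist_norm)
      qed
      then show "eventually (\<lambda>z. dist (F z) L < e) (at \<zeta> within stolz \<alpha> \<zeta>)"
        unfolding eventually_at using d(1) sub by (auto simp: dist_commute intro!: exI[of _ d])
    qed
  qed
  then show ?thesis unfolding nt_converges_def by blast
qed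

text \<open>A density argument: a dilation G of F is continuous across the circle, and the maximal
  inequality for F - G confines the angles with large deviation to a set of small measure. Hence
  each \<open>Bad N m\<close> is negligible.\<close>

theorem H2_nt_converges:
  fixes F :: "complex \<Rightarrow> complex"
  assumes hol: "F holomorphic_on ball 0 1"
    and K: "\<And>r. 0 < r \<Longrightarrow> r < 1 \<Longrightarrow> integral {0..2*pi} (\<lambda>t. (cmod (F (rcis r t)))\<^sup>2) \<le> K"
  shows "AE \<theta> in lebesgue_on {0..2*pi}. nt_converges F (cis \<theta>)"
proof -
  define Bad where "Bad N m = {\<theta> \<in> {0..2*pi}. \<not> (\<exists>d>0. \<forall>z\<in>stolz (real N + 2) (cis \<theta>) \<inter> ball (cis \<theta>) d.
     \<forall>z'\<in>stolz (real N + 2) (cis \<theta>) \<inter> ball (cis \<theta>) d. cmod (F z - F z') \<le> 1 / (real m + 1))}" for N m :: nat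
  have "negligible (Bad N m)" for N m
    unfolding negligible_outer_le
  proof (intro allI impI)
    fix \<epsilon> :: real assume \<epsilon>: "0 < \<epsilon>"
    \<comment> \<open>F z - F z' will be split into four pieces of size at most l.\<close>
    define l where "l = 1 / (4 * (real m + 1))"
    have l: "0 < l" by (simp add: l_def)
    define C where "C = 270 * (1 + (real N + 2))\<^sup>2"
    have C: "0 < C" by (simp add: C_def)
    \<comment> \<open>This mean-square error makes the weak-type bound at level l^2 equal to
      \<epsilon>.\<close>
    have "0 < \<epsilon> * l\<^sup>2 / C" using \<epsilon> l C by simp
    then obtain \<rho> where \<rho>: "0 < \<rho>" "\<rho> < 1"
      "\<And>r s. \<rho> \<le> r \<Longrightarrow> r < 1 \<Longrightarrow> \<rho> \<le> s \<Longrightarrow> s < 1 \<Longrightarrow>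
       integral {0..2*pi} (\<lambda>t. (cmod (F (rcis r t) - F (rcis s t)))\<^sup>2) \<le> \<epsilon> * l\<^sup>2 / C"
      using H2_dilation_error[OF hol _ K] by blast
    \<comment> \<open>A square root, so that r \<ge> \<open>\<rho>1\<close> keeps the dilated radius
      \<open>\<rho>1 * r\<close> at or above \<open>\<rho>\<close>, where the Cauchy estimate
      holds.\<close>
    define \<rho>1 where "\<rho>1 = sqrt \<rho>"
    have \<rho>1: "0 < \<rho>1" "\<rho>1 < 1" "\<rho>1 * \<rho>1 = \<rho>"
      using \<rho> by (auto simp: \<rho>1_def real_sqrt_lt_1_iff)
    define G where "G z = F (of_real \<rho>1 * z)" for z
    have holG: "G holomorphic_on ball 0 (1 / \<rho>1)" unfolding G_def
      by (rule holomorphic_on_compose_gen[OF _ hol, unfolded o_def])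
         (use \<rho>1 in \<open>auto intro!: holomorphic_intros simp: norm_mult field_simps\<close>)
    have holG1: "G holomorphic_on ball 0 1"
    proof (rule holomorphic_on_subset[OF holG])
      have "1 < 1 / \<rho>1" using \<rho>1 by simp
      then show "ball 0 1 \<subseteq> ball (0::complex) (1 / \<rho>1)" by (intro subset_ball) simp
    qed
    have holH: "(\<lambda>z. F z - G z) holomorphic_on ball 0 1" by (intro holomorphic_intros hol holG1)
    have big: "integral {0..2*pi} (\<lambda>t. (cmod (F (rcis r t) - G (rcis r t)))\<^sup>2) \<le> \<epsilon> * l\<^sup>2 / C"
      if r: "\<rho>1 \<le> r" "r < 1" for r
    proof -
      have "\<rho> \<le> \<rho>1 * r" using mult_left_mono[OF r(1), of \<rho>1] \<rho>1 by simp
      moreover have "\<rho>1 * r < 1" using mult_strict_mono[of \<rho>1 1 r 1] \<rho>1 r by simp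
      moreover have "\<rho> \<le> r" using \<rho>1 r mult_left_le_one_le[of \<rho>1 \<rho>1] by simp
      moreover have "G (rcis r t) = F (rcis (\<rho>1 * r) t)" for t by (simp add: G_def rcis_def mult.assoc)
      ultimately show ?thesis using \<rho>(3)[of r "\<rho>1 * r"] r by simp
    qed
    \<comment> \<open>Below \<open>\<rho>1\<close> the mean of F - G is controlled by its mean at
      \<open>\<rho>1\<close>, by monotonicity in the radius.\<close>
    have "integral {0..2*pi} (\<lambda>t. (cmod (F (rcis r t) - G (rcis r t)))\<^sup>2) \<le> \<epsilon> * l\<^sup>2 / C"
      if r: "0 < r" "r < 1" for r
    proof (cases "\<rho>1 \<le> r")
      case False
      then show ?thesis
        using circle_mean_mono[OF holH r(1), of \<rho>1] big[of \<rho>1] \<rho>1 by simp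
    qed (use big r in auto)
    from nontangential_maximal_weak_type[OF holH _ _ this, of "real N + 2" "l\<^sup>2"]
    obtain E where E: "E \<in> lmeasurable" "measure lebesgue E \<le> C * (\<epsilon> * l\<^sup>2 / C) / l\<^sup>2"
      "{\<theta> \<in> {0..2*pi}. \<exists>z \<in> stolz (real N + 2) (cis \<theta>). l\<^sup>2 < (cmod (F z - G z))\<^sup>2} \<subseteq> E"
      using l by (auto simp: C_def)
    have "Bad N m \<subseteq> E"
    proof
      fix \<theta> assume th: "\<theta> \<in> Bad N m"
      show "\<theta> \<in> E"
      proof (rule ccontr)
        assume notE: "\<theta> \<notin> E"
        have H: "cmod (F z - G z) \<le> l" if zS: "z \<in> stolz (real N + 2) (cis \<theta>)" for z
        proof (rule ccontr)
          assume "\<not> cmod (F z - G z) \<le> l"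
          then have "l\<^sup>2 < (cmod (F z - G z))\<^sup>2" using l by (intro power_strict_mono) auto
          moreover have "\<theta> \<in> {0..2*pi}" using th by (simp add: Bad_def)
          ultimately have "\<theta> \<in> E" using E(3) zS by blast
          with notE show False ..
        qed
        have "isCont G (cis \<theta>)"
          using holomorphic_on_imp_continuous_on[OF holG] \<rho>1
          by (simp add: continuous_on_eq_continuous_at)
        then obtain d where d: "d > 0" "\<And>z. dist z (cis \<theta>) < d \<Longrightarrow> dist (G z) (G (cis \<theta>)) < l"
          using l unfolding continuous_at_eps_delta by blast
        have "cmod (F z - F z') \<le> 1 / (real m + 1)"
          if z: "z \<in> stolz (real N + 2) (cis \<theta>) \<inter> ball (cis \<theta>) d" "z' \<in> stolz (real N + 2) (cis \<theta>) \<inter> ball (cis \<theta>) d" for z z'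
        proof -
          have "cmod (G z - G (cis \<theta>)) < l" "cmod (G z' - G (cis \<theta>)) < l"
            using d(2)[of z] d(2)[of z'] z by (auto simp: dist_norm norm_minus_commute)
          moreover have "F z - F z' = (F z - G z) - (F z' - G z') + (G z - G (cis \<theta>)) - (G z' - G (cis \<theta>))"
            by simp
          moreover have "cmod (a - b + c - e) \<le> cmod a + cmod b + cmod c + cmod e" for a b c e
            by (smt (verit) norm_triangle_ineq norm_triangle_ineq4)
          ultimately have "cmod (F z - F z') \<le> l + l + l + l"
            using H[of z] H[of z'] z by (smt (verit) IntD1)
          also have "\<dots> = 1 / (real m + 1)" by (simp add: l_def field_simps)
          finally show ?thesis .
        qed
        with d(1) th show False unfolding Bad_def by blast
      qed
    qed
    moreover have "measure lebesgue E \<le> \<epsilon>" using E(2) C l by simp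
    ultimately show "\<exists>T. Bad N m \<subseteq> T \<and> T \<in> lmeasurable \<and> measure lebesgue T \<le> \<epsilon>" using E(1) by blast
  qed
  then have "negligible (\<Union>N. \<Union>m. Bad N m)"
    by (intro negligible_countable_Union) auto
  then show ?thesis
  proof (rule negligible_imp_AE_interval)
    fix \<theta> assume th: "\<theta> \<in> {0..2*pi}" "\<theta> \<notin> (\<Union>N. \<Union>m. Bad N m)"
    show "nt_converges F (cis \<theta>)"
      by (rule nt_cauchy_imp_nt_converges) (use th in \<open>auto simp: Bad_def\<close>)
  qed
qed

lemma borel_measurable_radial_limit:
  fixes F :: "complex \<Rightarrow> 'a::{banach, second_countable_topology}"
  assumes "continuous_on (ball 0 1) F"
  shows "(\<lambda>\<theta>. radial_limit F (cis \<theta>)) \<in> borel_measurable (lebesgue_on {0..2*pi})"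
  unfolding radial_limit_def
proof (rule borel_measurable_lim_metric)
  fix n :: nat
  have "continuous_on {0..2*pi} (\<lambda>\<theta>. F (of_real (1 - 1 / (real n + 2)) * cis \<theta>))"
    using continuous_on_circle[OF assms, of "1 - 1 / (real n + 2)"] by (simp add: rcis_def field_simps)
  then show "(\<lambda>\<theta>. F (of_real (1 - 1 / (real n + 2)) * cis \<theta>)) \<in> borel_measurable (lebesgue_on {0..2*pi})"
    by (rule continuous_imp_measurable_on_sets_lebesgue) simp
qed

text \<open>Fatou's lemma along the radii \<open>x n\<close> turns the Cauchy estimate between two
  circles into a bound for the distance from a circle to the boundary function. Finiteness follows
  by comparison with one fixed circle.\<close>

lemma H2_mean_convergence:
  fixes F :: "complex \<Rightarrow> complex"
  assumes hol: "F holomorphic_on ball 0 1"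
    and K: "\<And>r. 0 < r \<Longrightarrow> r < 1 \<Longrightarrow> integral {0..2*pi} (\<lambda>t. (cmod (F (rcis r t)))\<^sup>2) \<le> K"
  shows "((\<lambda>r. \<integral>\<^sup>+\<theta>. ennreal ((cmod (F (rcis r \<theta>) - radial_limit F (cis \<theta>)))\<^sup>2) \<partial>lebesgue_on {0..2*pi})
      \<longlongrightarrow> 0) (at_left 1)" (is "(?I \<longlongrightarrow> 0) _")
    and "(\<integral>\<^sup>+\<theta>. ennreal ((cmod (radial_limit F (cis \<theta>)))\<^sup>2) \<partial>lebesgue_on {0..2*pi}) < \<infinity>" (is ?fin)
proof -
  define M where "M = lebesgue_on {0..2*pi}"
  define x where "x n = 1 - 1 / (real n + 2)" for n
  have x: "0 < x n" "x n < 1" for n by (auto simp: x_def field_simps)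
  have contF: "continuous_on (ball 0 1) F" using hol by (rule holomorphic_on_imp_continuous_on)
  have AE: "AE \<theta> in M. (\<lambda>n. F (rcis (x n) \<theta>)) \<longlonglongrightarrow> radial_limit F (cis \<theta>)"
  proof -
   have "AE \<theta> in M. nt_converges F (cis \<theta>)" unfolding M_def by (rule H2_nt_converges[OF hol K])
   then show ?thesis
   proof (eventually_elim)
    case (elim \<theta>)
    from filterlim_compose[OF nt_converges_at_left(2)[OF elim] radial_sequence]
    show ?case by (simp add: rcis_def x_def)
   qed
  qed
  have nn: "(\<integral>\<^sup>+\<theta>. ennreal ((cmod (F (rcis r \<theta>) - F (rcis s \<theta>)))\<^sup>2) \<partial>M)
      = ennreal (integral {0..2*pi} (\<lambda>\<theta>. (cmod (F (rcis r \<theta>) - F (rcis s \<theta>)))\<^sup>2))"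
    if "0 < r" "r < 1" "0 < s" "s < 1" for r s
    unfolding M_def using that
    by (intro nn_integral_lebesgue_on_interval continuous_intros continuous_on_circle[OF contF]) auto
  have meas: "(\<lambda>\<theta>. F (rcis r \<theta>)) \<in> borel_measurable M" if "0 < r" "r < 1" for r
    unfolding M_def using that
    by (intro continuous_imp_measurable_on_sets_lebesgue continuous_on_circle[OF contF]) auto
  have close: "\<exists>\<rho>. 0 < \<rho> \<and> \<rho> < 1 \<and> (\<forall>r. \<rho> \<le> r \<and> r < 1 \<longrightarrow> ?I r \<le> ennreal \<epsilon>)" if \<epsilon>: "0 < \<epsilon>" for \<epsilon>
  proof -
    obtain \<rho> where \<rho>: "0 < \<rho>" "\<rho> < 1"
      "\<And>r s. \<rho> \<le> r \<Longrightarrow> r < 1 \<Longrightarrow> \<rho> \<le> s \<Longrightarrow> s < 1 \<Longrightarrow>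
       integral {0..2*pi} (\<lambda>t. (cmod (F (rcis r t) - F (rcis s t)))\<^sup>2) \<le> \<epsilon>"
      using H2_dilation_error[OF hol \<epsilon> K] by blast
    have "?I r \<le> ennreal \<epsilon>" if r: "\<rho> \<le> r" "r < 1" for r
    proof -
      have r0: "0 < r" using r \<rho> by simp
      have "?I r \<le> (\<integral>\<^sup>+\<theta>. liminf (\<lambda>n. ennreal ((cmod (F (rcis r \<theta>) - F (rcis (x n) \<theta>)))\<^sup>2)) \<partial>M)"
        unfolding M_def[symmetric]
      proof (rule nn_integral_mono_AE)
        show "AE \<theta> in M. ennreal ((cmod (F (rcis r \<theta>) - radial_limit F (cis \<theta>)))\<^sup>2)
            \<le> liminf (\<lambda>n. ennreal ((cmod (F (rcis r \<theta>) - F (rcis (x n) \<theta>)))\<^sup>2))"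
          using AE
        proof eventually_elim
          case (elim \<theta>)
          have "(\<lambda>n. ennreal ((cmod (F (rcis r \<theta>) - F (rcis (x n) \<theta>)))\<^sup>2)) \<longlonglongrightarrow>
              ennreal ((cmod (F (rcis r \<theta>) - radial_limit F (cis \<theta>)))\<^sup>2)"
            by (intro tendsto_intros elim)
          from lim_imp_Liminf[OF sequentially_bot this] show ?case by simp
        qed
      qed
      also have "\<dots> \<le> liminf (\<lambda>n. \<integral>\<^sup>+\<theta>. ennreal ((cmod (F (rcis r \<theta>) - F (rcis (x n) \<theta>)))\<^sup>2) \<partial>M)"
      proof (rule nn_integral_liminf)
        fix n
        note meas[OF r0 r(2), measurable] meas[OF x, measurable]
        show "(\<lambda>\<theta>. ennreal ((cmod (F (rcis r \<theta>) - F (rcis (x n) \<theta>)))\<^sup>2)) \<in> borel_measurable M"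
          by measurable
      qed
      also have "\<dots> \<le> liminf (\<lambda>n. ennreal \<epsilon>)"
      proof (rule Liminf_mono)
        have "eventually (\<lambda>n. \<rho> < x n) sequentially"
          using radial_sequence[unfolded filterlim_at] \<rho> unfolding x_def
          by (intro order_tendstoD(1)) auto
        then show "eventually (\<lambda>n. (\<integral>\<^sup>+\<theta>. ennreal ((cmod (F (rcis r \<theta>) - F (rcis (x n) \<theta>)))\<^sup>2) \<partial>M) \<le> ennreal \<epsilon>) sequentially"
          by eventually_elim (use r r0 x \<rho>(3) in \<open>simp add: nn ennreal_leI\<close>)
      qed
      finally show ?thesis by (simp add: Liminf_const)
    qed
    then show ?thesis using \<rho> by blast
  qed
  show "(?I \<longlongrightarrow> 0) (at_left 1)"
  proof (rule order_tendstoI)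
    fix a :: ennreal assume "0 < a"
    then obtain y where y: "0 < y" "y < a" using dense by blast
    then obtain \<epsilon> where "y = ennreal \<epsilon>" "0 \<le> \<epsilon>" by (cases y) auto
    moreover from this y have "\<epsilon> \<noteq> 0" by auto
    ultimately have \<epsilon>: "0 < \<epsilon>" "ennreal \<epsilon> < a" using y by auto
    then obtain \<rho> where \<rho>: "0 < \<rho>" "\<rho> < 1" "\<And>r. \<rho> \<le> r \<Longrightarrow> r < 1 \<Longrightarrow> ?I r \<le> ennreal \<epsilon>"
      using close[OF \<epsilon>(1)] by blast
    have "eventually (\<lambda>r. r \<in> {\<rho><..<1}) (at_left 1)" using \<rho> by (intro eventually_at_leftI[of \<rho>]) auto
    then show "eventually (\<lambda>r. ?I r < a) (at_left 1)"
    proof eventually_elim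
      case (elim r)
      then show ?case using le_less_trans[OF \<rho>(3)[of r] \<epsilon>(2)] by simp
    qed
  qed auto
  show ?fin
  proof -
    obtain \<rho> where \<rho>: "0 < \<rho>" "\<rho> < 1" "\<And>r. \<rho> \<le> r \<Longrightarrow> r < 1 \<Longrightarrow> ?I r \<le> ennreal 1"
      using close[of 1] by auto
    have "(\<integral>\<^sup>+\<theta>. ennreal ((cmod (radial_limit F (cis \<theta>)))\<^sup>2) \<partial>M)
      \<le> (\<integral>\<^sup>+\<theta>. 2 * ennreal ((cmod (F (rcis \<rho> \<theta>) - radial_limit F (cis \<theta>)))\<^sup>2) + 2 * ennreal ((cmod (F (rcis \<rho> \<theta>)))\<^sup>2) \<partial>M)"
    proof (rule nn_integral_mono)
      fix \<theta>
      have "(cmod b)\<^sup>2 \<le> 2 * (cmod (a - b))\<^sup>2 + 2 * (cmod a)\<^sup>2" for a b :: complex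
      proof -
        have "cmod b \<le> cmod (a - b) + cmod a" by (metis norm_minus_commute norm_triangle_sub add.commute)
        then have "(cmod b)\<^sup>2 \<le> (cmod (a - b) + cmod a)\<^sup>2" by (intro power_mono) auto
        also have "\<dots> \<le> 2 * (cmod (a - b))\<^sup>2 + 2 * (cmod a)\<^sup>2"
          using sum_squares_bound[of "cmod (a - b)" "cmod a"] by (simp add: power2_sum)
        finally show ?thesis .
      qed
      then have "ennreal ((cmod (radial_limit F (cis \<theta>)))\<^sup>2) \<le> ennreal (2 * (cmod (F (rcis \<rho> \<theta>) - radial_limit F (cis \<theta>)))\<^sup>2 + 2 * (cmod (F (rcis \<rho> \<theta>)))\<^sup>2)"
        by (intro ennreal_leI)
      then show "ennreal ((cmod (radial_limit F (cis \<theta>)))\<^sup>2) \<le> 2 * ennreal ((cmod (F (rcis \<rho> \<theta>) - radial_limit F (cis \<theta>)))\<^sup>2) + 2 * ennreal ((cmod (F (rcis \<rho> \<theta>)))\<^sup>2)"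
        by (simp add: ennreal_plus ennreal_mult)
    qed
    also have "\<dots> = 2 * ?I \<rho> + 2 * (\<integral>\<^sup>+\<theta>. ennreal ((cmod (F (rcis \<rho> \<theta>)))\<^sup>2) \<partial>M)"
      using meas[OF \<rho>(1,2)] borel_measurable_radial_limit[OF contF] unfolding M_def
      by (simp add: nn_integral_add nn_integral_cmult)
    also have "(\<integral>\<^sup>+\<theta>. ennreal ((cmod (F (rcis \<rho> \<theta>)))\<^sup>2) \<partial>M) = ennreal (integral {0..2*pi} (\<lambda>\<theta>. (cmod (F (rcis \<rho> \<theta>)))\<^sup>2))"
      unfolding M_def using \<rho>
      by (intro nn_integral_lebesgue_on_interval continuous_intros continuous_on_circle[OF contF]) auto
    also have "2 * ?I \<rho> + 2 * \<dots> < \<infinity>"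
    proof -
      have "?I \<rho> < \<infinity>" using le_less_trans[OF \<rho>(3)[of \<rho>] ennreal_less_top] \<rho> by simp
      then show ?thesis by (simp add: ennreal_mult_less_top)
    qed
    finally show ?thesis by (simp add: M_def)
  qed
qed


section \<open>Factorization in \<open>H\<^sup>p\<close>\<close>

lemma holomorphic_log_convex:
  assumes "convex S" "open S" "f holomorphic_on S" "\<And>z. z \<in> S \<Longrightarrow> f z \<noteq> 0"
  obtains g where "g holomorphic_on S" "\<And>z. z \<in> S \<Longrightarrow> f z = exp (g z)"
proof -
  have "simply_connected S" using assms(1) by (rule convex_imp_simply_connected)
  then show ?thesis
    using simply_connected_eq_holomorphic_log[OF assms(2)] assms(3,4) that by blast
qed

text \<open>The expansion at a zero is local; gluing it with h / (z - a)^m away from a gives a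
  quotient on all of S, which the induction over zeros requires.\<close>

lemma holomorphic_divide_zero:
  fixes h :: "complex \<Rightarrow> complex"
  assumes hol: "h holomorphic_on S" and S: "open S" "connected S" and a: "a \<in> S"
    and nz: "\<exists>w\<in>S. h w \<noteq> 0"
  obtains m k where "k holomorphic_on S" "\<And>z. z \<in> S \<Longrightarrow> h z = (z - a) ^ m * k z" "k a \<noteq> 0"
proof -
  obtain r where r: "r > 0" "cball a r \<subseteq> S" "zor_poly h a holomorphic_on cball a r"
    "\<And>w. w \<in> cball a r \<Longrightarrow> h w = zor_poly h a w * (w - a) ^ nat (zorder h a) \<and> zor_poly h a w \<noteq> 0"
    using zorder_exist_zero[OF hol S a nz] by blast
  define m where "m = nat (zorder h a)"
  define k where "k z = (if z = a then zor_poly h a a else h z / (z - a) ^ m)" for z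
  have keq: "k z = zor_poly h a z" if "z \<in> cball a r" for z
    using r(4)[OF that] by (auto simp: k_def m_def)
  have "k holomorphic_on (S - {a}) \<union> ball a r"
  proof (rule holomorphic_on_Un)
    have "(\<lambda>z. h z / (z - a) ^ m) holomorphic_on S - {a}"
      by (intro holomorphic_intros holomorphic_on_subset[OF hol]) auto
    then show "k holomorphic_on S - {a}"
      by (rule holomorphic_transform) (auto simp: k_def)
    have "zor_poly h a holomorphic_on ball a r" using r(3) by (rule holomorphic_on_subset) auto
    then show "k holomorphic_on ball a r"
      by (rule holomorphic_transform) (simp add: keq)
  qed (use S in \<open>auto intro: open_delete\<close>)
  moreover have "(S - {a}) \<union> ball a r = S" using r a ball_subset_cball by fastforce
  ultimately have "k holomorphic_on S" by simp
  moreover have "h z = (z - a) ^ m * k z" if "z \<in> S" for z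
    using r(4)[of a] r(1) by (cases "z = a") (auto simp: k_def m_def)
  moreover have "k a \<noteq> 0" using r(4)[of a] r(1) by (simp add: k_def)
  ultimately show ?thesis using that by blast
qed

text \<open>For |a| < 1 the right side is nonnegative on the closed disc and zero on the circle: the
  source of both the bound and the unimodularity of Blaschke factors.\<close>

lemma blaschke_factor_identity:
  "(cmod (1 - cnj a * z))\<^sup>2 - (cmod (z - a))\<^sup>2 = (1 - (cmod a)\<^sup>2) * (1 - (cmod z)\<^sup>2)"
  unfolding cmod_power2 by (simp add: power2_eq_square algebra_simps)

lemma blaschke_factor_le:
  assumes "cmod a < 1" "cmod z \<le> 1"
  shows "cmod (z - a) \<le> cmod (1 - cnj a * z)" "1 - cnj a * z \<noteq> 0"
proof -
  have "0 \<le> (1 - (cmod a)\<^sup>2) * (1 - (cmod z)\<^sup>2)"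
    using assms by (intro mult_nonneg_nonneg) (auto simp: abs_square_le_1)
  then show "cmod (z - a) \<le> cmod (1 - cnj a * z)"
    using blaschke_factor_identity[of a z] by (intro power2_le_imp_le[OF _ norm_ge_zero]) linarith
  have "cmod (cnj a * z) < 1"
    using assms mult_left_le[of "cmod z" "cmod a"] by (simp add: norm_mult)
  then show "1 - cnj a * z \<noteq> 0" by auto
qed

text \<open>Induction on the number of zeros in the closed disc, all of them interior by
  \<open>nz\<close>. Working up to radius R > 1 keeps g holomorphic across the circle on which its
  modulus is compared with that of h.\<close>

lemma blaschke_factorization:
  fixes h :: "complex \<Rightarrow> complex"
  assumes R: "1 < R" and hol: "h holomorphic_on ball 0 R"
    and nz: "\<And>z. cmod z = 1 \<Longrightarrow> h z \<noteq> 0"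
  shows "\<exists>B g. g holomorphic_on ball 0 R \<and> (\<forall>z. cmod z \<le> 1 \<longrightarrow> g z \<noteq> 0) \<and>
    B holomorphic_on ball 0 1 \<and> (\<forall>z. cmod z < 1 \<longrightarrow> cmod (B z) \<le> 1) \<and>
    (\<forall>z. cmod z < 1 \<longrightarrow> h z = B z * g z) \<and> (\<forall>z. cmod z = 1 \<longrightarrow> cmod (g z) = cmod (h z))"
proof -
  let ?P = "\<lambda>h. \<exists>B g. g holomorphic_on ball 0 R \<and> (\<forall>z. cmod z \<le> 1 \<longrightarrow> g z \<noteq> 0) \<and>
    B holomorphic_on ball 0 1 \<and> (\<forall>z. cmod z < 1 \<longrightarrow> cmod (B z) \<le> 1) \<and>
    (\<forall>z. cmod z < 1 \<longrightarrow> h z = B z * g z) \<and> (\<forall>z. cmod z = 1 \<longrightarrow> cmod (g z) = cmod (h z))"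
  have fin: "finite {z \<in> cball 0 1. h z = 0}" if hol: "h holomorphic_on ball 0 R"
    and nz: "\<And>z. cmod z = 1 \<Longrightarrow> h z \<noteq> 0" for h :: "complex \<Rightarrow> complex"
  proof (cases "h constant_on ball 0 R")
    case True
    then obtain c where c: "\<And>z. z \<in> ball 0 R \<Longrightarrow> h z = c" unfolding constant_on_def by blast
    have "h z \<noteq> 0" if "cmod z \<le> 1" for z
    proof -
      have "z \<in> ball 0 R" "1 \<in> ball (0::complex) R" using that R by auto
      then show ?thesis using c[of z] c[of 1] nz[of 1] by simp
    qed
    then have e: "{z \<in> cball 0 1. h z = 0} = {}" by auto
    show ?thesis unfolding e by simp
  next
    case False
    then show ?thesis using R by (intro holomorphic_compact_finite_zeros[OF hol]) auto
  qed
  have "?P h" if "card {z \<in> cball 0 1. h z = 0} = N" "h holomorphic_on ball 0 R"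
    "\<And>z. cmod z = 1 \<Longrightarrow> h z \<noteq> 0" for N and h :: "complex \<Rightarrow> complex"
    using that
  proof (induction N arbitrary: h)
    case 0
    then have "{z \<in> cball 0 1. h z = 0} = {}" using fin[OF 0(2,3)] by simp
    then have "\<forall>z. cmod z \<le> 1 \<longrightarrow> h z \<noteq> 0" by auto
    then show ?case using 0 by (intro exI[of _ "\<lambda>z. 1"] exI[of _ h]) auto
  next
    case (Suc N)
    have finh: "finite {z \<in> cball 0 1. h z = 0}" by (rule fin[OF Suc.prems(2,3)])
    have "{z \<in> cball 0 1. h z = 0} \<noteq> {}" using Suc.prems(1) by (metis card.empty nat.distinct(1))
    then obtain a where a': "cmod a \<le> 1" "h a = 0" by auto
    then have a: "cmod a < 1" using Suc.prems(3)[of a] by fastforce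
    obtain m k where k: "k holomorphic_on ball 0 R" "\<And>z. z \<in> ball 0 R \<Longrightarrow> h z = (z - a) ^ m * k z" "k a \<noteq> 0"
    proof (rule holomorphic_divide_zero[OF Suc.prems(2) open_ball connected_ball])
      show "a \<in> ball 0 R" using a R by simp
      show "\<exists>w\<in>ball 0 R. h w \<noteq> 0" using Suc.prems(3)[of 1] R by (intro bexI[of _ 1]) auto
    qed blast
    \<comment> \<open>This is h divided by the Blaschke factor at a. No pole arises, and its zeros
      in the closed disc are those of h other than a.\<close>
    define h' where "h' z = k z * (1 - cnj a * z) ^ m" for z
    have hk: "h z = (z - a) ^ m * k z" if "cmod z \<le> 1" for z using k(2) that R by simp
    have hol': "h' holomorphic_on ball 0 R" unfolding h'_def by (intro holomorphic_intros k)
    have nz': "h' z \<noteq> 0" if "cmod z = 1" for z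
      using Suc.prems(3)[OF that] hk[of z] blaschke_factor_le(2)[OF a, of z] that by (auto simp: h'_def)
    have m0: "m \<noteq> 0" using hk[of a] a a' k(3) by (cases m) auto
    have "{z \<in> cball 0 1. h' z = 0} = {z \<in> cball 0 1. h z = 0} - {a}"
    proof (rule set_eqI)
      fix z show "z \<in> {z \<in> cball 0 1. h' z = 0} \<longleftrightarrow> z \<in> {z \<in> cball 0 1. h z = 0} - {a}"
        using hk[of z] blaschke_factor_le(2)[OF a, of z] k(3) m0 by (cases "z = a") (auto simp: h'_def)
    qed
    then have "card {z \<in> cball 0 1. h' z = 0} = N"
      using Suc.prems(1) finh a' by (simp add: card_Diff_singleton)
    from Suc.IH[OF this hol' nz'] obtain B g where g: "g holomorphic_on ball 0 R" "\<And>z. cmod z \<le> 1 \<Longrightarrow> g z \<noteq> 0"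
      "B holomorphic_on ball 0 1" "\<And>z. cmod z < 1 \<Longrightarrow> cmod (B z) \<le> 1"
      "\<And>z. cmod z < 1 \<Longrightarrow> h' z = B z * g z" "\<And>z. cmod z = 1 \<Longrightarrow> cmod (g z) = cmod (h' z)" by blast
    define b where "b z = ((z - a) / (1 - cnj a * z)) ^ m" for z
    have "h z = b z * h' z" if "cmod z \<le> 1" for z
      using hk[OF that] blaschke_factor_le(2)[OF a that] by (simp add: b_def h'_def power_divide)
    moreover have "cmod (b z) \<le> 1" if "cmod z \<le> 1" for z
      using blaschke_factor_le[OF a that] unfolding b_def norm_power norm_divide
      by (intro power_le_one) (auto simp: divide_le_eq_1)
    moreover have "cmod (b z) = 1" if "cmod z = 1" for z
    proof -
      have "(cmod (1 - cnj a * z))\<^sup>2 = (cmod (z - a))\<^sup>2" using blaschke_factor_identity[of a z] that by simp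
      then have "cmod (1 - cnj a * z) = cmod (z - a)" by (simp add: power2_eq_iff_nonneg)
      then show ?thesis using blaschke_factor_le(2)[OF a, of z] that a by (auto simp add: b_def norm_power norm_divide)
    qed
    moreover have "(\<lambda>z. b z * B z) holomorphic_on ball 0 1"
      unfolding b_def using blaschke_factor_le(2)[OF a] by (intro holomorphic_intros g(3)) auto
    ultimately show ?case using g
      by (intro exI[of _ "\<lambda>z. b z * B z"] exI[of _ g]) (auto simp: norm_mult intro: mult_le_one)
  qed
  from this[OF refl hol nz] show ?thesis .
qed

section \<open>Normal families and factorization by limits\<close>

lemma montel_disc:
  fixes F :: "nat \<Rightarrow> complex \<Rightarrow> complex"
  assumes hol: "\<And>n. F n holomorphic_on ball 0 1"
    and bd: "\<And>s. 0 < s \<Longrightarrow> s < 1 \<Longrightarrow> \<exists>B. \<forall>n z. cmod z \<le> s \<longrightarrow> cmod (F n z) \<le> B"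
  obtains g r where "g holomorphic_on ball 0 1" "strict_mono (r :: nat \<Rightarrow> nat)"
    "\<And>z. cmod z < 1 \<Longrightarrow> (\<lambda>n. F (r n) z) \<longlonglongrightarrow> g z"
proof (rule Montel[where S = "ball 0 1" and \<H> = "range F" and \<F> = F])
  fix K :: "complex set" assume K: "compact K" "K \<subseteq> ball 0 1"
  obtain s where s: "0 < s" "s < 1" "\<And>z. z \<in> K \<Longrightarrow> cmod z \<le> s"
  proof (cases "K = {}")
    case False
    obtain w where w: "w \<in> K" "\<And>z. z \<in> K \<Longrightarrow> cmod z \<le> cmod w"
      using continuous_attains_sup[OF K(1) False, of cmod] by (auto intro: continuous_intros)
    show ?thesis
    proof (rule that[of "(cmod w + 1) / 2"])
      have "cmod w < 1" using w(1) K(2) by auto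
      then show "(cmod w + 1) / 2 < 1" by simp
      show "cmod z \<le> (cmod w + 1) / 2" if "z \<in> K" for z
        using w(2)[OF that] \<open>cmod w < 1\<close> by simp
      show "0 < (cmod w + 1) / 2" by (simp add: add_nonneg_pos)
    qed
  qed (use that[of "1/2"] in auto)
  show "\<exists>B. \<forall>h\<in>range F. \<forall>z\<in>K. cmod (h z) \<le> B" using bd[OF s(1,2)] s(3) by blast
qed (use hol that in auto)

text \<open>In the Poisson bound the denominator is at least (1 - s)^2 and the prefactor at most 1.
  These are the local bounds that feed Montel's theorem.\<close>

lemma H2_local_bound:
  fixes F :: "complex \<Rightarrow> complex"
  assumes hol: "F holomorphic_on ball 0 R" and R: "1 < R"
    and C: "integral {0..2*pi} (\<lambda>t. (cmod (F (cis t)))\<^sup>2) \<le> C" and s: "s < 1" and z: "cmod z \<le> s"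
  shows "cmod (F z) \<le> sqrt (C / (1 - s)\<^sup>2)"
proof -
  have z1: "cmod z < 1" using z s by simp
  have nz2: "cis t - z \<noteq> 0" for t using z1 by auto
  have "cball 0 1 \<subseteq> ball (0::complex) R" using R by auto
  then have hc: "F holomorphic_on cball 0 1" using hol holomorphic_on_subset by blast
  have contF: "continuous_on S (\<lambda>t. F (cis t))" for S
    by (rule continuous_on_compose2[OF holomorphic_on_imp_continuous_on[OF hc]])
       (auto intro!: continuous_intros)
  define I where "I = integral {0..2*pi} (\<lambda>t. (cmod (F (cis t)))\<^sup>2 / (cmod (cis t - z))\<^sup>2)"
  have "I \<le> integral {0..2*pi} (\<lambda>t. (1 / (1 - s)\<^sup>2) * (cmod (F (cis t)))\<^sup>2)"
    unfolding I_def
  proof (rule integral_le)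
    fix t
    have "1 - s \<le> cmod (cis t - z)" using norm_triangle_ineq2[of "cis t" z] z by simp
    then have "(1 - s)\<^sup>2 \<le> (cmod (cis t - z))\<^sup>2" using s by (intro power_mono) auto
    then have "(cmod (F (cis t)))\<^sup>2 / (cmod (cis t - z))\<^sup>2 \<le> (cmod (F (cis t)))\<^sup>2 / (1 - s)\<^sup>2"
      by (intro frac_le) (use s in \<open>simp_all del: power_mono_iff\<close>)
    then show "(cmod (F (cis t)))\<^sup>2 / (cmod (cis t - z))\<^sup>2 \<le> (1 / (1 - s)\<^sup>2) * (cmod (F (cis t)))\<^sup>2"
      by simp
  qed (intro integrable_continuous_interval continuous_intros contF; use nz2 s in auto)+
  also have "\<dots> = (1 / (1 - s)\<^sup>2) * integral {0..2*pi} (\<lambda>t. (cmod (F (cis t)))\<^sup>2)"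
    by (simp only: integral_mult_right)
  also have "\<dots> \<le> (1 / (1 - s)\<^sup>2) * C" using C by (intro mult_left_mono) auto
  finally have I: "I \<le> C / (1 - s)\<^sup>2" by simp
  have I0: "0 \<le> I" unfolding I_def
    by (intro integral_nonneg integrable_continuous_interval continuous_intros contF) (use nz2 in auto)
  have "(cmod (F z))\<^sup>2 \<le> (1 - (cmod z)\<^sup>2) / (2*pi) * I"
    unfolding I_def by (rule holomorphic_square_poisson_bound[OF hol R z1])
  also have "\<dots> \<le> 1 * I"
  proof (rule mult_right_mono[OF _ I0])
    have "1 - (cmod z)\<^sup>2 \<le> 1" by simp
    also have "1 \<le> 2 * pi" using pi_gt3 by simp
    finally show "(1 - (cmod z)\<^sup>2) / (2*pi) \<le> 1" by simp
  qed
  finally show ?thesis using I by (intro real_le_rsqrt) simp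
qed

lemma mean_square_limit:
  fixes F :: "nat \<Rightarrow> complex \<Rightarrow> complex"
  assumes r: "0 < r" "r < 1" and hol: "\<And>n. F n holomorphic_on ball 0 1" "G holomorphic_on ball 0 1"
    and conv: "\<And>z. cmod z < 1 \<Longrightarrow> (\<lambda>n. F n z) \<longlonglongrightarrow> G z"
    and bd: "\<And>n z. cmod z \<le> r \<Longrightarrow> cmod (F n z) \<le> B"
    and C: "\<And>n. integral {0..2*pi} (\<lambda>t. (cmod (F n (rcis r t)))\<^sup>2) \<le> C"
  shows "integral {0..2*pi} (\<lambda>t. (cmod (G (rcis r t)))\<^sup>2) \<le> C"
proof -
  have "(\<lambda>n. integral {0..2*pi} (\<lambda>t. (cmod (F n (rcis r t)))\<^sup>2)) \<longlonglongrightarrow> integral {0..2*pi} (\<lambda>t. (cmod (G (rcis r t)))\<^sup>2)"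
  proof (rule dominated_convergence(2))
    show "(\<lambda>t. (cmod (F n (rcis r t)))\<^sup>2) integrable_on {0..2*pi}" for n
      using r by (intro integrable_continuous_interval continuous_intros
          continuous_on_circle[OF holomorphic_on_imp_continuous_on[OF hol(1)]]) auto
    show "(\<lambda>t. B\<^sup>2) integrable_on {0..2*pi}" by (rule integrable_const_ivl)
    show "norm ((cmod (F n (rcis r t)))\<^sup>2) \<le> B\<^sup>2" for n t
      using bd[of "rcis r t" n] r by (simp add: power_mono)
    show "(\<lambda>n. (cmod (F n (rcis r t)))\<^sup>2) \<longlonglongrightarrow> (cmod (G (rcis r t)))\<^sup>2" for t
      using r by (intro tendsto_intros conv) auto
  qed
  then show ?thesis using C by (intro LIMSEQ_le_const2) auto
qed

text \<open>A slightly larger closed disc contains only finitely many zeros, hence finitely many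
  moduli, while an interval of radii is infinite.\<close>

lemma zero_free_circle:
  fixes h :: "complex \<Rightarrow> complex"
  assumes hol: "h holomorphic_on ball 0 1" and nz: "\<exists>z\<in>ball 0 1. h z \<noteq> 0" and s: "0 < s" "s < 1"
  obtains \<rho> where "s < \<rho>" "\<rho> < 1" "\<And>z. cmod z = \<rho> \<Longrightarrow> h z \<noteq> 0"
proof -
  define s' where "s' = (s + 1) / 2"
  have s': "s < s'" "s' < 1" using s by (auto simp: s'_def)
  have "finite {z \<in> cball 0 s'. h z = 0}"
  proof (cases "h constant_on ball 0 1")
    case False
    then show ?thesis using s' s by (intro holomorphic_compact_finite_zeros[OF hol]) auto
  next
    case True
    then obtain c where c: "\<And>z. z \<in> ball 0 1 \<Longrightarrow> h z = c" unfolding constant_on_def by blast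
    then have c0: "c \<noteq> 0" using nz by auto
    have "h z \<noteq> 0" if "cmod z \<le> s'" for z using c[of z] c0 that s' by simp
    then have e: "{z \<in> cball 0 s'. h z = 0} = {}" by auto
    show ?thesis unfolding e by simp
  qed
  then have "finite (cmod ` {z \<in> cball 0 s'. h z = 0})" by simp
  moreover have "infinite {s<..<s'}" using s' by simp
  ultimately have "infinite ({s<..<s'} - cmod ` {z \<in> cball 0 s'. h z = 0})" by (rule Diff_infinite_finite)
  then have "{s<..<s'} - cmod ` {z \<in> cball 0 s'. h z = 0} \<noteq> {}" by (rule infinite_imp_nonempty)
  then obtain \<rho> where \<rho>: "\<rho> \<in> {s<..<s'} - cmod ` {z \<in> cball 0 s'. h z = 0}" by blast
  show ?thesis
  proof (rule that[of \<rho>])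
    show "h z \<noteq> 0" if "cmod z = \<rho>" for z using \<rho> that by auto
  qed (use \<rho> s' in auto)
qed

text \<open>On the circle of radius \<open>\<rho>\<close> the zero-free part \<open>g\<close> of \<open>h\<close> has the same modulus as \<open>h\<close>,
  so that its powers \<open>g\<^sup>1\<^sup>/\<^sup>m\<close> and \<open>g\<^sup>p\<^sup>/\<^sup>2\<close> lie in \<open>H\<^sup>2\<close>.\<close>

lemma Hp_factorization_dilated:
  fixes h :: "complex \<Rightarrow> complex"
  assumes hol: "h holomorphic_on ball 0 1" and \<rho>: "0 < \<rho>" "\<rho> < 1"
    and nz: "\<And>z. cmod z = \<rho> \<Longrightarrow> h z \<noteq> 0" and p: "0 < p" and m: "2 \<le> p * real m" "0 < m"
    and K: "integral {0..2*pi} (\<lambda>t. cmod (h (rcis \<rho> t)) powr p) \<le> K"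
  obtains R B G D where "1 < R" "B holomorphic_on ball 0 1" "G holomorphic_on ball 0 R" "D holomorphic_on ball 0 R"
    "\<And>z. cmod z < 1 \<Longrightarrow> cmod (B z) \<le> 1"
    "\<And>z. cmod z < 1 \<Longrightarrow> h (of_real \<rho> * z) = B z * G z ^ m"
    "\<And>z. cmod z < 1 \<Longrightarrow> cmod (h (of_real \<rho> * z)) powr p \<le> (cmod (D z))\<^sup>2"
    "integral {0..2*pi} (\<lambda>t. (cmod (G (cis t)))\<^sup>2) \<le> K + 2 * pi"
    "integral {0..2*pi} (\<lambda>t. (cmod (D (cis t)))\<^sup>2) \<le> K + 2 * pi"
proof -
  define H where "H z = h (of_real \<rho> * z)" for z
  have R: "1 < 1 / \<rho>" using \<rho> by simp
  have holH: "H holomorphic_on ball 0 (1 / \<rho>)" unfolding H_def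
    by (rule holomorphic_on_compose_gen[OF _ hol, unfolded o_def])
       (use \<rho> in \<open>auto intro!: holomorphic_intros simp: norm_mult field_simps\<close>)
  have nzH: "H z \<noteq> 0" if "cmod z = 1" for z using nz[of "of_real \<rho> * z"] that \<rho> by (simp add: H_def norm_mult)
  obtain B g where g: "g holomorphic_on ball 0 (1 / \<rho>)" "\<And>z. cmod z \<le> 1 \<Longrightarrow> g z \<noteq> 0"
    "B holomorphic_on ball 0 1" "\<And>z. cmod z < 1 \<Longrightarrow> cmod (B z) \<le> 1"
    "\<And>z. cmod z < 1 \<Longrightarrow> H z = B z * g z" "\<And>z. cmod z = 1 \<Longrightarrow> cmod (g z) = cmod (H z)"
    using blaschke_factorization[OF R holH nzH] by blast
  \<comment> \<open>By compactness g is still zero-free on a slightly larger disc. The logarithm is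
    taken there, so that the powers of g are holomorphic across the circle.\<close>
  define V where "V = {z \<in> ball 0 (1 / \<rho>). g z \<noteq> 0}"
  have "V = ball 0 (1 / \<rho>) \<inter> g -` (- {0})" by (auto simp: V_def)
  also have "open \<dots>"
    by (rule continuous_open_preimage[OF holomorphic_on_imp_continuous_on[OF g(1)] open_ball]) auto
  finally have "open V" .
  moreover have "cball 0 1 \<subseteq> V" using g(2) R by (auto simp: V_def)
  ultimately obtain e where e: "e > 0" "(\<Union>x\<in>cball 0 1. ball x e) \<subseteq> V"
    using compact_subset_open_imp_ball_epsilon_subset[OF compact_cball] by blast
  have ball: "ball 0 (1 + e) \<subseteq> V"
  proof
    fix z :: complex assume z: "z \<in> ball 0 (1 + e)"
    show "z \<in> V"
    proof (cases "cmod z \<le> 1")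
      case True then show ?thesis using e by (auto intro!: subsetD[OF e(2)] bexI[of _ z])
    next
      case False
      then have z0: "z \<noteq> 0" "1 < cmod z" by auto
      have "dist (z / of_real (cmod z)) z = cmod z - 1"
      proof -
        have "z - z / of_real (cmod z) = of_real (1 - 1 / cmod z) * z" using z0 by (simp add: field_simps)
        then have "cmod (z - z / of_real (cmod z)) = \<bar>1 - 1 / cmod z\<bar> * cmod z" by (simp only: norm_mult norm_of_real)
        also have "\<dots> = cmod z - 1" using z0 by (simp add: field_simps abs_if)
        finally show ?thesis by (simp add: dist_norm norm_minus_commute)
      qed
      then have "z \<in> ball (z / of_real (cmod z)) e" using z by simp
      moreover have "z / of_real (cmod z) \<in> cball 0 1" using z0 by (simp add: norm_divide)
      ultimately show ?thesis using e(2) by blast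
    qed
  qed
  have "g holomorphic_on ball 0 (1 + e)" using g(1) by (rule holomorphic_on_subset) (use ball in \<open>auto simp: V_def\<close>)
  moreover have "g z \<noteq> 0" if "z \<in> ball 0 (1 + e)" for z using that ball by (auto simp: V_def)
  ultimately obtain L where L: "L holomorphic_on ball 0 (1 + e)" "\<And>z. z \<in> ball 0 (1 + e) \<Longrightarrow> g z = exp (L z)"
    using holomorphic_log_convex[OF convex_ball open_ball] by blast
  define G where "G z = exp (L z / of_nat m)" for z
  define D where "D z = exp (of_real (p / 2) * L z)" for z
  have Dg: "(cmod (D z))\<^sup>2 = cmod (g z) powr p" if "cmod z < 1 + e" for z
  proof -
    have "cmod (g z) powr p = exp (p * Re (L z))" using L(2)[of z] that by (simp add: powr_def)
    also have "\<dots> = (exp (p / 2 * Re (L z)))\<^sup>2" by (simp add: power2_eq_square flip: exp_add)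
    finally show ?thesis by (simp add: D_def)
  qed
  \<comment> \<open>|G|^2 is |g|^(2/m) with 2/m \<le> p: at most |g|^p where |g| \<ge> 1, and at
    most 1 elsewhere. The summand 1 integrates to the 2 pi in the final bounds.\<close>
  have Gg: "(cmod (G z))\<^sup>2 \<le> cmod (g z) powr p + 1" if "cmod z < 1 + e" for z
  proof -
    have G2: "(cmod (G z))\<^sup>2 = exp (2 / real m * Re (L z))"
      by (simp add: G_def power2_eq_square Re_divide_of_nat flip: exp_add)
    have gp: "cmod (g z) powr p = exp (p * Re (L z))" using L(2)[of z] that by (simp add: powr_def)
    show ?thesis
    proof (cases "0 \<le> Re (L z)")
      case True
      have "2 / real m * Re (L z) \<le> p * Re (L z)" using m True by (intro mult_right_mono) (auto simp: field_simps)
      then show ?thesis by (simp add: G2 gp add_increasing2)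
    next
      case False
      then have "2 / real m * Re (L z) \<le> 0" by (intro mult_nonneg_nonpos) auto
      then show ?thesis by (simp add: G2 gp add_increasing)
    qed
  qed
  have holG: "G holomorphic_on ball 0 (1 + e)" "D holomorphic_on ball 0 (1 + e)"
    unfolding G_def D_def using m by (auto intro!: holomorphic_intros L)
  have sub: "cis t \<in> ball 0 (1 + e)" "cis t \<in> cball 0 1" for t using e by auto
  have contG: "continuous_on S (\<lambda>t. G (cis t))" "continuous_on S (\<lambda>t. D (cis t))" for S
    using sub by (auto intro!: continuous_intros continuous_on_compose2[OF holomorphic_on_imp_continuous_on[OF holG(1)]]
       continuous_on_compose2[OF holomorphic_on_imp_continuous_on[OF holG(2)]])
  have gh: "cmod (g (cis t)) = cmod (h (rcis \<rho> t))" for t using g(6)[of "cis t"] by (simp add: H_def rcis_def)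
  have conth: "continuous_on S (\<lambda>t. cmod (h (rcis \<rho> t)) powr p)" for S
    using nz \<rho> by (intro continuous_on_powr continuous_intros continuous_on_circle[OF holomorphic_on_imp_continuous_on[OF hol]]) auto
  have KD: "integral {0..2*pi} (\<lambda>t. (cmod (D (cis t)))\<^sup>2) \<le> K"
    using K Dg e by (simp add: gh)
  have "integral {0..2*pi} (\<lambda>t. (cmod (G (cis t)))\<^sup>2) \<le> integral {0..2*pi} (\<lambda>t. cmod (h (rcis \<rho> t)) powr p + 1)"
  proof (rule integral_le)
    show "(\<lambda>t. (cmod (G (cis t)))\<^sup>2) integrable_on {0..2*pi}"
      by (intro integrable_continuous_interval continuous_intros contG)
    show "(\<lambda>t. cmod (h (rcis \<rho> t)) powr p + 1) integrable_on {0..2*pi}"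
      by (intro integrable_continuous_interval continuous_on_add conth continuous_on_const)
    show "(cmod (G (cis t)))\<^sup>2 \<le> cmod (h (rcis \<rho> t)) powr p + 1" for t
      using Gg[of "cis t"] e by (simp add: gh)
  qed
  also have "\<dots> = integral {0..2*pi} (\<lambda>t. cmod (h (rcis \<rho> t)) powr p) + 2 * pi"
    by (subst integral_add) (auto intro!: integrable_continuous_interval conth)
  finally have KG: "integral {0..2*pi} (\<lambda>t. (cmod (G (cis t)))\<^sup>2) \<le> K + 2 * pi" using K by simp
  have KD': "integral {0..2*pi} (\<lambda>t. (cmod (D (cis t)))\<^sup>2) \<le> K + 2 * pi"
    using KD pi_gt_zero by linarith
  show ?thesis
  proof (rule that[of "1 + e" B G D])
    show "h (of_real \<rho> * z) = B z * G z ^ m" if "cmod z < 1" for z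
      using g(5)[OF that] L(2)[of z] that e m by (simp add: H_def G_def flip: exp_of_nat_mult)
    show "cmod (h (of_real \<rho> * z)) powr p \<le> (cmod (D z))\<^sup>2" if "cmod z < 1" for z
    proof -
      have "cmod (H z) \<le> cmod (g z)" using g(4,5)[OF that] by (simp add: norm_mult mult_left_le_one_le)
      then show ?thesis using Dg[of z] that e p by (simp add: H_def powr_mono2)
    qed
  qed (use e g holG KG KD' in auto)
qed

definition H2_bounded :: "(complex \<Rightarrow> complex) \<Rightarrow> bool" where
  "H2_bounded F \<longleftrightarrow> F holomorphic_on ball 0 1 \<and>
     (\<exists>K. \<forall>r. 0 < r \<and> r < 1 \<longrightarrow> integral {0..2*pi} (\<lambda>t. (cmod (F (rcis r t)))\<^sup>2) \<le> K)"

text \<open>The dilations h(\<rho>_n z), with \<rho>_n tending to 1, are factored on zero-free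
  circles. The factors G and D have means at most K + 2 pi, and the Blaschke factors are bounded by
  1, so all three families are normal. The identity with an integer power of G and the non-strict
  inequality survive pointwise limits.\<close>

lemma Hp_factorization:
  fixes h :: "complex \<Rightarrow> complex"
  assumes hol: "h holomorphic_on ball 0 1" and nz: "\<exists>z\<in>ball 0 1. h z \<noteq> 0" and p: "0 < p"
    and K: "\<And>r. 0 < r \<Longrightarrow> r < 1 \<Longrightarrow> integral {0..2*pi} (\<lambda>t. cmod (h (rcis r t)) powr p) \<le> K"
  shows "\<exists>m b G D. b holomorphic_on ball 0 1 \<and> (\<forall>z. cmod z < 1 \<longrightarrow> cmod (b z) \<le> 1) \<and>
    H2_bounded G \<and> H2_bounded D \<and>
    (\<forall>z. cmod z < 1 \<longrightarrow> h z = b z * G z ^ m \<and> cmod (h z) powr p \<le> (cmod (D z))\<^sup>2)"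
proof -
  \<comment> \<open>Chosen with 2 / m \<le> p, which puts the m-th root of the zero-free part into
    \<open>H^2\<close>.\<close>
  obtain m :: nat where m: "2 / p \<le> real m" using real_arch_simple by blast
  have m0: "0 < m" using m p by (cases m) (auto simp: divide_le_0_iff)
  have mp: "2 \<le> p * real m" using m p by (simp add: field_simps)
  define x where "x n = 1 - 1 / (real n + 2)" for n
  have x: "0 < x n" "x n < 1" for n by (auto simp: x_def field_simps)
  have "\<exists>\<rho>. x n < \<rho> \<and> \<rho> < 1 \<and> (\<forall>z. cmod z = \<rho> \<longrightarrow> h z \<noteq> 0)" for n
    by (rule zero_free_circle[OF hol nz x, of n]) blast
  then obtain \<rho> where \<rho>: "\<And>n. x n < \<rho> n" "\<And>n. \<rho> n < 1" "\<And>n z. cmod z = \<rho> n \<Longrightarrow> h z \<noteq> 0"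
    using choice[of "\<lambda>n \<rho>. x n < \<rho> \<and> \<rho> < 1 \<and> (\<forall>z. cmod z = \<rho> \<longrightarrow> h z \<noteq> 0)"] by blast
  have \<rho>0: "0 < \<rho> n" for n using x(1)[of n] \<rho>(1)[of n] by simp
  have \<rho>lim: "\<rho> \<longlonglongrightarrow> 1"
  proof (rule tendsto_sandwich)
    show "x \<longlonglongrightarrow> 1" using radial_sequence by (auto simp: x_def[abs_def] filterlim_at)
    show "(\<lambda>n. 1::real) \<longlonglongrightarrow> 1" by simp
  qed (use \<rho> in \<open>auto intro!: always_eventually less_imp_le\<close>)
  define P where "P n R B G D \<longleftrightarrow> 1 < R \<and> B holomorphic_on ball 0 1 \<and> G holomorphic_on ball 0 R \<and> D holomorphic_on ball 0 R
    \<and> (\<forall>z. cmod z < 1 \<longrightarrow> cmod (B z) \<le> 1 \<and> h (of_real (\<rho> n) * z) = B z * G z ^ m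
       \<and> cmod (h (of_real (\<rho> n) * z)) powr p \<le> (cmod (D z))\<^sup>2)
    \<and> integral {0..2*pi} (\<lambda>t. (cmod (G (cis t)))\<^sup>2) \<le> K + 2 * pi
    \<and> integral {0..2*pi} (\<lambda>t. (cmod (D (cis t)))\<^sup>2) \<le> K + 2 * pi"
    for n :: nat and R :: real and B G D :: "complex \<Rightarrow> complex"
  have "\<exists>R B G D. P n R B G D" for n
    by (rule Hp_factorization_dilated[OF hol \<rho>0[of n] \<rho>(2)[of n] \<rho>(3)[of _ n] p mp m0 K[OF \<rho>0[of n] \<rho>(2)[of n]]])
       (assumption, unfold P_def, blast)
  then obtain R B G D where P: "\<And>n. P n (R n) (B n) (G n) (D n)"
    by metis
  have R: "1 < R n" for n using P by (simp add: P_def)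
  have holo: "B n holomorphic_on ball 0 1" "G n holomorphic_on ball 0 (R n)" "D n holomorphic_on ball 0 (R n)" for n
    using P by (auto simp: P_def)
  have sub: "ball 0 1 \<subseteq> ball (0::complex) (R n)" for n using R[of n] by auto
  have holo1: "G n holomorphic_on ball 0 1" "D n holomorphic_on ball 0 1" for n
    using holo sub holomorphic_on_subset by blast+
  have B1: "cmod (B n z) \<le> 1" and hB: "h (of_real (\<rho> n) * z) = B n z * G n z ^ m"
    and hD: "cmod (h (of_real (\<rho> n) * z)) powr p \<le> (cmod (D n z))\<^sup>2" if "cmod z < 1" for n z
    using P[of n] that by (auto simp: P_def)
  have KG: "integral {0..2*pi} (\<lambda>t. (cmod (G n (cis t)))\<^sup>2) \<le> K + 2 * pi"
    and KD: "integral {0..2*pi} (\<lambda>t. (cmod (D n (cis t)))\<^sup>2) \<le> K + 2 * pi" for n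
    using P[of n] by (auto simp: P_def)
  have KGr: "integral {0..2*pi} (\<lambda>t. (cmod (G n (rcis r t)))\<^sup>2) \<le> K + 2 * pi" if "0 < r" "r < 1" for n r
    using circle_mean_mono[OF holo(2)[of n] that(1), where s = 1] that R[of n] KG[of n] by (simp add: rcis_def)
  have KDr: "integral {0..2*pi} (\<lambda>t. (cmod (D n (rcis r t)))\<^sup>2) \<le> K + 2 * pi" if "0 < r" "r < 1" for n r
    using circle_mean_mono[OF holo(3)[of n] that(1), where s = 1] that R[of n] KD[of n] by (simp add: rcis_def)
  have bG: "cmod (G n z) \<le> sqrt ((K + 2 * pi) / (1 - s)\<^sup>2)" and bD: "cmod (D n z) \<le> sqrt ((K + 2 * pi) / (1 - s)\<^sup>2)"
    if "s < 1" "cmod z \<le> s" for n z s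
    using H2_local_bound[OF holo(2) R KG that] H2_local_bound[OF holo(3) R KD that] by auto
  obtain b r1 where b: "b holomorphic_on ball 0 1" "strict_mono r1" "\<And>z. cmod z < 1 \<Longrightarrow> (\<lambda>n. B (r1 n) z) \<longlonglongrightarrow> b z"
  proof (rule montel_disc[of B])
    show "\<exists>C. \<forall>n z. cmod z \<le> s \<longrightarrow> cmod (B n z) \<le> C" if "0 < s" "s < 1" for s
      using B1 that by (intro exI[of _ 1]) auto
  qed (use holo in auto)
  obtain g r2 where g: "g holomorphic_on ball 0 1" "strict_mono r2" "\<And>z. cmod z < 1 \<Longrightarrow> (\<lambda>n. G (r1 (r2 n)) z) \<longlonglongrightarrow> g z"
  proof (rule montel_disc[of "\<lambda>n. G (r1 n)"])
    show "\<exists>C. \<forall>n z. cmod z \<le> s \<longrightarrow> cmod (G (r1 n) z) \<le> C" if "0 < s" "s < 1" for s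
      using bG[OF that(2)] by blast
  qed (use holo1 in auto)
  obtain d r3 where d: "d holomorphic_on ball 0 1" "strict_mono r3" "\<And>z. cmod z < 1 \<Longrightarrow> (\<lambda>n. D (r1 (r2 (r3 n))) z) \<longlonglongrightarrow> d z"
  proof (rule montel_disc[of "\<lambda>n. D (r1 (r2 n))"])
    show "\<exists>C. \<forall>n z. cmod z \<le> s \<longrightarrow> cmod (D (r1 (r2 n)) z) \<le> C" if "0 < s" "s < 1" for s
      using bD[OF that(2)] by blast
  qed (use holo1 in auto)
  \<comment> \<open>Each extraction refines the preceding one, so B, G and D converge along common
    indices.\<close>
  define r where "r n = r1 (r2 (r3 n))" for n
  have rmono: "strict_mono r" unfolding r_def using b(2) g(2) d(2) by (simp add: strict_mono_def)
  have limb: "(\<lambda>n. B (r n) z) \<longlonglongrightarrow> b z" if "cmod z < 1" for z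
    using LIMSEQ_subseq_LIMSEQ[OF b(3)[OF that], of "\<lambda>n. r2 (r3 n)"] g(2) d(2) by (simp add: r_def strict_mono_def o_def)
  have limg: "(\<lambda>n. G (r n) z) \<longlonglongrightarrow> g z" if "cmod z < 1" for z
    using LIMSEQ_subseq_LIMSEQ[OF g(3)[OF that] d(2)] by (simp add: r_def o_def)
  have limd: "(\<lambda>n. D (r n) z) \<longlonglongrightarrow> d z" if "cmod z < 1" for z
    using d(3)[OF that] by (simp add: r_def)
  have limh: "(\<lambda>n. h (of_real (\<rho> (r n)) * z)) \<longlonglongrightarrow> h z" if z: "cmod z < 1" for z
  proof -
    have "isCont h z"
      using holomorphic_on_imp_continuous_on[OF hol] z by (simp add: continuous_on_eq_continuous_at)
    moreover have "(\<lambda>n. of_real (\<rho> (r n)) * z) \<longlonglongrightarrow> of_real 1 * z"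
      using LIMSEQ_subseq_LIMSEQ[OF \<rho>lim rmono] by (intro tendsto_intros) (simp add: o_def)
    ultimately show ?thesis using isCont_tendsto_compose by fastforce
  qed
  have "h z = b z * g z ^ m" if z: "cmod z < 1" for z
  proof (rule LIMSEQ_unique[OF limh[OF z]])
    show "(\<lambda>n. h (of_real (\<rho> (r n)) * z)) \<longlonglongrightarrow> b z * g z ^ m"
      unfolding hB[OF z] by (intro tendsto_intros limb limg z)
  qed
  moreover have "cmod (h z) powr p \<le> (cmod (d z))\<^sup>2" if z: "cmod z < 1" for z
  proof (rule LIMSEQ_le)
    show "(\<lambda>n. cmod (h (of_real (\<rho> (r n)) * z)) powr p) \<longlonglongrightarrow> cmod (h z) powr p"
      using p by (intro tendsto_powr' tendsto_norm limh z) auto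
    show "(\<lambda>n. (cmod (D (r n) z))\<^sup>2) \<longlonglongrightarrow> (cmod (d z))\<^sup>2" by (intro tendsto_intros limd z)
  qed (use hD z in auto)
  moreover have "cmod (b z) \<le> 1" if z: "cmod z < 1" for z
    using LIMSEQ_le_const2[OF tendsto_norm[OF limb[OF z]]] B1[OF z] by blast
  moreover have "H2_bounded g" "H2_bounded d"
  proof -
    have "integral {0..2*pi} (\<lambda>t. (cmod (g (rcis s t)))\<^sup>2) \<le> K + 2 * pi"
      "integral {0..2*pi} (\<lambda>t. (cmod (d (rcis s t)))\<^sup>2) \<le> K + 2 * pi" if s: "0 < s" "s < 1" for s
      by (rule mean_square_limit[OF s holo1(1) g(1) limg bG[OF s(2)] KGr[OF s]], assumption+)
         (rule mean_square_limit[OF s holo1(2) d(1) limd bD[OF s(2)] KDr[OF s]], assumption+)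
    then show "H2_bounded g" "H2_bounded d" using g(1) d(1) by (auto simp: H2_bounded_def)
  qed
  ultimately show ?thesis using b(1) by blast
qed

section \<open>Boundary behaviour in \<open>H^p\<close>\<close>

lemma nt_converges_mult:
  fixes F G :: "complex \<Rightarrow> complex"
  assumes "nt_converges F \<zeta>" "nt_converges G \<zeta>" shows "nt_converges (\<lambda>z. F z * G z) \<zeta>"
  using assms unfolding nt_converges_def by (blast intro: tendsto_mult)

lemma nt_converges_power:
  fixes F :: "complex \<Rightarrow> complex"
  assumes "nt_converges F \<zeta>" shows "nt_converges (\<lambda>z. F z ^ m) \<zeta>"
  using assms unfolding nt_converges_def by (blast intro: tendsto_power)

lemma nt_converges_cong:
  assumes "\<And>z. cmod z < 1 \<Longrightarrow> F z = G z" shows "nt_converges F \<zeta> \<longleftrightarrow> nt_converges G \<zeta>"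
proof -
  have "(F \<longlongrightarrow> L) (at \<zeta> within stolz \<alpha> \<zeta>) \<longleftrightarrow> (G \<longlongrightarrow> L) (at \<zeta> within stolz \<alpha> \<zeta>)" for L \<alpha>
    by (rule Lim_cong_within) (use assms in \<open>auto simp: stolz_def\<close>)
  then show ?thesis by (simp add: nt_converges_def)
qed

lemma H2_bounded_nt:
  assumes "H2_bounded F" shows "AE \<theta> in lebesgue_on {0..2*pi}. nt_converges F (cis \<theta>)"
proof -
  obtain K where "F holomorphic_on ball 0 1"
    "\<And>r. 0 < r \<Longrightarrow> r < 1 \<Longrightarrow> integral {0..2*pi} (\<lambda>t. (cmod (F (rcis r t)))\<^sup>2) \<le> K"
    using assms by (auto simp: H2_bounded_def)
  then show ?thesis by (rule H2_nt_converges)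
qed

lemma bounded_imp_H2_bounded:
  assumes "b holomorphic_on ball 0 1" "\<And>z. cmod z < 1 \<Longrightarrow> cmod (b z) \<le> 1"
  shows "H2_bounded b"
  unfolding H2_bounded_def
proof (intro conjI exI allI impI)
  fix r :: real assume r: "0 < r \<and> r < 1"
  have "integral {0..2*pi} (\<lambda>t. (cmod (b (rcis r t)))\<^sup>2) \<le> integral {0..2*pi} (\<lambda>t. 1)"
    using r assms(2) by (intro integral_le integrable_continuous_interval continuous_intros
        continuous_on_circle[OF holomorphic_on_imp_continuous_on[OF assms(1)]]) (auto simp: power_le_one)
  then show "integral {0..2*pi} (\<lambda>t. (cmod (b (rcis r t)))\<^sup>2) \<le> 2 * pi" by simp
qed fact

text \<open>In h = b G^m both b and G lie in \<open>H^2\<close>, and nontangential limits multiply.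
  The zero function is treated apart because dividing out zeros presupposes a nonzero value.\<close>

theorem Hp_boundary:
  fixes h :: "complex \<Rightarrow> complex"
  assumes hol: "h holomorphic_on ball 0 1" and p: "0 < p"
    and K: "\<And>r. 0 < r \<Longrightarrow> r < 1 \<Longrightarrow> integral {0..2*pi} (\<lambda>t. cmod (h (rcis r t)) powr p) \<le> K"
  shows "AE \<theta> in lebesgue_on {0..2*pi}. nt_converges h (cis \<theta>)" (is ?nt)
    and "\<exists>D. H2_bounded D \<and> (\<forall>z. cmod z < 1 \<longrightarrow> cmod (h z) powr p \<le> (cmod (D z))\<^sup>2)" (is ?dom)
proof -
  have "?nt \<and> ?dom"
  proof (cases "\<exists>z\<in>ball 0 1. h z \<noteq> 0")
    case True
    obtain m b G D where D: "b holomorphic_on ball 0 1" "\<forall>z. cmod z < 1 \<longrightarrow> cmod (b z) \<le> 1"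
      "H2_bounded G" "H2_bounded D"
      "\<forall>z. cmod z < 1 \<longrightarrow> h z = b z * G z ^ m \<and> cmod (h z) powr p \<le> (cmod (D z))\<^sup>2"
      using Hp_factorization[OF hol True p K] by blast
    have "H2_bounded b" using D(1,2) by (intro bounded_imp_H2_bounded) auto
    from H2_bounded_nt[OF this] H2_bounded_nt[OF D(3)] have ?nt
    proof eventually_elim
      case (elim \<theta>)
      have "nt_converges (\<lambda>z. b z * G z ^ m) (cis \<theta>)"
        by (intro nt_converges_mult nt_converges_power elim)
      then show ?case using nt_converges_cong[of h "\<lambda>z. b z * G z ^ m"] D(5) by blast
    qed
    then show ?thesis using D by blast
  next
    case False
    have "H2_bounded (\<lambda>z. 0)" by (rule bounded_imp_H2_bounded) auto
    moreover from H2_bounded_nt[OF this] have ?nt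
      by eventually_elim (use nt_converges_cong[of h "\<lambda>z. 0"] False in auto)
    ultimately show ?thesis using False p by (auto intro!: exI[of _ "\<lambda>z. 0"])
  qed
  then show ?nt ?dom by auto
qed


section \<open>Test functions and mollifiers\<close>

definition smooth :: "('a::real_normed_vector \<Rightarrow> 'b::real_normed_vector) \<Rightarrow> bool"
  where "smooth f \<longleftrightarrow> (\<forall>k. C_k k f)"

lemma C_k_add: "C_k k f \<Longrightarrow> C_k k g \<Longrightarrow> C_k k (\<lambda>z. f z + g z)"
proof (induction k arbitrary: f g)
  case (Suc k)
  have "((\<lambda>z. f z + g z) has_derivative (\<lambda>v. frechet_derivative f (at z) v + frechet_derivative g (at z) v)) (at z)" for z
    using Suc.prems by (intro has_derivative_add) (auto simp flip: frechet_derivative_works)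
  from this[THEN frechet_derivative_at] this
  have "frechet_derivative (\<lambda>z. f z + g z) (at z) = (\<lambda>v. frechet_derivative f (at z) v + frechet_derivative g (at z) v)"
    "(\<lambda>z. f z + g z) differentiable at z" for z by (auto simp: differentiable_def)
  then show ?case using Suc by simp
qed (auto intro: continuous_intros)

lemma C_k_cmult:
  fixes f :: "'a::real_normed_vector \<Rightarrow> real"
  shows "C_k k f \<Longrightarrow> C_k k (\<lambda>z. c * f z)"
proof (induction k arbitrary: f)
  case (Suc k)
  have "((\<lambda>z. c * f z) has_derivative (\<lambda>v. c * frechet_derivative f (at z) v)) (at z)" for z
    using Suc.prems frechet_derivative_works[of f "at z"] by (intro has_derivative_mult_right) auto
  from this[THEN frechet_derivative_at] this
  have "frechet_derivative (\<lambda>z. c * f z) (at z) = (\<lambda>v. c * frechet_derivative f (at z) v)"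
    "(\<lambda>z. c * f z) differentiable at z" for z by (auto simp: differentiable_def)
  then show ?case using Suc by simp
qed (auto intro: continuous_intros)

text \<open>A coinduction rule: a class of differentiable functions that contains its own
  directional derivatives consists of smooth functions. Several closure lemmas below only have to
  exhibit such a class.\<close>

lemma smooth_class:
  assumes f: "P f"
    and diff: "\<And>f z. P f \<Longrightarrow> f differentiable at z"
    and closed: "\<And>f v. P f \<Longrightarrow> P (\<lambda>z. frechet_derivative f (at z) v)"
  shows "smooth f"
proof -
  have "C_k k f" if "P f" for k f
    using that
  proof (induction k arbitrary: f)
    case 0
    then show ?case using diff
      by (auto intro!: differentiable_imp_continuous_on simp: differentiable_on_def intro: differentiable_at_withinI)
  qed (use diff closed in auto)
  then show ?thesis using f by (simp add: smooth_def)
qed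

lemma smooth_differentiable: "smooth f \<Longrightarrow> f differentiable at z"
  using C_k.simps(2)[of 0 f] by (auto simp: smooth_def)

lemma smooth_frechet: "smooth f \<Longrightarrow> smooth (\<lambda>z. frechet_derivative f (at z) v)"
  unfolding smooth_def using C_k.simps(2)[of _ f] by blast

lemma smooth_partial: "smooth f \<Longrightarrow> smooth (partial_x f)" "smooth f \<Longrightarrow> smooth (partial_y f)"
  unfolding partial_x_def[abs_def] partial_y_def[abs_def] by (auto intro: smooth_frechet)

lemma smooth_continuous_on: "smooth f \<Longrightarrow> continuous_on S f"
proof -
  assume "smooth f"
  then have "continuous_on UNIV f" using C_k.simps(1)[of f] unfolding smooth_def by blast
  then show "continuous_on S f" by (rule continuous_on_subset) simp
qed

lemma smooth_add: "smooth f \<Longrightarrow> smooth g \<Longrightarrow> smooth (\<lambda>z. f z + g z)"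
  by (simp add: smooth_def C_k_add)

lemma smooth_cmult: "smooth f \<Longrightarrow> smooth (\<lambda>z. c * f z :: real)"
  by (simp add: smooth_def C_k_cmult)

lemma complex_linear_expand:
  assumes "linear (f :: complex \<Rightarrow> 'a::real_vector)"
  shows "f v = Re v *\<^sub>R f 1 + Im v *\<^sub>R f \<i>"
proof -
  have "f v = f (Re v *\<^sub>R 1 + Im v *\<^sub>R \<i>)"
    by (rule arg_cong[where f = f]) (simp add: complex_eq_iff)
  then show ?thesis using assms by (simp add: linear_add linear_scale)
qed

lemma smooth_has_derivative:
  assumes "smooth (f :: complex \<Rightarrow> real)"
  shows "(f has_derivative (\<lambda>v. Re v * partial_x f z + Im v * partial_y f z)) (at z)"
proof -
  have d: "(f has_derivative frechet_derivative f (at z)) (at z)"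
    using smooth_differentiable[OF assms] frechet_derivative_works by blast
  have "frechet_derivative f (at z) = (\<lambda>v. Re v * partial_x f z + Im v * partial_y f z)"
    by (rule ext, subst complex_linear_expand[OF has_derivative_linear[OF d]])
       (simp add: partial_x_def partial_y_def)
  with d show ?thesis by simp
qed

lemma partial_eqI:
  assumes "(f has_derivative f') (at z)"
  shows "partial_x f z = f' 1" "partial_y f z = f' \<i>"
  using frechet_derivative_at[OF assms] by (auto simp: partial_x_def partial_y_def)

text \<open>The functions f l + g form an invariant class, because the derivative of l in a fixed
  direction is constant. Multiplying test functions by coordinates later gives the product rule for
  \<open>cnj z\<close>.\<close>

lemma smooth_mult_linear:
  fixes f l :: "complex \<Rightarrow> real"
  assumes f: "smooth f" and l: "bounded_linear l"
  shows "smooth (\<lambda>z. f z * l z)"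
proof (rule smooth_class[where P = "\<lambda>h. \<exists>f g. smooth f \<and> smooth g \<and> h = (\<lambda>z. f z * l z + g z)"])
  have "smooth (\<lambda>z. 0 * f z)" by (rule smooth_cmult[OF f])
  then show "\<exists>fa g. smooth fa \<and> smooth g \<and> (\<lambda>z. f z * l z) = (\<lambda>z. fa z * l z + g z)"
    using f by (intro exI[of _ f] exI[of _ "\<lambda>z. 0"]) auto
next
  fix h :: "complex \<Rightarrow> real" assume "\<exists>f g. smooth f \<and> smooth g \<and> h = (\<lambda>z. f z * l z + g z)"
  then obtain f g where fg: "smooth f" "smooth g" "h = (\<lambda>z. f z * l z + g z)" by blast
  let ?D = "\<lambda>z v. frechet_derivative f (at z) v * l z + (f z * l v + frechet_derivative g (at z) v)"
  have d: "(h has_derivative ?D z) (at z)" for z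
  proof -
    have "(f has_derivative frechet_derivative f (at z)) (at z)" "(g has_derivative frechet_derivative g (at z)) (at z)"
      using smooth_differentiable[OF fg(1)] smooth_differentiable[OF fg(2)] frechet_derivative_works by blast+
    from has_derivative_add[OF has_derivative_mult[OF this(1) bounded_linear_imp_has_derivative[OF l]] this(2)]
    show ?thesis unfolding fg(3) by (simp add: algebra_simps)
  qed
  show "h differentiable at z" for z using d by (auto simp: differentiable_def)
  have "(\<lambda>z. frechet_derivative h (at z) v) = (\<lambda>z. ?D z v)" for v
    by (simp add: frechet_derivative_at[OF d, symmetric])
  moreover have "smooth (\<lambda>z. f z * l v + frechet_derivative g (at z) v)" for v
    using smooth_add[OF smooth_cmult[OF fg(1), of "l v"] smooth_frechet[OF fg(2)]] by (simp add: mult.commute)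
  ultimately show "\<exists>f g. smooth f \<and> smooth g \<and> (\<lambda>z. frechet_derivative h (at z) v) = (\<lambda>z. f z * l z + g z)" for v
    using smooth_frechet[OF fg(1)] by blast
qed

text \<open>Differentiation replaces the direction v by -v and stays in the class. Such reflections
  are the test functions behind convolution.\<close>

lemma smooth_reflect:
  fixes f :: "complex \<Rightarrow> real"
  assumes f: "smooth f"
  shows "smooth (\<lambda>z. f (c - z))"
proof (rule smooth_class[where P = "\<lambda>h. \<exists>f. smooth f \<and> h = (\<lambda>z. f (c - z))"])
  fix h :: "complex \<Rightarrow> real" assume "\<exists>f. smooth f \<and> h = (\<lambda>z. f (c - z))"
  then obtain f where fg: "smooth f" "h = (\<lambda>z. f (c - z))" by blast
  have d: "(h has_derivative (\<lambda>v. frechet_derivative f (at (c - z)) (- v))) (at z)" for z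
  proof -
    have "((\<lambda>z. c - z) has_derivative (\<lambda>v. - v)) (at z)" by (auto intro!: derivative_eq_intros)
    moreover have "(f has_derivative frechet_derivative f (at (c - z))) (at (c - z))"
      using smooth_differentiable[OF fg(1)] frechet_derivative_works by blast
    ultimately show ?thesis unfolding fg(2) by (rule has_derivative_compose)
  qed
  show "h differentiable at z" for z using d by (auto simp: differentiable_def)
  have "(\<lambda>z. frechet_derivative h (at z) v) = (\<lambda>z. frechet_derivative f (at (c - z)) (- v))" for v
    by (simp add: frechet_derivative_at[OF d, symmetric])
  then show "\<exists>f. smooth f \<and> (\<lambda>z. frechet_derivative h (at z) v) = (\<lambda>z. f (c - z))" for v
    using smooth_frechet[OF fg(1)] by blast
qed (use f in blast)

lemma partial_reflect:
  fixes f :: "complex \<Rightarrow> real"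
  assumes f: "smooth f"
  shows "partial_x (\<lambda>z. f (c - z)) z = - partial_x f (c - z)"
    "partial_y (\<lambda>z. f (c - z)) z = - partial_y f (c - z)"
proof -
  have "((\<lambda>z. f (c - z)) has_derivative (\<lambda>v. Re (-v) * partial_x f (c - z) + Im (-v) * partial_y f (c - z))) (at z)"
    by (rule has_derivative_compose[of "\<lambda>z. c - z" _ _ _ f])
       (use smooth_has_derivative[OF f] in \<open>auto intro!: derivative_eq_intros\<close>)
  from partial_eqI[OF this] show "partial_x (\<lambda>z. f (c - z)) z = - partial_x f (c - z)"
    "partial_y (\<lambda>z. f (c - z)) z = - partial_y f (c - z)" by auto
qed

text \<open>The functions \<open>P(1/t) e\<^sup>-\<^sup>1\<^sup>/\<^sup>t\<close>, extended by zero: a class closed under differentiation.\<close>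

definition flat :: "real poly \<Rightarrow> real \<Rightarrow> real" where
  "flat P t = (if 0 < t then poly P (1 / t) * exp (- (1 / t)) else 0)"

lemma poly_exp_decay: "((\<lambda>s. poly P s * exp (- s)) \<longlongrightarrow> (0::real)) at_top"
proof -
  have "((\<lambda>s. \<Sum>i\<le>degree P. coeff P i * (s ^ i / exp s)) \<longlongrightarrow> (\<Sum>i\<le>degree P. coeff P i * 0)) at_top"
    by (intro tendsto_intros tendsto_power_div_exp_0)
  then show ?thesis by (simp add: poly_altdef sum_distrib_right exp_minus field_simps sum_divide_distrib)
qed

text \<open>With s = 1/t the derivative is s^2 (P(s) - P'(s)) e^(-s); the polynomial s^2 is
  \<open>[:0, 0, 1:]\<close>.\<close>

lemma flat_has_derivative:
  "(flat P has_real_derivative flat ([:0, 0, 1:] * (P - pderiv P)) t) (at t)"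
proof -
  consider "t < 0" | "0 < t" | "t = 0" by linarith
  then show ?thesis
  proof cases
    case 1
    have "((\<lambda>t. 0) has_real_derivative 0) (at t)" by simp
    then have "(flat P has_real_derivative 0) (at t)"
      by (rule has_field_derivative_transform_within_open[of _ _ _ "{..<0}"]) (use 1 in \<open>auto simp: flat_def\<close>)
    then show ?thesis using 1 by (simp add: flat_def)
  next
    case 2
    have "((\<lambda>t. poly P (1 / t) * exp (- (1 / t))) has_real_derivative
        (1/t)^2 * (poly P (1/t) - poly (pderiv P) (1/t)) * exp (- (1 / t))) (at t)"
      using 2 by (auto intro!: derivative_eq_intros DERIV_chain2[OF poly_DERIV] simp: field_simps power2_eq_square)
    then have "(flat P has_real_derivative
        (1/t)^2 * (poly P (1/t) - poly (pderiv P) (1/t)) * exp (- (1 / t))) (at t)"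
      by (rule has_field_derivative_transform_within_open[of _ _ _ "{0<..}"]) (use 2 in \<open>auto simp: flat_def\<close>)
    then show ?thesis using 2 by (simp add: flat_def power2_eq_square)
  next
    case 3
    \<comment> \<open>From the right, the difference quotient at 0 is s P(s) e^(-s) at s = 1/h, and
      the exponential beats the polynomial.\<close>
    have "((\<lambda>h. flat P h / h) \<longlongrightarrow> 0) (at_right 0)"
    proof -
      have "((\<lambda>h. poly ([:0, 1:] * P) (inverse h) * exp (- inverse h)) \<longlongrightarrow> 0) (at_right 0)"
        by (rule filterlim_compose[OF poly_exp_decay filterlim_inverse_at_top_right])
      moreover have "eventually (\<lambda>h. poly ([:0, 1:] * P) (inverse h) * exp (- inverse h) = flat P h / h) (at_right 0)"
        by (rule eventually_at_rightI[of 0 1]) (auto simp: flat_def field_simps)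
      ultimately show ?thesis by (rule Lim_transform_eventually)
    qed
    moreover have "((\<lambda>h. flat P h / h) \<longlongrightarrow> 0) (at_left 0)"
    proof (rule Lim_transform_eventually[OF tendsto_const])
      show "eventually (\<lambda>h. 0 = flat P h / h) (at_left 0)"
        by (rule eventually_at_leftI[of "-1"]) (auto simp: flat_def)
    qed
    ultimately have "((\<lambda>h. flat P h / h) \<longlongrightarrow> 0) (at 0)" by (simp add: filterlim_split_at)
    then show ?thesis using 3 by (simp add: DERIV_def flat_def)
  qed
qed

section \<open>Mollifiers and integrals of derivatives\<close>

text \<open>Supported in the square |Re z|, |Im z| \<le> e. The four independent polynomials make
  the family closed, up to linear combinations, under both partial derivatives.\<close>

definition square_bump :: "real \<Rightarrow> real poly \<Rightarrow> real poly \<Rightarrow> real poly \<Rightarrow> real poly \<Rightarrow> complex \<Rightarrow> real" where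
  "square_bump e P1 P2 P3 P4 z = flat P1 (e - Re z) * flat P2 (e + Re z) * flat P3 (e - Im z) * flat P4 (e + Im z)"

lemma smooth_square_bump: "smooth (square_bump e P1 P2 P3 P4)"
proof -
  define d where "d P = [:0, 0, 1:] * (P - pderiv P)" for P :: "real poly"
  have D: "(square_bump e P1 P2 P3 P4 has_derivative (\<lambda>v.
      (- Re v) * square_bump e (d P1) P2 P3 P4 z + Re v * square_bump e P1 (d P2) P3 P4 z
      + ((- Im v) * square_bump e P1 P2 (d P3) P4 z + Im v * square_bump e P1 P2 P3 (d P4) z))) (at z)"
    for P1 P2 P3 P4 z
  proof -
    have c: "((\<lambda>z. flat P (g z)) has_derivative (\<lambda>v. flat (d P) (g z) * g' v)) (at z)"
      if "(g has_derivative g') (at z)" for P and g g' :: "complex \<Rightarrow> real"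
      using has_derivative_compose[OF that flat_has_derivative[of P "g z", unfolded has_field_derivative_def]]
      by (simp add: d_def)
    have l: "((\<lambda>z. e - Re z) has_derivative (\<lambda>v. - Re v)) (at z)" "((\<lambda>z. e + Re z) has_derivative (\<lambda>v. Re v)) (at z)"
      "((\<lambda>z. e - Im z) has_derivative (\<lambda>v. - Im v)) (at z)" "((\<lambda>z. e + Im z) has_derivative (\<lambda>v. Im v)) (at z)"
      by (auto intro!: derivative_eq_intros)
    show ?thesis unfolding square_bump_def
      by (rule derivative_eq_intros c[OF l(1)] c[OF l(2)] c[OF l(3)] c[OF l(4)] refl)+
         (simp add: fun_eq_iff algebra_simps)
  qed
  have "C_k k (square_bump e P1 P2 P3 P4)" for k P1 P2 P3 P4
  proof (induction k arbitrary: P1 P2 P3 P4)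
    case 0
    have "square_bump e P1 P2 P3 P4 differentiable at z" for z unfolding differentiable_def by (rule exI, rule D)
    then show ?case
      by (auto intro!: differentiable_imp_continuous_on simp: differentiable_on_def intro: differentiable_at_withinI)
  next
    case (Suc k)
    have "square_bump e P1 P2 P3 P4 differentiable at z" for z unfolding differentiable_def by (rule exI, rule D)
    moreover have "C_k k (\<lambda>z. frechet_derivative (square_bump e P1 P2 P3 P4) (at z) v)" for v
      unfolding frechet_derivative_at[OF D, symmetric] by (intro C_k_add C_k_cmult Suc)
    ultimately show ?case by simp
  qed
  then show ?thesis by (simp add: smooth_def)
qed

definition mollifier :: "real \<Rightarrow> (complex \<Rightarrow> real) \<Rightarrow> bool" where
  "mollifier e \<beta> \<longleftrightarrow> smooth \<beta> \<and> (\<forall>t. 0 \<le> \<beta> t) \<and> (\<forall>t. e < norm t \<longrightarrow> \<beta> t = 0) \<and>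
     integrable lborel \<beta> \<and> integral\<^sup>L lborel \<beta> = 1"

lemma integrable_continuous_compact_support:
  fixes f :: "complex \<Rightarrow> 'a::{banach, second_countable_topology}"
  assumes c: "continuous_on UNIV f" and s: "\<And>t. R < norm t \<Longrightarrow> f t = 0"
  shows "integrable lborel f"
proof -
  have "integrable lborel (\<lambda>x. indicator (cball 0 R) x *\<^sub>R f x)"
    using borel_integrable_compact[OF compact_cball, of 0 R f] c continuous_on_subset by (auto simp: set_integrable_def)
  moreover have "(\<lambda>x. indicator (cball 0 R) x *\<^sub>R f x) = f" using s by (auto simp: indicator_def fun_eq_iff not_le)
  ultimately show ?thesis by simp
qed

lemma mollifier_exists:
  assumes "0 < e" shows "\<exists>\<beta>. mollifier e \<beta>"
proof -
  \<comment> \<open>The square of half-side e / 2 lies in the disc of radius e because |t| \<le> |Re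
    t| + |Im t|.\<close>
  define \<gamma> where "\<gamma> = square_bump (e / 2) 1 1 1 1"
  have sm: "smooth \<gamma>" unfolding \<gamma>_def by (rule smooth_square_bump)
  have cont: "continuous_on S \<gamma>" for S by (rule smooth_continuous_on[OF sm])
  have nonneg: "0 \<le> \<gamma> t" for t by (simp add: \<gamma>_def square_bump_def flat_def)
  have supp: "\<gamma> t = 0" if "e < norm t" for t
  proof -
    have "norm t \<le> \<bar>Re t\<bar> + \<bar>Im t\<bar>" by (rule cmod_le)
    then have "e / 2 < \<bar>Re t\<bar> \<or> e / 2 < \<bar>Im t\<bar>" using that by linarith
    then show ?thesis by (auto simp: \<gamma>_def square_bump_def flat_def abs_if split: if_splits)
  qed
  have int: "integrable lborel \<gamma>" by (rule integrable_continuous_compact_support[OF cont supp])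
  have "integral\<^sup>L lborel \<gamma> \<noteq> 0"
  proof
    assume "integral\<^sup>L lborel \<gamma> = 0"
    then have "AE t in lborel. \<gamma> t = 0" using integral_nonneg_eq_0_iff_AE[OF int] nonneg by auto
    then have "AE t in lebesgue. t \<notin> {t. \<gamma> t \<noteq> 0}" by (simp add: AE_completion)
    moreover have op: "open {t. \<gamma> t \<noteq> 0}"
      using continuous_open_preimage[OF cont open_UNIV, of "- {0}"] by (auto simp: vimage_def)
    ultimately have "negligible {t. \<gamma> t \<noteq> 0}"
      by (simp add: negligible_iff_null_sets AE_iff_null_sets)
    moreover have "0 \<in> {t. \<gamma> t \<noteq> 0}" using assms by (simp add: \<gamma>_def square_bump_def flat_def)
    ultimately show False using open_not_negligible[OF op] by blast
  qed
  moreover have "0 \<le> integral\<^sup>L lborel \<gamma>" using nonneg by simp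
  ultimately have pos: "0 < integral\<^sup>L lborel \<gamma>" by simp
  define \<beta> where "\<beta> t = (1 / integral\<^sup>L lborel \<gamma>) * \<gamma> t" for t
  have "mollifier e \<beta>" unfolding mollifier_def
    using smooth_cmult[OF sm, of "1 / integral\<^sup>L lborel \<gamma>"] pos nonneg supp int
    by (auto simp: \<beta>_def[abs_def])
  then show ?thesis by blast
qed

lemma integral_lborel_translate:
  fixes f :: "complex \<Rightarrow> 'a::{banach, second_countable_topology}"
  assumes "f \<in> borel_measurable borel"
  shows "(LINT z|lborel. f (c + z)) = integral\<^sup>L lborel f"
  using integral_distr[of "(+) c" lborel borel f] assms by (simp add: lborel_distr_plus)

lemma lborel_reflect: "distr lborel borel (\<lambda>z. c - z) = (lborel :: complex measure)"
proof -
  have "lborel = density (distr lborel borel (\<lambda>x::complex. c + (-1) *\<^sub>R x)) (\<lambda>_. ennreal (\<bar>-1\<bar> ^ DIM(complex)))"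
    by (rule lborel_affine) simp
  then show ?thesis by (simp add: density_1)
qed

lemma integral_lborel_reflect:
  fixes f :: "complex \<Rightarrow> 'a::{banach, second_countable_topology}"
  assumes "f \<in> borel_measurable borel"
  shows "(LINT z|lborel. f (c - z)) = integral\<^sup>L lborel f"
  using integral_distr[of "(-) c" lborel borel f] assms by (simp add: lborel_reflect)

lemma derivative_zero_outside:
  fixes f :: "complex \<Rightarrow> 'a::real_normed_vector"
  assumes d: "(f has_derivative f') (at z)" and s: "\<And>t. R < norm t \<Longrightarrow> f t = 0" and z: "R < norm z"
  shows "f' = (\<lambda>v. 0)"
proof -
  have op: "open {t::complex. R < norm t}" by (intro open_Collect_less continuous_intros)
  have "((\<lambda>t. 0 :: 'a) has_derivative (\<lambda>v. 0)) (at z)" by simp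
  then have "(f has_derivative (\<lambda>v. 0)) (at z)"
    by (rule has_derivative_transform_within_open[OF _ op]) (use s z in auto)
  then show ?thesis using d has_derivative_unique by blast
qed

lemma bounded_of_compact_support:
  fixes g :: "complex \<Rightarrow> 'a::real_normed_vector"
  assumes c: "continuous_on UNIV g" and s: "\<And>t. R < norm t \<Longrightarrow> g t = 0"
  obtains B where "0 < B" "\<And>t. norm (g t) \<le> B"
proof -
  have "compact (g ` cball 0 R)"
    by (intro compact_continuous_image continuous_on_subset[OF c]) auto
  then obtain B where "\<And>y. y \<in> g ` cball 0 R \<Longrightarrow> norm y \<le> B"
    using compact_imp_bounded bounded_iff by metis
  then have B: "\<And>t. norm t \<le> R \<Longrightarrow> norm (g t) \<le> B" by auto
  show ?thesis
  proof (rule that[of "max B 1"])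
    show "norm (g t) \<le> max B 1" for t
      using B[of t] s[of t] by (cases "norm t \<le> R") auto
  qed simp
qed

lemma segment_lipschitz:
  fixes f :: "complex \<Rightarrow> 'a::real_normed_vector"
  assumes d: "\<And>z. (f has_derivative f' z) (at z)" and B: "\<And>z. norm (f' z v) \<le> B" and h: "0 \<le> h"
  shows "norm (f (z + h *\<^sub>R v) - f z) \<le> B * h"
proof -
  have "norm (f (z + h *\<^sub>R v) - f (z + 0 *\<^sub>R v)) \<le> B * norm (h - 0)"
  proof (rule differentiable_bound[of "{0..h}" "\<lambda>t. f (z + t *\<^sub>R v)" "\<lambda>t s. f' (z + t *\<^sub>R v) (s *\<^sub>R v)"])
    fix t assume "t \<in> {0..h}"
    have "((\<lambda>t. z + t *\<^sub>R v) has_derivative (\<lambda>s. s *\<^sub>R v)) (at t within {0..h})"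
      by (auto intro!: derivative_eq_intros)
    then show "((\<lambda>t. f (z + t *\<^sub>R v)) has_derivative (\<lambda>s. f' (z + t *\<^sub>R v) (s *\<^sub>R v))) (at t within {0..h})"
      by (rule has_derivative_compose) (rule d)
    have "norm (f' (z + t *\<^sub>R v) (s *\<^sub>R v)) \<le> B * norm s" for s
      using mult_left_mono[OF B[of "z + t *\<^sub>R v"], of "\<bar>s\<bar>"] linear_scale[OF has_derivative_linear[OF d]]
      by (simp add: mult.commute)
    then show "onorm (\<lambda>s. f' (z + t *\<^sub>R v) (s *\<^sub>R v)) \<le> B" by (rule onorm_le)
  qed (use h in auto)
  then show ?thesis using h by simp
qed

text \<open>Difference quotients have integral zero by translation invariance.\<close>

lemma integral_derivative_compact_support:
  fixes f :: "complex \<Rightarrow> complex"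
  assumes d: "\<And>z. (f has_derivative f' z) (at z)" and c: "continuous_on UNIV (\<lambda>z. f' z v)"
    and s: "\<And>t. R < norm t \<Longrightarrow> f t = 0"
  shows "(LINT z|lborel. f' z v) = 0"
proof -
  have s': "f' z v = 0" if "R < norm z" for z
    using derivative_zero_outside[OF d s that] by simp
  obtain B where B: "0 < B" "\<And>z. norm (f' z v) \<le> B"
    using bounded_of_compact_support[OF c s'] by blast
  have contf: "continuous_on UNIV f"
    using d by (intro continuous_at_imp_continuous_on) (auto intro: has_derivative_continuous)
  have intf: "integrable lborel f" by (rule integrable_continuous_compact_support[OF contf s])
  have mf: "f \<in> borel_measurable borel" using contf by (rule borel_measurable_continuous_onI)
  have mf': "(\<lambda>z. f' z v) \<in> borel_measurable borel" using c by (rule borel_measurable_continuous_onI)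
  define h where "h n = 1 / (real n + 1)" for n
  have h: "0 < h n" "h n \<le> 1" for n by (auto simp: h_def)
  have hlim: "h \<longlonglongrightarrow> 0" unfolding h_def by real_asymp
  define q where "q n z = (1 / h n) *\<^sub>R (f (z + h n *\<^sub>R v) - f z)" for n z
  have intT: "integrable lborel (\<lambda>z. f (z + h n *\<^sub>R v))" for n
    using lborel_integrable_real_affine intf
    by (subst (asm) lborel_distr_plus[symmetric, of "h n *\<^sub>R v"], subst (asm) integrable_distr_eq)
       (use mf in \<open>auto simp: add.commute\<close>)
  have "integral\<^sup>L lborel (q n) = 0" for n
  proof -
    have "integral\<^sup>L lborel (q n) = (1 / h n) *\<^sub>R ((LINT z|lborel. f (z + h n *\<^sub>R v)) - integral\<^sup>L lborel f)"
      unfolding q_def using intf intT by simp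
    also have "(LINT z|lborel. f (z + h n *\<^sub>R v)) = integral\<^sup>L lborel f"
      using integral_lborel_translate[OF mf, of "h n *\<^sub>R v"] by (simp add: add.commute)
    finally show ?thesis by simp
  qed
  \<comment> \<open>The increments \<open>h n\<close> are at most 1, so the difference quotients
    vanish outside radius R + |v|; inside, \<open>segment_lipschitz\<close> bounds them by
    B.\<close>
  moreover have "(\<lambda>n. integral\<^sup>L lborel (q n)) \<longlonglongrightarrow> (LINT z|lborel. f' z v)"
  proof (rule integral_dominated_convergence[where w = "\<lambda>z. indicator (cball 0 (R + norm v)) z *\<^sub>R B"])
    show "(\<lambda>z. f' z v) \<in> borel_measurable lborel" using mf' by simp
    show "q n \<in> borel_measurable lborel" for n unfolding q_def using mf by measurable
    show "integrable lborel (\<lambda>z. indicator (cball 0 (R + norm v)) z *\<^sub>R B)"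
      by (intro integrable_real_indicator integrable_scaleR_left) (auto simp: emeasure_lborel_cball_finite[simplified])
    show "AE z in lborel. (\<lambda>n. q n z) \<longlonglongrightarrow> f' z v"
    proof (rule AE_I2)
      fix z
      have "((\<lambda>t. f (z + t *\<^sub>R v)) has_vector_derivative f' z v) (at 0)"
      proof -
        have "((\<lambda>t. z + t *\<^sub>R v) has_derivative (\<lambda>s. s *\<^sub>R v)) (at 0)"
          by (auto intro!: derivative_eq_intros)
        from has_derivative_compose[OF this, of f "f' z"] d[of z]
        show ?thesis using has_derivative_linear[OF d[of z]]
          by (simp add: has_vector_derivative_def linear_scale)
      qed
      then have lim: "((\<lambda>t. norm (f (z + t *\<^sub>R v) - f z - t *\<^sub>R f' z v) / norm t) \<longlongrightarrow> 0) (at 0)"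
        unfolding has_vector_derivative_def has_derivative_at by simp
      have "norm (f (z + t *\<^sub>R v) - f z - t *\<^sub>R f' z v) / norm t = norm ((1 / t) *\<^sub>R (f (z + t *\<^sub>R v) - f z) - f' z v)"
        if "t \<noteq> 0" for t
      proof -
        have "(1 / t) *\<^sub>R (f (z + t *\<^sub>R v) - f z) - f' z v = (1 / t) *\<^sub>R (f (z + t *\<^sub>R v) - f z - t *\<^sub>R f' z v)"
          using that by (simp add: scaleR_diff_right)
        then show ?thesis by (simp only: norm_scaleR) simp
      qed
      then have "eventually (\<lambda>t. norm (f (z + t *\<^sub>R v) - f z - t *\<^sub>R f' z v) / norm t
          = norm ((1 / t) *\<^sub>R (f (z + t *\<^sub>R v) - f z) - f' z v)) (at 0)"
        unfolding eventually_at_filter by (intro always_eventually allI impI) blast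
      from Lim_transform_eventually[OF lim this]
      have "((\<lambda>t. (1 / t) *\<^sub>R (f (z + t *\<^sub>R v) - f z)) \<longlongrightarrow> f' z v) (at 0)"
        by (simp add: tendsto_norm_zero_iff Lim_null[of _ "f' z v"])
      then show "(\<lambda>n. q n z) \<longlonglongrightarrow> f' z v"
        unfolding q_def by (rule filterlim_compose) (use hlim h in \<open>auto simp: filterlim_at less_imp_neq[symmetric] intro!: always_eventually\<close>)
    qed
    show "AE z in lborel. norm (q n z) \<le> indicator (cball 0 (R + norm v)) z *\<^sub>R B" for n
    proof (rule AE_I2)
      fix z
      show "norm (q n z) \<le> indicator (cball 0 (R + norm v)) z *\<^sub>R B"
      proof (cases "norm z \<le> R + norm v")
        case True
        have "norm (q n z) \<le> (1 / h n) * (B * h n)"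
          unfolding q_def norm_scaleR
          using segment_lipschitz[OF d B(2), of "h n" z] h[of n] by (simp add: divide_le_eq)
        then show ?thesis using True h[of n] by simp
      next
        case False
        have "norm z \<le> norm (z + h n *\<^sub>R v) + norm (h n *\<^sub>R v)"
          using norm_triangle_ineq4[of "z + h n *\<^sub>R v" "h n *\<^sub>R v"] by simp
        moreover have "norm (h n *\<^sub>R v) \<le> norm v" using h[of n] by (simp add: mult_left_le_one_le)
        ultimately have "f (z + h n *\<^sub>R v) = 0" using False by (intro s) linarith
        moreover have "f z = 0" using False norm_ge_zero[of v] by (intro s) linarith
        ultimately show ?thesis using False by (simp add: q_def)
      qed
    qed
  qed
  ultimately show ?thesis by (simp add: LIMSEQ_const_iff)
qed

definition csmooth :: "real \<Rightarrow> (complex \<Rightarrow> real) \<Rightarrow> bool" where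
  "csmooth e \<gamma> \<longleftrightarrow> smooth \<gamma> \<and> (\<forall>t. e < norm t \<longrightarrow> \<gamma> t = 0)"

lemma csmooth_partial:
  assumes "csmooth e \<gamma>" shows "csmooth e (partial_x \<gamma>)" "csmooth e (partial_y \<gamma>)"
proof -
  have sm: "smooth \<gamma>" and s: "\<And>t. e < norm t \<Longrightarrow> \<gamma> t = 0" using assms by (auto simp: csmooth_def)
  have "(\<lambda>v. Re v * partial_x \<gamma> t + Im v * partial_y \<gamma> t) = (\<lambda>v. 0)" if "e < norm t" for t
    by (rule derivative_zero_outside[OF smooth_has_derivative[OF sm] s that])
  from fun_cong[OF this, of _ 1] fun_cong[OF this, of _ \<i>]
  show "csmooth e (partial_x \<gamma>)" "csmooth e (partial_y \<gamma>)"
    using smooth_partial[OF sm] by (auto simp: csmooth_def)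
qed

lemma csmooth_continuous: "csmooth e \<gamma> \<Longrightarrow> continuous_on S \<gamma>"
  by (simp add: csmooth_def smooth_continuous_on)

lemma csmooth_bounded:
  assumes "csmooth e \<gamma>" obtains B where "0 < B" "\<And>t. \<bar>\<gamma> t\<bar> \<le> B"
  using bounded_of_compact_support[OF csmooth_continuous[OF assms], of e] assms
  by (auto simp: csmooth_def)

lemma csmooth_measurable: "csmooth e \<gamma> \<Longrightarrow> \<gamma> \<in> borel_measurable borel"
  by (rule borel_measurable_continuous_onI[OF csmooth_continuous])

lemma mollifier_csmooth: "mollifier e \<beta> \<Longrightarrow> csmooth e \<beta>"
  by (simp add: mollifier_def csmooth_def)

section \<open>Convolution with mollifiers\<close>

definition conv :: "(complex \<Rightarrow> real) \<Rightarrow> (complex \<Rightarrow> complex) \<Rightarrow> complex \<Rightarrow> complex" where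
  "conv \<gamma> u z = (LINT \<zeta>|lborel. \<gamma> (z - \<zeta>) *\<^sub>R u \<zeta>)"

lemma conv_integrable:
  fixes u :: "complex \<Rightarrow> complex"
  assumes "csmooth e \<gamma>" "integrable lborel u"
  shows "integrable lborel (\<lambda>\<zeta>. \<gamma> (z - \<zeta>) *\<^sub>R u \<zeta>)"
proof -
  obtain B where B: "0 < B" "\<And>t. \<bar>\<gamma> t\<bar> \<le> B" using csmooth_bounded[OF assms(1)] by blast
  have [measurable]: "\<gamma> \<in> borel_measurable borel" "u \<in> borel_measurable borel"
    using csmooth_measurable[OF assms(1)] assms(2) by auto
  have "integrable lborel (\<lambda>\<zeta>. B *\<^sub>R u \<zeta>)" using assms(2) by simp
  then show ?thesis
    by (rule Bochner_Integration.integrable_bound) (use B in \<open>auto intro!: mult_right_mono\<close>)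
qed

text \<open>The first-order remainder of \<gamma> is bounded by a constant times |h| uniformly and
  is o(|h|) pointwise. Dominated convergence with a multiple of |u| then differentiates under the
  integral, whatever the regularity of u.\<close>

lemma conv_has_derivative:
  assumes g: "csmooth e \<gamma>" and u: "integrable lborel u"
  shows "(conv \<gamma> u has_derivative (\<lambda>v. Re v *\<^sub>R conv (partial_x \<gamma>) u z + Im v *\<^sub>R conv (partial_y \<gamma>) u z)) (at z)"
    (is "(_ has_derivative ?D) _")
  unfolding has_derivative_at
proof
  show "bounded_linear ?D"
    by (intro bounded_linear_add bounded_linear_compose[OF bounded_linear_scaleR_left bounded_linear_Re]
        bounded_linear_compose[OF bounded_linear_scaleR_left bounded_linear_Im])
  note gx = csmooth_partial(1)[OF g] and gy = csmooth_partial(2)[OF g]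
  have sm: "smooth \<gamma>" using g by (simp add: csmooth_def)
  obtain Bx By where B: "0 < Bx" "\<And>t. \<bar>partial_x \<gamma> t\<bar> \<le> Bx" "0 < By" "\<And>t. \<bar>partial_y \<gamma> t\<bar> \<le> By"
    using csmooth_bounded[OF gx] csmooth_bounded[OF gy] by metis
  define r where "r h w = \<gamma> (w + h) - \<gamma> w - (Re h * partial_x \<gamma> w + Im h * partial_y \<gamma> w)" for h w
  have lin: "\<bar>Re v * partial_x \<gamma> w + Im v * partial_y \<gamma> w\<bar> \<le> (Bx + By) * norm v" for v w
  proof -
    have "\<bar>Re v * partial_x \<gamma> w + Im v * partial_y \<gamma> w\<bar> \<le> \<bar>Re v\<bar> * \<bar>partial_x \<gamma> w\<bar> + \<bar>Im v\<bar> * \<bar>partial_y \<gamma> w\<bar>"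
      by (metis abs_mult abs_triangle_ineq)
    also have "\<dots> \<le> norm v * Bx + norm v * By"
      by (intro add_mono mult_mono abs_Re_le_cmod abs_Im_le_cmod B) auto
    finally show ?thesis by (simp add: algebra_simps)
  qed
  have rb: "\<bar>r h w\<bar> \<le> 2 * (Bx + By) * norm h" for h w
  proof -
    have "\<bar>\<gamma> (w + h) - \<gamma> w\<bar> \<le> (Bx + By) * norm h"
      using segment_lipschitz[OF smooth_has_derivative[OF sm], of h "(Bx + By) * norm h" 1 w] lin by simp
    then show ?thesis using lin[of h w] unfolding r_def by linarith
  qed
  have [measurable]: "\<gamma> \<in> borel_measurable borel" "u \<in> borel_measurable borel"
    "partial_x \<gamma> \<in> borel_measurable borel" "partial_y \<gamma> \<in> borel_measurable borel"
    using csmooth_measurable[OF g] csmooth_measurable[OF gx] csmooth_measurable[OF gy] u by auto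
  have eq: "conv \<gamma> u (z + h) - conv \<gamma> u z - ?D h = (LINT \<zeta>|lborel. r h (z - \<zeta>) *\<^sub>R u \<zeta>)" for h
  proof -
    have "r h (z - \<zeta>) *\<^sub>R u \<zeta> = \<gamma> (z + h - \<zeta>) *\<^sub>R u \<zeta> - \<gamma> (z - \<zeta>) *\<^sub>R u \<zeta>
       - (Re h *\<^sub>R (partial_x \<gamma> (z - \<zeta>) *\<^sub>R u \<zeta>) + Im h *\<^sub>R (partial_y \<gamma> (z - \<zeta>) *\<^sub>R u \<zeta>))" for \<zeta>
      by (simp add: r_def algebra_simps)
    then show ?thesis
      unfolding conv_def using conv_integrable[OF g u] conv_integrable[OF gx u] conv_integrable[OF gy u]
      by (simp del: scaleR_scaleR)
  qed
  show "((\<lambda>h. norm (conv \<gamma> u (z + h) - conv \<gamma> u z - ?D h) / norm h) \<longlongrightarrow> 0) (at 0)"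
    unfolding eq tendsto_at_iff_sequentially comp_def
  proof (intro allI impI)
    fix X :: "nat \<Rightarrow> complex" assume X: "\<forall>i. X i \<in> UNIV - {0}" "X \<longlonglongrightarrow> 0"
    have X0: "X i \<noteq> 0" for i using X by auto
    have "(\<lambda>i. LINT \<zeta>|lborel. (r (X i) (z - \<zeta>) / norm (X i)) *\<^sub>R u \<zeta>) \<longlonglongrightarrow> (LINT (\<zeta>::complex)|lborel. 0)"
    proof (rule integral_dominated_convergence[where w = "\<lambda>\<zeta>. (2 * (Bx + By)) * norm (u \<zeta>)"])
      show "(\<lambda>\<zeta>. (r (X i) (z - \<zeta>) / norm (X i)) *\<^sub>R u \<zeta>) \<in> borel_measurable lborel" for i
        unfolding r_def by measurable
      show "integrable lborel (\<lambda>\<zeta>. (2 * (Bx + By)) * norm (u \<zeta>))" using u by simp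
      show "AE \<zeta> in lborel. (\<lambda>i. (r (X i) (z - \<zeta>) / norm (X i)) *\<^sub>R u \<zeta>) \<longlonglongrightarrow> 0"
      proof (rule AE_I2)
        fix \<zeta>
        have "((\<lambda>h. norm (r h (z - \<zeta>)) / norm h) \<longlongrightarrow> 0) (at 0)"
          using smooth_has_derivative[OF sm, of "z - \<zeta>"] unfolding has_derivative_at r_def by blast
        then have "(\<lambda>i. norm (r (X i) (z - \<zeta>)) / norm (X i)) \<longlonglongrightarrow> 0"
          by (rule filterlim_compose) (use X in \<open>auto simp: filterlim_at\<close>)
        then have "(\<lambda>i. r (X i) (z - \<zeta>) / norm (X i)) \<longlonglongrightarrow> 0"
          by (subst tendsto_rabs_zero_iff[symmetric]) simp
        from tendsto_scaleR[OF this tendsto_const[of "u \<zeta>"]]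
        show "(\<lambda>i. (r (X i) (z - \<zeta>) / norm (X i)) *\<^sub>R u \<zeta>) \<longlonglongrightarrow> 0" by simp
      qed
      show "AE \<zeta> in lborel. norm ((r (X i) (z - \<zeta>) / norm (X i)) *\<^sub>R u \<zeta>) \<le> (2 * (Bx + By)) * norm (u \<zeta>)" for i
      proof (rule AE_I2)
        fix \<zeta>
        have "\<bar>r (X i) (z - \<zeta>)\<bar> / norm (X i) \<le> 2 * (Bx + By)"
          using rb[of "X i" "z - \<zeta>"] X0[of i] by (simp add: divide_le_eq)
        from mult_right_mono[OF this norm_ge_zero[of "u \<zeta>"]] show "norm ((r (X i) (z - \<zeta>) / norm (X i)) *\<^sub>R u \<zeta>) \<le> (2 * (Bx + By)) * norm (u \<zeta>)"
          by simp
      qed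
    qed simp
    moreover have "(r (X i) (z - \<zeta>) / norm (X i)) *\<^sub>R u \<zeta> = (1 / norm (X i)) *\<^sub>R (r (X i) (z - \<zeta>) *\<^sub>R u \<zeta>)" for i \<zeta>
      by simp
    ultimately have "(\<lambda>i. (1 / norm (X i)) *\<^sub>R (LINT \<zeta>|lborel. r (X i) (z - \<zeta>) *\<^sub>R u \<zeta>)) \<longlonglongrightarrow> 0"
      by (simp only: integral_scaleR_right) simp
    from tendsto_norm[OF this]
    show "(\<lambda>i. norm (LINT \<zeta>|lborel. r (X i) (z - \<zeta>) *\<^sub>R u \<zeta>) / norm (X i)) \<longlonglongrightarrow> 0" by simp
  qed
qed

lemma conv_continuous:
  assumes "csmooth e \<gamma>" "integrable lborel u" shows "continuous_on S (conv \<gamma> u)"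
  using conv_has_derivative[OF assms]
  by (intro continuous_at_imp_continuous_on) (auto intro: has_derivative_continuous)

lemma mollifier_integral:
  assumes "mollifier e \<beta>"
  shows "integrable lborel (\<lambda>\<zeta>. \<beta> (z - \<zeta>))" "(LINT \<zeta>|lborel. \<beta> (z - \<zeta>)) = 1"
proof -
  have m: "\<beta> \<in> borel_measurable borel" using csmooth_measurable[OF mollifier_csmooth[OF assms]] .
  show "(LINT \<zeta>|lborel. \<beta> (z - \<zeta>)) = 1"
    using integral_lborel_reflect[OF m, of z] assms by (simp add: mollifier_def)
  then show "integrable lborel (\<lambda>\<zeta>. \<beta> (z - \<zeta>))" using not_integrable_integral_eq by fastforce
qed

lemma integrable_cut:
  fixes u :: "complex \<Rightarrow> complex"
  assumes "continuous_on (cball 0 \<rho>) u"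
  shows "integrable lborel (\<lambda>\<zeta>. indicator (cball 0 \<rho>) \<zeta> *\<^sub>R u \<zeta>)"
  using borel_integrable_compact[OF compact_cball assms] by (simp add: set_integrable_def)

text \<open>An average of u - c with total weight 1. The free constant serves twice: c = 0 gives sup
  bounds, c = u z gives convergence.\<close>

lemma mollify_deviation:
  fixes u :: "complex \<Rightarrow> complex"
  assumes m: "mollifier e \<beta>" and int: "integrable lborel u"
    and c: "\<And>\<zeta>. norm (\<zeta> - z) \<le> e \<Longrightarrow> norm (u \<zeta> - c) \<le> \<epsilon>"
  shows "norm (conv \<beta> u z - c) \<le> \<epsilon>"
proof -
  note cs = mollifier_csmooth[OF m] and mi = mollifier_integral[OF m, of z]
  have ci: "integrable lborel (\<lambda>\<zeta>. \<beta> (z - \<zeta>) *\<^sub>R c)" using mi by simp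
  have "conv \<beta> u z - c = (LINT \<zeta>|lborel. \<beta> (z - \<zeta>) *\<^sub>R u \<zeta>) - (LINT \<zeta>|lborel. \<beta> (z - \<zeta>) *\<^sub>R c)"
    using mi by (simp add: conv_def)
  also have "\<dots> = (LINT \<zeta>|lborel. \<beta> (z - \<zeta>) *\<^sub>R (u \<zeta> - c))"
    using conv_integrable[OF cs int] ci by (simp add: scaleR_diff_right)
  also have "norm \<dots> \<le> (LINT \<zeta>|lborel. \<beta> (z - \<zeta>) * \<epsilon>)"
  proof (rule Bochner_Integration.integral_norm_bound_integral)
    show "integrable lborel (\<lambda>\<zeta>. \<beta> (z - \<zeta>) *\<^sub>R (u \<zeta> - c))"
      using Bochner_Integration.integrable_diff[OF conv_integrable[OF cs int] ci] by (simp add: scaleR_diff_right)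
    show "norm (\<beta> (z - \<zeta>) *\<^sub>R (u \<zeta> - c)) \<le> \<beta> (z - \<zeta>) * \<epsilon>" for \<zeta>
    proof (cases "norm (z - \<zeta>) \<le> e")
      case True
      then show ?thesis using c[of \<zeta>] m by (simp add: mollifier_def norm_minus_commute mult_left_mono)
    next
      case False
      then show ?thesis using m by (simp add: mollifier_def)
    qed
  qed (use mi in simp)
  also have "\<dots> = \<epsilon>" using mi by simp
  finally show ?thesis .
qed

text \<open>One d controls both the mollification error and the modulus of continuity, since the
  commutator estimate uses them at the same scale.\<close>

lemma mollify_close:
  fixes u :: "complex \<Rightarrow> complex"
  assumes c: "continuous_on (cball 0 \<rho>) u" and \<epsilon>: "0 < \<epsilon>"
  shows "\<exists>d>0. (\<forall>e \<beta> z. e < d \<and> mollifier e \<beta> \<and> norm z + e \<le> \<rho> \<longrightarrow> norm (conv \<beta> (\<lambda>\<zeta>. indicator (cball 0 \<rho>) \<zeta> *\<^sub>R u \<zeta>) z - u z) \<le> \<epsilon>)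
    \<and> (\<forall>z \<zeta>. norm z \<le> \<rho> \<and> norm \<zeta> \<le> \<rho> \<and> norm (\<zeta> - z) < d \<longrightarrow> norm (u \<zeta> - u z) \<le> \<epsilon>)"
proof -
  have "uniformly_continuous_on (cball 0 \<rho>) u" by (rule compact_uniformly_continuous[OF c compact_cball])
  then obtain d where d: "0 < d" "\<And>z \<zeta>. z \<in> cball 0 \<rho> \<Longrightarrow> \<zeta> \<in> cball 0 \<rho> \<Longrightarrow> dist \<zeta> z < d \<Longrightarrow> dist (u \<zeta>) (u z) < \<epsilon>"
    unfolding uniformly_continuous_on_def using \<epsilon> by metis
  have d2: "norm (u \<zeta> - u z) \<le> \<epsilon>" if "norm z \<le> \<rho>" "norm \<zeta> \<le> \<rho>" "norm (\<zeta> - z) < d" for z \<zeta>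
    using d(2)[of z \<zeta>] that by (auto simp: dist_norm less_imp_le)
  show ?thesis
  proof (intro exI[of _ d] conjI allI impI d(1); (elim conjE)?)
    fix e :: real and \<beta> and z :: complex assume e: "e < d" "mollifier e \<beta>" "norm z + e \<le> \<rho>"
    \<comment> \<open>A negative radius would force \<beta> = 0, against its integral 1.\<close>
    have e0: "0 \<le> e"
    proof (rule ccontr)
      assume "\<not> 0 \<le> e"
      then have "e < norm t" for t :: complex using norm_ge_zero[of t] by linarith
      then have "\<beta> t = 0" for t using e(2) by (simp add: mollifier_def)
      then have "\<beta> = (\<lambda>t. 0)" by (rule ext)
      then show False using e(2) by (simp add: mollifier_def)
    qed
    show "norm (conv \<beta> (\<lambda>\<zeta>. indicator (cball 0 \<rho>) \<zeta> *\<^sub>R u \<zeta>) z - u z) \<le> \<epsilon>"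
    proof (rule mollify_deviation[OF e(2) integrable_cut[OF c]])
      fix \<zeta> assume z: "norm (\<zeta> - z) \<le> e"
      have "norm \<zeta> \<le> \<rho>" using norm_triangle_sub[of \<zeta> z] z e by linarith
      then show "norm (indicator (cball 0 \<rho>) \<zeta> *\<^sub>R u \<zeta> - u z) \<le> \<epsilon>" using d2[of z \<zeta>] z e e0 by simp
    qed
  qed (rule d2)
qed


section \<open>The Cauchy transform\<close>

definition dzb :: "(complex \<Rightarrow> real) \<Rightarrow> complex \<Rightarrow> complex" where
  "dzb \<psi> z = (of_real (partial_x \<psi> z) + \<i> * of_real (partial_y \<psi> z)) / 2"

text \<open>The equation is read over \<open>lborel\<close> on the whole plane: test functions
  vanish off the disc, and Borel measure is the setting of the translation and Fubini arguments.
  Integrability is supplied separately where a step uses it.\<close>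

definition weak_sol :: "(complex \<Rightarrow> complex) \<Rightarrow> (complex \<Rightarrow> complex) \<Rightarrow> bool" where
  "weak_sol u w \<longleftrightarrow> (\<forall>\<psi>. test_function \<psi> \<longrightarrow>
     (LINT z|lborel. dzb \<psi> z * u z) = - (LINT z|lborel. \<psi> z *\<^sub>R w z))"

lemma test_function_csmooth:
  assumes "test_function \<psi>" obtains \<rho> where "0 < \<rho>" "\<rho> < 1" "csmooth \<rho> \<psi>"
proof -
  obtain K where K: "compact K" "K \<subseteq> unit_disc" "\<And>z. z \<notin> K \<Longrightarrow> \<psi> z = 0" and sm: "smooth \<psi>"
    using assms by (auto simp: test_function_def smooth_def)
  obtain s where s: "0 < s" "s < 1" "\<And>z. z \<in> K \<Longrightarrow> cmod z \<le> s"
  proof (cases "K = {}")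
    case False
    obtain w where w: "w \<in> K" "\<And>z. z \<in> K \<Longrightarrow> cmod z \<le> cmod w"
      using continuous_attains_sup[OF K(1) False, of cmod] by (auto intro: continuous_intros)
    have w1: "cmod w < 1" using w(1) K(2) by auto
    show ?thesis
    proof (rule that[of "(cmod w + 1) / 2"])
      show "(cmod w + 1) / 2 < 1" using w1 by simp
      show "cmod z \<le> (cmod w + 1) / 2" if "z \<in> K" for z using w(2)[OF that] w1 by simp
      show "0 < (cmod w + 1) / 2" by (simp add: add_nonneg_pos)
    qed
  qed (use that[of "1/2"] in auto)
  show ?thesis
    by (rule that[OF s(1,2)]) (use sm K(3) s(3) in \<open>auto simp: csmooth_def not_le[symmetric]\<close>)
qed

lemma csmooth_test_function:
  assumes "csmooth \<rho> \<psi>" "\<rho> < 1" shows "test_function \<psi>"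
  unfolding test_function_def
proof (intro conjI exI)
  show "\<forall>k. C_k k \<psi>" using assms by (simp add: csmooth_def smooth_def)
  show "compact (cball (0::complex) \<rho>)" by simp
  show "cball 0 \<rho> \<subseteq> unit_disc" using assms by auto
  show "\<forall>z. z \<notin> cball 0 \<rho> \<longrightarrow> \<psi> z = 0" using assms by (auto simp: csmooth_def)
qed

lemma csmooth_reflect:
  assumes "csmooth e \<gamma>" "norm z + e \<le> \<rho>" shows "csmooth \<rho> (\<lambda>\<zeta>. \<gamma> (z - \<zeta>))"
  unfolding csmooth_def
proof (intro conjI allI impI)
  show "smooth (\<lambda>\<zeta>. \<gamma> (z - \<zeta>))" using assms by (simp add: csmooth_def smooth_reflect)
  fix \<zeta> :: complex assume "\<rho> < norm \<zeta>"
  then have "e < norm (z - \<zeta>)" using assms(2) norm_triangle_ineq2[of \<zeta> z] by (simp add: norm_minus_commute)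
  then show "\<gamma> (z - \<zeta>) = 0" using assms(1) by (simp add: csmooth_def)
qed

lemma integral_half_add:
  fixes A B :: "'a \<Rightarrow> complex"
  assumes "integrable M A" "integrable M B"
  shows "(LINT x|M. - ((A x + \<i> * B x) / 2)) = - ((integral\<^sup>L M A + \<i> * integral\<^sup>L M B) / 2)"
  using assms by simp

text \<open>The weak equation is tested with the reflected kernel \<gamma>(z - \<zeta>) as a
  function of \<zeta>, admissible because |z| + e \<le> \<rho> < 1. Thus mollification commutes with
  the weak derivative on a smaller disc.\<close>

lemma conv_dbar:
  assumes weak: "weak_sol u w" and g: "csmooth e \<gamma>" and z: "norm z + e \<le> \<rho>" and \<rho>: "\<rho> < 1"
    and int: "integrable lborel (\<lambda>\<zeta>. indicator (cball 0 \<rho>) \<zeta> *\<^sub>R u \<zeta>)" (is "integrable _ ?u")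
  shows "(conv (partial_x \<gamma>) ?u z + \<i> * conv (partial_y \<gamma>) ?u z) / 2
       = conv \<gamma> (\<lambda>\<zeta>. indicator (cball 0 \<rho>) \<zeta> *\<^sub>R w \<zeta>) z"
proof -
  define \<psi> where "\<psi> \<zeta> = \<gamma> (z - \<zeta>)" for \<zeta>
  have cs: "csmooth \<rho> \<psi>" unfolding \<psi>_def by (rule csmooth_reflect[OF g z])
  have sm: "smooth \<gamma>" using g by (simp add: csmooth_def)
  note gx = csmooth_partial(1)[OF g] and gy = csmooth_partial(2)[OF g]
  have p: "partial_x \<psi> \<zeta> = - partial_x \<gamma> (z - \<zeta>)" "partial_y \<psi> \<zeta> = - partial_y \<gamma> (z - \<zeta>)" for \<zeta>
    unfolding \<psi>_def by (rule partial_reflect[OF sm])+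
  have d: "dzb \<psi> \<zeta> * u \<zeta> = - ((partial_x \<gamma> (z - \<zeta>) *\<^sub>R ?u \<zeta> + \<i> * (partial_y \<gamma> (z - \<zeta>) *\<^sub>R ?u \<zeta>)) / 2)" for \<zeta>
  proof (cases "norm \<zeta> \<le> \<rho>")
    case True then show ?thesis by (simp add: dzb_def p scaleR_conv_of_real field_simps)
  next
    case False
    then have "partial_x \<psi> \<zeta> = 0" "partial_y \<psi> \<zeta> = 0"
      using csmooth_partial[OF cs] by (auto simp: csmooth_def)
    then show ?thesis using False by (simp add: dzb_def)
  qed
  have "(LINT \<zeta>|lborel. dzb \<psi> \<zeta> * u \<zeta>) = - ((conv (partial_x \<gamma>) ?u z + \<i> * conv (partial_y \<gamma>) ?u z) / 2)"
    unfolding d conv_def by (rule integral_half_add[OF conv_integrable[OF gx int] conv_integrable[OF gy int]])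
  moreover have "(LINT \<zeta>|lborel. dzb \<psi> \<zeta> * u \<zeta>) = - (LINT \<zeta>|lborel. \<psi> \<zeta> *\<^sub>R w \<zeta>)"
    using weak csmooth_test_function[OF cs \<rho>] by (simp add: weak_sol_def)
  moreover have "\<psi> \<zeta> *\<^sub>R w \<zeta> = \<gamma> (z - \<zeta>) *\<^sub>R (indicator (cball 0 \<rho>) \<zeta> *\<^sub>R w \<zeta>)" for \<zeta>
    using cs by (cases "norm \<zeta> \<le> \<rho>") (auto simp: \<psi>_def csmooth_def)
  ultimately show ?thesis by (simp add: conv_def)
qed

text \<open>A \<open>C\<^sup>1\<close> regularisation of the Cauchy kernel \<open>1/z\<close>, unchanged outside the disc of radius
  \<open>\<surd>p\<close>. Its \<open>\<partial>/\<partial>z\<^sup>*\<close>-derivative is an approximate identity.\<close>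

definition reg_inv :: "real \<Rightarrow> real \<Rightarrow> real" where
  "reg_inv p s = (if s < p then (2 - s / p) / p else 1 / s)"

definition cauchy_reg :: "real \<Rightarrow> complex \<Rightarrow> complex" where
  "cauchy_reg p z = cnj z * of_real (reg_inv p ((norm z)\<^sup>2))"

definition bump_reg :: "real \<Rightarrow> complex \<Rightarrow> real" where
  "bump_reg p z = 2 / p * max 0 (1 - (norm z)\<^sup>2 / p)"

text \<open>Below p the function is the tangent line of 1/s at s = p, so both one-sided derivatives
  there equal -1 / p^2.\<close>

lemma reg_inv_has_derivative:
  assumes p: "0 < p"
  shows "(reg_inv p has_real_derivative - 1 / (max p s)\<^sup>2) (at s)"
proof -
  consider "s < p" | "p < s" | "s = p" by linarith
  then show ?thesis
  proof cases
    case 1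
    have "((\<lambda>s. (2 - s / p) / p) has_real_derivative - 1 / p\<^sup>2) (at s)"
      using p by (auto intro!: derivative_eq_intros simp: power2_eq_square)
    then have "(reg_inv p has_real_derivative - 1 / p\<^sup>2) (at s)"
      by (rule has_field_derivative_transform_within_open[of _ _ _ "{..<p}"]) (use 1 in \<open>auto simp: reg_inv_def\<close>)
    then show ?thesis using 1 by (simp add: max_def)
  next
    case 2
    have "((\<lambda>s. 1 / s) has_real_derivative - 1 / s\<^sup>2) (at s)"
      using p 2 by (auto intro!: derivative_eq_intros simp: power2_eq_square)
    then have "(reg_inv p has_real_derivative - 1 / s\<^sup>2) (at s)"
      by (rule has_field_derivative_transform_within_open[of _ _ _ "{p<..}"]) (use 2 in \<open>auto simp: reg_inv_def\<close>)
    then show ?thesis using 2 by (simp add: max_def)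
  next
    case 3
    have "((\<lambda>h. (reg_inv p (p + h) - reg_inv p p) / h) \<longlongrightarrow> - 1 / p\<^sup>2) (at_right 0)"
    proof -
      have "((\<lambda>h. - 1 / (p * (p + h))) \<longlongrightarrow> - 1 / (p * (p + 0))) (at_right 0)"
        using p by (intro tendsto_intros) auto
      moreover have "eventually (\<lambda>h. - 1 / (p * (p + h)) = (reg_inv p (p + h) - reg_inv p p) / h) (at_right 0)"
      proof (rule eventually_at_rightI[of 0 1])
        fix h :: real assume "h \<in> {0<..<1}"
        then have h: "0 < h" by simp
        have "1 / (p + h) - 1 / p = h * (- 1 / (p * (p + h)))" using p h by (simp add: field_simps)
        then show "- 1 / (p * (p + h)) = (reg_inv p (p + h) - reg_inv p p) / h"
          using p h by (simp add: reg_inv_def)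
      qed simp
      ultimately show ?thesis by (simp add: Lim_transform_eventually power2_eq_square)
    qed
    moreover have "((\<lambda>h. (reg_inv p (p + h) - reg_inv p p) / h) \<longlongrightarrow> - 1 / p\<^sup>2) (at_left 0)"
    proof (rule Lim_transform_eventually[OF tendsto_const])
      show "eventually (\<lambda>h. - 1 / p\<^sup>2 = (reg_inv p (p + h) - reg_inv p p) / h) (at_left 0)"
        by (rule eventually_at_leftI[of "-1"]) (use p in \<open>auto simp: reg_inv_def field_simps power2_eq_square\<close>)
    qed
    ultimately have "((\<lambda>h. (reg_inv p (p + h) - reg_inv p p) / h) \<longlongrightarrow> - 1 / p\<^sup>2) (at 0)"
      by (simp add: filterlim_split_at)
    then show ?thesis using 3 by (simp add: DERIV_def)
  qed
qed

lemma continuous_on_reg_inv: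
  "0 < p \<Longrightarrow> continuous_on S (reg_inv p)"
  using reg_inv_has_derivative by (intro continuous_at_imp_continuous_on) (blast intro: DERIV_isCont)

definition cauchy_reg' :: "real \<Rightarrow> complex \<Rightarrow> complex \<Rightarrow> complex" where
  "cauchy_reg' p z v = cnj v * of_real (reg_inv p ((norm z)\<^sup>2))
     + cnj z * of_real (- 1 / (max p ((norm z)\<^sup>2))\<^sup>2 * (2 * (z \<bullet> v)))"

lemma cauchy_reg_has_derivative:
  assumes p: "0 < p"
  shows "(cauchy_reg p has_derivative cauchy_reg' p z) (at z)"
proof -
  have "((\<lambda>z::complex. (norm z)\<^sup>2) has_derivative (\<lambda>v. 2 * (z \<bullet> v))) (at z)"
    unfolding power2_norm_eq_inner by (auto intro!: derivative_eq_intros simp: inner_commute)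
  from has_derivative_compose[OF this reg_inv_has_derivative[OF p, unfolded has_field_derivative_def]]
  have "((\<lambda>z. reg_inv p ((norm z)\<^sup>2)) has_derivative (\<lambda>v. - 1 / (max p ((norm z)\<^sup>2))\<^sup>2 * (2 * (z \<bullet> v)))) (at z)" .
  from has_derivative_mult[OF has_derivative_cnj[OF has_derivative_ident] has_derivative_of_real[OF this]]
  show ?thesis unfolding cauchy_reg_def[abs_def] cauchy_reg'_def[abs_def] by (simp add: add.commute)
qed

lemma continuous_on_cauchy_reg':
  assumes p: "0 < p" shows "continuous_on S (\<lambda>z. cauchy_reg' p z v)"
proof -
  have "max p ((norm z)\<^sup>2) \<noteq> 0" for z :: complex using p by (auto simp: max_def)
  then show ?thesis unfolding cauchy_reg'_def
    by (intro continuous_intros continuous_on_compose2[OF continuous_on_reg_inv[OF p, of UNIV]]) auto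
qed

text \<open>For a radial profile N(s) with s = |z|^2, the derivative of cnj z N(s) with respect to
  cnj z is N(s) + s N'(s). It vanishes where N(s) = 1/s and equals (2/p) (1 - s/p) on the tangent
  part.\<close>

lemma cauchy_reg'_dbar:
  assumes p: "0 < p"
  shows "(cauchy_reg' p z 1 + \<i> * cauchy_reg' p z \<i>) / 2 = of_real (bump_reg p z)"
proof -
  define s where "s = (norm z)\<^sup>2"
  define m where "m = - 1 / (max p s)\<^sup>2"
  have in1: "z \<bullet> 1 = Re z" "z \<bullet> \<i> = Im z" by (auto simp: inner_complex_def)
  have "cauchy_reg' p z 1 + \<i> * cauchy_reg' p z \<i> = of_real (2 * reg_inv p s) + of_real (2 * m) * (cnj z * (of_real (Re z) + \<i> * of_real (Im z)))"
    unfolding cauchy_reg'_def in1 s_def[symmetric] m_def[symmetric]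
    by (simp add: algebra_simps)
  also have "of_real (Re z) + \<i> * of_real (Im z) = z" by (rule complex_eq[symmetric])
  also have "cnj z * z = of_real s" unfolding s_def by (simp add: complex_norm_square mult.commute flip: of_real_power)
  finally have "(cauchy_reg' p z 1 + \<i> * cauchy_reg' p z \<i>) / 2 = of_real (reg_inv p s + m * s)" by simp
  also have "reg_inv p s + m * s = bump_reg p z"
  proof (cases "s < p")
    case True
    then have "0 \<le> 1 - s / p" using p by simp
    then show ?thesis using p True unfolding bump_reg_def s_def[symmetric]
      by (simp add: reg_inv_def m_def max_def field_simps power2_eq_square)
  next
    case False
    then have "1 - s / p \<le> 0" "s > 0" using p by (auto simp: field_simps)
    then show ?thesis using p False unfolding bump_reg_def s_def[symmetric]
      by (auto simp: reg_inv_def m_def max_def field_simps power2_eq_square)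
  qed
  finally show ?thesis .
qed

lemma continuous_on_cauchy_reg: "0 < p \<Longrightarrow> continuous_on S (cauchy_reg p)"
  unfolding cauchy_reg_def by (intro continuous_intros continuous_on_compose2[OF continuous_on_reg_inv[of p UNIV]]) auto

lemma continuous_on_bump_reg: "continuous_on S (bump_reg p)"
  unfolding bump_reg_def divide_inverse by (intro continuous_intros)

lemma bump_reg_nonneg: "0 < p \<Longrightarrow> 0 \<le> bump_reg p z" by (simp add: bump_reg_def)

lemma bump_reg_support: "0 < p \<Longrightarrow> sqrt p < norm z \<Longrightarrow> bump_reg p z = 0"
proof -
  assume p: "0 < p" "sqrt p < norm z"
  then have "p < (norm z)\<^sup>2" using real_less_rsqrt real_sqrt_less_iff by (metis real_sqrt_pow2 less_imp_le power_strict_mono real_sqrt_ge_zero zero_less_numeral)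
  then show ?thesis using p by (simp add: bump_reg_def field_simps)
qed

lemma cauchy_reg_eq: "sqrt p \<le> norm z \<Longrightarrow> 0 < p \<Longrightarrow> cauchy_reg p z = inverse z"
proof -
  assume z: "sqrt p \<le> norm z" "0 < p"
  then have "p \<le> (norm z)\<^sup>2" using sqrt_le_D by blast
  moreover have "z \<noteq> 0" using z by auto
  ultimately show ?thesis
    by (simp add: cauchy_reg_def reg_inv_def inverse_eq_divide complex_div_cnj[of 1 z])
qed

text \<open>Within radius sqrt p the modulus is at most 2 |z| / p, and there |z|^2 < p. Being
  uniform in p, the bound dominates the passage to the kernel 1/z.\<close>

lemma cauchy_reg_bound: "0 < p \<Longrightarrow> norm (cauchy_reg p z) \<le> 2 * inverse (norm z)"
proof -
  assume p: "0 < p"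
  show ?thesis
  proof (cases "sqrt p \<le> norm z")
    case True
    then show ?thesis using cauchy_reg_eq[OF True p] by (simp add: norm_inverse)
  next
    case False
    then have s: "(norm z)\<^sup>2 < p" using p by (metis not_le real_le_lsqrt norm_ge_zero less_imp_le real_sqrt_le_iff real_sqrt_abs abs_norm_cancel)
    show ?thesis
    proof (cases "z = 0")
      case False
      have "norm (cauchy_reg p z) = norm z * ((2 - (norm z)\<^sup>2 / p) / p)"
      proof -
        have "(norm z)\<^sup>2 / p \<le> 1" using s p by simp
        then have "0 \<le> (2 - (norm z)\<^sup>2 / p) / p" using p by (intro divide_nonneg_pos) linarith+
        then show ?thesis using s
          by (simp only: cauchy_reg_def reg_inv_def norm_mult norm_of_real complex_mod_cnj if_True abs_of_nonneg)
      qed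
      also have "\<dots> \<le> norm z * (2 / (norm z)\<^sup>2)"
      proof (intro mult_left_mono)
        have "(2 - (norm z)\<^sup>2 / p) / p \<le> 2 / p" using p by (intro divide_right_mono) auto
        also have "\<dots> \<le> 2 / (norm z)\<^sup>2" using s False p by (intro divide_left_mono) auto
        finally show "(2 - (norm z)\<^sup>2 / p) / p \<le> 2 / (norm z)\<^sup>2" .
      qed simp
      also have "\<dots> = 2 * inverse (norm z)" using False by (simp add: power2_eq_square field_simps)
      finally show ?thesis .
    qed (simp add: cauchy_reg_def)
  qed
qed

section \<open>The Cauchy-Pompeiu formula\<close>

text \<open>The constant pi of the Cauchy-Pompeiu formula, carried as a symbol; its positivity and
  its independence of p are established below.\<close>

definition pompeiu_const :: real where "pompeiu_const = integral\<^sup>L lborel (bump_reg 1)"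

lemma integrable_bump_reg: "0 < p \<Longrightarrow> integrable lborel (bump_reg p)"
  by (rule integrable_continuous_compact_support[OF continuous_on_bump_reg bump_reg_support])

lemma dbar_integral_zero:
  fixes f :: "complex \<Rightarrow> complex"
  assumes d: "\<And>z. (f has_derivative f' z) (at z)" and c: "\<And>v. continuous_on UNIV (\<lambda>z. f' z v)"
    and s: "\<And>t. R < norm t \<Longrightarrow> f t = 0"
  shows "(LINT z|lborel. (f' z 1 + \<i> * f' z \<i>) / 2) = 0"
proof -
  have "f' z v = 0" if "R < norm z" for z v
    using derivative_zero_outside[OF d s that] by simp
  then have "integrable lborel (\<lambda>z. f' z v)" for v
    by (intro integrable_continuous_compact_support[OF c, of R]) auto
  moreover have "(LINT z|lborel. f' z v) = 0" for v
    by (rule integral_derivative_compact_support[OF d c s])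
  ultimately show ?thesis by simp
qed

text \<open>Two regularizations differ by a compactly supported C^1 function, whose derivatives
  integrate to zero; so the mass does not change with p.\<close>

lemma bump_reg_mass:
  assumes p: "0 < p" shows "integral\<^sup>L lborel (bump_reg p) = pompeiu_const"
proof -
  define f where "f z = cauchy_reg p z - cauchy_reg 1 z" for z
  have "(LINT z|lborel. ((cauchy_reg' p z 1 - cauchy_reg' 1 z 1) + \<i> * (cauchy_reg' p z \<i> - cauchy_reg' 1 z \<i>)) / 2) = 0"
  proof (rule dbar_integral_zero[where f = f and f' = "\<lambda>z v. cauchy_reg' p z v - cauchy_reg' 1 z v" and R = "max (sqrt p) 1"])
    show "(f has_derivative (\<lambda>v. cauchy_reg' p z v - cauchy_reg' 1 z v)) (at z)" for z
      unfolding f_def using p by (intro has_derivative_diff cauchy_reg_has_derivative) auto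
    show "continuous_on UNIV (\<lambda>z. cauchy_reg' p z v - cauchy_reg' 1 z v)" for v
      using p by (intro continuous_intros continuous_on_cauchy_reg') auto
    show "f t = 0" if "max (sqrt p) 1 < norm t" for t
      using that p cauchy_reg_eq[of p t] cauchy_reg_eq[of 1 t] by (simp add: f_def)
  qed
  moreover have "((cauchy_reg' p z 1 - cauchy_reg' 1 z 1) + \<i> * (cauchy_reg' p z \<i> - cauchy_reg' 1 z \<i>)) / 2
      = of_real (bump_reg p z - bump_reg 1 z)" for z
    using cauchy_reg'_dbar[OF p, of z] cauchy_reg'_dbar[of 1 z] by (simp add: field_simps)
  ultimately have "(LINT z|lborel. complex_of_real (bump_reg p z - bump_reg 1 z)) = 0" by simp
  then have "(LINT z|lborel. bump_reg p z - bump_reg 1 z) = 0"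
    by (simp only: integral_complex_of_real of_real_eq_0_iff)
  then show ?thesis using integrable_bump_reg[OF p] integrable_bump_reg[of 1] by (simp add: pompeiu_const_def)
qed

lemma pompeiu_const_pos: "0 < pompeiu_const"
proof -
  have int: "integrable lborel (bump_reg 1)" by (rule integrable_bump_reg) simp
  have "integral\<^sup>L lborel (bump_reg 1) \<noteq> 0"
  proof
    assume "integral\<^sup>L lborel (bump_reg 1) = 0"
    then have "AE t in lborel. bump_reg 1 t = 0"
      using integral_nonneg_eq_0_iff_AE[OF int] bump_reg_nonneg[of 1] by auto
    then have "AE t in lebesgue. t \<notin> {t. bump_reg 1 t \<noteq> 0}" by (simp add: AE_completion)
    moreover have op: "open {t. bump_reg 1 t \<noteq> 0}"
      using continuous_open_preimage[OF continuous_on_bump_reg open_UNIV, of "- {0}"] by (auto simp: vimage_def)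
    ultimately have "negligible {t. bump_reg 1 t \<noteq> 0}"
      by (simp add: negligible_iff_null_sets AE_iff_null_sets)
    moreover have "0 \<in> {t. bump_reg 1 t \<noteq> 0}" by (simp add: bump_reg_def)
    ultimately show False using open_not_negligible[OF op] by blast
  qed
  moreover have "0 \<le> integral\<^sup>L lborel (bump_reg 1)" by (simp add: bump_reg_nonneg)
  ultimately show ?thesis by (simp add: pompeiu_const_def)
qed

lemma csmooth_dzb_continuous:
  assumes "csmooth R \<psi>" shows "continuous_on S (dzb \<psi>)" "\<And>z. R < norm z \<Longrightarrow> dzb \<psi> z = 0"
proof -
  show "continuous_on S (dzb \<psi>)" unfolding dzb_def
    by (intro continuous_intros csmooth_continuous[OF csmooth_partial(1)[OF assms]]
        csmooth_continuous[OF csmooth_partial(2)[OF assms]]) auto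
  show "\<And>z. R < norm z \<Longrightarrow> dzb \<psi> z = 0"
    using csmooth_partial[OF assms] by (simp add: dzb_def csmooth_def)
qed

text \<open>Integration by parts: \<psi> f is compactly supported, so its derivative with respect to
  cnj z has integral zero.\<close>

lemma dzb_product_integral:
  assumes \<psi>: "csmooth R \<psi>" and d: "\<And>z. (f has_derivative f' z) (at z)"
    and c: "\<And>v. continuous_on UNIV (\<lambda>z. f' z v)"
  shows "(LINT z|lborel. dzb \<psi> z * f z) = - (LINT z|lborel. \<psi> z *\<^sub>R ((f' z 1 + \<i> * f' z \<i>) / 2))"
proof -
  have sm: "smooth \<psi>" using \<psi> by (simp add: csmooth_def)
  have contf: "continuous_on UNIV f"
    using d by (intro continuous_at_imp_continuous_on) (auto intro: has_derivative_continuous)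
  let ?g = "\<lambda>z v. \<psi> z *\<^sub>R f' z v + (Re v * partial_x \<psi> z + Im v * partial_y \<psi> z) *\<^sub>R f z"
  have 0: "(LINT z|lborel. (?g z 1 + \<i> * ?g z \<i>) / 2) = 0"
  proof (rule dbar_integral_zero[where f = "\<lambda>z. \<psi> z *\<^sub>R f z" and R = R])
    show "((\<lambda>z. \<psi> z *\<^sub>R f z) has_derivative ?g z) (at z)" for z
      by (rule has_derivative_scaleR[OF smooth_has_derivative[OF sm] d])
    show "continuous_on UNIV (\<lambda>z. ?g z v)" for v
      by (intro continuous_intros c contf csmooth_continuous[OF \<psi>] csmooth_continuous[OF csmooth_partial(1)[OF \<psi>]]
        csmooth_continuous[OF csmooth_partial(2)[OF \<psi>]])
    show "\<psi> t *\<^sub>R f t = 0" if "R < norm t" for t using \<psi> that by (simp add: csmooth_def)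
  qed
  have eq: "(?g z 1 + \<i> * ?g z \<i>) / 2 = dzb \<psi> z * f z + \<psi> z *\<^sub>R ((f' z 1 + \<i> * f' z \<i>) / 2)" for z
    by (simp add: dzb_def scaleR_conv_of_real field_simps)
  have i1: "integrable lborel (\<lambda>z. dzb \<psi> z * f z)"
    by (rule integrable_continuous_compact_support[where R = R])
       (auto intro!: continuous_intros contf csmooth_dzb_continuous[OF \<psi>])
  have i2: "integrable lborel (\<lambda>z. \<psi> z *\<^sub>R ((f' z 1 + \<i> * f' z \<i>) / 2))"
    by (rule integrable_continuous_compact_support[where R = R])
       (use \<psi> in \<open>auto intro!: continuous_intros c csmooth_continuous[OF \<psi>] simp: csmooth_def\<close>)
  show ?thesis using 0 i1 i2 unfolding eq by (simp add: eq_neg_iff_add_eq_0)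
qed

lemma dzb_cauchy_reg_integral:
  assumes p: "0 < p" and \<psi>: "csmooth R \<psi>"
  shows "(LINT z|lborel. dzb \<psi> z * cauchy_reg p (z - \<zeta>)) = - of_real (LINT z|lborel. \<psi> z * bump_reg p (z - \<zeta>))"
proof -
  have "(LINT z|lborel. dzb \<psi> z * cauchy_reg p (z - \<zeta>))
     = - (LINT z|lborel. \<psi> z *\<^sub>R ((cauchy_reg' p (z - \<zeta>) 1 + \<i> * cauchy_reg' p (z - \<zeta>) \<i>) / 2))"
  proof (rule dzb_product_integral[OF \<psi>])
    show "((\<lambda>z. cauchy_reg p (z - \<zeta>)) has_derivative cauchy_reg' p (z - \<zeta>)) (at z)" for z
    proof -
      have "((\<lambda>z. z - \<zeta>) has_derivative (\<lambda>v. v)) (at z)" by (auto intro!: derivative_eq_intros)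
      from has_derivative_compose[OF this cauchy_reg_has_derivative[OF p]] show ?thesis .
    qed
    show "continuous_on UNIV (\<lambda>z. cauchy_reg' p (z - \<zeta>) v)" for v
      by (rule continuous_on_compose2[OF continuous_on_cauchy_reg'[OF p, of UNIV]]) (auto intro!: continuous_intros)
  qed
  also have "\<dots> = - (LINT z|lborel. of_real (\<psi> z * bump_reg p (z - \<zeta>)))"
    unfolding cauchy_reg'_dbar[OF p] by (simp add: scaleR_conv_of_real)
  finally show ?thesis by (simp only: integral_complex_of_real)
qed

text \<open>On the annulus 2^(-k-1) < |t| \<le> 2^(-k) the integrand is at most 2^((k+1) s), and the
  disc has area pi 4^(-k). The resulting geometric series has ratio 2^(s-2) < 1.\<close>

lemma nn_integral_norm_powr_cball:
  assumes s: "0 < s" "s < 2"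
  shows "(\<integral>\<^sup>+t. ennreal (indicator (cball 0 \<rho>) t * norm (t::complex) powr - s) \<partial>lborel) < \<infinity>"
proof -
  let ?r = "\<lambda>k::nat. (1/2::real) ^ k"
  have pw: "ennreal (indicator (cball 0 \<rho>) t * norm t powr - s) \<le>
     indicator (cball 0 \<rho>) t + (\<Sum>k. ennreal (?r (Suc k) powr - s) * indicator (cball 0 (?r k)) t)" for t :: complex
  \<comment> \<open>At t = 0 the power is 0 by the convention for \<open>powr\<close>, and for |t|
    \<ge> 1 it is at most 1; the first indicator covers both.\<close>
  proof (cases "t = 0 \<or> 1 \<le> norm t")
    case True
    then have "norm t powr - s \<le> 1"
      using s by (auto intro: order_trans[OF powr_mono2'[of "-s" 1 "norm t"]])
    then have "ennreal (indicator (cball 0 \<rho>) t * norm t powr - s) \<le> indicator (cball 0 \<rho>) t"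
      by (auto simp: indicator_def intro: ennreal_leI)
    then show ?thesis by (rule order_trans) simp
  next
    case False
    then have t: "0 < norm t" "norm t < 1" by auto
    obtain n where n: "?r n < norm t" using real_arch_pow_inv[OF t(1), of "1/2"] by auto
    \<comment> \<open>The first dyadic radius below |t|; its predecessor k names the annulus
      containing t.\<close>
    define m where "m = (LEAST n. ?r n < norm t)"
    have m: "?r m < norm t" unfolding m_def using n by (rule LeastI)
    then have "m \<noteq> 0" using t by (cases m) auto
    then obtain k where k: "m = Suc k" using not0_implies_Suc by blast
    have "\<not> ?r k < norm t" using not_less_Least[of k "\<lambda>n. ?r n < norm t"] k by (simp add: m_def)
    then have tk: "t \<in> cball 0 (?r k)" by simp
    have "norm t powr - s \<le> ?r (Suc k) powr - s"
      using m k s by (intro powr_mono2') auto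
    then have "ennreal (indicator (cball 0 \<rho>) t * norm t powr - s) \<le> ennreal (?r (Suc k) powr - s) * indicator (cball 0 (?r k)) t"
      using tk by (auto simp: indicator_def intro: ennreal_leI)
    also have "\<dots> \<le> (\<Sum>k. ennreal (?r (Suc k) powr - s) * indicator (cball 0 (?r k)) t)"
    proof -
      define F where "F = (\<lambda>k. ennreal (?r (Suc k) powr - s) * indicator (cball 0 (?r k)) t)"
      have "sum F {k} \<le> suminf F" by (rule sum_le_suminf) auto
      then have "F k \<le> suminf F" by simp
      then show ?thesis unfolding F_def .
    qed
    finally show ?thesis by (rule order_trans) simp
  qed
  have em: "emeasure lborel (cball (0::complex) r) = ennreal (pi * r\<^sup>2)" if "0 \<le> r" for r
    using that by (simp add: emeasure_cball unit_ball_vol_2)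
  have "(\<integral>\<^sup>+t. ennreal (indicator (cball 0 \<rho>) t * norm (t::complex) powr - s) \<partial>lborel)
     \<le> (\<integral>\<^sup>+t. indicator (cball 0 \<rho>) t + (\<Sum>k. ennreal (?r (Suc k) powr - s) * indicator (cball 0 (?r k)) (t::complex)) \<partial>lborel)"
    by (intro nn_integral_mono pw)
  also have "\<dots> = emeasure lborel (cball (0::complex) \<rho>) + (\<Sum>k. ennreal (?r (Suc k) powr - s) * emeasure lborel (cball (0::complex) (?r k)))"
  proof -
    have [measurable]: "cball 0 r \<in> sets (borel :: complex measure)" for r by simp
    have "(\<integral>\<^sup>+t. (\<Sum>k. ennreal (?r (Suc k) powr - s) * indicator (cball 0 (?r k)) (t::complex)) \<partial>lborel)
       = (\<Sum>k. \<integral>\<^sup>+t. ennreal (?r (Suc k) powr - s) * indicator (cball 0 (?r k)) (t::complex) \<partial>lborel)"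
      by (rule nn_integral_suminf) measurable
    also have "\<dots> = (\<Sum>k. ennreal (?r (Suc k) powr - s) * emeasure lborel (cball (0::complex) (?r k)))"
      by (rule suminf_cong, rule nn_integral_cmult_indicator) simp
    finally have eq: "(\<integral>\<^sup>+t. (\<Sum>k. ennreal (?r (Suc k) powr - s) * indicator (cball 0 (?r k)) (t::complex)) \<partial>lborel)
      = (\<Sum>k. ennreal (?r (Suc k) powr - s) * emeasure lborel (cball (0::complex) (?r k)))" .
    define S where "S = (\<lambda>t::complex. \<Sum>k. ennreal (?r (Suc k) powr - s) * indicator (cball 0 (?r k)) t)"
    have [measurable]: "S \<in> borel_measurable lborel"
      unfolding S_def by (rule borel_measurable_suminf_order) measurable
    have "(\<integral>\<^sup>+t. indicator (cball 0 \<rho>) t + S t \<partial>lborel) = (\<integral>\<^sup>+t. indicator (cball 0 \<rho>) (t::complex) \<partial>lborel) + integral\<^sup>N lborel S"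
      by (rule nn_integral_add) measurable
    also have "(\<integral>\<^sup>+t. indicator (cball 0 \<rho>) (t::complex) \<partial>lborel) = emeasure lborel (cball (0::complex) \<rho>)"
      by (rule nn_integral_indicator) simp
    finally show ?thesis unfolding S_def eq .
  qed
  also have "(\<Sum>k. ennreal (?r (Suc k) powr - s) * emeasure lborel (cball (0::complex) (?r k)))
      = (\<Sum>k. ennreal (2 powr s * pi * (2 powr (s - 2)) ^ k))"
  proof (rule suminf_cong)
    fix k
    have "?r (Suc k) powr - s * (pi * (?r k)\<^sup>2) = 2 powr s * pi * (2 powr (s - 2)) ^ k"
    proof -
      have half: "?r n = 2 powr (- real n)" for n
        by (simp add: powr_minus powr_realpow power_one_over inverse_eq_divide)
      have "?r (Suc k) powr - s = 2 powr (s * real (Suc k))"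
        unfolding half powr_powr by (rule arg_cong[where f = "(powr) 2"]) (simp add: algebra_simps)
      moreover have "(?r k)\<^sup>2 = 2 powr (- 2 * real k)"
        by (simp add: half power2_eq_square flip: powr_add)
      moreover have "(2 powr (s - 2)) ^ k = 2 powr ((s - 2) * real k)" by (simp add: powr_powr flip: powr_realpow)
      moreover have "2 powr (s * real (Suc k)) * 2 powr (- 2 * real k) = 2 powr s * 2 powr ((s - 2) * real k)"
        by (simp add: algebra_simps flip: powr_add)
      ultimately show ?thesis by (simp add: mult_ac)
    qed
    then show "ennreal (?r (Suc k) powr - s) * emeasure lborel (cball (0::complex) (?r k)) = ennreal (2 powr s * pi * (2 powr (s - 2)) ^ k)"
      by (subst em) (simp_all flip: ennreal_mult)
  qed
  finally have le: "(\<integral>\<^sup>+t. ennreal (indicator (cball 0 \<rho>) t * norm (t::complex) powr - s) \<partial>lborel)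
     \<le> emeasure lborel (cball (0::complex) \<rho>) + (\<Sum>k. ennreal (2 powr s * pi * (2 powr (s - 2)) ^ k))" .
  have "(\<Sum>k. ennreal (2 powr s * pi * (2 powr (s - 2)) ^ k)) < \<infinity>"
  proof -
    have "(2::real) powr (s - 2) < 2 powr 0" using s by (intro powr_less_mono) auto
    then have "summable (\<lambda>k. 2 powr s * pi * (2 powr (s - 2)) ^ k)"
      by (intro summable_mult summable_geometric) simp
    then show ?thesis by (subst suminf_ennreal2) auto
  qed
  then have "emeasure lborel (cball (0::complex) \<rho>) + (\<Sum>k. ennreal (2 powr s * pi * (2 powr (s - 2)) ^ k)) < \<infinity>"
    using emeasure_lborel_cball_finite[of "0::complex" \<rho>] by (simp add: ennreal_add_less_top)
  then show ?thesis by (rule le_less_trans[OF le])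
qed

lemma integrable_norm_powr_cball:
  assumes s: "0 < s" "s < 2"
  shows "integrable lborel (\<lambda>t::complex. indicator (cball 0 \<rho>) t * norm t powr - s)"
proof (rule integrableI_nonneg)
  have [measurable]: "cball 0 \<rho> \<in> sets (borel :: complex measure)" by simp
  show "(\<lambda>t::complex. indicator (cball 0 \<rho>) t * norm t powr - s) \<in> borel_measurable lborel"
    by measurable
qed (use nn_integral_norm_powr_cball[OF s, of \<rho>] in auto)

lemma integrable_shift:
  fixes f :: "complex \<Rightarrow> 'a::{banach, second_countable_topology}"
  assumes "integrable lborel f" shows "integrable lborel (\<lambda>z. f (z - c))" "integrable lborel (\<lambda>z. f (c - z))"
proof -
  have m: "f \<in> borel_measurable borel" using assms by auto
  have "integrable (distr lborel borel ((+) (-c))) f" using assms by (simp only: lborel_distr_plus)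
  then show "integrable lborel (\<lambda>z. f (z - c))" by (subst (asm) integrable_distr_eq) (use m in auto)
  have "integrable (distr lborel borel (\<lambda>z. c - z)) f" using assms by (simp only: lborel_reflect)
  then show "integrable lborel (\<lambda>z. f (c - z))" by (subst (asm) integrable_distr_eq) (use m in auto)
qed

text \<open>The bump has mass \<open>pompeiu_const\<close> and lives within radius sqrt p = 1 / (n +
  1), which is why p is taken to be a square.\<close>

lemma bump_reg_approximation:
  assumes \<psi>: "csmooth R \<psi>"
  shows "(\<lambda>n. LINT z|lborel. \<psi> z * bump_reg ((1 / (real n + 1))\<^sup>2) (z - \<zeta>)) \<longlonglongrightarrow> pompeiu_const * \<psi> \<zeta>"
proof (rule LIMSEQ_I)
  fix r :: real assume r: "0 < r"
  define \<epsilon> where "\<epsilon> = r / (2 * pompeiu_const)"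
  have \<epsilon>: "0 < \<epsilon>" using r pompeiu_const_pos by (simp add: \<epsilon>_def)
  have "isCont \<psi> \<zeta>" using csmooth_continuous[OF \<psi>, of UNIV] by (simp add: continuous_on_eq_continuous_at)
  then obtain d where d: "0 < d" "\<And>z. dist z \<zeta> < d \<Longrightarrow> dist (\<psi> z) (\<psi> \<zeta>) < \<epsilon>"
    unfolding continuous_at_eps_delta using \<epsilon> by blast
  obtain N where N: "inverse (real (Suc N)) < d" using reals_Archimedean[OF d(1)] by blast
  have "norm ((LINT z|lborel. \<psi> z * bump_reg ((1 / (real n + 1))\<^sup>2) (z - \<zeta>)) - pompeiu_const * \<psi> \<zeta>) < r" if n: "N \<le> n" for n
  proof -
    define p where "p = (1 / (real n + 1))\<^sup>2"
    have p: "0 < p" "sqrt p = 1 / (real n + 1)" by (auto simp: p_def)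
    have "1 / (real n + 1) \<le> 1 / (real N + 1)" using n by (intro divide_left_mono) auto
    then have pd: "sqrt p < d" using N p by (simp add: inverse_eq_divide add.commute)
    have ib: "integrable lborel (\<lambda>z. bump_reg p (z - \<zeta>))" by (intro integrable_shift integrable_bump_reg p)
    have Ib: "(LINT z|lborel. bump_reg p (z - \<zeta>)) = pompeiu_const"
    proof -
      have "bump_reg p \<in> borel_measurable borel" using continuous_on_bump_reg by (rule borel_measurable_continuous_onI)
      from integral_lborel_translate[OF this, of "- \<zeta>"] show ?thesis by (simp add: bump_reg_mass[OF p(1)])
    qed
    have i1: "integrable lborel (\<lambda>z. \<psi> z * bump_reg p (z - \<zeta>))"
    proof (rule integrable_continuous_compact_support[where R = R])
      show "continuous_on UNIV (\<lambda>z. \<psi> z * bump_reg p (z - \<zeta>))"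
        by (intro continuous_intros csmooth_continuous[OF \<psi>] continuous_on_compose2[OF continuous_on_bump_reg[of UNIV]]) auto
    qed (use \<psi> in \<open>simp add: csmooth_def\<close>)
    have "(LINT z|lborel. \<psi> z * bump_reg p (z - \<zeta>)) - pompeiu_const * \<psi> \<zeta>
       = (LINT z|lborel. \<psi> z * bump_reg p (z - \<zeta>)) - (LINT z|lborel. \<psi> \<zeta> * bump_reg p (z - \<zeta>))"
      by (simp add: Ib)
    also have "\<dots> = (LINT z|lborel. \<psi> z * bump_reg p (z - \<zeta>) - \<psi> \<zeta> * bump_reg p (z - \<zeta>))"
      using i1 ib by simp
    also have "norm \<dots> \<le> (LINT z|lborel. \<epsilon> * bump_reg p (z - \<zeta>))"
    proof (rule Bochner_Integration.integral_norm_bound_integral)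
      show "norm (\<psi> z * bump_reg p (z - \<zeta>) - \<psi> \<zeta> * bump_reg p (z - \<zeta>)) \<le> \<epsilon> * bump_reg p (z - \<zeta>)" for z
      proof (cases "norm (z - \<zeta>) \<le> sqrt p")
        case True
        then have "\<bar>\<psi> z - \<psi> \<zeta>\<bar> \<le> \<epsilon>" using d(2)[of z] pd by (simp add: dist_norm)
        from mult_right_mono[OF this bump_reg_nonneg[OF p(1), of "z - \<zeta>"]]
        show ?thesis using bump_reg_nonneg[OF p(1), of "z - \<zeta>"] by (simp add: abs_mult flip: left_diff_distrib)
      next
        case False
        then show ?thesis using bump_reg_support[OF p(1), of "z - \<zeta>"] by simp
      qed
    qed (use i1 ib in auto)
    also have "\<dots> = \<epsilon> * pompeiu_const" by (simp add: Ib)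
    also have "\<dots> < r" using r pompeiu_const_pos by (simp add: \<epsilon>_def)
    finally show ?thesis by (simp add: p_def)
  qed
  then show "\<exists>no. \<forall>n\<ge>no. norm ((LINT z|lborel. \<psi> z * bump_reg ((1 / (real n + 1))\<^sup>2) (z - \<zeta>)) - pompeiu_const * \<psi> \<zeta>) < r" by blast
qed

lemma integrable_dzb_inverse:
  assumes \<psi>: "csmooth R \<psi>"
  shows "integrable lborel (\<lambda>z. norm (dzb \<psi> z) * (2 * inverse (norm (z - \<zeta>))))"
proof -
  obtain B where B: "0 < B" "\<And>z. norm (dzb \<psi> z) \<le> B"
    using bounded_of_compact_support[OF csmooth_dzb_continuous[OF \<psi>]] by blast
  have [measurable]: "dzb \<psi> \<in> borel_measurable borel"
    using csmooth_dzb_continuous(1)[OF \<psi>] by (rule borel_measurable_continuous_onI)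
  have "integrable lborel (\<lambda>z. (2 * B) * (indicator (cball 0 (R + norm \<zeta>)) (z - \<zeta>) * norm (z - \<zeta>) powr - 1))"
    by (intro integrable_mult_right integrable_shift integrable_norm_powr_cball) auto
  then show ?thesis
  proof (rule Bochner_Integration.integrable_bound)
    show "AE z in lborel. norm (norm (dzb \<psi> z) * (2 * inverse (norm (z - \<zeta>)))) \<le>
       norm ((2 * B) * (indicator (cball 0 (R + norm \<zeta>)) (z - \<zeta>) * norm (z - \<zeta>) powr - 1))"
    proof (rule AE_I2)
      fix z
      show "norm (norm (dzb \<psi> z) * (2 * inverse (norm (z - \<zeta>)))) \<le>
       norm ((2 * B) * (indicator (cball 0 (R + norm \<zeta>)) (z - \<zeta>) * norm (z - \<zeta>) powr - 1))"
      proof (cases "norm z \<le> R \<and> z \<noteq> \<zeta>")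
        case True
        then have "z - \<zeta> \<in> cball 0 (R + norm \<zeta>)" using norm_triangle_ineq4[of z \<zeta>] by simp
        moreover have "norm (z - \<zeta>) powr - 1 = inverse (norm (z - \<zeta>))" using True by (simp add: powr_minus)
        ultimately show ?thesis using mult_right_mono[OF B(2)[of z], of "2 * inverse (norm (z - \<zeta>))"] B(1)
          by (simp add: abs_mult)
      next
        case False
        then show ?thesis using csmooth_dzb_continuous(2)[OF \<psi>, of z] by auto
      qed
    qed
  qed measurable
qed

text \<open>Integration by parts against the regularized kernel leaves an approximate identity. As
  the regularization shrinks, one side becomes the Cauchy kernel and the other evaluation at
  \<zeta>.\<close>

lemma pompeiu:
  assumes \<psi>: "csmooth R \<psi>"
  shows "(LINT z|lborel. dzb \<psi> z * inverse (z - \<zeta>)) = - of_real (pompeiu_const * \<psi> \<zeta>)"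
proof -
  define p where "p n = (1 / (real n + 1))\<^sup>2" for n
  have p: "0 < p n" "sqrt (p n) = 1 / (real n + 1)" for n by (auto simp: p_def)
  have [measurable]: "dzb \<psi> \<in> borel_measurable borel"
    using csmooth_dzb_continuous(1)[OF \<psi>] by (rule borel_measurable_continuous_onI)
  have [measurable]: "cauchy_reg (p n) \<in> borel_measurable borel" for n
    by (rule borel_measurable_continuous_onI[OF continuous_on_cauchy_reg[OF p(1)]])
  have "(\<lambda>n. LINT z|lborel. dzb \<psi> z * cauchy_reg (p n) (z - \<zeta>)) \<longlonglongrightarrow> (LINT z|lborel. dzb \<psi> z * inverse (z - \<zeta>))"
  proof (rule integral_dominated_convergence[where w = "\<lambda>z. norm (dzb \<psi> z) * (2 * inverse (norm (z - \<zeta>)))"])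
    show "AE z in lborel. (\<lambda>n. dzb \<psi> z * cauchy_reg (p n) (z - \<zeta>)) \<longlonglongrightarrow> dzb \<psi> z * inverse (z - \<zeta>)"
    proof (rule AE_I2)
      fix z
      have "(\<lambda>n. cauchy_reg (p n) (z - \<zeta>)) \<longlonglongrightarrow> inverse (z - \<zeta>)"
      proof (cases "z = \<zeta>")
        \<comment> \<open>Both kernels are 0 at the origin, the unregularized one because
          \<open>inverse 0 = 0\<close>.\<close>
        case True then show ?thesis by (simp add: cauchy_reg_def)
      next
        case False
        then obtain N where N: "inverse (real (Suc N)) < norm (z - \<zeta>)"
          using reals_Archimedean[of "norm (z - \<zeta>)"] by auto
        have "cauchy_reg (p n) (z - \<zeta>) = inverse (z - \<zeta>)" if "N \<le> n" for n
        proof -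
          have "1 / (real n + 1) \<le> 1 / (real N + 1)" using that by (intro divide_left_mono) auto
          then have "sqrt (p n) \<le> norm (z - \<zeta>)" using N p(2)[of n] by (simp add: inverse_eq_divide add.commute)
          then show ?thesis using p(1) by (rule cauchy_reg_eq)
        qed
        then show ?thesis by (intro tendsto_eventually eventually_sequentiallyI[of N])
      qed
      then show "(\<lambda>n. dzb \<psi> z * cauchy_reg (p n) (z - \<zeta>)) \<longlonglongrightarrow> dzb \<psi> z * inverse (z - \<zeta>)"
        by (intro tendsto_intros)
    qed
    show "AE z in lborel. norm (dzb \<psi> z * cauchy_reg (p n) (z - \<zeta>)) \<le> norm (dzb \<psi> z) * (2 * inverse (norm (z - \<zeta>)))" for n
      using cauchy_reg_bound[OF p(1)] by (intro AE_I2) (simp add: norm_mult mult_left_mono)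
  qed (use integrable_dzb_inverse[OF \<psi>] in measurable)
  moreover have "(\<lambda>n. LINT z|lborel. dzb \<psi> z * cauchy_reg (p n) (z - \<zeta>)) \<longlonglongrightarrow> - of_real (pompeiu_const * \<psi> \<zeta>)"
    unfolding dzb_cauchy_reg_integral[OF p(1) \<psi>] unfolding p_def
    by (intro tendsto_minus tendsto_of_real bump_reg_approximation[OF \<psi>])
  ultimately show ?thesis by (rule LIMSEQ_unique)
qed

section \<open>The Cauchy transform of an \<open>L^q\<close> coefficient\<close>

text \<open>Young's inequality without the factors 1/q and 1/q': comparing y with x^(q-1) tells
  which of the two powers alone majorizes x y.\<close>

lemma young_powr:
  fixes x y q :: real
  assumes x: "0 \<le> x" and y: "0 \<le> y" and q: "1 < q"
  shows "x * y \<le> x powr q + y powr (q / (q - 1))"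
proof (cases "x = 0 \<or> y = 0")
  case False
  then have xy: "0 < x" "0 < y" using x y by auto
  show ?thesis
  proof (cases "y \<le> x powr (q - 1)")
    case True
    then have "x * y \<le> x * x powr (q - 1)" using x by (rule mult_left_mono)
    also have "\<dots> = x powr q" using xy by (simp add: powr_mult_base)
    finally show ?thesis by (simp add: add_increasing2)
  next
    case False
    then have "(x powr (q - 1)) powr (1 / (q - 1)) \<le> y powr (1 / (q - 1))"
      using q by (intro powr_mono2) auto
    then have "x \<le> y powr (1 / (q - 1))" using q xy by (simp add: powr_powr)
    then have "x * y \<le> y powr (1 / (q - 1)) * y" using y by (rule mult_right_mono)
    also have "\<dots> = y powr (1 + 1 / (q - 1))" using xy by (simp add: powr_mult_base mult.commute)
    also have "1 + 1 / (q - 1) = q / (q - 1)" using q by (simp add: field_simps)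
    finally show ?thesis by (simp add: add_increasing)
  qed
qed auto

text \<open>A coefficient on the disc is measurable only for the completed measure. Here a stands
  for a Borel representative extended by 0, so that the kernel is Borel on the product
  space.\<close>

locale cauchy_transform =
  fixes a :: "complex \<Rightarrow> complex" and q :: real
  assumes q: "2 < q" and meas[measurable]: "a \<in> borel_measurable borel"
    and supp: "\<And>z. z \<notin> unit_disc \<Longrightarrow> a z = 0"
    and Lq: "integrable lborel (\<lambda>z. norm (a z) powr q)"
begin

definition q' where "q' = q / (q - 1)"

text \<open>For q > 1 the inequality q' < 2 is equivalent to q > 2; it is what makes |t|^(-q')
  locally integrable in the plane.\<close>

lemma q': "0 < q'" "q' < 2" "1 < q"
  using q by (auto simp: q'_def field_simps)

lemma a_integrable: "integrable lborel a"
proof (rule Bochner_Integration.integrable_bound)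
  show "integrable lborel (\<lambda>z. norm (a z) powr q + indicator (cball 0 1) z)"
    using Lq by (intro Bochner_Integration.integrable_add integrable_real_indicator)
      (auto simp: emeasure_lborel_cball_finite[simplified])
  show "AE z in lborel. norm (a z) \<le> norm (norm (a z) powr q + indicator (cball 0 1) z)"
  proof (rule AE_I2)
    fix z show "norm (a z) \<le> norm (norm (a z) powr q + indicator (cball 0 1) z)"
      using young_powr[of "norm (a z)" 1 q] q' supp[of z] by (cases "norm z < 1") auto
  qed
qed simp

text \<open>The weight l makes the \<open>L^q\<close> term small at the price of a larger kernel
  term, which is afterwards reduced by shrinking the disc of integration.\<close>

lemma scaled_young:
  assumes "0 < l" and that: "0 \<le> k"
  shows "norm (a \<zeta>) * k \<le> l powr q * norm (a \<zeta>) powr q + l powr - q' * k powr q'"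
proof -
  have "norm (a \<zeta>) * k = (l * norm (a \<zeta>)) * (k / l)" using assms by simp
  also have "\<dots> \<le> (l * norm (a \<zeta>)) powr q + (k / l) powr q'"
    unfolding q'_def using assms that q' by (intro young_powr) auto
  also have "\<dots> = l powr q * norm (a \<zeta>) powr q + l powr - q' * k powr q'"
    using assms that by (simp add: powr_mult powr_minus divide_inverse inverse_powr mult.commute)
  finally show ?thesis .
qed

lemma dominated:
  assumes "norm z \<le> \<rho>"
  shows "norm (a \<zeta>) * inverse (norm (z - \<zeta>)) \<le> norm (a \<zeta>) powr q + indicator (cball 0 (\<rho> + 1)) (z - \<zeta>) * norm (z - \<zeta>) powr - q'"
proof (cases "norm \<zeta> < 1")
  case True
  have "norm (a \<zeta>) * inverse (norm (z - \<zeta>)) \<le> norm (a \<zeta>) powr q + inverse (norm (z - \<zeta>)) powr q'"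
    using scaled_young[of 1 "inverse (norm (z - \<zeta>))" \<zeta>] by simp
  moreover have "inverse (norm (z - \<zeta>)) powr q' = norm (z - \<zeta>) powr - q'" 
    by (simp add: powr_minus inverse_powr)
  moreover have "norm (z - \<zeta>) \<le> \<rho> + 1" using norm_triangle_ineq4[of z \<zeta>] True assms by simp
  ultimately show ?thesis by simp
qed (use supp in auto)

lemma dominating_integrable:
  "integrable lborel (\<lambda>\<zeta>. norm (a \<zeta>) powr q + indicator (cball 0 \<rho>) (z - \<zeta>) * norm (z - \<zeta>) powr - q')"
  using Lq q' by (intro Bochner_Integration.integrable_add integrable_shift(2) integrable_norm_powr_cball) auto

definition T :: "complex \<Rightarrow> complex" where
  "T z = (LINT \<zeta>|lborel. a \<zeta> * inverse (z - \<zeta>))"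

definition Tr :: "real \<Rightarrow> complex \<Rightarrow> complex" where
  "Tr p z = (LINT \<zeta>|lborel. a \<zeta> * cauchy_reg p (z - \<zeta>))"

lemma abs_kernel_integrable: "integrable lborel (\<lambda>\<zeta>. norm (a \<zeta>) * inverse (norm (z - \<zeta>)))"
  by (rule Bochner_Integration.integrable_bound[OF dominating_integrable[of "norm z + 1" z]])
     (use dominated[of z "norm z"] in \<open>auto intro!: AE_I2 order_trans[OF _ abs_ge_self]\<close>)

lemma kernel_integrable: "integrable lborel (\<lambda>\<zeta>. a \<zeta> * inverse (z - \<zeta>))"
  by (rule Bochner_Integration.integrable_bound[OF abs_kernel_integrable[of z]])
     (auto simp: norm_mult norm_inverse)

lemma cauchy_reg_measurable: "0 < p \<Longrightarrow> cauchy_reg p \<in> borel_measurable borel"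
  by (rule borel_measurable_continuous_onI[OF continuous_on_cauchy_reg])

lemma kernel_reg_integrable:
  assumes p: "0 < p" shows "integrable lborel (\<lambda>\<zeta>. a \<zeta> * cauchy_reg p (z - \<zeta>))"
proof (rule Bochner_Integration.integrable_bound)
  note cauchy_reg_measurable[OF p, measurable]
  show "integrable lborel (\<lambda>\<zeta>. 2 * (norm (a \<zeta>) * inverse (norm (z - \<zeta>))))"
    by (intro integrable_mult_right abs_kernel_integrable)
  show "(\<lambda>\<zeta>. a \<zeta> * cauchy_reg p (z - \<zeta>)) \<in> borel_measurable lborel" by measurable
  show "AE \<zeta> in lborel. norm (a \<zeta> * cauchy_reg p (z - \<zeta>)) \<le> norm (2 * (norm (a \<zeta>) * inverse (norm (z - \<zeta>))))"
  proof (rule AE_I2)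
    fix \<zeta>
    show "norm (a \<zeta> * cauchy_reg p (z - \<zeta>)) \<le> norm (2 * (norm (a \<zeta>) * inverse (norm (z - \<zeta>))))"
      using mult_left_mono[OF cauchy_reg_bound[OF p, of "z - \<zeta>"], of "norm (a \<zeta>)"]
      by (simp add: norm_mult abs_mult mult_ac)
  qed
qed

lemma Tr_continuous:
  assumes p: "0 < p" shows "continuous_on UNIV (Tr p)"
proof -
  note cauchy_reg_measurable[OF p, measurable]
  \<comment> \<open>The summands are the bounds outside and inside radius sqrt p. A bounded
    continuous kernel leaves a multiple of |a| as integrable majorant.\<close>
  have bd: "norm (cauchy_reg p t) \<le> 2 * inverse (sqrt p) + 2 * sqrt p * inverse p" for t
  proof (cases "sqrt p \<le> norm t")
    case True
    have "norm (cauchy_reg p t) \<le> 2 * inverse (norm t)" by (rule cauchy_reg_bound[OF p])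
    also have "\<dots> \<le> 2 * inverse (sqrt p)" using True p by (intro mult_left_mono le_imp_inverse_le) auto
    finally show ?thesis using p by (simp add: add_increasing2)
  next
    case False
    have "(norm t)\<^sup>2 < (sqrt p)\<^sup>2" using False by (intro power_strict_mono) auto
    then have s: "(norm t)\<^sup>2 < p" using p by simp
    have "reg_inv p ((norm t)\<^sup>2) = (2 - (norm t)\<^sup>2 / p) / p" using s by (simp add: reg_inv_def)
    moreover have "0 \<le> (2 - (norm t)\<^sup>2 / p) / p"
    proof -
      have "(norm t)\<^sup>2 / p \<le> 1" using s p by simp
      then show ?thesis using p by (intro divide_nonneg_pos) linarith+
    qed
    moreover have "(2 - (norm t)\<^sup>2 / p) / p \<le> 2 * inverse p" using p by (simp add: divide_inverse mult_right_mono)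
    ultimately have "\<bar>reg_inv p ((norm t)\<^sup>2)\<bar> \<le> 2 * inverse p" by simp
    then have "norm t * \<bar>reg_inv p ((norm t)\<^sup>2)\<bar> \<le> sqrt p * (2 * inverse p)"
      using False p by (intro mult_mono) auto
    then have "norm (cauchy_reg p t) \<le> 2 * sqrt p * inverse p"
      by (simp add: cauchy_reg_def norm_mult mult_ac)
    then show ?thesis using p by (simp add: add_increasing)
  qed
  show ?thesis
  proof (intro continuous_at_imp_continuous_on ballI)
    fix z
    show "isCont (Tr p) z"
      unfolding continuous_at_sequentially
    proof (intro allI impI)
      fix x :: "nat \<Rightarrow> complex" assume x: "x \<longlonglongrightarrow> z"
      show "(Tr p \<circ> x) \<longlonglongrightarrow> Tr p z"
        unfolding Tr_def comp_def
      proof (rule integral_dominated_convergence[where w = "\<lambda>\<zeta>. norm (a \<zeta>) * (2 * inverse (sqrt p) + 2 * sqrt p * inverse p)"])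
        show "integrable lborel (\<lambda>\<zeta>. norm (a \<zeta>) * (2 * inverse (sqrt p) + 2 * sqrt p * inverse p))"
          using a_integrable by (intro integrable_mult_left integrable_norm)
        show "AE \<zeta> in lborel. (\<lambda>n. a \<zeta> * cauchy_reg p (x n - \<zeta>)) \<longlonglongrightarrow> a \<zeta> * cauchy_reg p (z - \<zeta>)"
        proof (rule AE_I2)
          fix \<zeta>
          have "isCont (cauchy_reg p) (z - \<zeta>)"
            using continuous_on_cauchy_reg[OF p, of UNIV] by (simp add: continuous_on_eq_continuous_at)
          moreover have "(\<lambda>n. x n - \<zeta>) \<longlonglongrightarrow> z - \<zeta>" by (intro tendsto_intros x)
          ultimately show "(\<lambda>n. a \<zeta> * cauchy_reg p (x n - \<zeta>)) \<longlonglongrightarrow> a \<zeta> * cauchy_reg p (z - \<zeta>)"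
            by (intro tendsto_mult tendsto_const) (rule isCont_tendsto_compose)
        qed
        show "AE \<zeta> in lborel. norm (a \<zeta> * cauchy_reg p (x n - \<zeta>)) \<le> norm (a \<zeta>) * (2 * inverse (sqrt p) + 2 * sqrt p * inverse p)" for n
          using bd by (intro AE_I2) (simp add: norm_mult mult_left_mono)
      qed measurable
    qed
  qed
qed

text \<open>The kernels agree for |z - \<zeta>| \<ge> sqrt p and differ by at most 3 / |z - \<zeta>|
  otherwise. After \<open>scaled_young\<close> the kernel term depends on z only through a
  translation, so the error is uniform in z and T inherits continuity from the
  \<open>Tr p\<close>.\<close>

lemma T_approx:
  assumes \<epsilon>: "0 < \<epsilon>" shows "\<exists>p>0. \<forall>z. norm (Tr p z - T z) \<le> \<epsilon>"
proof -
  define A where "A = (LINT \<zeta>|lborel. norm (a \<zeta>) powr q)"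
  have A: "0 \<le> A" unfolding A_def by simp
  \<comment> \<open>Solves l^q = \<epsilon> / (2 (A + 1)); adding 1 avoids division by zero.\<close>
  define l where "l = (\<epsilon> / (2 * (A + 1))) powr (1 / q)"
  have l: "0 < l" using A \<epsilon> by (simp add: l_def)
  have lq: "l powr q * A \<le> \<epsilon> / 2"
  proof -
    have "l powr q = \<epsilon> / (2 * (A + 1))" using A \<epsilon> q by (simp add: l_def powr_powr)
    moreover have "\<epsilon> / (2 * (A + 1)) * A \<le> \<epsilon> / 2 * 1"
      using A \<epsilon> by (simp add: divide_le_eq field_simps)
    ultimately show ?thesis by simp
  qed
  define g where "g n t = indicator (cball 0 (1 / (real n + 1))) t * norm t powr - q'" for n and t :: complex
  have g_int: "integrable lborel (g n)" for n unfolding g_def using q' by (intro integrable_norm_powr_cball) auto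
  \<comment> \<open>The mass of |t|^(-q') on shrinking discs tends to 0. The index n is chosen only
    after l is fixed.\<close>
  have "(\<lambda>n. integral\<^sup>L lborel (g n)) \<longlonglongrightarrow> (LINT (t::complex)|lborel. 0)"
  proof (rule integral_dominated_convergence[where w = "g 0"])
    show "AE t in lborel. (\<lambda>n. g n t) \<longlonglongrightarrow> 0"
    proof (rule AE_I2)
      fix t :: complex
      show "(\<lambda>n. g n t) \<longlonglongrightarrow> 0"
      proof (cases "t = 0")
        case False
        then obtain N where N: "inverse (real (Suc N)) < norm t" using reals_Archimedean[of "norm t"] by auto
        have "g n t = 0" if "N \<le> n" for n
        proof -
          have "1 / (real n + 1) \<le> 1 / (real N + 1)" using that by (intro divide_left_mono) auto
          then have "1 / (real n + 1) < norm t" using N by (simp add: inverse_eq_divide add.commute)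
          then show ?thesis by (simp add: g_def)
        qed
        then show ?thesis by (intro tendsto_eventually eventually_sequentiallyI[of N])
      qed (simp add: g_def)
    qed
    show "AE t in lborel. norm (g n t) \<le> g 0 t" for n
    proof (rule AE_I2)
      fix t :: complex
      have "norm t \<le> 1" if "norm t \<le> 1 / (real n + 1)"
        using that by (rule order_trans) simp
      then show "norm (g n t) \<le> g 0 t" by (auto simp: g_def indicator_def)
    qed
  qed (use g_int in \<open>auto\<close>)
  then have "(\<lambda>n. l powr - q' * 3 powr q' * integral\<^sup>L lborel (g n)) \<longlonglongrightarrow> l powr - q' * 3 powr q' * 0"
    by (intro tendsto_mult tendsto_const) simp
  then have "eventually (\<lambda>n. l powr - q' * 3 powr q' * integral\<^sup>L lborel (g n) < \<epsilon> / 2) sequentially"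
    by (rule order_tendstoD(2)) (use \<epsilon> in simp)
  then obtain n where n: "l powr - q' * 3 powr q' * integral\<^sup>L lborel (g n) < \<epsilon> / 2"
    by (auto simp: eventually_sequentially)
  define p where "p = (1 / (real n + 1))\<^sup>2"
  have p: "0 < p" "sqrt p = 1 / (real n + 1)" by (auto simp: p_def)
  have "norm (Tr p z - T z) \<le> \<epsilon>" for z
  proof -
    have "Tr p z - T z = (LINT \<zeta>|lborel. a \<zeta> * cauchy_reg p (z - \<zeta>) - a \<zeta> * inverse (z - \<zeta>))"
      unfolding Tr_def T_def using kernel_integrable[of z] kernel_reg_integrable[OF p(1), of z] by simp
    also have "norm \<dots> \<le> (LINT \<zeta>|lborel. l powr q * norm (a \<zeta>) powr q + l powr - q' * 3 powr q' * g n (z - \<zeta>))"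
    proof (rule Bochner_Integration.integral_norm_bound_integral)
      show "integrable lborel (\<lambda>\<zeta>. l powr q * norm (a \<zeta>) powr q + l powr - q' * 3 powr q' * g n (z - \<zeta>))"
        using Lq integrable_shift(2)[OF g_int[of n], of z] by simp
      fix \<zeta>
      show "norm (a \<zeta> * cauchy_reg p (z - \<zeta>) - a \<zeta> * inverse (z - \<zeta>)) \<le> l powr q * norm (a \<zeta>) powr q + l powr - q' * 3 powr q' * g n (z - \<zeta>)"
      proof (cases "sqrt p \<le> norm (z - \<zeta>)")
        case True
        then show ?thesis using cauchy_reg_eq[OF True p(1)] by (simp add: g_def)
      next
        case False
        define t where "t = z - \<zeta>"
        have "norm (a \<zeta> * cauchy_reg p t - a \<zeta> * inverse t) = norm (a \<zeta>) * norm (cauchy_reg p t - inverse t)"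
          by (simp add: norm_mult flip: right_diff_distrib)
        also have "\<dots> \<le> norm (a \<zeta>) * (3 * inverse (norm t))"
        proof (intro mult_left_mono)
          show "norm (cauchy_reg p t - inverse t) \<le> 3 * inverse (norm t)"
            using norm_triangle_ineq4[of "cauchy_reg p t" "inverse t"] cauchy_reg_bound[OF p(1), of t]
            by (simp add: norm_inverse)
        qed simp
        also have "\<dots> \<le> l powr q * norm (a \<zeta>) powr q + l powr - q' * (3 * inverse (norm t)) powr q'"
          using l by (intro scaled_young) auto
        also have "(3 * inverse (norm t)) powr q' = 3 powr q' * norm t powr - q'"
          by (simp add: powr_mult powr_minus inverse_powr)
        also have "l powr - q' * (3 powr q' * norm t powr - q') = l powr - q' * 3 powr q' * g n t"
          using False p(2) by (simp add: g_def t_def)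
        finally show ?thesis by (simp add: t_def)
      qed
    qed (use kernel_integrable[of z] kernel_reg_integrable[OF p(1), of z] in simp)
    also have "\<dots> = l powr q * A + l powr - q' * 3 powr q' * (LINT \<zeta>|lborel. g n (z - \<zeta>))"
      unfolding A_def using Lq integrable_shift(2)[OF g_int[of n], of z] by simp
    also have "(LINT \<zeta>|lborel. g n (z - \<zeta>)) = integral\<^sup>L lborel (g n)"
      using g_int[of n] by (intro integral_lborel_reflect) auto
    finally show ?thesis using lq n by linarith
  qed
  then show ?thesis using p(1) by blast
qed

lemma T_continuous: "continuous_on S T"
proof -
  have "\<forall>n::nat. \<exists>p>0. \<forall>z. norm (Tr p z - T z) \<le> 1 / (real n + 1)" using T_approx by simp
  then obtain p where p: "\<And>n. 0 < p n" "\<And>n z. norm (Tr (p n) z - T z) \<le> 1 / (real n + 1)"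
    by (auto dest!: choice)
  have "uniform_limit UNIV (\<lambda>n. Tr (p n)) T sequentially"
  proof (rule uniform_limitI)
    fix e :: real assume "0 < e"
    then obtain N where N: "inverse (real (Suc N)) < e" using reals_Archimedean by blast
    have "dist (Tr (p n) z) (T z) < e" if "N \<le> n" for n z
    proof -
      have "1 / (real n + 1) \<le> 1 / (real N + 1)" using that by (intro divide_left_mono) auto
      then show ?thesis using N p(2)[of n z] by (simp add: dist_norm inverse_eq_divide add.commute)
    qed
    then show "eventually (\<lambda>n. \<forall>z\<in>UNIV. dist (Tr (p n) z) (T z) < e) sequentially"
      by (intro eventually_sequentiallyI[of N]) auto
  qed
  then have "continuous_on UNIV T"
    by (rule uniform_limit_theorem[rotated]) (use Tr_continuous[OF p(1)] in \<open>auto intro: always_eventually\<close>)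
  then show ?thesis by (rule continuous_on_subset) simp
qed

lemma AE_bound:
  fixes g h :: "complex \<Rightarrow> real"
  assumes "\<And>z. g z \<le> h z" "integrable lborel h" "g \<in> borel_measurable lborel" "\<And>z. 0 \<le> g z"
  shows "integrable lborel g"
proof (rule Bochner_Integration.integrable_bound[OF assms(2,3)])
  show "AE z in lborel. norm (g z) \<le> norm (h z)"
    using assms(4) order_trans[OF assms(1) abs_ge_self] by (intro AE_I2) simp
qed

text \<open>Fubini moves the test function onto the kernel, where \<open>pompeiu\<close> evaluates
  it. Integrability on the product comes from a bound on the inner integral that is uniform for z in
  the support of \<psi>.\<close>

lemma T_weak: "weak_sol (\<lambda>z. T z / of_real pompeiu_const) a"
  unfolding weak_sol_def
proof (intro allI impI)
  fix \<psi> assume "test_function \<psi>"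
  then obtain R where R: "0 < R" "R < 1" and \<psi>: "csmooth R \<psi>" by (rule test_function_csmooth)
  obtain B where B: "0 < B" "\<And>z. norm (dzb \<psi> z) \<le> B"
    using bounded_of_compact_support[OF csmooth_dzb_continuous[OF \<psi>]] by blast
  have [measurable]: "dzb \<psi> \<in> borel_measurable borel"
    using csmooth_dzb_continuous(1)[OF \<psi>] by (rule borel_measurable_continuous_onI)
  let ?f = "\<lambda>z \<zeta>. dzb \<psi> z * (a \<zeta> * inverse (z - \<zeta>))"
  have I: "integrable (lborel \<Otimes>\<^sub>M lborel) (case_prod ?f)"
  proof (rule lborel_pair.Fubini_integrable)
    show "case_prod ?f \<in> borel_measurable (lborel \<Otimes>\<^sub>M lborel)" by measurable
    show "AE z in lborel. integrable lborel (\<lambda>\<zeta>. case_prod ?f (z, \<zeta>))"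
      using kernel_integrable by (intro AE_I2) simp
    \<comment> \<open>B times the integrated majorant of \<open>dominated\<close> with \<rho> = 1;
      translation invariance removes the dependence on z.\<close>
    define C where "C = B * (LINT \<zeta>|lborel. norm (a \<zeta>) powr q) + B * (LINT (t::complex)|lborel. indicator (cball 0 2) t * norm t powr - q')"
    have "(LINT \<zeta>|lborel. norm (case_prod ?f (z, \<zeta>))) \<le> indicator (cball 0 1) z * C" for z
    proof (cases "norm z \<le> R")
      case True
      then have z: "norm z \<le> 1" using R by simp
      have "(LINT \<zeta>|lborel. norm (case_prod ?f (z, \<zeta>))) \<le>
        (LINT \<zeta>|lborel. B * (norm (a \<zeta>) powr q + indicator (cball 0 2) (z - \<zeta>) * norm (z - \<zeta>) powr - q'))"
      proof (rule integral_mono)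
        show "integrable lborel (\<lambda>\<zeta>. norm (case_prod ?f (z, \<zeta>)))" using kernel_integrable[of z] by simp
        show "integrable lborel (\<lambda>\<zeta>. B * (norm (a \<zeta>) powr q + indicator (cball 0 2) (z - \<zeta>) * norm (z - \<zeta>) powr - q'))"
          using dominating_integrable[of 2 z] by simp
        show "norm (case_prod ?f (z, \<zeta>)) \<le> B * (norm (a \<zeta>) powr q + indicator (cball 0 2) (z - \<zeta>) * norm (z - \<zeta>) powr - q')" for \<zeta>
          using mult_mono[OF B(2)[of z] dominated[OF z, of \<zeta>]] B(1) by (simp add: norm_mult norm_inverse)
      qed
      also have "\<dots> = B * ((LINT \<zeta>|lborel. norm (a \<zeta>) powr q) + (LINT \<zeta>|lborel. indicator (cball 0 2) (z - \<zeta>) * norm (z - \<zeta>) powr - q'))"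
        using Lq integrable_shift(2)[OF integrable_norm_powr_cball[of q' 2], of z] q' by simp
      also have "(LINT \<zeta>|lborel. indicator (cball 0 2) (z - \<zeta>) * norm (z - \<zeta>) powr - q') = (LINT (t::complex)|lborel. indicator (cball 0 2) t * norm t powr - q')"
      proof (rule integral_lborel_reflect)
        show "(\<lambda>t::complex. indicator (cball 0 2) t * norm t powr - q') \<in> borel_measurable borel"
          using integrable_norm_powr_cball[of q' 2] q' by auto
      qed
      finally show ?thesis using z by (simp add: C_def algebra_simps)
    next
      case False
      have "0 \<le> C" unfolding C_def using B(1) by (intro add_nonneg_nonneg mult_nonneg_nonneg) auto
      then show ?thesis using csmooth_dzb_continuous(2)[OF \<psi>, of z] False by simp
    qed
    moreover have "integrable lborel (\<lambda>z::complex. indicator (cball 0 1) z * C)"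
      by (intro integrable_mult_left integrable_real_indicator) (auto simp: emeasure_lborel_cball_finite[simplified])
    moreover have "(\<lambda>z. LINT \<zeta>|lborel. norm (case_prod ?f (z, \<zeta>))) \<in> borel_measurable lborel"
      by (rule lborel.borel_measurable_lebesgue_integral) measurable
    moreover have "0 \<le> (LINT \<zeta>|lborel. norm (case_prod ?f (z, \<zeta>)))" for z by simp
    ultimately show "integrable lborel (\<lambda>z. LINT \<zeta>|lborel. norm (case_prod ?f (z, \<zeta>)))"
      by (rule AE_bound)
  qed
  have "(LINT z|lborel. dzb \<psi> z * T z) = (LINT z|lborel. LINT \<zeta>|lborel. ?f z \<zeta>)"
    unfolding T_def using kernel_integrable by simp
  also have "\<dots> = (LINT \<zeta>|lborel. LINT z|lborel. ?f z \<zeta>)"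
    by (rule lborel_pair.Fubini_integral[OF I, symmetric])
  also have "\<dots> = (LINT \<zeta>|lborel. a \<zeta> * - of_real (pompeiu_const * \<psi> \<zeta>))"
  proof (intro Bochner_Integration.integral_cong refl)
    fix \<zeta>
    have "(LINT z|lborel. ?f z \<zeta>) = (LINT z|lborel. a \<zeta> * (dzb \<psi> z * inverse (z - \<zeta>)))"
      by (simp add: mult_ac)
    also have "\<dots> = a \<zeta> * (LINT z|lborel. dzb \<psi> z * inverse (z - \<zeta>))" by (rule integral_mult_right_zero)
    finally show "(LINT z|lborel. ?f z \<zeta>) = a \<zeta> * - of_real (pompeiu_const * \<psi> \<zeta>)" unfolding pompeiu[OF \<psi>] .
  qed
  also have "\<dots> = (LINT \<zeta>|lborel. - of_real pompeiu_const * (\<psi> \<zeta> *\<^sub>R a \<zeta>))"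
    by (simp add: scaleR_conv_of_real mult_ac)
  also have "\<dots> = - of_real pompeiu_const * (LINT \<zeta>|lborel. \<psi> \<zeta> *\<^sub>R a \<zeta>)" by (rule integral_mult_right_zero)
  finally have eq: "(LINT z|lborel. dzb \<psi> z * T z) = - of_real pompeiu_const * (LINT \<zeta>|lborel. \<psi> \<zeta> *\<^sub>R a \<zeta>)" .
  have "(LINT z|lborel. dzb \<psi> z * (T z / of_real pompeiu_const)) = (LINT z|lborel. dzb \<psi> z * T z) / of_real pompeiu_const"
    by simp
  also have "\<dots> = - (LINT \<zeta>|lborel. \<psi> \<zeta> *\<^sub>R a \<zeta>)" unfolding eq using pompeiu_const_pos by simp
  finally show "(LINT z|lborel. dzb \<psi> z * (T z / of_real pompeiu_const)) = - (LINT \<zeta>|lborel. \<psi> \<zeta> *\<^sub>R a \<zeta>)" .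
qed

end


section \<open>Weyl's lemma and the similarity principle\<close>

abbreviation cut :: "real \<Rightarrow> (complex \<Rightarrow> complex) \<Rightarrow> complex \<Rightarrow> complex" where
  "cut \<rho> u \<equiv> (\<lambda>\<zeta>. indicator (cball 0 \<rho>) \<zeta> *\<^sub>R u \<zeta>)"

lemma continuous_on_cball_disc:
  "continuous_on unit_disc u \<Longrightarrow> \<rho> < 1 \<Longrightarrow> continuous_on (cball 0 \<rho>) u"
  by (erule continuous_on_subset) auto

text \<open>Mollifications with radii within the margin \<rho> - s satisfy the Cauchy-Riemann
  equations on the disc of radius s, and they converge to h uniformly there.\<close>

lemma weyl_disc:
  fixes h :: "complex \<Rightarrow> complex"
  assumes c: "continuous_on unit_disc h" and w: "weak_sol h (\<lambda>z. 0)" and s: "0 < s" "s < 1"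
  shows "h holomorphic_on ball 0 s"
proof -
  define \<rho> where "\<rho> = (1 + s) / 2"
  have \<rho>: "s < \<rho>" "\<rho> < 1" using s by (auto simp: \<rho>_def)
  note ch = continuous_on_cball_disc[OF c \<rho>(2)]
  define e where "e n = (\<rho> - s) / (real n + 1)" for n
  have e: "0 < e n" "e n \<le> \<rho> - s" for n using \<rho> by (auto simp: e_def divide_le_eq)
  have "\<forall>n. \<exists>\<beta>. mollifier (e n) \<beta>" using mollifier_exists[OF e(1)] by blast
  then obtain \<beta> where \<beta>: "\<And>n. mollifier (e n) (\<beta> n)" by (auto dest!: choice)
  have hol: "conv (\<beta> n) (cut \<rho> h) holomorphic_on ball 0 s" for n
    unfolding holomorphic_on_open[OF open_ball]
  proof
    fix z :: complex assume z: "z \<in> ball 0 s"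
    let ?A = "conv (partial_x (\<beta> n)) (cut \<rho> h) z" and ?B = "conv (partial_y (\<beta> n)) (cut \<rho> h) z"
    have "norm z + e n \<le> \<rho>" using z e(2)[of n] by simp
    from conv_dbar[OF w mollifier_csmooth[OF \<beta>] this \<rho>(2) integrable_cut[OF ch]]
    have "(?A + \<i> * ?B) / 2 = 0" by (simp add: conv_def)
    \<comment> \<open>The two partial derivatives satisfy B = i A, so the real derivative is
      multiplication by A.\<close>
    then have "?A = - (\<i> * ?B)" by (simp add: add_eq_0_iff2)
    then have B: "?B = \<i> * ?A" by simp
    have "Re v *\<^sub>R ?A + Im v *\<^sub>R ?B = ?A * v" for v
      unfolding B by (subst (3) complex_eq[of v]) (simp add: scaleR_conv_of_real algebra_simps)
    then have "(conv (\<beta> n) (cut \<rho> h) has_field_derivative ?A) (at z)"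
      using conv_has_derivative[OF mollifier_csmooth[OF \<beta>[of n]] integrable_cut[OF ch], of z]
      by (simp add: has_field_derivative_def)
    then show "\<exists>f'. (conv (\<beta> n) (cut \<rho> h) has_field_derivative f') (at z)" by blast
  qed
  have ul: "uniform_limit (ball 0 s) (\<lambda>n. conv (\<beta> n) (cut \<rho> h)) h sequentially"
  proof (rule uniform_limitI)
    fix \<epsilon> :: real assume \<epsilon>: "0 < \<epsilon>"
    obtain d where d: "0 < d" "\<And>e \<beta> z. e < d \<Longrightarrow> mollifier e \<beta> \<Longrightarrow> norm z + e \<le> \<rho> \<Longrightarrow> norm (conv \<beta> (cut \<rho> h) z - h z) \<le> \<epsilon> / 2"
      using mollify_close[OF ch half_gt_zero[OF \<epsilon>]] by blast
    have "e \<longlonglongrightarrow> 0" unfolding e_def by real_asymp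
    then have "eventually (\<lambda>n. e n < d) sequentially" using d(1) by (rule order_tendstoD)
    then show "eventually (\<lambda>n. \<forall>z\<in>ball 0 s. dist (conv (\<beta> n) (cut \<rho> h) z) (h z) < \<epsilon>) sequentially"
    proof eventually_elim
      case (elim n)
      show ?case
      proof
        fix z :: complex assume z: "z \<in> ball 0 s"
        have "norm z + e n \<le> \<rho>" using z e(2)[of n] by simp
        from d(2)[OF elim \<beta> this] show "dist (conv (\<beta> n) (cut \<rho> h) z) (h z) < \<epsilon>"
          using \<epsilon> by (simp add: dist_norm)
      qed
    qed
  qed
  show ?thesis
  proof (rule holomorphic_uniform_sequence[OF open_ball hol])
    fix x :: complex assume "x \<in> ball 0 s"
    then obtain d where "0 < d" "cball x d \<subseteq> ball 0 s" using open_contains_cball open_ball by blast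
    then show "\<exists>d>0. cball x d \<subseteq> ball 0 s \<and> uniform_limit (cball x d) (\<lambda>n. conv (\<beta> n) (cut \<rho> h)) h sequentially"
      using uniform_limit_on_subset[OF ul] by blast
  qed
qed

lemma weyl:
  fixes h :: "complex \<Rightarrow> complex"
  assumes c: "continuous_on unit_disc h" and w: "weak_sol h (\<lambda>z. 0)"
  shows "h holomorphic_on unit_disc"
  unfolding holomorphic_on_open[OF open_ball]
proof
  fix z :: complex assume "z \<in> unit_disc"
  then have "z \<in> ball 0 ((1 + norm z) / 2)" "0 < (1 + norm z) / 2" "(1 + norm z) / 2 < 1"
    by (auto intro: add_pos_nonneg)
  then show "\<exists>f'. (h has_field_derivative f') (at z)"
    using weyl_disc[OF c w] holomorphic_on_open[OF open_ball] by blast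
qed

text \<open>A mollifier centred at z is itself a test function; its integral against h is a
  mollified value within |h z| / 2 of h z.\<close>

lemma test_functions_separate:
  fixes h :: "complex \<Rightarrow> complex"
  assumes c: "continuous_on unit_disc h"
    and 0: "\<And>\<psi>. test_function \<psi> \<Longrightarrow> (LINT z|lborel. \<psi> z *\<^sub>R h z) = 0" and z: "norm z < 1"
  shows "h z = 0"
proof (rule ccontr)
  assume "h z \<noteq> 0"
  then have \<epsilon>: "0 < norm (h z) / 2" by simp
  define \<rho> where "\<rho> = (1 + norm z) / 2"
  have \<rho>: "norm z < \<rho>" "\<rho> < 1" using z by (auto simp: \<rho>_def)
  obtain d where d: "0 < d" "\<And>e \<beta> x. e < d \<Longrightarrow> mollifier e \<beta> \<Longrightarrow> norm x + e \<le> \<rho> \<Longrightarrow> norm (conv \<beta> (cut \<rho> h) x - h x) \<le> norm (h z) / 2"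
    using mollify_close[OF continuous_on_cball_disc[OF c \<rho>(2)] \<epsilon>] by blast
  define e where "e = min (d / 2) (\<rho> - norm z)"
  have e: "0 < e" "e < d" "norm z + e \<le> \<rho>" using d(1) \<rho> by (auto simp: e_def)
  obtain \<beta> where \<beta>: "mollifier e \<beta>" using mollifier_exists[OF e(1)] by blast
  define \<psi> where "\<psi> \<zeta> = \<beta> (z - \<zeta>)" for \<zeta>
  have cs: "csmooth \<rho> \<psi>" unfolding \<psi>_def by (rule csmooth_reflect[OF mollifier_csmooth[OF \<beta>] e(3)])
  have "\<beta> (z - \<zeta>) *\<^sub>R cut \<rho> h \<zeta> = \<psi> \<zeta> *\<^sub>R h \<zeta>" for \<zeta>
    using cs by (cases "norm \<zeta> \<le> \<rho>") (auto simp: \<psi>_def csmooth_def)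
  then have "conv \<beta> (cut \<rho> h) z = 0"
    using 0[OF csmooth_test_function[OF cs \<rho>(2)]] by (simp only: conv_def)
  then show False using d(2)[OF e(2) \<beta> e(3)] \<epsilon> by simp
qed

section \<open>The similarity principle\<close>

context cauchy_transform
begin

definition S :: "complex \<Rightarrow> complex" where "S z = T z / of_real pompeiu_const"

lemma S_continuous: "continuous_on A S"
  unfolding S_def using pompeiu_const_pos by (intro continuous_intros T_continuous) simp

text \<open>The difference is the integral of \<beta>(z - \<zeta>) a(\<zeta>) (u(\<zeta>) - v), so
  only the oscillation of u near z survives; no smallness of a is involved.\<close>

lemma commutator_bound:
  assumes \<beta>: "mollifier e \<beta>" and U: "integrable lborel (cut \<rho> u)" and z: "norm z + e \<le> \<rho>"
    and aU: "integrable lborel (cut \<rho> (\<lambda>z. a z * u z))"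
    and osc: "\<And>\<zeta>. norm (z - \<zeta>) \<le> e \<Longrightarrow> norm (u \<zeta> - v) \<le> \<epsilon>"
  shows "norm (conv \<beta> (cut \<rho> (\<lambda>z. a z * u z)) z - v * conv \<beta> (cut \<rho> a) z) \<le> \<epsilon> * (LINT \<zeta>|lborel. \<beta> (z - \<zeta>) * norm (a \<zeta>))"
proof -
  note cs = mollifier_csmooth[OF \<beta>]
  have ca: "integrable lborel (cut \<rho> a)"
    by (rule Bochner_Integration.integrable_bound[OF a_integrable]) (auto simp: indicator_def)
  have b0: "0 \<le> \<beta> t" for t using \<beta> by (simp add: mollifier_def)
  have i1: "integrable lborel (\<lambda>\<zeta>. \<beta> (z - \<zeta>) *\<^sub>R cut \<rho> (\<lambda>z. a z * u z) \<zeta>)" by (rule conv_integrable[OF cs aU])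
  have i2: "integrable lborel (\<lambda>\<zeta>. v * (\<beta> (z - \<zeta>) *\<^sub>R cut \<rho> a \<zeta>))" by (intro integrable_mult_right conv_integrable[OF cs ca])
  have "integrable lborel (\<lambda>\<zeta>. norm (\<beta> (z - \<zeta>) *\<^sub>R a \<zeta>))" by (rule integrable_norm[OF conv_integrable[OF cs a_integrable]])
  then have i3: "integrable lborel (\<lambda>\<zeta>. \<beta> (z - \<zeta>) * norm (a \<zeta>))" using b0 by simp
  have "conv \<beta> (cut \<rho> (\<lambda>z. a z * u z)) z - v * conv \<beta> (cut \<rho> a) z
     = (LINT \<zeta>|lborel. \<beta> (z - \<zeta>) *\<^sub>R cut \<rho> (\<lambda>z. a z * u z) \<zeta> - v * (\<beta> (z - \<zeta>) *\<^sub>R cut \<rho> a \<zeta>))"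
    unfolding conv_def by (simp only: Bochner_Integration.integral_diff[OF i1 i2] integral_mult_right_zero)
  also have "norm \<dots> \<le> (LINT \<zeta>|lborel. \<epsilon> * (\<beta> (z - \<zeta>) * norm (a \<zeta>)))"
  proof (rule Bochner_Integration.integral_norm_bound_integral)
    fix \<zeta>
    show "norm (\<beta> (z - \<zeta>) *\<^sub>R cut \<rho> (\<lambda>z. a z * u z) \<zeta> - v * (\<beta> (z - \<zeta>) *\<^sub>R cut \<rho> a \<zeta>)) \<le> \<epsilon> * (\<beta> (z - \<zeta>) * norm (a \<zeta>))"
    proof (cases "norm (z - \<zeta>) \<le> e")
      case False
      then show ?thesis using \<beta> by (simp add: mollifier_def)
    next
      case True
      then have "norm \<zeta> \<le> \<rho>" using norm_triangle_ineq2[of \<zeta> z] z by (simp add: norm_minus_commute)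
      then have "\<beta> (z - \<zeta>) *\<^sub>R cut \<rho> (\<lambda>z. a z * u z) \<zeta> - v * (\<beta> (z - \<zeta>) *\<^sub>R cut \<rho> a \<zeta>) = \<beta> (z - \<zeta>) *\<^sub>R (a \<zeta> * (u \<zeta> - v))"
        by (simp add: scaleR_conv_of_real algebra_simps)
      then have "norm (\<beta> (z - \<zeta>) *\<^sub>R cut \<rho> (\<lambda>z. a z * u z) \<zeta> - v * (\<beta> (z - \<zeta>) *\<^sub>R cut \<rho> a \<zeta>)) = \<beta> (z - \<zeta>) * norm (a \<zeta>) * norm (u \<zeta> - v)"
        using b0 by (simp add: norm_mult)
      also have "\<dots> \<le> \<beta> (z - \<zeta>) * norm (a \<zeta>) * \<epsilon>" using osc[OF True] b0 by (intro mult_left_mono) auto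
      finally show ?thesis by (simp add: mult_ac)
    qed
  qed (use i1 i2 i3 in auto)
  finally show ?thesis by simp
qed

text \<open>By Fubini the mollification of |a| keeps its total mass. The commutator is therefore
  bounded by its oscillation times a fixed \<open>L^1\<close> norm, however small the
  radius.\<close>

lemma mollified_mass:
  assumes \<beta>: "mollifier e \<beta>"
  shows "integrable lborel (\<lambda>z. LINT \<zeta>|lborel. \<beta> (z - \<zeta>) * norm (a \<zeta>))"
    and "(LINT z|lborel. LINT \<zeta>|lborel. \<beta> (z - \<zeta>) * norm (a \<zeta>)) = (LINT \<zeta>|lborel. norm (a \<zeta>))"
proof -
  note cs = mollifier_csmooth[OF \<beta>]
  have [measurable]: "\<beta> \<in> borel_measurable borel" by (rule csmooth_measurable[OF cs])
  have b0: "0 \<le> \<beta> t" for t using \<beta> by (simp add: mollifier_def)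
  have bi: "integrable lborel (\<lambda>z. \<beta> (z - \<zeta>))" "(LINT z|lborel. \<beta> (z - \<zeta>)) = 1" for \<zeta>
    using integrable_shift(1)[of \<beta> \<zeta>] integral_lborel_translate[of \<beta> "- \<zeta>"] \<beta> by (auto simp: mollifier_def)
  let ?f = "\<lambda>\<zeta> z. \<beta> (z - \<zeta>) * norm (a \<zeta>)"
  have I: "integrable (lborel \<Otimes>\<^sub>M lborel) (case_prod ?f)"
  proof (rule lborel_pair.Fubini_integrable)
    show "case_prod ?f \<in> borel_measurable (lborel \<Otimes>\<^sub>M lborel)" by measurable
    have "(LINT z|lborel. norm (case_prod ?f (\<zeta>, z))) = norm (a \<zeta>)" for \<zeta>
      using bi[of \<zeta>] b0 by simp
    then show "integrable lborel (\<lambda>\<zeta>. LINT z|lborel. norm (case_prod ?f (\<zeta>, z)))"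
      using a_integrable by simp
    show "AE \<zeta> in lborel. integrable lborel (\<lambda>z. case_prod ?f (\<zeta>, z))" using bi by (intro AE_I2) simp
  qed
  show "integrable lborel (\<lambda>z. LINT \<zeta>|lborel. \<beta> (z - \<zeta>) * norm (a \<zeta>))"
    using lborel_pair.integrable_snd[OF I] .
  show "(LINT z|lborel. LINT \<zeta>|lborel. \<beta> (z - \<zeta>) * norm (a \<zeta>)) = (LINT \<zeta>|lborel. norm (a \<zeta>))"
    using lborel_pair.Fubini_integral[OF I] bi by simp
qed

text \<open>The similarity principle. Mollifying \<open>u\<close> and \<open>S\<close> with the same kernel leaves only a commutator,
  which tends to zero in \<open>L\<^sup>1\<close> because \<open>u\<close> is continuous.\<close>

lemma similarity_weak:
  assumes c: "continuous_on unit_disc u" and w: "weak_sol u (\<lambda>z. a z * u z)"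
  shows "weak_sol (\<lambda>z. exp (- S z) * u z) (\<lambda>z. 0)"
  unfolding weak_sol_def
proof (intro allI impI)
  fix \<psi> assume "test_function \<psi>"
  then obtain R where R: "0 < R" "R < 1" and \<psi>: "csmooth R \<psi>" by (rule test_function_csmooth)
  define \<rho> where "\<rho> = (1 + R) / 2"
  have \<rho>: "R < \<rho>" "\<rho> < 1" using R by (auto simp: \<rho>_def)
  note cu = continuous_on_cball_disc[OF c \<rho>(2)]
  have cS: "continuous_on (cball 0 \<rho>) S" by (rule S_continuous)
  have wS: "weak_sol S a" using T_weak by (simp add: S_def[abs_def])
  note U = integrable_cut[OF cu] and SU = integrable_cut[OF cS]
  obtain Bu where Bu: "\<And>\<zeta>. \<zeta> \<in> cball 0 \<rho> \<Longrightarrow> norm (u \<zeta>) \<le> Bu"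
    using compact_imp_bounded[OF compact_continuous_image[OF cu compact_cball]] unfolding bounded_iff by blast
  obtain BS where BS: "\<And>\<zeta>. \<zeta> \<in> cball 0 \<rho> \<Longrightarrow> norm (S \<zeta>) \<le> BS"
    using compact_imp_bounded[OF compact_continuous_image[OF cS compact_cball]] unfolding bounded_iff by blast
  have Bu0: "0 \<le> Bu" using Bu[of 0] \<rho> R by (auto intro: order_trans[OF norm_ge_zero])
  have BS0: "0 \<le> BS" using BS[of 0] \<rho> R by (auto intro: order_trans[OF norm_ge_zero])
  have Bu': "norm (cut \<rho> u \<zeta> - 0) \<le> Bu" and BS': "norm (cut \<rho> S \<zeta> - 0) \<le> BS" for \<zeta>
    using Bu[of \<zeta>] BS[of \<zeta>] Bu0 BS0 by (auto simp: indicator_def)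
  have aU: "integrable lborel (cut \<rho> (\<lambda>z. a z * u z))"
  proof (rule Bochner_Integration.integrable_bound)
    show "integrable lborel (\<lambda>\<zeta>. Bu * norm (a \<zeta>))" using a_integrable by simp
    have cu: "cut \<rho> (\<lambda>z. a z * u z) = (\<lambda>\<zeta>. a \<zeta> * cut \<rho> u \<zeta>)" by (auto simp: fun_eq_iff)
    have [measurable]: "cut \<rho> u \<in> borel_measurable borel" using U by auto
    show "cut \<rho> (\<lambda>z. a z * u z) \<in> borel_measurable lborel" unfolding cu by measurable
    show "AE \<zeta> in lborel. norm (cut \<rho> (\<lambda>z. a z * u z) \<zeta>) \<le> norm (Bu * norm (a \<zeta>))"
    proof (rule AE_I2)
      fix \<zeta> show "norm (cut \<rho> (\<lambda>z. a z * u z) \<zeta>) \<le> norm (Bu * norm (a \<zeta>))"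
        using mult_right_mono[OF Bu[of \<zeta>] norm_ge_zero[of "a \<zeta>"]] Bu0
        by (cases "\<zeta> \<in> cball 0 \<rho>") (auto simp: norm_mult abs_mult mult.commute)
    qed
  qed
  obtain B\<psi> where B\<psi>: "0 < B\<psi>" "\<And>t. \<bar>\<psi> t\<bar> \<le> B\<psi>" using csmooth_bounded[OF \<psi>] by blast
  define e where "e n = (\<rho> - R) / (real n + 1)" for n
  have e: "0 < e n" "e n \<le> \<rho> - R" for n using \<rho> by (auto simp: e_def divide_le_eq)
  have elim0: "e \<longlonglongrightarrow> 0" unfolding e_def by real_asymp
  have "\<forall>n. \<exists>\<beta>. mollifier (e n) \<beta>" using mollifier_exists[OF e(1)] by blast
  then obtain \<beta> where \<beta>: "\<And>n. mollifier (e n) (\<beta> n)" by (auto dest!: choice)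
  note cs = mollifier_csmooth[OF \<beta>]
  define un where "un n = conv (\<beta> n) (cut \<rho> u)" for n
  define Sn where "Sn n = conv (\<beta> n) (cut \<rho> S)" for n
  \<comment> \<open>A product of C^1 functions, to which the classical product rule applies.\<close>
  define F where "F n z = exp (- Sn n z) * un n z" for n z
  have Snb: "norm (Sn n z) \<le> BS" for n z
    using mollify_deviation[OF \<beta>[of n] SU, where c = 0 and z = z and \<epsilon> = BS] BS' by (simp add: Sn_def)
  have unb: "norm (un n z) \<le> Bu" for n z
    using mollify_deviation[OF \<beta>[of n] U, where c = 0 and z = z and \<epsilon> = Bu] Bu' by (simp add: un_def)
  have expb: "norm (exp (- Sn n z)) \<le> exp BS" for n z
    using norm_exp[of "- Sn n z"] Snb[of n z] by (simp add: order_trans[OF norm_exp])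
  have Rz: "norm z + e n \<le> \<rho>" if "norm z \<le> R" for n z using that e(2)[of n] by simp
  let ?D = "\<lambda>u n z v. Re v *\<^sub>R conv (partial_x (\<beta> n)) (cut \<rho> u) z + Im v *\<^sub>R conv (partial_y (\<beta> n)) (cut \<rho> u) z"
  let ?F' = "\<lambda>n z v. exp (- Sn n z) * (?D u n z v - ?D S n z v * un n z)"
  have dF: "(F n has_derivative ?F' n z) (at z)" for n z
  proof -
    have du: "(un n has_derivative ?D u n z) (at z)" unfolding un_def by (rule conv_has_derivative[OF cs U])
    have dS: "(Sn n has_derivative ?D S n z) (at z)" unfolding Sn_def by (rule conv_has_derivative[OF cs SU])
    have "((\<lambda>z. exp (- Sn n z)) has_derivative (\<lambda>v. exp (- Sn n z) * (- ?D S n z v))) (at z)"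
      using has_derivative_compose[OF has_derivative_minus[OF dS] DERIV_exp[of "- Sn n z", unfolded has_field_derivative_def]] .
    from has_derivative_mult[OF this du] show ?thesis
      unfolding F_def[abs_def] by (simp add: algebra_simps)
  qed
  have contF': "continuous_on UNIV (\<lambda>z. ?F' n z v)" for n v
    unfolding Sn_def un_def
    by (intro continuous_intros conv_continuous[OF cs SU] conv_continuous[OF cs U]
        conv_continuous[OF csmooth_partial(1)[OF cs] SU] conv_continuous[OF csmooth_partial(2)[OF cs] SU]
        conv_continuous[OF csmooth_partial(1)[OF cs] U] conv_continuous[OF csmooth_partial(2)[OF cs] U])
  \<comment> \<open>For |z| \<le> R the derivative of \<open>F n\<close> collapses to this
    commutator, because \<open>conv_dbar\<close> replaces the derivatives of the mollified u and S
    by the mollified a u and a.\<close>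
  define E where "E n z = exp (- Sn n z) * (conv (\<beta> n) (cut \<rho> (\<lambda>z. a z * u z)) z - un n z * conv (\<beta> n) (cut \<rho> a) z)" for n z
  have FE: "(?F' n z 1 + \<i> * ?F' n z \<i>) / 2 = E n z" if "norm z \<le> R" for n z
  proof -
    have "(?F' n z 1 + \<i> * ?F' n z \<i>) / 2 = exp (- Sn n z) *
       ((?D u n z 1 + \<i> * ?D u n z \<i>) / 2 - un n z * ((?D S n z 1 + \<i> * ?D S n z \<i>) / 2))"
      by (simp add: field_simps)
    then show ?thesis unfolding E_def
      using conv_dbar[OF w cs Rz[OF that] \<rho>(2) U] conv_dbar[OF wS cs Rz[OF that] \<rho>(2) SU] by simp
  qed
  have IF: "(LINT z|lborel. dzb \<psi> z * F n z) = - (LINT z|lborel. \<psi> z *\<^sub>R ((?F' n z 1 + \<i> * ?F' n z \<i>) / 2))" for n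
    by (rule dzb_product_integral[OF \<psi> dF contF'])
  define A where "A = (LINT \<zeta>|lborel. norm (a \<zeta>))"
  have A0: "0 \<le> A" by (simp add: A_def)
  have est: "eventually (\<lambda>n. norm (LINT z|lborel. dzb \<psi> z * F n z) \<le> B\<psi> * exp BS * (2 * \<epsilon>) * A) sequentially"
    if \<epsilon>: "0 < \<epsilon>" for \<epsilon>
  proof -
    obtain d where d: "0 < d" "\<And>e \<beta> z. e < d \<Longrightarrow> mollifier e \<beta> \<Longrightarrow> norm z + e \<le> \<rho> \<Longrightarrow> norm (conv \<beta> (cut \<rho> u) z - u z) \<le> \<epsilon>"
      "\<And>z \<zeta>. norm z \<le> \<rho> \<Longrightarrow> norm \<zeta> \<le> \<rho> \<Longrightarrow> norm (\<zeta> - z) < d \<Longrightarrow> norm (u \<zeta> - u z) \<le> \<epsilon>"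
      using mollify_close[OF cu \<epsilon>] by blast
    have "eventually (\<lambda>n. e n < d) sequentially" using elim0 d(1) by (rule order_tendstoD)
    then show ?thesis
    proof eventually_elim
      case (elim n)
      let ?C = "\<lambda>z. LINT \<zeta>|lborel. \<beta> n (z - \<zeta>) * norm (a \<zeta>)"
      have C0: "0 \<le> ?C z" for z using \<beta>[of n] by (simp add: mollifier_def)
      have pt: "norm (\<psi> z *\<^sub>R ((?F' n z 1 + \<i> * ?F' n z \<i>) / 2)) \<le> B\<psi> * exp BS * (2 * \<epsilon>) * ?C z" for z
      proof (cases "norm z \<le> R")
        case True
        \<comment> \<open>One \<epsilon> is for the oscillation of u near z, the other for the
          mollification error at z.\<close>
        have "norm (conv (\<beta> n) (cut \<rho> (\<lambda>z. a z * u z)) z - un n z * conv (\<beta> n) (cut \<rho> a) z) \<le> (2 * \<epsilon>) * ?C z"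
        proof (rule commutator_bound[OF \<beta> U Rz[OF True] aU])
          fix \<zeta> assume zz: "norm (z - \<zeta>) \<le> e n"
          have "norm \<zeta> \<le> \<rho>" using norm_triangle_ineq2[of \<zeta> z] zz Rz[OF True, of n] by (simp add: norm_minus_commute)
          then have 1: "norm (u \<zeta> - u z) \<le> \<epsilon>" using True \<rho> zz elim by (intro d(3)) (auto simp: norm_minus_commute)
          have 2: "norm (un n z - u z) \<le> \<epsilon>" unfolding un_def by (rule d(2)[OF elim \<beta> Rz[OF True]])
          have "norm (u \<zeta> - un n z) \<le> norm (u \<zeta> - u z) + norm (un n z - u z)"
            using norm_triangle_ineq4[of "u \<zeta> - u z" "un n z - u z"] by simp
          then show "norm (u \<zeta> - un n z) \<le> 2 * \<epsilon>" using 1 2 by simp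
        qed
        then have "norm (E n z) \<le> exp BS * ((2 * \<epsilon>) * ?C z)"
          unfolding E_def norm_mult by (intro mult_mono expb) auto
        then have "\<bar>\<psi> z\<bar> * norm (E n z) \<le> B\<psi> * (exp BS * ((2 * \<epsilon>) * ?C z))"
          using B\<psi> by (intro mult_mono) auto
        then show ?thesis unfolding FE[OF True] by (simp add: mult_ac)
      next
        case False
        then have "\<psi> z = 0" using \<psi> by (simp add: csmooth_def)
        then show ?thesis using B\<psi>(1) \<epsilon> C0[of z] by simp
      qed
      have "norm (LINT z|lborel. dzb \<psi> z * F n z) = norm (LINT z|lborel. \<psi> z *\<^sub>R ((?F' n z 1 + \<i> * ?F' n z \<i>) / 2))"
        unfolding IF by simp
      also have "\<dots> \<le> (LINT z|lborel. B\<psi> * exp BS * (2 * \<epsilon>) * ?C z)"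
      proof (rule Bochner_Integration.integral_norm_bound_integral[OF _ _ pt])
        have "continuous_on UNIV (\<lambda>z. \<psi> z *\<^sub>R ((?F' n z 1 + \<i> * ?F' n z \<i>) / 2))"
          by (rule continuous_on_scaleR[OF csmooth_continuous[OF \<psi>]],
              rule continuous_on_divide[OF continuous_on_add[OF contF' continuous_on_mult[OF continuous_on_const contF']] continuous_on_const]) simp
        then show "integrable lborel (\<lambda>z. \<psi> z *\<^sub>R ((?F' n z 1 + \<i> * ?F' n z \<i>) / 2))"
          by (rule integrable_continuous_compact_support[where R = R]) (use \<psi> in \<open>simp add: csmooth_def\<close>)
        show "integrable lborel (\<lambda>z. B\<psi> * exp BS * (2 * \<epsilon>) * ?C z)"
          by (intro integrable_mult_right mollified_mass(1)[OF \<beta>])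
      qed
      also have "\<dots> = B\<psi> * exp BS * (2 * \<epsilon>) * A"
        by (simp only: integral_mult_right_zero mollified_mass(2)[OF \<beta>[of n]] A_def)
      finally show ?case .
    qed
  qed
  have lim: "(\<lambda>n. LINT z|lborel. dzb \<psi> z * F n z) \<longlonglongrightarrow> (LINT z|lborel. dzb \<psi> z * cut \<rho> (\<lambda>z. exp (- S z) * u z) z)"
  proof (rule integral_dominated_convergence[where w = "\<lambda>z. norm (dzb \<psi> z) * (exp BS * Bu)"])
    have [measurable]: "dzb \<psi> \<in> borel_measurable borel"
      using csmooth_dzb_continuous(1)[OF \<psi>] by (rule borel_measurable_continuous_onI)
    have contF: "continuous_on UNIV (F n)" for n
      using dF[of n] by (intro continuous_at_imp_continuous_on) (blast intro: has_derivative_continuous)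
    have [measurable]: "F n \<in> borel_measurable borel" for n by (rule borel_measurable_continuous_onI[OF contF])
    have "continuous_on (cball 0 \<rho>) (\<lambda>z. exp (- S z) * u z)" by (intro continuous_intros cu cS)
    from integrable_cut[OF this] have [measurable]: "cut \<rho> (\<lambda>z. exp (- S z) * u z) \<in> borel_measurable borel" by auto
    show "(\<lambda>z. dzb \<psi> z * cut \<rho> (\<lambda>z. exp (- S z) * u z) z) \<in> borel_measurable lborel" by measurable
    show "(\<lambda>z. dzb \<psi> z * F n z) \<in> borel_measurable lborel" for n by measurable
    show "integrable lborel (\<lambda>z. norm (dzb \<psi> z) * (exp BS * Bu))"
      by (intro integrable_mult_left integrable_norm integrable_continuous_compact_support[OF csmooth_dzb_continuous[OF \<psi>]])
    show "AE z in lborel. norm (dzb \<psi> z * F n z) \<le> norm (dzb \<psi> z) * (exp BS * Bu)" for n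
      unfolding F_def norm_mult by (intro AE_I2 mult_left_mono mult_mono expb unb) auto
    show "AE z in lborel. (\<lambda>n. dzb \<psi> z * F n z) \<longlonglongrightarrow> dzb \<psi> z * cut \<rho> (\<lambda>z. exp (- S z) * u z) z"
    proof (rule AE_I2)
      fix z :: complex
      show "(\<lambda>n. dzb \<psi> z * F n z) \<longlonglongrightarrow> dzb \<psi> z * cut \<rho> (\<lambda>z. exp (- S z) * u z) z"
      proof (cases "norm z \<le> R")
        case True
        have cv: "(\<lambda>n. conv (\<beta> n) (cut \<rho> f) z) \<longlonglongrightarrow> f z" if cf: "continuous_on (cball 0 \<rho>) f" for f
        proof (rule tendstoI)
          fix \<epsilon> :: real assume \<epsilon>: "0 < \<epsilon>"
          obtain d where d: "0 < d" "\<And>e \<beta> z. e < d \<Longrightarrow> mollifier e \<beta> \<Longrightarrow> norm z + e \<le> \<rho> \<Longrightarrow> norm (conv \<beta> (cut \<rho> f) z - f z) \<le> \<epsilon> / 2"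
            using mollify_close[OF cf half_gt_zero[OF \<epsilon>]] by blast
          have "eventually (\<lambda>n. e n < d) sequentially" using elim0 d(1) by (rule order_tendstoD)
          then show "eventually (\<lambda>n. dist (conv (\<beta> n) (cut \<rho> f) z) (f z) < \<epsilon>) sequentially"
          proof eventually_elim
            case (elim n)
            from d(2)[OF elim \<beta> Rz[OF True]] show ?case using \<epsilon> by (simp add: dist_norm)
          qed
        qed
        have "(\<lambda>n. dzb \<psi> z * F n z) \<longlonglongrightarrow> dzb \<psi> z * (exp (- S z) * u z)"
          unfolding F_def Sn_def un_def by (intro tendsto_intros cv cu cS)
        then show ?thesis using True \<rho> by simp
      next
        case False
        then show ?thesis using csmooth_dzb_continuous(2)[OF \<psi>, of z] by simp
      qed
    qed
  qed
  have eq: "dzb \<psi> z * cut \<rho> (\<lambda>z. exp (- S z) * u z) z = dzb \<psi> z * (exp (- S z) * u z)" for z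
    using csmooth_dzb_continuous(2)[OF \<psi>, of z] \<rho> by (cases "norm z \<le> R") auto
  have "norm (LINT z|lborel. dzb \<psi> z * (exp (- S z) * u z)) \<le> 0"
  proof (rule field_le_epsilon)
    fix x :: real assume x: "0 < x"
    \<comment> \<open>Tuned so that the estimate with A + 1 in place of A gives exactly x.\<close>
    define \<epsilon> where "\<epsilon> = x / (2 * B\<psi> * exp BS * (A + 1))"
    have \<epsilon>: "0 < \<epsilon>" using x B\<psi> A0 by (simp add: \<epsilon>_def)
    have "norm (LINT z|lborel. dzb \<psi> z * cut \<rho> (\<lambda>z. exp (- S z) * u z) z) \<le> B\<psi> * exp BS * (2 * \<epsilon>) * A"
      by (rule tendsto_upperbound[OF tendsto_norm[OF lim] est[OF \<epsilon>]]) simp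
    also have "\<dots> \<le> B\<psi> * exp BS * (2 * \<epsilon>) * (A + 1)" using B\<psi> \<epsilon> by (intro mult_left_mono) auto
    also have "\<dots> = x" using B\<psi> A0 by (simp add: \<epsilon>_def)
    finally show "norm (LINT z|lborel. dzb \<psi> z * (exp (- S z) * u z)) \<le> 0 + x" unfolding eq by simp
  qed
  then show "(LINT z|lborel. dzb \<psi> z * (exp (- S z) * u z)) = - (LINT z|lborel. \<psi> z *\<^sub>R (0::complex))" by simp
qed

lemma similarity:
  assumes c: "continuous_on unit_disc u" and w: "weak_sol u (\<lambda>z. a z * u z)"
  shows "(\<lambda>z. exp (- S z) * u z) holomorphic_on unit_disc"
  by (rule weyl[OF _ similarity_weak[OF assms]]) (intro continuous_intros S_continuous c)

end


section \<open>Polyanalytic solutions\<close>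

definition loc_int :: "(complex \<Rightarrow> complex) \<Rightarrow> bool" where
  "loc_int w \<longleftrightarrow> (\<forall>\<rho><1. integrable lborel (cut \<rho> w))"

lemma loc_int_continuous: "continuous_on unit_disc v \<Longrightarrow> loc_int v"
  unfolding loc_int_def using integrable_cut continuous_on_cball_disc by blast

lemma loc_int_add: "loc_int v \<Longrightarrow> loc_int w \<Longrightarrow> loc_int (\<lambda>z. v z + w z)"
  unfolding loc_int_def by (simp add: scaleR_add_right)

lemma loc_int_mult:
  assumes w: "loc_int w" and c: "continuous_on unit_disc v" shows "loc_int (\<lambda>z. w z * v z)"
  unfolding loc_int_def
proof (intro allI impI)
  fix \<rho> :: real assume \<rho>: "\<rho> < 1"
  note cv = continuous_on_cball_disc[OF c \<rho>]
  have iw: "integrable lborel (cut \<rho> w)" using w \<rho> by (simp add: loc_int_def)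
  obtain B where B: "\<And>\<zeta>. \<zeta> \<in> cball 0 \<rho> \<Longrightarrow> norm (v \<zeta>) \<le> B"
    using compact_imp_bounded[OF compact_continuous_image[OF cv compact_cball]] unfolding bounded_iff by blast
  have eq: "cut \<rho> (\<lambda>z. w z * v z) = (\<lambda>z. cut \<rho> w z * cut \<rho> v z)"
    by (auto simp: fun_eq_iff indicator_def)
  show "integrable lborel (cut \<rho> (\<lambda>z. w z * v z))"
  proof (rule Bochner_Integration.integrable_bound)
    show "integrable lborel (\<lambda>z. B * norm (cut \<rho> w z))" using iw by (intro integrable_mult_right integrable_norm)
    have [measurable]: "cut \<rho> w \<in> borel_measurable borel" "cut \<rho> v \<in> borel_measurable borel"
      using iw integrable_cut[OF cv] by auto
    show "cut \<rho> (\<lambda>z. w z * v z) \<in> borel_measurable lborel" unfolding eq by measurable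
    show "AE z in lborel. norm (cut \<rho> (\<lambda>z. w z * v z) z) \<le> norm (B * norm (cut \<rho> w z))"
    proof (rule AE_I2)
      fix z show "norm (cut \<rho> (\<lambda>z. w z * v z) z) \<le> norm (B * norm (cut \<rho> w z))"
      proof (cases "z \<in> cball 0 \<rho>")
        case True
        have "norm (w z) * norm (v z) \<le> norm (w z) * \<bar>B\<bar>"
          using B[OF True] by (intro mult_left_mono) auto
        then show ?thesis using True by (simp add: norm_mult abs_mult mult.commute)
      qed auto
    qed
  qed
qed

lemma loc_int_integrable:
  assumes w: "loc_int w" and m: "continuous_on UNIV m" "\<And>z. \<rho> < norm z \<Longrightarrow> m z = 0" and \<rho>: "\<rho> < 1"
  shows "integrable lborel (\<lambda>z. m z * w z)"
proof -
  obtain B where B: "0 < B" "\<And>t. norm (m t) \<le> B" using bounded_of_compact_support[OF m] by blast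
  have [measurable]: "m \<in> borel_measurable borel" using m(1) by (rule borel_measurable_continuous_onI)
  have iw: "integrable lborel (cut \<rho> w)" using w \<rho> by (simp add: loc_int_def)
  then have [measurable]: "cut \<rho> w \<in> borel_measurable borel" by auto
  have "(\<lambda>z. m z * w z) = (\<lambda>z. m z * cut \<rho> w z)"
  proof
    fix z show "m z * w z = m z * cut \<rho> w z" using m(2)[of z] by (cases "norm z \<le> \<rho>") auto
  qed
  moreover have "integrable lborel (\<lambda>z. m z * cut \<rho> w z)"
  proof (rule Bochner_Integration.integrable_bound)
    show "integrable lborel (\<lambda>z. B * norm (cut \<rho> w z))" using iw by (intro integrable_mult_right integrable_norm)
    show "AE z in lborel. norm (m z * cut \<rho> w z) \<le> norm (B * norm (cut \<rho> w z))"
      using order_trans[OF mult_right_mono[OF B(2) norm_ge_zero] abs_ge_self]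
      by (intro AE_I2) (simp only: norm_mult real_norm_def)
  qed measurable
  ultimately show ?thesis by simp
qed

lemma loc_int_test:
  assumes w: "loc_int w" and \<psi>: "csmooth \<rho> \<psi>" and \<rho>: "\<rho> < 1"
  shows "integrable lborel (\<lambda>z. \<psi> z *\<^sub>R w z)" "integrable lborel (\<lambda>z. dzb \<psi> z * w z)"
proof -
  have "integrable lborel (\<lambda>z. of_real (\<psi> z) * w z)"
    by (rule loc_int_integrable[OF w _ _ \<rho>])
       (use \<psi> in \<open>auto intro!: continuous_intros csmooth_continuous[OF \<psi>] simp: csmooth_def\<close>)
  then show "integrable lborel (\<lambda>z. \<psi> z *\<^sub>R w z)" by (simp add: scaleR_conv_of_real)
  show "integrable lborel (\<lambda>z. dzb \<psi> z * w z)"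
    by (rule loc_int_integrable[OF w csmooth_dzb_continuous[OF \<psi>] \<rho>])
qed

lemma weak_sol_cong:
  assumes "weak_sol u w" "\<And>z. z \<in> unit_disc \<Longrightarrow> u z = u' z" "\<And>z. z \<in> unit_disc \<Longrightarrow> w z = w' z"
  shows "weak_sol u' w'"
  unfolding weak_sol_def
proof (intro allI impI)
  fix \<psi> assume t: "test_function \<psi>"
  then obtain R where R: "0 < R" "R < 1" and \<psi>: "csmooth R \<psi>" by (rule test_function_csmooth)
  have e: "dzb \<psi> z * u' z = dzb \<psi> z * u z" "\<psi> z *\<^sub>R w' z = \<psi> z *\<^sub>R w z" for z
    using assms(2,3)[of z] csmooth_dzb_continuous(2)[OF \<psi>, of z] \<psi> R
    by (cases "norm z \<le> R"; simp add: csmooth_def)+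
  show "(LINT z|lborel. dzb \<psi> z * u' z) = - (LINT z|lborel. \<psi> z *\<^sub>R w' z)"
    unfolding e using assms(1) t by (simp add: weak_sol_def)
qed

lemma weak_sol_unique:
  assumes "weak_sol u w" "weak_sol u w'" "test_function \<psi>"
  shows "(LINT z|lborel. \<psi> z *\<^sub>R w z) = (LINT z|lborel. \<psi> z *\<^sub>R w' z)"
proof -
  have "(LINT z|lborel. dzb \<psi> z * u z) = - (LINT z|lborel. \<psi> z *\<^sub>R w z)"
    "(LINT z|lborel. dzb \<psi> z * u z) = - (LINT z|lborel. \<psi> z *\<^sub>R w' z)"
    using assms by (auto simp: weak_sol_def)
  from this(1)[symmetric] this(2) have "- (LINT z|lborel. \<psi> z *\<^sub>R w z) = - (LINT z|lborel. \<psi> z *\<^sub>R w' z)"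
    by (rule trans)
  then show ?thesis by (simp only: neg_equal_iff_equal)
qed

lemma weak_sol_add:
  assumes "weak_sol u w" "weak_sol u' w'" "loc_int u" "loc_int u'" "loc_int w" "loc_int w'"
  shows "weak_sol (\<lambda>z. u z + u' z) (\<lambda>z. w z + w' z)"
  unfolding weak_sol_def
proof (intro allI impI)
  fix \<psi> assume t: "test_function \<psi>"
  then obtain R where R: "0 < R" "R < 1" and \<psi>: "csmooth R \<psi>" by (rule test_function_csmooth)
  show "(LINT z|lborel. dzb \<psi> z * (u z + u' z)) = - (LINT z|lborel. \<psi> z *\<^sub>R (w z + w' z))"
    using assms(1,2) t loc_int_test[OF assms(3) \<psi> R(2)] loc_int_test[OF assms(4) \<psi> R(2)]
      loc_int_test[OF assms(5) \<psi> R(2)] loc_int_test[OF assms(6) \<psi> R(2)]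
    by (simp add: weak_sol_def distrib_left scaleR_add_right)
qed

lemma weak_sol_cmult:
  assumes "weak_sol u w" shows "weak_sol (\<lambda>z. c * u z) (\<lambda>z. c * w z)"
  unfolding weak_sol_def
proof (intro allI impI)
  fix \<psi> assume t: "test_function \<psi>"
  have "(LINT z|lborel. dzb \<psi> z * (c * u z)) = (LINT z|lborel. c * (dzb \<psi> z * u z))" by (simp add: mult_ac)
  also have "\<dots> = c * (LINT z|lborel. dzb \<psi> z * u z)" by (rule integral_mult_right_zero)
  also have "\<dots> = - (c * (LINT z|lborel. \<psi> z *\<^sub>R w z))" using assms t by (simp add: weak_sol_def)
  also have "c * (LINT z|lborel. \<psi> z *\<^sub>R w z) = (LINT z|lborel. c * (\<psi> z *\<^sub>R w z))" by (rule integral_mult_right_zero[symmetric])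
  finally show "(LINT z|lborel. dzb \<psi> z * (c * u z)) = - (LINT z|lborel. \<psi> z *\<^sub>R (c * w z))" by simp
qed

lemma csmooth_mult_linear:
  assumes "csmooth \<rho> \<psi>" "bounded_linear l" shows "csmooth \<rho> (\<lambda>z. \<psi> z * l z)"
  using assms by (simp add: csmooth_def smooth_mult_linear)

lemma dzb_mult_linear:
  assumes \<psi>: "csmooth \<rho> \<psi>" and l: "bounded_linear l"
  shows "dzb (\<lambda>z. \<psi> z * l z) z = dzb \<psi> z * of_real (l z) + of_real (\<psi> z) * (of_real (l 1) + \<i> * of_real (l \<i>)) / 2"
proof -
  have sm: "smooth \<psi>" using \<psi> by (simp add: csmooth_def)
  have "((\<lambda>z. \<psi> z * l z) has_derivative (\<lambda>v. \<psi> z * l v + (Re v * partial_x \<psi> z + Im v * partial_y \<psi> z) * l z)) (at z)"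
    by (rule has_derivative_mult[OF smooth_has_derivative[OF sm] bounded_linear_imp_has_derivative[OF l]])
  from partial_eqI[OF this] show ?thesis by (simp add: dzb_def field_simps)
qed

text \<open>Test functions are real-valued, so the equation is tested with \<psi> x and \<psi> y
  separately and recombined through cnj z = x - i y. The extra term u stems from the derivative of
  cnj z.\<close>

lemma weak_sol_cnj_mult:
  assumes u: "weak_sol u w" and c: "continuous_on unit_disc u" and w: "loc_int w"
  shows "weak_sol (\<lambda>z. cnj z * u z) (\<lambda>z. u z + cnj z * w z)"
  unfolding weak_sol_def
proof (intro allI impI)
  fix \<psi> assume t: "test_function \<psi>"
  then obtain R where R: "0 < R" "R < 1" and \<psi>: "csmooth R \<psi>" by (rule test_function_csmooth)
  note cx = csmooth_mult_linear[OF \<psi> bounded_linear_Re] and cy = csmooth_mult_linear[OF \<psi> bounded_linear_Im]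
  note lu = loc_int_continuous[OF c]
  note ix = loc_int_test[OF lu cx R(2)] loc_int_test[OF w cx R(2)] and iy = loc_int_test[OF lu cy R(2)] loc_int_test[OF w cy R(2)]
    and iu = loc_int_test[OF lu \<psi> R(2)]
  have X: "(LINT z|lborel. dzb (\<lambda>z. \<psi> z * Re z) z * u z) = - (LINT z|lborel. (\<psi> z * Re z) *\<^sub>R w z)"
    and Y: "(LINT z|lborel. dzb (\<lambda>z. \<psi> z * Im z) z * u z) = - (LINT z|lborel. (\<psi> z * Im z) *\<^sub>R w z)"
    using u csmooth_test_function[OF cx R(2)] csmooth_test_function[OF cy R(2)] by (auto simp: weak_sol_def)
  have cnj_eq: "cnj z = of_real (Re z) - \<i> * of_real (Im z)" for z by (simp add: complex_eq_iff)
  have e1: "dzb \<psi> z * (cnj z * u z) = dzb (\<lambda>z. \<psi> z * Re z) z * u z - \<i> * (dzb (\<lambda>z. \<psi> z * Im z) z * u z) - \<psi> z *\<^sub>R u z" for z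
    unfolding dzb_mult_linear[OF \<psi> bounded_linear_Re] dzb_mult_linear[OF \<psi> bounded_linear_Im] cnj_eq
    by (simp add: scaleR_conv_of_real field_simps)
  have e2: "\<psi> z *\<^sub>R (u z + cnj z * w z) = \<psi> z *\<^sub>R u z + (\<psi> z * Re z) *\<^sub>R w z - \<i> * ((\<psi> z * Im z) *\<^sub>R w z)" for z
    unfolding cnj_eq by (simp add: scaleR_conv_of_real algebra_simps)
  have "(LINT z|lborel. dzb \<psi> z * (cnj z * u z)) = (LINT z|lborel. dzb (\<lambda>z. \<psi> z * Re z) z * u z)
      - \<i> * (LINT z|lborel. dzb (\<lambda>z. \<psi> z * Im z) z * u z) - (LINT z|lborel. \<psi> z *\<^sub>R u z)"
    unfolding e1
    by (simp only: Bochner_Integration.integral_diff Bochner_Integration.integrable_diff integrable_mult_right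
        integral_mult_right_zero ix iy iu)
  also have "\<dots> = - ((LINT z|lborel. \<psi> z *\<^sub>R u z) + (LINT z|lborel. (\<psi> z * Re z) *\<^sub>R w z) - \<i> * (LINT z|lborel. (\<psi> z * Im z) *\<^sub>R w z))"
    unfolding X Y by simp
  also have "(LINT z|lborel. \<psi> z *\<^sub>R u z) + (LINT z|lborel. (\<psi> z * Re z) *\<^sub>R w z) - \<i> * (LINT z|lborel. (\<psi> z * Im z) *\<^sub>R w z)
      = (LINT z|lborel. \<psi> z *\<^sub>R (u z + cnj z * w z))"
    unfolding e2
    by (simp only: Bochner_Integration.integral_diff Bochner_Integration.integral_add Bochner_Integration.integrable_add integrable_mult_right
        integral_mult_right_zero ix iy iu)
  finally show "(LINT z|lborel. dzb \<psi> z * (cnj z * u z)) = - (LINT z|lborel. \<psi> z *\<^sub>R (u z + cnj z * w z))" .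
qed

section \<open>Hardy bounds under sums and bounded factors\<close>

definition hardy_bounded :: "real \<Rightarrow> (complex \<Rightarrow> complex) \<Rightarrow> bool" where
  "hardy_bounded p u \<longleftrightarrow> continuous_on unit_disc u \<and>
     (\<exists>K. \<forall>r. 0 < r \<and> r < 1 \<longrightarrow> integral {0..2*pi} (\<lambda>t. cmod (u (rcis r t)) powr p) \<le> K)"

lemma circle_powr_integrable:
  fixes u :: "complex \<Rightarrow> 'a::real_normed_vector"
  assumes "continuous_on unit_disc u" "0 < p" "0 < r" "r < 1"
  shows "continuous_on {0..2*pi} (\<lambda>t. norm (u (rcis r t)) powr p)"
    "(\<lambda>t. norm (u (rcis r t)) powr p) integrable_on {0..2*pi}"
proof -
  show "continuous_on {0..2*pi} (\<lambda>t. norm (u (rcis r t)) powr p)"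
    using assms by (intro continuous_on_powr' continuous_intros continuous_on_circle[OF assms(1)]) auto
  then show "(\<lambda>t. norm (u (rcis r t)) powr p) integrable_on {0..2*pi}"
    by (rule integrable_continuous_interval)
qed

lemma powr_add_le:
  fixes x y p :: real
  assumes "0 \<le> x" "0 \<le> y" "0 < p"
  shows "(x + y) powr p \<le> 2 powr p * (x powr p + y powr p)"
proof -
  have "(x + y) powr p \<le> (2 * max x y) powr p" using assms by (intro powr_mono2) auto
  also have "\<dots> = 2 powr p * max x y powr p" using assms by (simp add: powr_mult max_def)
  also have "\<dots> \<le> 2 powr p * (x powr p + y powr p)" by (intro mult_left_mono) (auto simp: max_def)
  finally show ?thesis .
qed

text \<open>The quasi-triangle inequality \<open>powr_add_le\<close>, with constant 2^p, treats all
  p > 0 alike.\<close>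

lemma hardy_bounded_le:
  assumes p: "0 < p" and c: "continuous_on unit_disc v" and u: "hardy_bounded p u" and u': "hardy_bounded p u'"
    and le: "\<And>z. cmod z < 1 \<Longrightarrow> cmod (v z) \<le> M * cmod (u z) + M * cmod (u' z)" and M: "0 \<le> M"
  shows "hardy_bounded p v"
proof -
  obtain K K' where K: "\<And>r. 0 < r \<Longrightarrow> r < 1 \<Longrightarrow> integral {0..2*pi} (\<lambda>t. cmod (u (rcis r t)) powr p) \<le> K"
    "\<And>r. 0 < r \<Longrightarrow> r < 1 \<Longrightarrow> integral {0..2*pi} (\<lambda>t. cmod (u' (rcis r t)) powr p) \<le> K'"
    and cu: "continuous_on unit_disc u" "continuous_on unit_disc u'"
    using u u' by (auto simp: hardy_bounded_def)
  define C where "C = 2 powr p * M powr p"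
  have C: "0 \<le> C" by (simp add: C_def)
  have "integral {0..2*pi} (\<lambda>t. cmod (v (rcis r t)) powr p) \<le> C * (K + K')" if r: "0 < r" "r < 1" for r
  proof -
    note i = circle_powr_integrable(2)[OF cu(1) p r] circle_powr_integrable(2)[OF cu(2) p r]
    have "integral {0..2*pi} (\<lambda>t. cmod (v (rcis r t)) powr p)
      \<le> integral {0..2*pi} (\<lambda>t. C * (cmod (u (rcis r t)) powr p + cmod (u' (rcis r t)) powr p))"
    proof (rule integral_le)
      show "(\<lambda>t. cmod (v (rcis r t)) powr p) integrable_on {0..2*pi}" by (rule circle_powr_integrable(2)[OF c p r])
      show "(\<lambda>t. C * (cmod (u (rcis r t)) powr p + cmod (u' (rcis r t)) powr p)) integrable_on {0..2*pi}"
        by (intro integrable_continuous_interval continuous_on_mult continuous_on_add continuous_on_const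
            circle_powr_integrable(1)[OF cu(1) p r] circle_powr_integrable(1)[OF cu(2) p r])
      fix t
      have "cmod (v (rcis r t)) powr p \<le> (M * cmod (u (rcis r t)) + M * cmod (u' (rcis r t))) powr p"
        using le[of "rcis r t"] r p by (intro powr_mono2) auto
      also have "\<dots> \<le> 2 powr p * ((M * cmod (u (rcis r t))) powr p + (M * cmod (u' (rcis r t))) powr p)"
        using M p by (intro powr_add_le) auto
      also have "\<dots> = C * (cmod (u (rcis r t)) powr p + cmod (u' (rcis r t)) powr p)"
        using M by (simp add: C_def powr_mult algebra_simps)
      finally show "cmod (v (rcis r t)) powr p \<le> C * (cmod (u (rcis r t)) powr p + cmod (u' (rcis r t)) powr p)" .
    qed
    also have "\<dots> = C * (integral {0..2*pi} (\<lambda>t. cmod (u (rcis r t)) powr p) + integral {0..2*pi} (\<lambda>t. cmod (u' (rcis r t)) powr p))"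
      by (simp only: integral_mult_right Henstock_Kurzweil_Integration.integral_add[OF i])
    also have "\<dots> \<le> C * (K + K')" using K(1)[OF r] K(2)[OF r] C by (intro mult_left_mono add_mono) auto
    finally show ?thesis .
  qed
  then show ?thesis using c unfolding hardy_bounded_def by blast
qed

lemma hardy_bounded_zero: "hardy_bounded p (\<lambda>z. 0)"
  by (auto simp: hardy_bounded_def intro!: exI[of _ 0])

lemma hardy_bounded_single:
  assumes "0 < p" "continuous_on unit_disc v" "hardy_bounded p u"
    "\<And>z. cmod z < 1 \<Longrightarrow> cmod (v z) \<le> M * cmod (u z)" "0 \<le> M"
  shows "hardy_bounded p v"
  by (rule hardy_bounded_le[OF assms(1,2,3) hardy_bounded_zero[of p] _ assms(5)]) (use assms(4) in simp)

lemma hardy_bounded_add: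
  assumes "0 < p" "hardy_bounded p u" "hardy_bounded p v" shows "hardy_bounded p (\<lambda>z. u z + v z)"
  by (rule hardy_bounded_le[OF assms(1) _ assms(2,3), where M = 1])
     (use assms in \<open>auto simp: hardy_bounded_def intro!: continuous_intros norm_triangle_ineq\<close>)

lemma hardy_bounded_sum:
  assumes "0 < p" "finite I" "\<And>i. i \<in> I \<Longrightarrow> hardy_bounded p (u i)" shows "hardy_bounded p (\<lambda>z. \<Sum>i\<in>I. u i z)"
  using assms(2,3) by (induction I rule: finite_induct) (auto intro: hardy_bounded_zero hardy_bounded_add assms(1))

section \<open>Recovering the coefficients from the iterates\<close>

context cauchy_transform
begin

lemma loc_int_a: "loc_int a"
  unfolding loc_int_def
proof (intro allI impI)
  fix \<rho> :: real
  show "integrable lborel (cut \<rho> a)"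
    by (rule Bochner_Integration.integrable_bound[OF a_integrable]) (auto simp: indicator_def)
qed

text \<open>Each further factor \<open>cnj z\<close> contributes one term by the product rule. For k
  = 0 the truncated exponent k - 1 is harmless because its term carries the factor
  \<open>of_nat 0\<close>.\<close>

lemma weak_sol_cnj_power:
  assumes u: "weak_sol u (\<lambda>z. a z * u z)" and c: "continuous_on unit_disc u"
  shows "weak_sol (\<lambda>z. cnj z ^ k * u z) (\<lambda>z. a z * (cnj z ^ k * u z) + of_nat k * cnj z ^ (k - 1) * u z)"
proof (induction k)
  case 0 then show ?case using u by simp
next
  case (Suc k)
  have cc: "continuous_on unit_disc (\<lambda>z. cnj z ^ k * u z)" by (intro continuous_intros c)
  have "loc_int (\<lambda>z. a z * (cnj z ^ k * u z) + of_nat k * cnj z ^ (k - 1) * u z)"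
    by (intro loc_int_add loc_int_mult[OF loc_int_a cc] loc_int_continuous continuous_intros c)
  from weak_sol_cnj_mult[OF Suc cc this]
  show ?case by (rule weak_sol_cong) (cases k; simp add: algebra_simps)+
qed

lemma weak_sol_poly:
  assumes "\<And>k. k < n \<Longrightarrow> weak_sol (u k) (\<lambda>z. a z * u k z)" "\<And>k. k < n \<Longrightarrow> continuous_on unit_disc (u k)"
  shows "weak_sol (\<lambda>z. \<Sum>k<n. cnj z ^ k * u k z)
     (\<lambda>z. a z * (\<Sum>k<n. cnj z ^ k * u k z) + (\<Sum>k<n. of_nat k * cnj z ^ (k - 1) * u k z))"
  using assms
proof (induction n)
  case 0 show ?case by (simp add: weak_sol_def)
next
  case (Suc n)
  have c: "continuous_on unit_disc (u k)" if "k < Suc n" for k using Suc.prems(2)[OF that] .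
  have cs: "continuous_on unit_disc (\<lambda>z. \<Sum>k<n. cnj z ^ k * u k z)" "continuous_on unit_disc (\<lambda>z. \<Sum>k<n. of_nat k * cnj z ^ (k - 1) * u k z)"
    "continuous_on unit_disc (\<lambda>z. cnj z ^ n * u n z)" "continuous_on unit_disc (\<lambda>z. of_nat n * cnj z ^ (n - 1) * u n z)"
    using c by (auto intro!: continuous_intros)
  have "weak_sol (\<lambda>z. (\<Sum>k<n. cnj z ^ k * u k z) + cnj z ^ n * u n z)
     (\<lambda>z. (a z * (\<Sum>k<n. cnj z ^ k * u k z) + (\<Sum>k<n. of_nat k * cnj z ^ (k - 1) * u k z))
        + (a z * (cnj z ^ n * u n z) + of_nat n * cnj z ^ (n - 1) * u n z))"
    using Suc by (intro weak_sol_add weak_sol_cnj_power loc_int_add loc_int_mult loc_int_a loc_int_continuous cs) auto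
  then show ?case by (rule weak_sol_cong) (auto simp: algebra_simps)
qed

text \<open>The operator \<open>\<partial>/\<partial>z\<^sup>* - a\<close> shifts the coefficients of a polynomial in \<open>z\<^sup>*\<close>, so the
  coefficients are recovered from the iterates, from the top down.\<close>

lemma coefficients_hardy_bounded:
  assumes p: "0 < p"
    and "\<And>k. k < n \<Longrightarrow> weak_sol (u k) (\<lambda>z. a z * u k z)" "\<And>k. k < n \<Longrightarrow> continuous_on unit_disc (u k)"
    and "\<And>z. cmod z < 1 \<Longrightarrow> g 0 z = (\<Sum>k<n. cnj z ^ k * u k z)"
    and "\<And>k. k < n \<Longrightarrow> weak_sol (g k) (\<lambda>z. a z * g k z + g (Suc k) z)"
    and "\<And>k. k < n \<Longrightarrow> hardy_bounded p (g k)"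
  shows "\<forall>k<n. hardy_bounded p (u k)"
  using assms(2-)
proof (induction n arbitrary: u g)
  case (Suc n)
  note weak = Suc.prems(1) and cont = Suc.prems(2) and g0 = Suc.prems(3) and wg = Suc.prems(4) and hg = Suc.prems(5)
  \<comment> \<open>The coefficients of the first iterate, from differentiating the powers of cnj z;
    the induction runs over the sequence of iterates starting there.\<close>
  define u' where "u' k z = of_nat (Suc k) * u (Suc k) z" for k z
  have contg: "continuous_on unit_disc (g k)" if "k < Suc n" for k using hg[OF that] by (simp add: hardy_bounded_def)
  have up': "\<forall>k<n. hardy_bounded p (u' k)"
  \<comment> \<open>For n = 0 there is no higher coefficient to treat, and \<open>contg\<close> does
    not reach \<open>g (Suc 0)\<close>.\<close>
  proof (cases "n = 0")
   case False
   show ?thesis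
   proof (rule Suc.IH[of u' "\<lambda>k. g (Suc k)"])
    show "weak_sol (u' k) (\<lambda>z. a z * u' k z)" if "k < n" for k
      using weak_sol_cmult[OF weak[of "Suc k"], of "of_nat (Suc k)"] that
      unfolding u'_def by (simp add: mult.left_commute)
    show "continuous_on unit_disc (u' k)" if "k < n" for k
      unfolding u'_def using cont[of "Suc k"] that by (intro continuous_intros) auto
    show "weak_sol (g (Suc k)) (\<lambda>z. a z * g (Suc k) z + g (Suc (Suc k)) z)" if "k < n" for k using wg[of "Suc k"] that by simp
    show "hardy_bounded p (g (Suc k))" if "k < n" for k using hg[of "Suc k"] that by simp
    show "g (Suc 0) z = (\<Sum>k<n. cnj z ^ k * u' k z)" if z: "cmod z < 1" for z
    proof -
      let ?P = "\<lambda>z. \<Sum>k<Suc n. cnj z ^ k * u k z" and ?Q = "\<lambda>z. \<Sum>k<Suc n. of_nat k * cnj z ^ (k - 1) * u k z"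
      have Q: "?Q z = (\<Sum>k<n. cnj z ^ k * u' k z)" for z
        by (subst sum.lessThan_Suc_shift) (simp add: u'_def mult_ac)
      have cQ: "continuous_on unit_disc ?Q" by (intro continuous_intros cont) auto
      have cP: "continuous_on unit_disc ?P" by (intro continuous_intros cont) auto
      have cg1: "continuous_on unit_disc (g (Suc 0))" using contg[of "Suc 0"] False by simp
      have w1: "weak_sol ?P (\<lambda>z. a z * ?P z + g (Suc 0) z)"
        by (rule weak_sol_cong[OF wg[of 0]]) (use g0 in auto)
      have w2: "weak_sol ?P (\<lambda>z. a z * ?P z + ?Q z)" by (rule weak_sol_poly[OF weak cont])
      \<comment> \<open>The polynomial has two expressions for its weak derivative. The common term
        a P cancels and both remainders are continuous, so agreement against test functions is
        agreement at every point.\<close>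
      have "g (Suc 0) z - ?Q z = 0"
      proof (rule test_functions_separate[OF _ _ z])
        show "continuous_on unit_disc (\<lambda>z. g (Suc 0) z - ?Q z)" by (intro continuous_intros cg1 cont) auto
        fix \<psi> assume t: "test_function \<psi>"
        then obtain R where R: "0 < R" "R < 1" and \<psi>: "csmooth R \<psi>" by (rule test_function_csmooth)
        have "(LINT z|lborel. \<psi> z *\<^sub>R (a z * ?P z + g (Suc 0) z)) = (LINT z|lborel. \<psi> z *\<^sub>R (a z * ?P z + ?Q z))"
          by (rule weak_sol_unique[OF w1 w2 t])
        moreover note loc_int_test(1)[OF loc_int_mult[OF loc_int_a cP] \<psi> R(2)]
          loc_int_test(1)[OF loc_int_continuous[OF cg1] \<psi> R(2)] loc_int_test(1)[OF loc_int_continuous[OF cQ] \<psi> R(2)]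
        ultimately show "(LINT z|lborel. \<psi> z *\<^sub>R (g (Suc 0) z - ?Q z)) = 0"
          by (simp only: scaleR_add_right scaleR_diff_right Bochner_Integration.integral_add Bochner_Integration.integral_diff) simp
      qed
      then have "g (Suc 0) z = ?Q z" by (simp only: right_minus_eq)
      then show ?thesis by (simp only: Q)
    qed
   qed
  qed simp
  have up: "hardy_bounded p (u (Suc k))" if "k < n" for k
  proof -
    have hb: "hardy_bounded p (u' k)" using that up' by blast
    show ?thesis
    proof (rule hardy_bounded_single[OF p _ hb, where M = 1])
      show "continuous_on unit_disc (u (Suc k))" using cont that by simp
      show "cmod (u (Suc k) z) \<le> 1 * cmod (u' k z)" for z
        using mult_right_mono[of 1 "real (Suc k)" "cmod (u (Suc k) z)"] unfolding u'_def norm_mult norm_of_nat by simp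
    qed simp
  qed
  \<comment> \<open>The bottom coefficient is what remains of the polynomial after removing the
    others; powers of cnj z have modulus at most 1 in the disc.\<close>
  have hs: "hardy_bounded p (\<lambda>z. g 0 z + (\<Sum>k<n. - (cnj z ^ Suc k * u (Suc k) z)))"
  proof (intro hardy_bounded_add hardy_bounded_sum p)
    show "hardy_bounded p (g 0)" using hg by simp
    show "hardy_bounded p (\<lambda>z. - (cnj z ^ Suc k * u (Suc k) z))" if "k \<in> {..<n}" for k
      by (rule hardy_bounded_single[OF p _ up[of k], where M = 1])
         (use cont[of "Suc k"] that in \<open>auto intro!: continuous_intros mult_left_le_one_le power_le_one mult_le_one simp: norm_mult norm_power\<close>)
  qed simp
  have "hardy_bounded p (u 0)"
    by (rule hardy_bounded_single[OF p _ hs, where M = 1])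
       (simp_all add: cont g0 sum.lessThan_Suc_shift sum_negf del: sum.lessThan_Suc)
  then show ?case using up by (metis less_Suc_eq_0_disj)
qed simp

end

section \<open>Boundary behaviour of the complex components\<close>

lemma nt_converges_continuous:
  fixes v :: "complex \<Rightarrow> complex"
  assumes "continuous_on UNIV v" shows "nt_converges v \<zeta>"
proof -
  have "isCont v \<zeta>" using assms by (simp add: continuous_on_eq_continuous_at)
  then have "(v \<longlongrightarrow> v \<zeta>) (at \<zeta> within s)" for s
    using isCont_def tendsto_within_subset by blast
  then show ?thesis unfolding nt_converges_def by blast
qed

lemma nt_converges_add:
  fixes F G :: "complex \<Rightarrow> 'a::real_normed_vector"
  assumes "nt_converges F \<zeta>" "nt_converges G \<zeta>" shows "nt_converges (\<lambda>z. F z + G z) \<zeta>"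
  using assms unfolding nt_converges_def by (blast intro: tendsto_add)

lemma nt_converges_sum:
  fixes F :: "nat \<Rightarrow> complex \<Rightarrow> complex"
  assumes "\<And>k. k < n \<Longrightarrow> nt_converges (F k) \<zeta>" shows "nt_converges (\<lambda>z. \<Sum>k<n. F k z) \<zeta>"
  using assms
  by (induction n) (auto intro: nt_converges_add nt_converges_continuous continuous_on_const)

lemma nt_converges_bounded_linear:
  assumes "bounded_linear T" "nt_converges F \<zeta>" shows "nt_converges (\<lambda>z. T (F z)) \<zeta>"
  using assms unfolding nt_converges_def by (blast intro: bounded_linear.tendsto)

lemma sum_powr_le:
  fixes x :: "nat \<Rightarrow> real"
  assumes p: "0 < p" and x: "\<And>k. 0 \<le> x k"
  shows "(\<Sum>k<n. x k) powr p \<le> (2 powr p) ^ n * (\<Sum>k<n. x k powr p)"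
proof (induction n)
  case (Suc n)
  have "(\<Sum>k<Suc n. x k) powr p \<le> 2 powr p * ((\<Sum>k<n. x k) powr p + x n powr p)"
    using powr_add_le[of "\<Sum>k<n. x k" "x n" p] x p by (simp add: sum_nonneg)
  also have "\<dots> \<le> 2 powr p * ((2 powr p) ^ n * (\<Sum>k<n. x k powr p) + (2 powr p) ^ n * x n powr p)"
  proof (intro mult_left_mono add_mono Suc)
    have "1 \<le> (2 powr p) ^ n" using p by (intro one_le_power) (simp add: ge_one_powr_ge_zero)
    from mult_right_mono[OF this, of "x n powr p"] show "x n powr p \<le> (2 powr p) ^ n * x n powr p" by simp
  qed auto
  finally show ?case by (simp add: algebra_simps)
qed simp

text \<open>Finitely many \<open>H^2\<close> squares form a majorant that depends on the radius but
  converges in \<open>L^1\<close> as r tends to 1. This form is stable under finite sums and bounded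
  factors.\<close>

definition H2_dominated :: "real \<Rightarrow> nat \<Rightarrow> (complex \<Rightarrow> 'a::real_normed_vector) \<Rightarrow> bool" where
  "H2_dominated p n F \<longleftrightarrow> (\<exists>D C. (\<forall>k<n. H2_bounded (D k)) \<and> 0 \<le> C \<and>
     (\<forall>z\<in>unit_disc. norm (F z) powr p \<le> C * (\<Sum>k<n. (cmod (D k z))\<^sup>2)))"

text \<open>e^S is continuous on the plane, hence has a limit at every boundary point and is bounded
  on the closed disc. Limits and majorants of the holomorphic h_k therefore pass to the u_k and to
  the polynomial in cnj z.\<close>

lemma (in cauchy_transform) vekua_boundary:
  assumes p: "0 < p"
    and weak: "\<And>k. k < n \<Longrightarrow> weak_sol (u k) (\<lambda>z. a z * u k z)" and cont: "\<And>k. k < n \<Longrightarrow> continuous_on unit_disc (u k)"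
    and F: "\<And>z. cmod z < 1 \<Longrightarrow> F z = (\<Sum>k<n. cnj z ^ k * u k z)"
    and g0: "\<And>z. cmod z < 1 \<Longrightarrow> g 0 z = F z"
    and wg: "\<And>k. k < n \<Longrightarrow> weak_sol (g k) (\<lambda>z. a z * g k z + g (Suc k) z)"
    and hg: "\<And>k. k < n \<Longrightarrow> hardy_bounded p (g k)"
  shows "AE \<theta> in lebesgue_on {0..2*pi}. nt_converges F (cis \<theta>)" "H2_dominated p n F"
proof -
  have hb: "hardy_bounded p (u k)" if "k < n" for k
  proof -
    have "g 0 z = (\<Sum>k<n. cnj z ^ k * u k z)" if "cmod z < 1" for z using g0[OF that] F[OF that] by simp
    from coefficients_hardy_bounded[of p n u g, OF p weak cont this wg hg] that show ?thesis by blast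
  qed
  define h where "h k z = exp (- S z) * u k z" for k z
  have S: "continuous_on A S" for A by (rule S_continuous)
  obtain B where B: "\<And>\<zeta>. \<zeta> \<in> cball 0 1 \<Longrightarrow> norm (S \<zeta>) \<le> B"
    using compact_imp_bounded[OF compact_continuous_image[OF S compact_cball]] unfolding bounded_iff by blast
  have eB: "norm (exp (- S z)) \<le> exp B" "norm (exp (S z)) \<le> exp B" if "norm z < 1" for z
    using B[of z] that order_trans[OF norm_exp[of "- S z"]] order_trans[OF norm_exp[of "S z"]] by auto
  have hol: "h k holomorphic_on unit_disc" if "k < n" for k
    unfolding h_def by (rule similarity[OF cont[OF that] weak[OF that]])
  have hh: "hardy_bounded p (h k)" if "k < n" for k
  proof (rule hardy_bounded_single[OF p _ hb[OF that], where M = "exp B"])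
    show "continuous_on unit_disc (h k)" using hol[OF that] by (rule holomorphic_on_imp_continuous_on)
    show "cmod (h k z) \<le> exp B * cmod (u k z)" if "cmod z < 1" for z
      unfolding h_def norm_mult using eB(1)[OF that] by (intro mult_right_mono) auto
  qed simp
  have uh: "u k z = exp (S z) * h k z" for k z by (simp add: h_def exp_minus)
  have bd: "AE \<theta> in lebesgue_on {0..2*pi}. nt_converges (h k) (cis \<theta>)"
    "\<exists>D. H2_bounded D \<and> (\<forall>z. cmod z < 1 \<longrightarrow> cmod (h k z) powr p \<le> (cmod (D z))\<^sup>2)" if kn: "k < n" for k
  proof -
    obtain K where "\<And>r. 0 < r \<Longrightarrow> r < 1 \<Longrightarrow> integral {0..2*pi} (\<lambda>t. cmod (h k (rcis r t)) powr p) \<le> K"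
      using hh[OF kn] by (auto simp: hardy_bounded_def)
    from Hp_boundary[OF hol[OF kn] p this]
    show "AE \<theta> in lebesgue_on {0..2*pi}. nt_converges (h k) (cis \<theta>)"
      "\<exists>D. H2_bounded D \<and> (\<forall>z. cmod z < 1 \<longrightarrow> cmod (h k z) powr p \<le> (cmod (D z))\<^sup>2)" by auto
  qed
  have "AE \<theta> in lebesgue_on {0..2*pi}. \<forall>k\<in>{..<n}. nt_converges (h k) (cis \<theta>)"
    using bd(1) by (intro AE_finite_allI) auto
  then show "AE \<theta> in lebesgue_on {0..2*pi}. nt_converges F (cis \<theta>)"
  proof eventually_elim
    case (elim \<theta>)
    have "nt_converges (\<lambda>z. \<Sum>k<n. (cnj z ^ k * exp (S z)) * h k z) (cis \<theta>)"
    proof (rule nt_converges_sum)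
      fix k assume "k < n"
      then have hk: "nt_converges (h k) (cis \<theta>)" using elim by simp
      show "nt_converges (\<lambda>z. (cnj z ^ k * exp (S z)) * h k z) (cis \<theta>)"
        by (rule nt_converges_mult[OF _ hk]) (intro nt_converges_continuous continuous_intros S)
    qed
    moreover have "F z = (\<Sum>k<n. (cnj z ^ k * exp (S z)) * h k z)" if "cmod z < 1" for z
      using F[OF that] by (simp add: uh mult.assoc)
    ultimately show ?case using nt_converges_cong[of F "\<lambda>z. \<Sum>k<n. (cnj z ^ k * exp (S z)) * h k z"] by blast
  qed
  have "\<forall>k. \<exists>D. k < n \<longrightarrow> H2_bounded D \<and> (\<forall>z. cmod z < 1 \<longrightarrow> cmod (h k z) powr p \<le> (cmod (D z))\<^sup>2)"
    using bd(2) by blast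
  from choice[OF this] obtain D where D: "\<And>k. k < n \<Longrightarrow> H2_bounded (D k)"
    "\<And>k z. k < n \<Longrightarrow> cmod z < 1 \<Longrightarrow> cmod (h k z) powr p \<le> (cmod (D k z))\<^sup>2" by blast
  \<comment> \<open>(2^p)^n splits the power of a sum of n terms, and exp B bounds |e^S|.\<close>
  define C where "C = (2 powr p) ^ n * exp B powr p"
  have "norm (F z) powr p \<le> C * (\<Sum>k<n. (cmod (D k z))\<^sup>2)" if z: "z \<in> unit_disc" for z
  proof -
    have z1: "cmod z < 1" using z by simp
    have "norm (F z) \<le> (\<Sum>k<n. exp B * cmod (h k z))"
    proof -
      have "norm (F z) \<le> (\<Sum>k<n. norm (cnj z ^ k * u k z))" unfolding F[OF z1] by (rule norm_sum)
      also have "\<dots> \<le> (\<Sum>k<n. exp B * cmod (h k z))"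
      proof (rule sum_mono)
        fix k
        have "norm (cnj z ^ k * u k z) = cmod z ^ k * (cmod (exp (S z)) * cmod (h k z))"
          by (simp add: uh norm_mult norm_power)
        also have "\<dots> \<le> 1 * (exp B * cmod (h k z))"
          using z1 eB(2)[OF z1] by (intro mult_mono mult_right_mono power_le_one) auto
        finally show "norm (cnj z ^ k * u k z) \<le> exp B * cmod (h k z)" by simp
      qed
      finally show ?thesis .
    qed
    then have "norm (F z) powr p \<le> (\<Sum>k<n. exp B * cmod (h k z)) powr p" using p by (intro powr_mono2) auto
    also have "\<dots> \<le> (2 powr p) ^ n * (\<Sum>k<n. (exp B * cmod (h k z)) powr p)" by (rule sum_powr_le[OF p]) simp
    also have "\<dots> = C * (\<Sum>k<n. cmod (h k z) powr p)"
      by (simp add: C_def powr_mult sum_distrib_left mult_ac)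
    also have "\<dots> \<le> C * (\<Sum>k<n. (cmod (D k z))\<^sup>2)"
      using D(2)[OF _ z1] by (intro mult_left_mono sum_mono) (auto simp: C_def)
    finally show ?thesis .
  qed
  moreover have "0 \<le> C" by (simp add: C_def)
  ultimately show "H2_dominated p n F" unfolding H2_dominated_def using D(1) by blast
qed

text \<open>Generalized dominated convergence: the p-th power of the difference is at most C' (e +
  d_r), where e is fixed and integrable and d_r tends to 0 in \<open>L^1\<close>.\<close>

lemma circle_int_tendsto_zero:
  fixes f :: "complex \<Rightarrow> 'a::euclidean_space"
  assumes p: "0 < p" and cont: "continuous_on unit_disc f"
    and nt: "AE \<theta> in lebesgue_on {0..2*pi}. nt_converges f (cis \<theta>)" and dom: "H2_dominated p n f"
  shows "((\<lambda>r. circle_int p (\<lambda>\<theta>. radial_limit f (cis \<theta>) - f (rcis r \<theta>))) \<longlongrightarrow> 0) (at_left 1)" (is ?lim)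
    and "integrable (lebesgue_on {0..2*pi}) (\<lambda>\<theta>. norm (radial_limit f (cis \<theta>)) powr p)" (is ?int)
proof -
  define M where "M = lebesgue_on {0..2*pi}"
  obtain D C where D: "\<And>k. k < n \<Longrightarrow> H2_bounded (D k)" and C: "0 \<le> C"
    and dom: "\<And>z. z \<in> unit_disc \<Longrightarrow> norm (f z) powr p \<le> C * (\<Sum>k<n. (cmod (D k z))\<^sup>2)"
    using dom unfolding H2_dominated_def by blast
  have Dh: "D k holomorphic_on unit_disc" and DK: "\<exists>K. \<forall>r. 0 < r \<and> r < 1 \<longrightarrow> integral {0..2*pi} (\<lambda>t. (cmod (D k (rcis r t)))\<^sup>2) \<le> K"
    if "k < n" for k using D[OF that] by (auto simp: H2_bounded_def)
  have Dc: "continuous_on unit_disc (D k)" if "k < n" for k using Dh[OF that] by (rule holomorphic_on_imp_continuous_on)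
  define Db where "Db k \<theta> = radial_limit (D k) (cis \<theta>)" for k \<theta>
  define fb where "fb \<theta> = radial_limit f (cis \<theta>)" for \<theta>
  have mfb: "fb \<in> borel_measurable M" unfolding M_def fb_def using cont by (rule borel_measurable_radial_limit)
  have mDb: "Db k \<in> borel_measurable M" if "k < n" for k unfolding M_def Db_def using Dc[OF that] by (rule borel_measurable_radial_limit)
  have mf: "(\<lambda>\<theta>. f (rcis r \<theta>)) \<in> borel_measurable M" if "0 < r" "r < 1" for r
    unfolding M_def using that by (intro continuous_imp_measurable_on_sets_lebesgue continuous_on_circle[OF cont]) auto
  have mD: "(\<lambda>\<theta>. D k (rcis r \<theta>)) \<in> borel_measurable M" if "0 < r" "r < 1" "k < n" for r k
    unfolding M_def using that by (intro continuous_imp_measurable_on_sets_lebesgue continuous_on_circle[OF Dc]) auto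
  define d where "d r \<theta> = (\<Sum>k<n. (cmod (D k (rcis r \<theta>) - Db k \<theta>))\<^sup>2)" for r \<theta>
  define e where "e \<theta> = (\<Sum>k<n. (cmod (Db k \<theta>))\<^sup>2)" for \<theta>
  have d0: "0 \<le> d r \<theta>" and e0: "0 \<le> e \<theta>" for r \<theta> by (auto simp: d_def e_def sum_nonneg)
  have md: "d r \<in> borel_measurable M" if "0 < r" "r < 1" for r
    unfolding d_def using mD[OF that] mDb
    by (intro borel_measurable_sum borel_measurable_power borel_measurable_norm borel_measurable_diff) auto
  have me: "e \<in> borel_measurable M"
    unfolding e_def using mDb by (intro borel_measurable_sum borel_measurable_power borel_measurable_norm) auto
  have Dlim: "((\<lambda>r. \<integral>\<^sup>+\<theta>. ennreal ((cmod (D k (rcis r \<theta>) - Db k \<theta>))\<^sup>2) \<partial>M) \<longlongrightarrow> 0) (at_left 1)"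
    and Dfin: "(\<integral>\<^sup>+\<theta>. ennreal ((cmod (Db k \<theta>))\<^sup>2) \<partial>M) < \<infinity>" if k: "k < n" for k
  proof -
    obtain K where "\<And>r. 0 < r \<Longrightarrow> r < 1 \<Longrightarrow> integral {0..2*pi} (\<lambda>t. (cmod (D k (rcis r t)))\<^sup>2) \<le> K" using DK[OF k] by blast
    from H2_mean_convergence[OF Dh[OF k] this]
    show "((\<lambda>r. \<integral>\<^sup>+\<theta>. ennreal ((cmod (D k (rcis r \<theta>) - Db k \<theta>))\<^sup>2) \<partial>M) \<longlongrightarrow> 0) (at_left 1)"
      "(\<integral>\<^sup>+\<theta>. ennreal ((cmod (Db k \<theta>))\<^sup>2) \<partial>M) < \<infinity>" by (auto simp: M_def Db_def)
  qed
  have efin: "(\<integral>\<^sup>+\<theta>. ennreal (e \<theta>) \<partial>M) < \<infinity>"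
  proof -
    have "(\<integral>\<^sup>+\<theta>. ennreal (e \<theta>) \<partial>M) = (\<Sum>k<n. \<integral>\<^sup>+\<theta>. ennreal ((cmod (Db k \<theta>))\<^sup>2) \<partial>M)"
      unfolding e_def using mDb by (subst nn_integral_sum[symmetric]) auto
    then show ?thesis using Dfin by simp
  qed
  have dlim: "((\<lambda>r. \<integral>\<^sup>+\<theta>. ennreal (d r \<theta>) \<partial>M) \<longlongrightarrow> 0) (at_left 1)"
  proof -
    have "((\<lambda>r. \<Sum>k<n. \<integral>\<^sup>+\<theta>. ennreal ((cmod (D k (rcis r \<theta>) - Db k \<theta>))\<^sup>2) \<partial>M) \<longlongrightarrow> (\<Sum>k<n. 0)) (at_left 1)"
      using Dlim by (intro tendsto_sum) auto
    moreover have "eventually (\<lambda>r. (\<Sum>k<n. \<integral>\<^sup>+\<theta>. ennreal ((cmod (D k (rcis r \<theta>) - Db k \<theta>))\<^sup>2) \<partial>M) = (\<integral>\<^sup>+\<theta>. ennreal (d r \<theta>) \<partial>M)) (at_left 1)"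
    proof (rule eventually_at_leftI[of 0])
      fix r :: real assume r: "r \<in> {0<..<1}"
      show "(\<Sum>k<n. \<integral>\<^sup>+\<theta>. ennreal ((cmod (D k (rcis r \<theta>) - Db k \<theta>))\<^sup>2) \<partial>M) = (\<integral>\<^sup>+\<theta>. ennreal (d r \<theta>) \<partial>M)"
        unfolding d_def using mDb mD[of r] r by (subst nn_integral_sum[symmetric]) auto
    qed simp
    ultimately show ?thesis by (simp add: Lim_transform_eventually)
  qed
  have AEf: "AE \<theta> in M. ((\<lambda>r. f (rcis r \<theta>)) \<longlongrightarrow> fb \<theta>) (at_left 1)"
    using nt unfolding M_def fb_def
  proof eventually_elim
    case (elim \<theta>)
    from nt_converges_at_left(2)[OF elim norm_cis] show ?case by (simp add: rcis_def)
  qed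
  have "AE \<theta> in M. \<forall>k\<in>{..<n}. ((\<lambda>r. D k (rcis r \<theta>)) \<longlongrightarrow> Db k \<theta>) (at_left 1)"
  proof (rule AE_finite_allI)
    fix k assume k: "k \<in> {..<n}"
    then have "AE \<theta> in M. nt_converges (D k) (cis \<theta>)" unfolding M_def using H2_bounded_nt[OF D[of k]] by simp
    then show "AE \<theta> in M. ((\<lambda>r. D k (rcis r \<theta>)) \<longlongrightarrow> Db k \<theta>) (at_left 1)"
      unfolding Db_def
    proof eventually_elim
      case (elim \<theta>)
      from nt_converges_at_left(2)[OF elim norm_cis] show ?case by (simp add: rcis_def)
    qed
  qed simp
  \<comment> \<open>The majorization inside the disc passes to the boundary along almost every
    radius.\<close>
  then have fbe: "AE \<theta> in M. norm (fb \<theta>) powr p \<le> C * e \<theta>"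
    using AEf
  proof eventually_elim
    case (elim \<theta>)
    show ?case
    proof (rule tendsto_le[OF trivial_limit_at_left_real])
      show "((\<lambda>r. norm (f (rcis r \<theta>)) powr p) \<longlongrightarrow> norm (fb \<theta>) powr p) (at_left 1)"
        using p by (intro tendsto_powr' tendsto_norm elim(2)) auto
      show "((\<lambda>r. C * (\<Sum>k<n. (cmod (D k (rcis r \<theta>)))\<^sup>2)) \<longlongrightarrow> C * e \<theta>) (at_left 1)"
        unfolding e_def using elim(1) by (intro tendsto_intros) auto
      show "eventually (\<lambda>r. norm (f (rcis r \<theta>)) powr p \<le> C * (\<Sum>k<n. (cmod (D k (rcis r \<theta>)))\<^sup>2)) (at_left 1)"
        by (rule eventually_at_leftI[of 0]) (auto intro!: dom)
    qed
  qed
  show ?int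
  proof (rule integrableI_nonneg)
    show "(\<lambda>\<theta>. norm (radial_limit f (cis \<theta>)) powr p) \<in> borel_measurable (lebesgue_on {0..2*pi})"
      using mfb unfolding fb_def M_def by measurable
    have "(\<integral>\<^sup>+\<theta>. ennreal (norm (fb \<theta>) powr p) \<partial>M) \<le> (\<integral>\<^sup>+\<theta>. ennreal C * ennreal (e \<theta>) \<partial>M)"
      using fbe by (intro nn_integral_mono_AE) (auto elim!: eventually_mono simp: ennreal_leI C e0 simp flip: ennreal_mult)
    also have "\<dots> = ennreal C * (\<integral>\<^sup>+\<theta>. ennreal (e \<theta>) \<partial>M)" using me by (intro nn_integral_cmult) auto
    also have "\<dots> < \<infinity>" using efin by (simp add: ennreal_mult_less_top)
    finally show "(\<integral>\<^sup>+\<theta>. ennreal (norm (radial_limit f (cis \<theta>)) powr p) \<partial>lebesgue_on {0..2*pi}) < \<infinity>"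
      by (simp add: fb_def M_def)
  qed auto
  \<comment> \<open>2^p splits the difference. The boundary value then contributes C e and the
    circle value 2 C e + 2 C d, whence the 3.\<close>
  define C' where "C' = 2 powr p * (3 * C)"
  have C': "0 \<le> C'" using C by (simp add: C'_def)
  define X where "X r \<theta> = norm (fb \<theta> - f (rcis r \<theta>)) powr p" for r \<theta>
  have key: "AE \<theta> in M. \<forall>r. 0 < r \<and> r < 1 \<longrightarrow> X r \<theta> \<le> C' * e \<theta> + C' * d r \<theta>"
    using fbe
  proof (eventually_elim, intro allI impI)
    fix \<theta> r assume b: "norm (fb \<theta>) powr p \<le> C * e \<theta>" and r: "0 < r \<and> r < (1::real)"
    have "(\<Sum>k<n. (cmod (D k (rcis r \<theta>)))\<^sup>2) \<le> 2 * d r \<theta> + 2 * e \<theta>"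
    proof -
      have "(cmod x)\<^sup>2 \<le> 2 * (cmod (x - y))\<^sup>2 + 2 * (cmod y)\<^sup>2" for x y :: complex
      proof -
        have "(cmod x)\<^sup>2 \<le> (cmod (x - y) + cmod y)\<^sup>2" using norm_triangle_sub[of x y] by (intro power_mono) auto
        then show ?thesis using sum_squares_bound[of "cmod (x - y)" "cmod y"] by (simp add: power2_sum)
      qed
      then have "(\<Sum>k<n. (cmod (D k (rcis r \<theta>)))\<^sup>2) \<le> (\<Sum>k<n. 2 * (cmod (D k (rcis r \<theta>) - Db k \<theta>))\<^sup>2 + 2 * (cmod (Db k \<theta>))\<^sup>2)"
        by (intro sum_mono)
      then show ?thesis by (simp add: d_def e_def sum.distrib sum_distrib_left)
    qed
    then have "C * (\<Sum>k<n. (cmod (D k (rcis r \<theta>)))\<^sup>2) \<le> C * (2 * d r \<theta> + 2 * e \<theta>)" using C by (rule mult_left_mono)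
    moreover have "norm (f (rcis r \<theta>)) powr p \<le> C * (\<Sum>k<n. (cmod (D k (rcis r \<theta>)))\<^sup>2)" using r by (intro dom) simp
    ultimately have fr: "norm (f (rcis r \<theta>)) powr p \<le> C * (2 * d r \<theta> + 2 * e \<theta>)" by linarith
    have "X r \<theta> \<le> (norm (fb \<theta>) + norm (f (rcis r \<theta>))) powr p"
      unfolding X_def using p by (intro powr_mono2 norm_triangle_ineq4) auto
    also have "\<dots> \<le> 2 powr p * (norm (fb \<theta>) powr p + norm (f (rcis r \<theta>)) powr p)" using p by (intro powr_add_le) auto
    also have "\<dots> \<le> 2 powr p * (C * e \<theta> + C * (2 * d r \<theta> + 2 * e \<theta>))" using b fr by (intro mult_left_mono add_mono) auto
    also have "\<dots> \<le> C' * e \<theta> + C' * d r \<theta>"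
    proof -
      have "0 \<le> 2 powr p * (C * d r \<theta>)" using C d0 by simp
      then show ?thesis by (simp add: C'_def algebra_simps)
    qed
    finally show "X r \<theta> \<le> C' * e \<theta> + C' * d r \<theta>" .
  qed
  have mX: "X r \<in> borel_measurable M" if "0 < r" "r < 1" for r
    unfolding X_def using mfb mf[OF that] by measurable
  have "((\<lambda>r. \<integral>\<^sup>+\<theta>. ennreal (X r \<theta>) \<partial>M) \<longlongrightarrow> 0) (at_left 1)"
  \<comment> \<open>Dominated convergence works along sequences, so the limit in r is tested on
    arbitrary sequences of radii.\<close>
  proof (rule tendsto_at_left_sequentially[of 0])
    fix r :: "nat \<Rightarrow> real" assume r: "\<And>i. r i < 1" "\<And>i. 0 < r i" "r \<longlonglongrightarrow> 1"
    have rl: "filterlim r (at_left 1) sequentially" using r by (auto simp: filterlim_at less_imp_neq)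
    \<comment> \<open>the majorant of \<open>X\<close> varies with \<open>r\<close>; after removing its part \<open>d\<close>, which tends to zero in
      \<open>L\<^sup>1\<close>, a fixed one remains\<close>
    define Y where "Y i \<theta> = max 0 (X (r i) \<theta> - C' * d (r i) \<theta>)" for i \<theta>
    have mY: "Y i \<in> borel_measurable M" for i unfolding Y_def using mX[OF r(2) r(1)] md[OF r(2) r(1)] by measurable
    have "(\<lambda>i. \<integral>\<^sup>+\<theta>. ennreal (Y i \<theta>) \<partial>M) \<longlonglongrightarrow> (\<integral>\<^sup>+\<theta>. 0 \<partial>M)"
    proof (rule nn_integral_dominated_convergence[where w = "\<lambda>\<theta>. ennreal C' * ennreal (e \<theta>)"])
      show "AE \<theta> in M. ennreal (Y i \<theta>) \<le> ennreal C' * ennreal (e \<theta>)" for i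
        using key
      proof eventually_elim
        case (elim \<theta>)
        then have "X (r i) \<theta> \<le> C' * e \<theta> + C' * d (r i) \<theta>" using r by blast
        then have "Y i \<theta> \<le> C' * e \<theta>" using C' e0[of \<theta>] by (simp add: Y_def)
        then show ?case by (simp add: ennreal_leI C' e0 flip: ennreal_mult)
      qed
      have "(\<integral>\<^sup>+\<theta>. ennreal C' * ennreal (e \<theta>) \<partial>M) = ennreal C' * (\<integral>\<^sup>+\<theta>. ennreal (e \<theta>) \<partial>M)" using me by (intro nn_integral_cmult) auto
      then show "(\<integral>\<^sup>+\<theta>. ennreal C' * ennreal (e \<theta>) \<partial>M) < \<infinity>" using efin by (simp add: ennreal_mult_less_top)
      show "AE \<theta> in M. (\<lambda>i. ennreal (Y i \<theta>)) \<longlonglongrightarrow> 0"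
        using AEf
      proof eventually_elim
        case (elim \<theta>)
        have "(\<lambda>i. f (rcis (r i) \<theta>)) \<longlonglongrightarrow> fb \<theta>" by (rule filterlim_compose[OF elim rl])
        then have "(\<lambda>i. X (r i) \<theta>) \<longlonglongrightarrow> norm (fb \<theta> - fb \<theta>) powr p"
          unfolding X_def using p by (intro tendsto_powr' tendsto_norm tendsto_diff tendsto_const) auto
        then have X0: "(\<lambda>i. X (r i) \<theta>) \<longlonglongrightarrow> 0" using p by simp
        have "(\<lambda>i. Y i \<theta>) \<longlonglongrightarrow> 0"
        proof (rule tendsto_sandwich[OF _ _ tendsto_const X0])
          show "eventually (\<lambda>i. 0 \<le> Y i \<theta>) sequentially" by (simp add: Y_def)
          have "0 \<le> X (r i) \<theta>" "0 \<le> C' * d (r i) \<theta>" for i using C' d0 by (auto simp: X_def)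
          then show "eventually (\<lambda>i. Y i \<theta> \<le> X (r i) \<theta>) sequentially" by (auto simp: Y_def)
        qed
        from tendsto_ennrealI[OF this] show ?case by simp
      qed
    qed (use mY me in measurable)
    then have Y0: "(\<lambda>i. \<integral>\<^sup>+\<theta>. ennreal (Y i \<theta>) \<partial>M) \<longlonglongrightarrow> 0" by simp
    have d0': "(\<lambda>i. \<integral>\<^sup>+\<theta>. ennreal (d (r i) \<theta>) \<partial>M) \<longlonglongrightarrow> 0" by (rule filterlim_compose[OF dlim rl])
    have "(\<lambda>i. (\<integral>\<^sup>+\<theta>. ennreal (Y i \<theta>) \<partial>M) + ennreal C' * (\<integral>\<^sup>+\<theta>. ennreal (d (r i) \<theta>) \<partial>M)) \<longlonglongrightarrow> 0 + ennreal C' * 0"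
      by (intro tendsto_add Y0 ennreal_tendsto_cmult d0') simp
    then have sum0: "(\<lambda>i. (\<integral>\<^sup>+\<theta>. ennreal (Y i \<theta>) \<partial>M) + ennreal C' * (\<integral>\<^sup>+\<theta>. ennreal (d (r i) \<theta>) \<partial>M)) \<longlonglongrightarrow> 0" by simp
    have le: "(\<integral>\<^sup>+\<theta>. ennreal (X (r i) \<theta>) \<partial>M) \<le> (\<integral>\<^sup>+\<theta>. ennreal (Y i \<theta>) \<partial>M) + ennreal C' * (\<integral>\<^sup>+\<theta>. ennreal (d (r i) \<theta>) \<partial>M)" for i
    proof -
      note md' = md[OF r(2) r(1), of i]
      have "(\<integral>\<^sup>+\<theta>. ennreal (X (r i) \<theta>) \<partial>M) \<le> (\<integral>\<^sup>+\<theta>. ennreal (Y i \<theta>) + ennreal C' * ennreal (d (r i) \<theta>) \<partial>M)"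
      proof (rule nn_integral_mono)
        fix \<theta>
        have "ennreal (X (r i) \<theta>) \<le> ennreal (Y i \<theta> + C' * d (r i) \<theta>)" by (intro ennreal_leI) (simp add: Y_def)
        also have "\<dots> = ennreal (Y i \<theta>) + ennreal C' * ennreal (d (r i) \<theta>)"
          using C' d0[of "r i" \<theta>] by (subst ennreal_plus) (auto simp: Y_def ennreal_mult)
        finally show "ennreal (X (r i) \<theta>) \<le> ennreal (Y i \<theta>) + ennreal C' * ennreal (d (r i) \<theta>)" .
      qed
      also have "\<dots> = (\<integral>\<^sup>+\<theta>. ennreal (Y i \<theta>) \<partial>M) + (\<integral>\<^sup>+\<theta>. ennreal C' * ennreal (d (r i) \<theta>) \<partial>M)"
        using mY[of i] md' by (intro nn_integral_add) auto
      also have "(\<integral>\<^sup>+\<theta>. ennreal C' * ennreal (d (r i) \<theta>) \<partial>M) = ennreal C' * (\<integral>\<^sup>+\<theta>. ennreal (d (r i) \<theta>) \<partial>M)"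
        using md' by (intro nn_integral_cmult) auto
      finally show ?thesis .
    qed
    show "(\<lambda>i. \<integral>\<^sup>+\<theta>. ennreal (X (r i) \<theta>) \<partial>M) \<longlonglongrightarrow> 0"
      by (rule tendsto_sandwich[OF _ _ tendsto_const sum0]) (use le in auto)
  qed simp
  then show ?lim by (simp add: circle_int_def X_def fb_def M_def)
qed


section \<open>Bicomplex components\<close>

text \<open>A real algebra homomorphism with j sent to i carries the bicomplex derivative to the
  derivative in cnj z. Linearity is over the reals because the conjugated component is not complex
  linear.\<close>

locale bc_component =
  fixes c :: "bicomplex \<Rightarrow> complex"
  assumes lin: "linear c" and mult: "c (v * w) = c v * c w" and one: "c 1 = 1" and j: "c bc_j = \<i>"
begin

lemma bounded: "bounded_linear c"
  using lin by (simp add: linear_conv_bounded_linear)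

lemma add: "c (v + w) = c v + c w" and scale: "c (x *\<^sub>R w) = x *\<^sub>R c w"
  using linear_add[OF lin] linear_scale[OF lin] by auto

lemma of_real: "c (of_real x) = of_real x"
  unfolding of_real_def by (simp add: scale one)

lemma power: "c (w ^ k) = c w ^ k"
  by (induction k) (auto simp: one mult)

lemma sum: "c (\<Sum>k\<in>I. w k) = (\<Sum>k\<in>I. c (w k))"
  using lin by (rule linear_sum)

lemma hat_cnj: "c (bc_hat (cnj z)) = cnj z"
proof -
  have "c (bc_hat (cnj z)) = complex_of_real (Re z) + \<i> * complex_of_real (- Im z)"
    unfolding bc_hat_def add mult j of_real by simp
  then show ?thesis by (simp add: complex_eq_iff)
qed

lemma bound: obtains K where "0 < K" "\<And>w. cmod (c w) \<le> K * norm w"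
  using bounded_linear.pos_bounded[OF bounded] by (metis mult.commute)

end

lemma bc_component_minus: "bc_component bc_minus"
  by unfold_locales (auto simp: bc_minus_def bc_j_def algebra_simps)

text \<open>\<open>bc_plus\<close> sends \<open>j\<close> to \<open>-i\<close>; conjugation repairs this.\<close>

lemma bc_component_plus: "bc_component (\<lambda>w. cnj (bc_plus w))"
  by unfold_locales (auto simp: bc_plus_def bc_j_def complex_eq_iff algebra_simps)

lemma borel_measurable_bicomplex:
  assumes "(\<lambda>z. bc_fst (A z)) \<in> borel_measurable M" "(\<lambda>z. bc_snd (A z)) \<in> borel_measurable M"
  shows "A \<in> borel_measurable M"
  by (subst borel_measurable_euclidean_space)
     (use assms in \<open>auto simp: Basis_bicomplex_def inner_bicomplex_def intro!: borel_measurable_inner\<close>)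

lemma norm_bicomplex_le: "norm w \<le> cmod (bc_fst w) + cmod (bc_snd w)"
proof -
  have "norm w = sqrt ((cmod (bc_fst w))\<^sup>2 + (cmod (bc_snd w))\<^sup>2)"
    unfolding norm_eq_sqrt_inner[of w] inner_bicomplex_def by (simp add: power2_norm_eq_inner)
  then show ?thesis by (simp add: sqrt_sum_squares_le_sum)
qed

lemma norm_bicomplex_le_components: "norm w \<le> cmod (bc_minus w) + cmod (cnj (bc_plus w))"
proof -
  have "((cmod (bc_plus w))\<^sup>2 + (cmod (bc_minus w))\<^sup>2) / 2 \<le> (cmod (bc_minus w) + cmod (cnj (bc_plus w)))\<^sup>2"
    by (simp add: power2_sum)
  then show ?thesis unfolding norm_bicomplex_def by (intro real_le_lsqrt) auto
qed

lemma norm_powr_integrable_bc: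
  assumes q: "0 < q" and A: "(\<lambda>z. bc_fst (A z)) \<in> Lq_disc q" "(\<lambda>z. bc_snd (A z)) \<in> Lq_disc q"
  shows "A \<in> borel_measurable (lebesgue_on unit_disc)" "integrable (lebesgue_on unit_disc) (\<lambda>z. norm (A z) powr q)"
proof -
  show m: "A \<in> borel_measurable (lebesgue_on unit_disc)"
    using A by (intro borel_measurable_bicomplex) (auto simp: Lq_disc_def)
  have "integrable (lebesgue_on unit_disc) (\<lambda>z. 2 powr q * (cmod (bc_fst (A z)) powr q + cmod (bc_snd (A z)) powr q))"
    using A by (intro integrable_mult_right Bochner_Integration.integrable_add) (auto simp: Lq_disc_def)
  then show "integrable (lebesgue_on unit_disc) (\<lambda>z. norm (A z) powr q)"
  proof (rule Bochner_Integration.integrable_bound)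
    show "(\<lambda>z. norm (A z) powr q) \<in> borel_measurable (lebesgue_on unit_disc)" using m by measurable
    have "norm (A z) powr q \<le> 2 powr q * (cmod (bc_fst (A z)) powr q + cmod (bc_snd (A z)) powr q)" for z
      using powr_mono2[OF _ _ norm_bicomplex_le[of "A z"], of q] powr_add_le[of "cmod (bc_fst (A z))" "cmod (bc_snd (A z))" q] q
      by simp
    then show "AE z in lebesgue_on unit_disc. norm (norm (A z) powr q)
        \<le> norm (2 powr q * (cmod (bc_fst (A z)) powr q + cmod (bc_snd (A z)) powr q))"
      by simp
  qed
qed

section \<open>From completed Lebesgue measure to Borel measure\<close>

lemma ex_borel_complex:
  fixes h :: "complex \<Rightarrow> complex"
  assumes "h \<in> borel_measurable lebesgue"
  obtains h' where "h' \<in> borel_measurable borel" "AE z in lborel. h z = h' z"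
proof -
  have "(\<lambda>z. Re (h z)) \<in> borel_measurable lebesgue" "(\<lambda>z. Im (h z)) \<in> borel_measurable lebesgue"
    using assms by (auto intro: borel_measurable_Re borel_measurable_Im measurable_compose)
  from this[THEN completion_ex_borel_measurable_real]
  obtain r i where ri: "r \<in> borel_measurable lborel" "i \<in> borel_measurable lborel"
    "AE z in lborel. Re (h z) = r z" "AE z in lborel. Im (h z) = i z"
    by auto
  show ?thesis
  proof
    show "(\<lambda>z. Complex (r z) (i z)) \<in> borel_measurable borel"
      using ri(1,2) unfolding Complex_eq by measurable
    show "AE z in lborel. h z = Complex (r z) (i z)"
      using ri(3,4) by eventually_elim (simp add: complex_eq_iff)
  qed
qed

text \<open>Completion gives a Borel representative up to a null set; multiplying it by the
  indicator makes it vanish off the disc everywhere, as the locale demands.\<close>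

lemma (in bc_component) ex_coefficient:
  assumes q: "2 < q" and A: "(\<lambda>z. bc_fst (A z)) \<in> Lq_disc q" "(\<lambda>z. bc_snd (A z)) \<in> Lq_disc q"
  obtains a where "cauchy_transform a q" "AE z in lborel. z \<in> unit_disc \<longrightarrow> a z = c (A z)"
proof -
  have q0: "0 < q" using q by simp
  note m = norm_powr_integrable_bc(1)[OF q0 A] and int = norm_powr_integrable_bc(2)[OF q0 A]
  have cm: "c \<in> borel_measurable borel" using bounded by (intro borel_measurable_continuous_onI linear_continuous_on)
  have "(\<lambda>z. c (A z)) \<in> borel_measurable (lebesgue_on unit_disc)" using m cm by (rule measurable_compose)
  then have "(\<lambda>z. indicator unit_disc z *\<^sub>R c (A z)) \<in> borel_measurable lebesgue"
    by (subst (asm) borel_measurable_restrict_space_iff) auto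
  then obtain h where h: "h \<in> borel_measurable borel" "AE z in lborel. indicator unit_disc z *\<^sub>R c (A z) = h z"
    by (rule ex_borel_complex)
  define a where "a z = indicator unit_disc z *\<^sub>R h z" for z
  have ma: "a \<in> borel_measurable borel" unfolding a_def by (intro borel_measurable_scaleR borel_measurable_indicator h(1)) auto
  have ae: "AE z in lborel. a z = indicator unit_disc z *\<^sub>R c (A z)"
    using h(2) by eventually_elim (auto simp: a_def indicator_def split: if_splits)
  obtain K where K: "0 < K" "\<And>w. cmod (c w) \<le> K * norm w" by (rule bound) blast
  have "integrable lebesgue (\<lambda>z. indicator unit_disc z *\<^sub>R (norm (A z) powr q))"
    using int by (subst (asm) integrable_restrict_space) auto
  then have "integrable lebesgue (\<lambda>z. K powr q * (indicator unit_disc z *\<^sub>R (norm (A z) powr q)))"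
    by (rule integrable_mult_right)
  then have "integrable lebesgue (\<lambda>z. norm (a z) powr q)"
  proof (rule Bochner_Integration.integrable_bound)
    have "(\<lambda>z. norm (a z) powr q) \<in> borel_measurable borel" using ma by measurable
    then show "(\<lambda>z. norm (a z) powr q) \<in> borel_measurable lebesgue" by (simp add: measurable_completion)
    have "AE z in lebesgue. a z = indicator unit_disc z *\<^sub>R c (A z)" using ae by (rule AE_completion)
    then show "AE z in lebesgue. norm (norm (a z) powr q) \<le> norm (K powr q * (indicator unit_disc z *\<^sub>R (norm (A z) powr q)))"
    proof eventually_elim
      case (elim z)
      have "cmod (c (A z)) powr q \<le> (K * norm (A z)) powr q" using q K(2) by (intro powr_mono2) auto
      then show ?case using K(1) q by (simp add: elim powr_mult indicator_def)
    qed
  qed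
  moreover have "(\<lambda>z. norm (a z) powr q) \<in> borel_measurable lborel" using ma by measurable
  ultimately have "integrable lborel (\<lambda>z. norm (a z) powr q)" by (simp add: integrable_completion)
  then have "cauchy_transform a q" by unfold_locales (use q ma in \<open>auto simp: a_def\<close>)
  then show ?thesis
  proof (rule that)
    show "AE z in lborel. z \<in> unit_disc \<longrightarrow> a z = c (A z)"
      using ae by eventually_elim (auto simp: indicator_def)
  qed
qed

text \<open>Local integrability controls compact subsets only, and the cutoff is supported in one of
  them, the closed disc of radius \<rho>.\<close>

lemma integrable_disc_cutoff:
  fixes f :: "complex \<Rightarrow> 'a::euclidean_space"
  assumes f: "locally_integrable f" and m: "csmooth \<rho> m" and \<rho>: "\<rho> < 1"
  shows "integrable (lebesgue_on unit_disc) (\<lambda>z. m z *\<^sub>R f z)"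
proof -
  have "integrable (lebesgue_on (cball 0 \<rho>)) f" 
  proof -
    have "cball 0 \<rho> \<subseteq> unit_disc" using \<rho> by auto
    then show ?thesis using f compact_cball unfolding locally_integrable_def by blast
  qed
  then have i: "integrable lebesgue (\<lambda>z. indicator (cball 0 \<rho>) z *\<^sub>R f z)"
    by (subst (asm) integrable_restrict_space) auto
  obtain B where B: "0 < B" "\<And>t. \<bar>m t\<bar> \<le> B" using csmooth_bounded[OF m] by blast
  have mm: "m \<in> borel_measurable lebesgue" using csmooth_measurable[OF m] by (simp add: measurable_completion)
  have "integrable lebesgue (\<lambda>z. m z *\<^sub>R (indicator (cball 0 \<rho>) z *\<^sub>R f z))"
  proof (rule Bochner_Integration.integrable_bound)
    show "integrable lebesgue (\<lambda>z. B *\<^sub>R (indicator (cball 0 \<rho>) z *\<^sub>R f z))" using i by (rule integrable_scaleR_right)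
    show "(\<lambda>z. m z *\<^sub>R (indicator (cball 0 \<rho>) z *\<^sub>R f z)) \<in> borel_measurable lebesgue"
      using mm borel_measurable_integrable[OF i] by (rule borel_measurable_scaleR)
    show "AE z in lebesgue. norm (m z *\<^sub>R (indicator (cball 0 \<rho>) z *\<^sub>R f z)) \<le> norm (B *\<^sub>R (indicator (cball 0 \<rho>) z *\<^sub>R f z))"
      using B by (intro AE_I2) (simp add: mult_right_mono abs_mult)
  qed
  also have "(\<lambda>z. m z *\<^sub>R (indicator (cball 0 \<rho>) z *\<^sub>R f z)) = (\<lambda>z. indicator unit_disc z *\<^sub>R (m z *\<^sub>R f z))"
  proof
    fix z
    have "m z = 0" if "\<not> norm z \<le> \<rho>" using m that by (simp add: csmooth_def)
    then show "m z *\<^sub>R (indicator (cball 0 \<rho>) z *\<^sub>R f z) = indicator unit_disc z *\<^sub>R (m z *\<^sub>R f z)"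
      using \<rho> by (cases "norm z \<le> \<rho>") (auto simp: indicator_def)
  qed
  finally show ?thesis by (subst integrable_restrict_space) auto
qed

text \<open>The bridge from the integrals in the given definitions to \<open>lborel\<close>: h'
  vanishes off the disc, so agreement almost everywhere inside is enough.\<close>

lemma integral_disc_eq_lborel:
  fixes h h' :: "complex \<Rightarrow> 'a::euclidean_space"
  assumes h: "h \<in> borel_measurable (lebesgue_on unit_disc)" and h': "h' \<in> borel_measurable borel"
    and eq: "AE z in lborel. z \<in> unit_disc \<longrightarrow> h z = h' z" and z: "\<And>z. z \<notin> unit_disc \<Longrightarrow> h' z = 0"
  shows "(LINT z|lebesgue_on unit_disc. h z) = (LINT z|lborel. h' z)"
proof -
  have "(LINT z|lebesgue_on unit_disc. h z) = (LINT z|lebesgue. indicator unit_disc z *\<^sub>R h z)"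
    by (rule integral_restrict_space) auto
  also have "\<dots> = (LINT z|lebesgue. h' z)"
  proof (rule integral_cong_AE)
    show "(\<lambda>z. indicator unit_disc z *\<^sub>R h z) \<in> borel_measurable lebesgue"
      using h by (subst (asm) borel_measurable_restrict_space_iff) auto
    show "h' \<in> borel_measurable lebesgue" using h' by (simp add: measurable_completion)
    show "AE z in lebesgue. indicator unit_disc z *\<^sub>R h z = h' z"
      using AE_completion[OF eq] by eventually_elim (use z in \<open>auto simp: indicator_def\<close>)
  qed
  also have "\<dots> = (LINT z|lborel. h' z)" using h' by (intro integral_completion) auto
  finally show ?thesis .
qed

text \<open>c is bounded and real linear, so it commutes with the integrals; it is multiplicative
  with c j = i, so it turns the bicomplex test expression into \<open>dzb \<psi>\<close>.\<close>

lemma (in bc_component) weak_sol_component: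
  assumes w: "weak_dbar f (\<lambda>z. A z * f z + g z)"
    and cf: "continuous_on unit_disc f" and cg: "continuous_on unit_disc g"
    and a: "a \<in> borel_measurable borel" "AE z in lborel. z \<in> unit_disc \<longrightarrow> a z = c (A z)"
  shows "weak_sol (\<lambda>z. c (f z)) (\<lambda>z. a z * c (f z) + c (g z))"
  unfolding weak_sol_def
proof (intro allI impI)
  fix \<psi> assume t: "test_function \<psi>"
  then obtain \<rho> where \<rho>: "0 < \<rho>" "\<rho> < 1" and \<psi>: "csmooth \<rho> \<psi>" by (rule test_function_csmooth)
  let ?w = "\<lambda>z. A z * f z + g z"
  have lf: "locally_integrable f" and lw: "locally_integrable ?w" using w by (auto simp: weak_dbar_def)
  note cx = csmooth_partial(1)[OF \<psi>] and cy = csmooth_partial(2)[OF \<psi>]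
  note cc = linear_continuous_on[OF bounded]
  have ccf: "continuous_on unit_disc (\<lambda>z. c (f z))" and ccg: "continuous_on unit_disc (\<lambda>z. c (g z))"
    using continuous_on_compose2[OF cc cf] continuous_on_compose2[OF cc cg] by auto
  \<comment> \<open>Rewritten with real scalars and one multiplication by j. The norm on
    \<open>bicomplex\<close> is not submultiplicative, so boundedness of that multiplication is
    checked separately in \<open>bj\<close>.\<close>
  define h where "h z = (1/2) *\<^sub>R (partial_x \<psi> z *\<^sub>R f z + bc_j * (partial_y \<psi> z *\<^sub>R f z))" for z
  have hf: "((1/2) *\<^sub>R (of_real (partial_x \<psi> z) + bc_j * of_real (partial_y \<psi> z))) * f z = h z" for z
    by (rule bicomplex.expand) (simp add: h_def of_real_def bc_j_def algebra_simps)
  have bj: "bounded_linear (\<lambda>w. bc_j * w)"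
    by (simp add: linear_conv_bounded_linear[symmetric] linear_iff algebra_simps)
  have ih: "integrable (lebesgue_on unit_disc) h" unfolding h_def
    by (intro integrable_scaleR_right Bochner_Integration.integrable_add integrable_bounded_linear[OF bj]
        integrable_disc_cutoff[OF lf cx \<rho>(2)] integrable_disc_cutoff[OF lf cy \<rho>(2)])
  have iw: "integrable (lebesgue_on unit_disc) (\<lambda>z. \<psi> z *\<^sub>R ?w z)" by (rule integrable_disc_cutoff[OF lw \<psi> \<rho>(2)])
  have ch: "c (h z) = dzb \<psi> z * c (f z)" for z
    unfolding h_def add scale mult j by (simp add: dzb_def scaleR_conv_of_real field_simps)
  have eq: "(LINT z|lebesgue_on unit_disc. h z) = - (LINT z|lebesgue_on unit_disc. \<psi> z *\<^sub>R ?w z)"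

  proof -
    have "(LINT z|lebesgue_on unit_disc. ((1/2) *\<^sub>R (of_real (partial_x \<psi> z) + bc_j * of_real (partial_y \<psi> z))) * f z)
        = - (LINT z|lebesgue_on unit_disc. \<psi> z *\<^sub>R ?w z)"
      using w t unfolding weak_dbar_def by blast
    then show ?thesis by (simp only: hf)
  qed
  have "(LINT z|lebesgue_on unit_disc. c (h z)) = c (LINT z|lebesgue_on unit_disc. h z)"
    by (rule integral_bounded_linear[OF bounded ih])
  also have "\<dots> = - c (LINT z|lebesgue_on unit_disc. \<psi> z *\<^sub>R ?w z)" unfolding eq by (rule linear_neg[OF lin])
  also have "c (LINT z|lebesgue_on unit_disc. \<psi> z *\<^sub>R ?w z) = (LINT z|lebesgue_on unit_disc. c (\<psi> z *\<^sub>R ?w z))"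
    by (rule integral_bounded_linear[OF bounded iw, symmetric])
  finally have *: "(LINT z|lebesgue_on unit_disc. c (h z)) = - (LINT z|lebesgue_on unit_disc. c (\<psi> z *\<^sub>R ?w z))" .
  have cut: "(\<lambda>z. indicator unit_disc z *\<^sub>R v z) \<in> borel_measurable borel"
    if "continuous_on unit_disc v" for v :: "complex \<Rightarrow> complex"
    using that by (intro borel_measurable_continuous_on_indicator) auto
  have \<psi>0: "\<psi> z = 0" "dzb \<psi> z = 0" if "z \<notin> unit_disc" for z
    using \<psi> csmooth_dzb_continuous(2)[OF \<psi>, of z] that \<rho> by (auto simp: csmooth_def)
  have "(LINT z|lebesgue_on unit_disc. c (h z)) = (LINT z|lborel. dzb \<psi> z * c (f z))"
  proof (rule integral_disc_eq_lborel)
    show "(\<lambda>z. c (h z)) \<in> borel_measurable (lebesgue_on unit_disc)"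
      using integrable_bounded_linear[OF bounded ih] by (rule borel_measurable_integrable)
    have "(\<lambda>z. dzb \<psi> z * (indicator unit_disc z *\<^sub>R c (f z))) \<in> borel_measurable borel"
      by (intro borel_measurable_times cut ccf borel_measurable_continuous_onI csmooth_dzb_continuous(1)[OF \<psi>])
    also have "(\<lambda>z. dzb \<psi> z * (indicator unit_disc z *\<^sub>R c (f z))) = (\<lambda>z. dzb \<psi> z * c (f z))"
      using \<psi>0 by (intro ext) (auto simp: indicator_def)
    finally show "(\<lambda>z. dzb \<psi> z * c (f z)) \<in> borel_measurable borel" .
  qed (auto simp: ch \<psi>0)
  moreover have "(LINT z|lebesgue_on unit_disc. c (\<psi> z *\<^sub>R ?w z)) = (LINT z|lborel. \<psi> z *\<^sub>R (a z * c (f z) + c (g z)))"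
  proof (rule integral_disc_eq_lborel)
    show "(\<lambda>z. c (\<psi> z *\<^sub>R ?w z)) \<in> borel_measurable (lebesgue_on unit_disc)"
      using integrable_bounded_linear[OF bounded iw] by (rule borel_measurable_integrable)
    have "(\<lambda>z. \<psi> z *\<^sub>R (a z * (indicator unit_disc z *\<^sub>R c (f z)) + indicator unit_disc z *\<^sub>R c (g z))) \<in> borel_measurable borel"
      by (intro borel_measurable_scaleR borel_measurable_add borel_measurable_times cut ccf ccg a csmooth_measurable[OF \<psi>])
    also have "(\<lambda>z. \<psi> z *\<^sub>R (a z * (indicator unit_disc z *\<^sub>R c (f z)) + indicator unit_disc z *\<^sub>R c (g z)))
        = (\<lambda>z. \<psi> z *\<^sub>R (a z * c (f z) + c (g z)))"
      using \<psi>0 by (intro ext) (auto simp: indicator_def)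
    finally show "(\<lambda>z. \<psi> z *\<^sub>R (a z * c (f z) + c (g z))) \<in> borel_measurable borel" .
    show "AE z in lborel. z \<in> unit_disc \<longrightarrow> c (\<psi> z *\<^sub>R ?w z) = \<psi> z *\<^sub>R (a z * c (f z) + c (g z))"
      using a(2) by eventually_elim (auto simp: add mult scale)
  qed (auto simp: \<psi>0)
  ultimately show "(LINT z|lborel. dzb \<psi> z * c (f z)) = - (LINT z|lborel. \<psi> z *\<^sub>R (a z * c (f z) + c (g z)))"
    using * by simp
qed

text \<open>\<open>hardy_norm\<close> bounds p-th roots of circle integrals, so its value is raised
  to the power p; the other factor is the operator bound of c.\<close>

lemma (in bc_component) hardy_bounded_component:
  assumes p: "0 < p" and cg: "continuous_on unit_disc g" and fin: "hardy_norm p g < \<infinity>"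
  shows "hardy_bounded p (\<lambda>z. c (g z))"
proof -
  have cc: "continuous_on unit_disc (\<lambda>z. c (g z))"
    using continuous_on_compose2[OF linear_continuous_on[OF bounded] cg] by auto
  obtain K where K: "0 < K" "\<And>w. cmod (c w) \<le> K * norm w" by (rule bound) blast
  define s where "s = enn2real (hardy_norm p g)"
  have s: "0 \<le> s" "hardy_norm p g = ennreal s" using fin by (auto simp: s_def less_top)
  have "integral {0..2*pi} (\<lambda>t. cmod (c (g (rcis r t))) powr p) \<le> K powr p * s powr p" if r: "0 < r" "r < 1" for r
  proof -
    let ?I = "integral {0..2*pi} (\<lambda>t. norm (g (rcis r t)) powr p)"
    note ci = circle_powr_integrable[OF cg p r]
    have I0: "0 \<le> ?I" by (rule integral_nonneg[OF ci(2)]) simp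
    have "circle_int p (\<lambda>\<theta>. g (rcis r \<theta>)) = ennreal ?I"
      unfolding circle_int_def by (rule nn_integral_lebesgue_on_interval[OF ci(1)]) simp
    then have "ennreal (?I powr (1/p)) = ennreal_root p (circle_int p (\<lambda>\<theta>. g (rcis r \<theta>)))"
      using I0 by (simp add: ennreal_root_def)
    also have "\<dots> \<le> hardy_norm p g" unfolding hardy_norm_def using r by (intro SUP_upper) auto
    finally have "?I powr (1/p) \<le> s" using s by simp
    then have "(?I powr (1/p)) powr p \<le> s powr p" using p by (intro powr_mono2) auto
    then have I: "?I \<le> s powr p" using I0 p by (simp add: powr_powr)
    have "integral {0..2*pi} (\<lambda>t. cmod (c (g (rcis r t))) powr p) \<le> integral {0..2*pi} (\<lambda>t. K powr p * norm (g (rcis r t)) powr p)"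
    proof (rule integral_le)
      show "(\<lambda>t. cmod (c (g (rcis r t))) powr p) integrable_on {0..2*pi}" by (rule circle_powr_integrable(2)[OF cc p r])
      show "(\<lambda>t. K powr p * norm (g (rcis r t)) powr p) integrable_on {0..2*pi}" using ci(2) by (rule integrable_on_mult_right)
      show "cmod (c (g (rcis r t))) powr p \<le> K powr p * norm (g (rcis r t)) powr p" for t
        using powr_mono2[OF _ _ K(2)[of "g (rcis r t)"], of p] p K(1) by (simp add: powr_mult)
    qed
    also have "\<dots> = K powr p * ?I" by simp
    also have "\<dots> \<le> K powr p * s powr p" using I by (intro mult_left_mono) auto
    finally show ?thesis .
  qed
  then show ?thesis unfolding hardy_bounded_def using cc by blast
qed

lemma (in bc_component) component_boundary:
  assumes p: "0 < p" and q: "2 < q" and A: "(\<lambda>z. bc_fst (A z)) \<in> Lq_disc q" "(\<lambda>z. bc_snd (A z)) \<in> Lq_disc q"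
    and f: "f \<in> V_A0 n p A" and \<phi>: "\<And>k. k < n \<Longrightarrow> \<phi> k \<in> H_A0 A"
    and rep: "\<And>z. z \<in> unit_disc \<Longrightarrow> f z = (\<Sum>k<n. bc_hat (cnj z) ^ k * \<phi> k z)"
  shows "AE \<theta> in lebesgue_on {0..2*pi}. nt_converges (\<lambda>z. c (f z)) (cis \<theta>)" "H2_dominated p n (\<lambda>z. c (f z))"
proof -
  obtain a where ct: "cauchy_transform a q" and a: "AE z in lborel. z \<in> unit_disc \<longrightarrow> a z = c (A z)"
    using ex_coefficient[OF q A] by blast
  interpret cauchy_transform a q by (rule ct)
  obtain g where g0: "g 0 = f" and g: "\<And>k. k < n \<Longrightarrow> continuous_on unit_disc (g k)"
      "\<And>k. k < n \<Longrightarrow> weak_dbar (g k) (\<lambda>z. A z * g k z + g (Suc k) z)"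
    and gn: "\<And>z. z \<in> unit_disc \<Longrightarrow> g n z = 0" and fin: "(\<Sum>k<n. hardy_norm p (g k)) < \<infinity>"
    using f unfolding V_A0_def by blast
  \<comment> \<open>\<open>V_A0\<close> gives continuity for indices below n only; at n the iterate
    vanishes on the disc.\<close>
  have gc: "continuous_on unit_disc (g k)" if "k \<le> n" for k
  proof (cases "k = n")
    case True
    then show ?thesis using continuous_on_cong[OF refl gn, of unit_disc] by simp
  qed (use g(1) that in simp)
  have wu: "weak_sol (\<lambda>z. c (\<phi> k z)) (\<lambda>z. a z * c (\<phi> k z))" and cu: "continuous_on unit_disc (\<lambda>z. c (\<phi> k z))"
    if "k < n" for k
  proof -
    \<comment> \<open>Adding 0 presents the homogeneous equation as an instance of
      \<open>weak_sol_component\<close>.\<close>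
    have w: "weak_dbar (\<phi> k) (\<lambda>z. A z * \<phi> k z + 0)" and \<phi>c: "continuous_on unit_disc (\<phi> k)"
      using \<phi>[OF that] by (auto simp: H_A0_def)
    from weak_sol_component[OF w \<phi>c continuous_on_const meas a]
    show "weak_sol (\<lambda>z. c (\<phi> k z)) (\<lambda>z. a z * c (\<phi> k z))" by (simp add: linear_0[OF lin])
    show "continuous_on unit_disc (\<lambda>z. c (\<phi> k z))"
      using continuous_on_compose2[OF linear_continuous_on[OF bounded] \<phi>c] by auto
  qed
  have wg: "weak_sol (\<lambda>z. c (g k z)) (\<lambda>z. a z * c (g k z) + c (g (Suc k) z))" if "k < n" for k
    using that by (intro weak_sol_component[OF g(2) _ _ meas a] gc) auto
  have hg: "hardy_bounded p (\<lambda>z. c (g k z))" if "k < n" for k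
  proof (rule hardy_bounded_component[OF p g(1)[OF that]])
    have "hardy_norm p (g k) \<le> (\<Sum>k<n. hardy_norm p (g k))" using that by (intro member_le_sum) auto
    then show "hardy_norm p (g k) < \<infinity>" using fin by (rule le_less_trans)
  qed
  have F: "c (f z) = (\<Sum>k<n. cnj z ^ k * c (\<phi> k z))" if "cmod z < 1" for z
    using that by (simp add: rep sum mult power hat_cnj)
  note vb = vekua_boundary[where u = "\<lambda>k z. c (\<phi> k z)" and g = "\<lambda>k z. c (g k z)", OF p wu cu F _ wg hg]
  show "AE \<theta> in lebesgue_on {0..2*pi}. nt_converges (\<lambda>z. c (f z)) (cis \<theta>)" "H2_dominated p n (\<lambda>z. c (f z))"
    by (rule vb; simp add: g0)+
qed

section \<open>Recombination of the two components\<close>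

lemma H2_dominated_combine:
  fixes f :: "complex \<Rightarrow> 'a::real_normed_vector"
  assumes p: "0 < p" and F: "H2_dominated p n F" and G: "H2_dominated p m G"
    and le: "\<And>z. z \<in> unit_disc \<Longrightarrow> norm (f z) \<le> norm (F z) + norm (G z)"
  shows "H2_dominated p (n + m) f"
proof -
  obtain D1 C1 where D1: "\<And>k. k < n \<Longrightarrow> H2_bounded (D1 k)" "0 \<le> C1"
    "\<And>z. z \<in> unit_disc \<Longrightarrow> norm (F z) powr p \<le> C1 * (\<Sum>k<n. (cmod (D1 k z))\<^sup>2)"
    using F unfolding H2_dominated_def by blast
  obtain D2 C2 where D2: "\<And>k. k < m \<Longrightarrow> H2_bounded (D2 k)" "0 \<le> C2"
    "\<And>z. z \<in> unit_disc \<Longrightarrow> norm (G z) powr p \<le> C2 * (\<Sum>k<m. (cmod (D2 k z))\<^sup>2)"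
    using G unfolding H2_dominated_def by blast
  \<comment> \<open>The two families are concatenated, the second shifted by n.\<close>
  define D where "D k = (if k < n then D1 k else D2 (k - n))" for k
  have sum: "(\<Sum>k<n + m. (cmod (D k z))\<^sup>2) = (\<Sum>k<n. (cmod (D1 k z))\<^sup>2) + (\<Sum>k<m. (cmod (D2 k z))\<^sup>2)" for z
    by (induction m) (simp_all add: D_def)
  have "norm (f z) powr p \<le> 2 powr p * (C1 + C2) * (\<Sum>k<n + m. (cmod (D k z))\<^sup>2)" if z: "z \<in> unit_disc" for z
  proof -
    have "norm (f z) powr p \<le> (norm (F z) + norm (G z)) powr p" using le[OF z] p by (intro powr_mono2) auto
    also have "\<dots> \<le> 2 powr p * (norm (F z) powr p + norm (G z) powr p)" using p by (intro powr_add_le) auto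
    also have "\<dots> \<le> 2 powr p * (C1 * (\<Sum>k<n. (cmod (D1 k z))\<^sup>2) + C2 * (\<Sum>k<m. (cmod (D2 k z))\<^sup>2))"
      using D1(3)[OF z] D2(3)[OF z] by (intro mult_left_mono add_mono) auto
    also have "\<dots> \<le> 2 powr p * ((C1 + C2) * (\<Sum>k<n + m. (cmod (D k z))\<^sup>2))"
    proof (rule mult_left_mono)
      have "0 \<le> C1 * (\<Sum>k<m. (cmod (D2 k z))\<^sup>2)" "0 \<le> C2 * (\<Sum>k<n. (cmod (D1 k z))\<^sup>2)"
        using D1(2) D2(2) by (auto intro!: mult_nonneg_nonneg sum_nonneg)
      then show "C1 * (\<Sum>k<n. (cmod (D1 k z))\<^sup>2) + C2 * (\<Sum>k<m. (cmod (D2 k z))\<^sup>2) \<le> (C1 + C2) * (\<Sum>k<n + m. (cmod (D k z))\<^sup>2)"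
        unfolding sum by (simp add: algebra_simps)
    qed simp
    finally show ?thesis by (simp add: mult.assoc)
  qed
  moreover have "H2_bounded (D k)" if "k < n + m" for k using that D1(1) D2(1) by (auto simp: D_def)
  moreover have "0 \<le> 2 powr p * (C1 + C2)" using D1(2) D2(2) by simp
  ultimately show ?thesis unfolding H2_dominated_def by blast
qed

theorem theorem6p6:
  fixes p q :: real and n :: nat
    and A f :: "complex \<Rightarrow> bicomplex" and \<phi> :: "nat \<Rightarrow> complex \<Rightarrow> bicomplex"
    and w :: "nat \<Rightarrow> complex \<Rightarrow> complex" and Q :: "nat \<Rightarrow> real"
  assumes "0 < p" and "0 < n" and "2 < q"
    and "A \<in> sobolev_disc_bc (n - 1) q"
    and "f \<in> V_A0 n p A"
    and "\<And>k. k < n \<Longrightarrow> \<phi> k \<in> H_A0 A"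
    and "\<And>z. z \<in> unit_disc \<Longrightarrow> f z = (\<Sum>k<n. bc_hat (cnj z) ^ k * \<phi> k z)"
    and "\<And>k. k < n \<Longrightarrow> w k \<in> Lq_disc (Q k)"
    and "\<And>k. k < n \<Longrightarrow> 2 < Q k \<or> (1 < Q k \<and> Q k \<le> 2 \<and> (Q k = 2 \<or> p < Q k / (2 - Q k)))"
    and "\<And>k. k < n \<Longrightarrow> (\<lambda>z. bc_plus (\<phi> k z)) \<in> H_w p (w k)"
  shows "\<exists>fnt. has_nt_limit f fnt \<and> fnt \<in> Lp_circle p \<and>
           ((\<lambda>r. circle_int p (\<lambda>\<theta>. fnt (cis \<theta>) - f (rcis r \<theta>))) \<longlongrightarrow> 0) (at_left 1)"
proof -
  note p = assms(1)
  have A: "(\<lambda>z. bc_fst (A z)) \<in> Lq_disc q" "(\<lambda>z. bc_snd (A z)) \<in> Lq_disc q"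
    using assms(4) by (auto simp: sobolev_disc_bc_def sobolev_disc_def)
  have cont: "continuous_on unit_disc f" using assms(2,5) by (auto simp: V_A0_def)
  define Fm Fp where "Fm z = bc_minus (f z)" and "Fp z = cnj (bc_plus (f z))" for z
  have m: "AE \<theta> in lebesgue_on {0..2*pi}. nt_converges Fm (cis \<theta>)" "H2_dominated p n Fm"
    using bc_component.component_boundary[OF bc_component_minus p assms(3) A assms(5) assms(6,7)] unfolding Fm_def by blast+
  have pl: "AE \<theta> in lebesgue_on {0..2*pi}. nt_converges Fp (cis \<theta>)" "H2_dominated p n Fp"
    using bc_component.component_boundary[OF bc_component_plus p assms(3) A assms(5) assms(6,7)] unfolding Fp_def by blast+
  define Lm Lp where "Lm x = Bicomplex (x / 2) (- (\<i> * x) / 2)" and "Lp x = Bicomplex (cnj x / 2) (\<i> * cnj x / 2)" for x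
  have L: "bounded_linear Lm" "bounded_linear Lp"
    unfolding linear_conv_bounded_linear[symmetric]
    by (auto intro!: linearI bicomplex.expand simp: Lm_def Lp_def complex_eq_iff field_simps)
  have fL: "f z = Lm (Fm z) + Lp (Fp z)" for z
    by (rule bicomplex.expand) (simp add: Lm_def Lp_def Fm_def Fp_def bc_minus_def bc_plus_def field_simps)
  have nt: "AE \<theta> in lebesgue_on {0..2*pi}. nt_converges f (cis \<theta>)"
    using m(1) pl(1)
  proof eventually_elim
    case (elim \<theta>)
    from nt_converges_add[OF nt_converges_bounded_linear[OF L(1) elim(1)] nt_converges_bounded_linear[OF L(2) elim(2)]]
    show ?case by (simp only: fL[symmetric])
  qed
  have dom: "H2_dominated p (n + n) f"
    by (rule H2_dominated_combine[OF p m(2) pl(2)]) (simp add: Fm_def Fp_def norm_bicomplex_le_components del: complex_mod_cnj)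
  note lim = circle_int_tendsto_zero[OF p cont nt dom]
  \<comment> \<open>The boundary function is \<open>radial_limit f\<close>: it is measurable by
    construction and agrees with the nontangential limit wherever that exists.\<close>
  show ?thesis
  proof (intro exI conjI)
    show "has_nt_limit f (radial_limit f)" unfolding has_nt_limit_def using nt
      by eventually_elim (use nt_converges_at_left(1)[OF _ norm_cis] in blast)
    show "radial_limit f \<in> Lp_circle p" unfolding Lp_circle_def
      using borel_measurable_radial_limit[OF cont] lim(2) by simp
    show "((\<lambda>r. circle_int p (\<lambda>\<theta>. radial_limit f (cis \<theta>) - f (rcis r \<theta>))) \<longlongrightarrow> 0) (at_left 1)" by (rule lim(1))
  qed
qed

end
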